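(* Let $\Omega\subset\mathbb{R}^2$ be a smooth, strictly convex, bounded open set, let $0<T<+\infty$, and let $\mathcal{N}_t=\bigcup_{i=1}^n\gamma^i(t,[0,1])$ be a $C^{1,2}$ curvature flow of regular networks with fixed end-points in $\overline\Omega$ in the time interval $[0,T)$. Assume that the lengths $L^i(t)$ of the curves of the networks are uniformly in time bounded away from zero for every $i\in\{1,2,\dots,n\}$. Then for every $x_0\in\mathbb{R}^2$ and for every subset $\mathcal{I}$ of $[-\frac12\log T,+\infty)$ with infinite Lebesgue measure, there exists a sequence of rescaled times $\mathfrak{t}_j\to+\infty$, with $\mathfrak{t}_j\in\mathcal{I}$, such that the sequence of rescaled networks $\widetilde{\mathcal{N}}_{\mathfrak{t}_j,x_0}$ converges in $C^{1,\alpha}_{\mathrm{loc}}\cap W^{2,2}_{\mathrm{loc}}$, for any $\alpha\in(0,1/2)$, to a (possibly empty) limit, which is (if non-empty) one of the following: - a straight line through the origin with multiplicity $m\in\mathbb{N}$ (in this case $\widehat\Theta(T,x_0)=m$); - a standard triod centered at the origin with multiplicity $1$ (in this case $\widehat\Theta(T,x_0)=3/2$); - a halfline from the origin with multiplicity $1$ (in this case $\widehat\Theta(T,x_0)=1/2$). Moreover, the $L^2$-norm of the curvature of $\widetilde{\mathcal{N}}_{\mathfrak{t}_j,x_0}$ goes to zero in every ball $B_R\subset\mathbb{R}^2$, as $j\to\infty$.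
   Context: A $C^1$ curve $\gamma:[0,1]\to\mathbb{R}^2$ is regular if $\gamma_x\neq 0$ everywhere; $\tau=\gamma_x/|\gamma_x|$, $\nu$ is $\tau$ rotated anticlockwise by $\pi/2$, $\partial_s=|\gamma_x|^{-1}\partial_x$, and the curvature vector is $\boldsymbol{k}=\tau_s=k\nu$. A network in $\overline\Omega$ is a connected set described by a finite family of regular $C^1$ curves contained in $\overline\Omega$ such that: (1) the interior of every curve is injective, and a curve can self-intersect only at its end-points; (2) two different curves can intersect each other only at their end-points; (3) a curve can meet $\partial\Omega$ only at its end-points; (4) if an end-point of a curve coincides with $P\in\partial\Omega$, then no other end-point of any curve coincides with $P$. Multi-points lie in $\Omega$; the vertices of order one $P^1,\dots,P^l\in\partial\Omega$ are the end-points of the network. A network is regular if all its multi-points are triple and at each of them the sum of the outward unit tangent vectors of the three concurring curves is zero. A $C^{1,2}$ curvature flow of regular networks with fixed end-points on $[0,T)$ is a family of networks $\mathcal{N}_t=\bigcup_{i=1}^n\gamma^i(t,[0,1])$ with $\gamma^i:[0,T)\times[0,1]\to\overline\Omega$ of class $C^1$ in time and $C^2$ in space, each $\gamma^i(t,\cdot)$ regular, such that: $(\gamma^i_t)^\perp=\boldsymbol{k}^i$ (normal component of the velocity equals the curvature vector); curves concurring at a triple point remain concurrent for all times; at each triple point the sum of the three outward unit tangents is zero; the end-points $P^r\in\partial\Omega$ stay fixed. Huisken's dynamical rescaling at $x_0\in\mathbb{R}^2$: with $\mathfrak{t}(t)=-\frac12\log(T-t)$, the rescaled networks are $$\widetilde{\mathcal{N}}_{\mathfrak{t},x_0}=\frac{\mathcal{N}_t-x_0}{\sqrt{2(T-t)}},\qquad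 t=T-e^{-2\mathfrak{t}},\quad \mathfrak{t}\in[-\tfrac12\log T,+\infty).$$ Limit Gaussian density: $\widehat\Theta(T,x_0)=\lim_{t\to T}\int_{\mathcal{N}_t}\rho_{T,x_0}(t,x)\,ds$, where $\rho_{T,x_0}(t,x)=\frac{e^{-|x-x_0|^2/(4(T-t))}}{\sqrt{4\pi(T-t)}}$ (this limit exists and is finite). Convergence of networks in $C^{1,\alpha}_{\mathrm{loc}}\cap W^{2,2}_{\mathrm{loc}}$ means that, in every compact set, after reparametrization (by arclength), the curves describing the networks converge in $C^{1,\alpha}$ and $W^{2,2}$ to curves describing the limit; the multiplicity of the limit is the number of curves of the approximating networks converging to the same limit curve. A standard triod is the union of three halflines from the origin forming angles of $120$ degrees. *)

theory Defs
  imports "HOL-Analysis.Analysis"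
begin

type_synonym plane = "real^2"

section \<open>Domains\<close>

definition smooth_fun :: "(real \<Rightarrow> real) \<Rightarrow> bool" where
  "smooth_fun f \<longleftrightarrow> (\<forall>k x. (deriv ^^ k) f field_differentiable at x)"

definition rot90 :: "plane \<Rightarrow> plane" where
  "rot90 v = vector [- (v $ 2), v $ 1]"

text \<open>Smooth boundary: near each boundary point, in some orthonormal frame
  \<open>(e, rot90 e)\<close>, the open set is the strict epigraph of a smooth function.\<close>

definition smooth_domain :: "plane set \<Rightarrow> bool" where
  "smooth_domain \<Omega> \<longleftrightarrow> open \<Omega> \<and>
     (\<forall>p\<in>frontier \<Omega>. \<exists>r>0. \<exists>e f. norm e = 1 \<and> smooth_fun f \<and>
        \<Omega> \<inter> ball p r = {x \<in> ball p r. x \<bullet> rot90 e > f (x \<bullet> e)})"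

definition strictly_convex_domain :: "plane set \<Rightarrow> bool" where
  "strictly_convex_domain \<Omega> \<longleftrightarrow>
     (\<forall>x\<in>closure \<Omega>. \<forall>y\<in>closure \<Omega>. x \<noteq> y \<longrightarrow> open_segment x y \<subseteq> \<Omega>)"

section \<open>Curves\<close>

text \<open>Curves are functions on the whole real line of which only the values on a compact
  interval matter, so derivatives are taken within that interval (one-sided at its ends).
  The library predicate \<open>C1_differentiable_on\<close> uses two-sided derivatives and is
  therefore not used.\<close>

definition C1_on :: "real set \<Rightarrow> (real \<Rightarrow> 'a::real_normed_vector) \<Rightarrow> bool" where
  "C1_on S f \<longleftrightarrow> (\<exists>f'. (\<forall>x\<in>S. (f has_vector_derivative f' x) (at x within S)) \<and>
                     continuous_on S f')"

definition velocity :: "(real \<Rightarrow> plane) \<Rightarrow> real \<Rightarrow> plane" where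
  "velocity g x = vector_derivative g (at x within {0..1})"

definition regular_curve :: "(real \<Rightarrow> plane) \<Rightarrow> bool" where
  "regular_curve g \<longleftrightarrow> C1_on {0..1} g \<and> (\<forall>x\<in>{0..1}. velocity g x \<noteq> 0)"

definition unit_tangent :: "(real \<Rightarrow> plane) \<Rightarrow> real \<Rightarrow> plane" where
  "unit_tangent g x = sgn (velocity g x)"

definition unit_normal :: "(real \<Rightarrow> plane) \<Rightarrow> real \<Rightarrow> plane" where
  "unit_normal g x = rot90 (unit_tangent g x)"

definition curvature_vector :: "(real \<Rightarrow> plane) \<Rightarrow> real \<Rightarrow> plane" where
  "curvature_vector g x =
     (1 / norm (velocity g x)) *\<^sub>R vector_derivative (unit_tangent g) (at x within {0..1})"

text \<open>Integral along the curve \<open>g\<close> with respect to arclength; the integrand is given as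
  a function of the curve parameter.\<close>

definition arc_integral :: "(real \<Rightarrow> plane) \<Rightarrow> (real \<Rightarrow> real) \<Rightarrow> real" where
  "arc_integral g h = (LINT x|lebesgue_on {0..1}. h x * norm (velocity g x))"

definition curve_length :: "(real \<Rightarrow> plane) \<Rightarrow> real" where
  "curve_length g = arc_integral g (\<lambda>x. 1)"

section \<open>Networks\<close>

text \<open>A network is given by curves \<open>G 0, \<dots>, G (n - 1)\<close> on the unit interval.
  An end of a curve is a pair \<open>(i, e)\<close> with \<open>e \<in> {0, 1}\<close>; the order of a vertex
  \<open>p\<close> is the number of curve ends at \<open>p\<close> (so a curve with both ends at \<open>p\<close>
  counts twice).\<close>

definition curve_ends :: "nat \<Rightarrow> (nat \<Rightarrow> real \<Rightarrow> plane) \<Rightarrow> plane \<Rightarrow> (nat \<times> real) set" where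
  "curve_ends n G p = {(i, e). i < n \<and> e \<in> {0, 1} \<and> G i e = p}"

text \<open>In \<^const>\<open>simple_path\<close> the only admissible self-intersection is the coincidence of
  the two end-points. The last clause says that the vertices of order one lie on the
  boundary; that the multi-points lie in \<open>\<Omega>\<close> follows from the clause before it.\<close>

definition network :: "plane set \<Rightarrow> nat \<Rightarrow> (nat \<Rightarrow> real \<Rightarrow> plane) \<Rightarrow> bool" where
  "network \<Omega> n G \<longleftrightarrow>
     (\<forall>i<n. regular_curve (G i) \<and> G i ` {0..1} \<subseteq> closure \<Omega>) \<and>
     connected (\<Union>i<n. G i ` {0..1}) \<and>
     (\<forall>i<n. simple_path (G i)) \<and>
     (\<forall>i<n. \<forall>j<n. \<forall>x\<in>{0..1}. \<forall>y\<in>{0..1}.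
        i \<noteq> j \<and> G i x = G j y \<longrightarrow> x \<in> {0, 1} \<and> y \<in> {0, 1}) \<and>
     (\<forall>i<n. \<forall>x\<in>{0..1}. G i x \<in> frontier \<Omega> \<longrightarrow> x \<in> {0, 1}) \<and>
     (\<forall>p\<in>frontier \<Omega>. card (curve_ends n G p) \<le> 1) \<and>
     (\<forall>p. card (curve_ends n G p) = 1 \<longrightarrow> p \<in> frontier \<Omega>)"

definition outward_tangent :: "(real \<Rightarrow> plane) \<Rightarrow> real \<Rightarrow> plane" where
  "outward_tangent g e = (if e = 0 then - unit_tangent g e else unit_tangent g e)"

definition regular_network :: "plane set \<Rightarrow> nat \<Rightarrow> (nat \<Rightarrow> real \<Rightarrow> plane) \<Rightarrow> bool" where
  "regular_network \<Omega> n G \<longleftrightarrow> network \<Omega> n G \<and>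
     (\<forall>p. card (curve_ends n G p) > 1 \<longrightarrow>
        card (curve_ends n G p) = 3 \<and>
        (\<Sum>(i, e)\<in>curve_ends n G p. outward_tangent (G i) e) = 0)"

section \<open>Curvature flow of networks\<close>

definition C12_on :: "real \<Rightarrow> (real \<Rightarrow> real \<Rightarrow> plane) \<Rightarrow> bool" where
  "C12_on T g \<longleftrightarrow>
     (\<exists>gt gx gxx.
        (\<forall>t\<in>{0..<T}. \<forall>x\<in>{0..1}.
           ((\<lambda>s. g s x) has_vector_derivative gt t x) (at t within {0..<T}) \<and>
           (g t has_vector_derivative gx t x) (at x within {0..1}) \<and>
           (gx t has_vector_derivative gxx t x) (at x within {0..1})) \<and>
        continuous_on ({0..<T} \<times> {0..1}) (\<lambda>(t, x). g t x) \<and>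
        continuous_on ({0..<T} \<times> {0..1}) (\<lambda>(t, x). gt t x) \<and>
        continuous_on ({0..<T} \<times> {0..1}) (\<lambda>(t, x). gx t x) \<and>
        continuous_on ({0..<T} \<times> {0..1}) (\<lambda>(t, x). gxx t x))"

definition normal_velocity :: "real \<Rightarrow> (real \<Rightarrow> real \<Rightarrow> plane) \<Rightarrow> real \<Rightarrow> real \<Rightarrow> plane" where
  "normal_velocity T g t x =
     (vector_derivative (\<lambda>s. g s x) (at t within {0..<T}) \<bullet> unit_normal (g t) x)
       *\<^sub>R unit_normal (g t) x"

text \<open>\<open>\<gamma> i t\<close> is the \<open>i\<close>-th curve at time \<open>t\<close>.\<close>

definition network_flow ::
  "plane set \<Rightarrow> real \<Rightarrow> nat \<Rightarrow> (nat \<Rightarrow> real \<Rightarrow> real \<Rightarrow> plane) \<Rightarrow> bool" where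
  "network_flow \<Omega> T n \<gamma> \<longleftrightarrow>
     (\<forall>i<n. C12_on T (\<gamma> i)) \<and>
     (\<forall>t\<in>{0..<T}. regular_network \<Omega> n (\<lambda>i. \<gamma> i t)) \<and>
     (\<forall>i<n. \<forall>t\<in>{0..<T}. \<forall>x\<in>{0..1}.
        normal_velocity T (\<gamma> i) t x = curvature_vector (\<gamma> i t) x) \<and>
     (\<forall>i<n. \<forall>j<n. \<forall>e\<in>{0, 1}. \<forall>e'\<in>{0, 1}. \<forall>s\<in>{0..<T}. \<forall>t\<in>{0..<T}.
        \<gamma> i s e = \<gamma> j s e' \<longrightarrow> \<gamma> i t e = \<gamma> j t e') \<and>
     (\<forall>i<n. \<forall>e\<in>{0, 1}. \<forall>s\<in>{0..<T}. \<forall>t\<in>{0..<T}.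
        \<gamma> i s e \<in> frontier \<Omega> \<longrightarrow> \<gamma> i t e = \<gamma> i s e)"

text \<open>The argument \<open>\<tau>\<close> below is the rescaled time.\<close>

definition rescaled_network ::
  "(nat \<Rightarrow> real \<Rightarrow> real \<Rightarrow> plane) \<Rightarrow> real \<Rightarrow> plane \<Rightarrow> real \<Rightarrow> nat \<Rightarrow> real \<Rightarrow> plane" where
  "rescaled_network \<gamma> T x0 \<tau> i x =
     (let t = T - exp (- 2 * \<tau>) in (\<gamma> i t x - x0) /\<^sub>R sqrt (2 * (T - t)))"

definition backward_heat_kernel :: "real \<Rightarrow> plane \<Rightarrow> real \<Rightarrow> plane \<Rightarrow> real" where
  "backward_heat_kernel T x0 t x =
     exp (- (norm (x - x0))\<^sup>2 / (4 * (T - t))) / sqrt (4 * pi * (T - t))"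

text \<open>A relation rather than a function, so that the existence of the limit is asserted
  together with its value.\<close>

definition has_limit_gaussian_density ::
  "(nat \<Rightarrow> real \<Rightarrow> real \<Rightarrow> plane) \<Rightarrow> nat \<Rightarrow> real \<Rightarrow> plane \<Rightarrow> real \<Rightarrow> bool" where
  "has_limit_gaussian_density \<gamma> n T x0 \<theta> \<longleftrightarrow>
     ((\<lambda>t. \<Sum>i<n. arc_integral (\<gamma> i t) (\<lambda>x. backward_heat_kernel T x0 t (\<gamma> i t x)))
        \<longlongrightarrow> \<theta>) (at_left T)"

definition curvature_L2_in_ball :: "nat \<Rightarrow> (nat \<Rightarrow> real \<Rightarrow> plane) \<Rightarrow> real \<Rightarrow> real" where
  "curvature_L2_in_ball n G R =
     sqrt (\<Sum>i<n. arc_integral (G i)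
        (\<lambda>x. indicator (ball 0 R) (G i x) * (norm (curvature_vector (G i) x))\<^sup>2))"

section \<open>Convergence of functions on a compact interval\<close>

definition C1_hoelder_on :: "real \<Rightarrow> real \<Rightarrow> real \<Rightarrow> (real \<Rightarrow> plane) \<Rightarrow> bool" where
  "C1_hoelder_on \<alpha> a b f \<longleftrightarrow> C1_on {a..b} f \<and>
     (\<exists>B. \<forall>s\<in>{a..b}. \<forall>s'\<in>{a..b}.
        norm (vector_derivative f (at s within {a..b}) - vector_derivative f (at s' within {a..b}))
          \<le> B * \<bar>s - s'\<bar> powr \<alpha>)"

definition C1_hoelder_tendsto ::
  "real \<Rightarrow> real \<Rightarrow> real \<Rightarrow> (nat \<Rightarrow> real \<Rightarrow> plane) \<Rightarrow> (real \<Rightarrow> plane) \<Rightarrow> bool" where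
  "C1_hoelder_tendsto \<alpha> a b F f \<longleftrightarrow>
     C1_hoelder_on \<alpha> a b f \<and> (\<forall>\<^sub>F j in sequentially. C1_hoelder_on \<alpha> a b (F j)) \<and>
     (\<forall>\<epsilon>>0. \<forall>\<^sub>F j in sequentially.
        let D = (\<lambda>s. vector_derivative (F j) (at s within {a..b})
                     - vector_derivative f (at s within {a..b}))
        in (\<forall>s\<in>{a..b}. norm (F j s - f s) \<le> \<epsilon> \<and> norm (D s) \<le> \<epsilon>) \<and>
           (\<forall>s\<in>{a..b}. \<forall>s'\<in>{a..b}. norm (D s - D s') \<le> \<epsilon> * \<bar>s - s'\<bar> powr \<alpha>))"

definition L2_on :: "real \<Rightarrow> real \<Rightarrow> (real \<Rightarrow> plane) \<Rightarrow> bool" where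
  "L2_on a b f \<longleftrightarrow> f \<in> borel_measurable (lebesgue_on {a..b}) \<and>
     integrable (lebesgue_on {a..b}) (\<lambda>s. (norm (f s))\<^sup>2)"

definition L2_norm_on :: "real \<Rightarrow> real \<Rightarrow> (real \<Rightarrow> plane) \<Rightarrow> real" where
  "L2_norm_on a b f = sqrt (LINT s|lebesgue_on {a..b}. (norm (f s))\<^sup>2)"

definition test_function :: "real \<Rightarrow> real \<Rightarrow> (real \<Rightarrow> real) \<Rightarrow> bool" where
  "test_function a b \<psi> \<longleftrightarrow> smooth_fun \<psi> \<and>
     (\<exists>a' b'. a < a' \<and> a' < b' \<and> b' < b \<and> (\<forall>s. s \<notin> {a'..b'} \<longrightarrow> \<psi> s = 0))"

definition weak_derivative_on ::
  "real \<Rightarrow> real \<Rightarrow> (real \<Rightarrow> plane) \<Rightarrow> (real \<Rightarrow> plane) \<Rightarrow> bool" where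
  "weak_derivative_on a b f g \<longleftrightarrow>
     (\<forall>\<psi>. test_function a b \<psi> \<longrightarrow>
        (LINT s|lebesgue_on {a..b}. deriv \<psi> s *\<^sub>R f s)
          = - (LINT s|lebesgue_on {a..b}. \<psi> s *\<^sub>R g s))"

definition W22_on ::
  "real \<Rightarrow> real \<Rightarrow> (real \<Rightarrow> plane) \<Rightarrow> (real \<Rightarrow> plane) \<Rightarrow> (real \<Rightarrow> plane) \<Rightarrow> bool" where
  "W22_on a b f f1 f2 \<longleftrightarrow> L2_on a b f \<and> L2_on a b f1 \<and> L2_on a b f2 \<and>
     weak_derivative_on a b f f1 \<and> weak_derivative_on a b f1 f2"

definition W22_tendsto ::
  "real \<Rightarrow> real \<Rightarrow> (nat \<Rightarrow> real \<Rightarrow> plane) \<Rightarrow> (real \<Rightarrow> plane) \<Rightarrow> bool" where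
  "W22_tendsto a b F f \<longleftrightarrow>
     (\<exists>F1 F2 f1 f2. W22_on a b f f1 f2 \<and>
        (\<forall>\<^sub>F j in sequentially. W22_on a b (F j) (F1 j) (F2 j)) \<and>
        (\<lambda>j. L2_norm_on a b (\<lambda>s. F j s - f s)) \<longlonglongrightarrow> 0 \<and>
        (\<lambda>j. L2_norm_on a b (\<lambda>s. F1 j s - f1 s)) \<longlonglongrightarrow> 0 \<and>
        (\<lambda>j. L2_norm_on a b (\<lambda>s. F2 j s - f2 s)) \<longlonglongrightarrow> 0)"

section \<open>Local convergence of networks\<close>

text \<open>A reparametrization \<open>\<phi>\<close> by arclength, possibly orientation-reversing, of a
  sub-arc of \<open>g\<close>.\<close>

definition arclength_piece :: "(real \<Rightarrow> plane) \<Rightarrow> real \<Rightarrow> real \<Rightarrow> (real \<Rightarrow> real) \<Rightarrow> bool" where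
  "arclength_piece g a b \<phi> \<longleftrightarrow>
     a < b \<and> C1_on {a..b} \<phi> \<and> inj_on \<phi> {a..b} \<and> \<phi> ` {a..b} \<subseteq> {0..1} \<and>
     C1_on {a..b} (g \<circ> \<phi>) \<and>
     (\<forall>s\<in>{a..b}. norm (vector_derivative (g \<circ> \<phi>) (at s within {a..b})) = 1)"

text \<open>The network \<open>G\<close> is described in the ball of radius \<open>R\<close> by \<open>m\<close> arcs: the
  \<open>l\<close>-th one is a sub-arc of the curve with index \<open>idx l\<close>, parametrized by arclength on
  \<open>{a l..b l}\<close>. The arcs cover every part of every curve inside the ball and do not overlap.
  One curve may contribute several arcs, since it may cross the ball several times.\<close>

definition described_in_ball ::
  "real \<Rightarrow> nat \<Rightarrow> (nat \<Rightarrow> real \<Rightarrow> plane) \<Rightarrow> nat \<Rightarrow> (nat \<Rightarrow> real) \<Rightarrow> (nat \<Rightarrow> real) \<Rightarrow>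
     (nat \<Rightarrow> nat) \<Rightarrow> (nat \<Rightarrow> real \<Rightarrow> real) \<Rightarrow> bool" where
  "described_in_ball R n G m a b idx \<phi> \<longleftrightarrow>
     (\<forall>l<m. idx l < n \<and> arclength_piece (G (idx l)) (a l) (b l) (\<phi> l)) \<and>
     (\<forall>l<m. \<forall>l'<m. l \<noteq> l' \<and> idx l = idx l' \<longrightarrow>
        \<phi> l ` {a l<..<b l} \<inter> \<phi> l' ` {a l'<..<b l'} = {}) \<and>
     (\<forall>i<n. \<forall>x\<in>{0..1}. G i x \<in> ball 0 R \<longrightarrow>
        (\<exists>l<m. idx l = i \<and> x \<in> \<phi> l ` {a l..b l}))"

text \<open>The limit is a list \<open>L\<close> of pairs \<open>(J, \<eta>)\<close> of a closed interval and a curve on it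
  parametrized by arclength; a limit curve of multiplicity \<open>m\<close> is listed \<open>m\<close> times, one
  entry for each sequence of arcs converging to it, and \<open>[]\<close> is the empty limit. It
  suffices to consider balls, as they exhaust the compact sets. For each of them the arcs
  describing \<open>G j\<close> converge on fixed compact intervals \<open>{a l..b l}\<close> containing all the
  parameters at which the limit curves lie in the ball.\<close>

definition network_tendsto ::
  "real \<Rightarrow> nat \<Rightarrow> (nat \<Rightarrow> nat \<Rightarrow> real \<Rightarrow> plane) \<Rightarrow> (real set \<times> (real \<Rightarrow> plane)) list \<Rightarrow> bool" where
  "network_tendsto \<alpha> n G L \<longleftrightarrow>
     (\<forall>R>0. \<exists>a b idx \<phi>.
        (\<forall>l<length L. case L ! l of (J, \<eta>) \<Rightarrow>
           a l < b l \<and> {a l..b l} \<subseteq> J \<and> {s \<in> J. \<eta> s \<in> ball 0 R} \<subseteq> {a l..b l} \<and>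
           C1_hoelder_tendsto \<alpha> (a l) (b l) (\<lambda>j. G j (idx j l) \<circ> \<phi> j l) \<eta> \<and>
           W22_tendsto (a l) (b l) (\<lambda>j. G j (idx j l) \<circ> \<phi> j l) \<eta>) \<and>
        (\<forall>\<^sub>F j in sequentially. described_in_ball R n (G j) (length L) a b (idx j) (\<phi> j)))"

definition ray :: "plane \<Rightarrow> real set \<times> (real \<Rightarrow> plane)" where
  "ray v = ({0..}, \<lambda>s. s *\<^sub>R v)"

definition line_with_multiplicity :: "nat \<Rightarrow> (real set \<times> (real \<Rightarrow> plane)) list \<Rightarrow> bool" where
  "line_with_multiplicity m L \<longleftrightarrow>
     m \<ge> 1 \<and> (\<exists>v. norm v = 1 \<and> L = replicate m (UNIV, \<lambda>s. s *\<^sub>R v))"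

definition standard_triod :: "(real set \<times> (real \<Rightarrow> plane)) list \<Rightarrow> bool" where
  "standard_triod L \<longleftrightarrow>
     (\<exists>u v w. norm u = 1 \<and> norm v = 1 \<and> norm w = 1 \<and>
        u \<bullet> v = cos (2 * pi / 3) \<and> v \<bullet> w = cos (2 * pi / 3) \<and> w \<bullet> u = cos (2 * pi / 3) \<and>
        L = [ray u, ray v, ray w])"

definition halfline_from_origin :: "(real set \<times> (real \<Rightarrow> plane)) list \<Rightarrow> bool" where
  "halfline_from_origin L \<longleftrightarrow> (\<exists>v. norm v = 1 \<and> L = [ray v])"

end

theory Submission
  imports Defs "HOL-Probability.Probability"
begin

text \<open>Huisken's monotonicity formula bounds the time integral of the shrinker defect
  \<open>\<bar>k + x\<^sup>\<bottom>\<bar>\<^sup>2\<close> with Gaussian weight, so along some rescaled times in \<open>I\<close> this defect tends to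
  zero. Since the rescaled curves become infinitely long while their Gaussian length stays bounded, the
  support function \<open>x \<bullet> \<nu>\<close> then tends to zero locally, hence so does the curvature in \<open>L\<^sup>2\<close>, and every
  arc close to the origin is nearly a line through it or a ray from an end of its curve. As the curves
  do not cross, two nearly straight arcs have to be parallel, and triple points near the origin exclude
  each other and any other arc. A fixed end-point at \<open>x\<^sub>0\<close> excludes everything else because, by
  strict convexity and the Hopf boundary lemma, the flow stays in a cone with an angle less than \<open>\<pi>\<close> there.
  The density is read off from the Gaussian lengths of the limiting lines and rays.\<close>

lemma inner_plane: "x \<bullet> y = x $ 1 * y $ 1 + x $ 2 * y $ 2" for x y :: plane
  by (simp add: inner_vec_def UNIV_2)

lemma rot90_nth [simp]: "rot90 v $ 1 = - (v $ 2)" "rot90 v $ 2 = v $ 1"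
  by (simp_all add: rot90_def)

lemma plane_eq_iff: "x = y \<longleftrightarrow> x $ 1 = y $ 1 \<and> x $ 2 = y $ 2" for x y :: plane
  by (auto simp: vec_eq_iff forall_2)

lemma linear_rot90: "linear rot90"
  by (rule linearI) (simp_all add: plane_eq_iff)

lemma bounded_linear_rot90: "bounded_linear rot90"
  by (simp add: linear_conv_bounded_linear[symmetric] linear_rot90)

lemma rot90_simps [simp]: "rot90 (x + y) = rot90 x + rot90 y" "rot90 (x - y) = rot90 x - rot90 y"
  "rot90 (c *\<^sub>R x) = c *\<^sub>R rot90 x" "rot90 (- x) = - rot90 x" "rot90 0 = 0"
  by (simp_all add: plane_eq_iff)

lemma inner_rot90 [simp]: "x \<bullet> rot90 x = 0" "rot90 x \<bullet> x = 0" "rot90 x \<bullet> rot90 y = x \<bullet> y"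
  by (simp_all add: inner_plane)

lemma inner_rot90_swap: "rot90 x \<bullet> y = - (x \<bullet> rot90 y)"
  by (simp add: inner_plane)

lemma norm_rot90 [simp]: "norm (rot90 x) = norm x"
  by (simp add: norm_eq_sqrt_inner)

lemma plane_decomp:
  assumes "norm t = 1"
  shows "x = (x \<bullet> t) *\<^sub>R t + (x \<bullet> rot90 t) *\<^sub>R rot90 t"
proof -
  have 1: "t $ 1 * t $ 1 + t $ 2 * t $ 2 = 1"
    using assms by (simp add: norm_eq_1 inner_plane)
  have "(x \<bullet> t) * t $ 1 + (x \<bullet> rot90 t) * rot90 t $ 1 = x $ 1 * (t $ 1 * t $ 1 + t $ 2 * t $ 2)"
       "(x \<bullet> t) * t $ 2 + (x \<bullet> rot90 t) * rot90 t $ 2 = x $ 2 * (t $ 1 * t $ 1 + t $ 2 * t $ 2)"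
    by (simp_all add: inner_plane algebra_simps)
  then show ?thesis using 1 by (simp add: plane_eq_iff)
qed

lemma inner_decomp:
  assumes "norm t = 1"
  shows "x \<bullet> y = (x \<bullet> t) * (y \<bullet> t) + (x \<bullet> rot90 t) * (y \<bullet> rot90 t)"
proof -
  have "x \<bullet> y = ((x \<bullet> t) *\<^sub>R t + (x \<bullet> rot90 t) *\<^sub>R rot90 t) \<bullet> y"
    using plane_decomp[OF assms, of x] by simp
  also have "\<dots> = (x \<bullet> t) * (t \<bullet> y) + (x \<bullet> rot90 t) * (rot90 t \<bullet> y)"
    by (simp add: inner_add_left)
  finally show ?thesis by (simp add: inner_commute)
qed

lemma norm_decomp:
  assumes "norm t = 1"
  shows "(norm x)\<^sup>2 = (x \<bullet> t)\<^sup>2 + (x \<bullet> rot90 t)\<^sup>2"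
  using inner_decomp[OF assms, of x x] unfolding power2_norm_eq_inner by (simp add: power2_eq_square)

lemma norm_le_decomp:
  assumes "norm t = 1"
  shows "norm x \<le> \<bar>x \<bullet> t\<bar> + \<bar>x \<bullet> rot90 t\<bar>"
proof -
  have "(norm x)\<^sup>2 \<le> (\<bar>x \<bullet> t\<bar> + \<bar>x \<bullet> rot90 t\<bar>)\<^sup>2"
    unfolding norm_decomp[OF assms] by (simp add: power2_sum)
  then show ?thesis by (rule power2_le_imp_le) simp
qed

lemma orthogonal_unit_parallel:
  assumes "norm t = 1" "x \<bullet> t = 0"
  shows "x = (x \<bullet> rot90 t) *\<^sub>R rot90 t"
  using plane_decomp[OF assms(1), of x] assms(2) by simp

abbreviation (input) gaussian_length :: "(real \<Rightarrow> plane) \<Rightarrow> real" where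
  "gaussian_length h \<equiv> arc_integral h (\<lambda>x. exp (- (norm (h x))\<^sup>2 / 2))"

abbreviation (input) wide_gaussian_length :: "(real \<Rightarrow> plane) \<Rightarrow> real" where
  "wide_gaussian_length h \<equiv> arc_integral h (\<lambda>x. exp (- (norm (h x))\<^sup>2 / 4))"

abbreviation (input) shrinker_energy :: "(real \<Rightarrow> plane) \<Rightarrow> real" where
  "shrinker_energy h \<equiv> arc_integral h (\<lambda>x. exp (- (norm (h x))\<^sup>2 / 2) *
     ((curvature_vector h x + h x) \<bullet> unit_normal h x)\<^sup>2)"

lemmas real_derivative_iff_vector = has_real_derivative_iff_has_vector_derivative

section \<open>Arclength parametrization\<close>

lemma has_vector_derivative_sgn:
  fixes f :: "real \<Rightarrow> 'a::real_inner"
  assumes f: "(f has_vector_derivative f') (at x within S)" and nz: "f x \<noteq> 0"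
  shows "((\<lambda>x. sgn (f x)) has_vector_derivative
           (f' /\<^sub>R norm (f x) - ((f x \<bullet> f') / norm (f x) ^ 3) *\<^sub>R f x)) (at x within S)"
proof -
  have n: "((\<lambda>x. norm (f x)) has_vector_derivative (f' \<bullet> sgn (f x))) (at x within S)"
  proof -
    have "((norm \<circ> f) has_vector_derivative (f' \<bullet> sgn (f x))) (at x within S)"
      by (rule vector_derivative_diff_chain_within[OF f])
         (rule has_derivative_at_withinI, rule has_derivative_norm[OF nz])
    then show ?thesis by (simp add: o_def)
  qed
  then have n': "((\<lambda>x. norm (f x)) has_field_derivative (f' \<bullet> sgn (f x))) (at x within S)"
    by (simp add: real_derivative_iff_vector)
  have "((\<lambda>x. inverse (norm (f x))) has_field_derivative
          - (inverse (norm (f x)) * (f' \<bullet> sgn (f x)) * inverse (norm (f x)))) (at x within S)"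
    by (rule DERIV_inverse'[OF n']) (use nz in simp)
  from has_vector_derivative_scaleR[OF this f]
  have "((\<lambda>x. inverse (norm (f x)) *\<^sub>R f x) has_vector_derivative
     inverse (norm (f x)) *\<^sub>R f' +
     (- (inverse (norm (f x)) * (f' \<bullet> sgn (f x)) * inverse (norm (f x)))) *\<^sub>R f x) (at x within S)"
    by simp
  moreover have "inverse (norm (f x)) * (f' \<bullet> sgn (f x)) * inverse (norm (f x))
      = (f x \<bullet> f') / norm (f x) ^ 3"
    using nz by (simp add: sgn_div_norm field_simps power3_eq_cube inner_commute)
  ultimately show ?thesis
    by (simp add: sgn_div_norm)
qed

definition C2_data :: "(real \<Rightarrow> plane) \<Rightarrow> (real \<Rightarrow> plane) \<Rightarrow> (real \<Rightarrow> plane) \<Rightarrow> bool" where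
  "C2_data g g1 g2 \<longleftrightarrow>
     (\<forall>x\<in>{0..1}. (g has_vector_derivative g1 x) (at x within {0..1}) \<and>
        (g1 has_vector_derivative g2 x) (at x within {0..1}) \<and> g1 x \<noteq> 0) \<and>
     continuous_on {0..1} g2"

lemma vector_derivative_within_unit:
  fixes f :: "real \<Rightarrow> 'a::euclidean_space"
  assumes "(f has_vector_derivative f') (at x within {0..1})" "x \<in> {0..1}"
  shows "vector_derivative f (at x within {0..1}) = f'"
  using vector_derivative_within_cbox[of 0 1 x f f'] assms by simp

context
  fixes g g1 g2
  assumes C2: "C2_data g g1 g2"
begin

lemma C2_continuous: "continuous_on {0..1} g" "continuous_on {0..1} g1" "continuous_on {0..1} g2"
  using C2 unfolding C2_data_def
  by (auto intro!: continuous_on_vector_derivative)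

lemma C2_velocity: "x \<in> {0..1} \<Longrightarrow> velocity g x = g1 x"
  using C2 unfolding C2_data_def velocity_def by (intro vector_derivative_within_unit) auto

lemma C2_nonzero: "x \<in> {0..1} \<Longrightarrow> g1 x \<noteq> 0"
  using C2 unfolding C2_data_def by auto

lemma C2_unit_tangent: "x \<in> {0..1} \<Longrightarrow> unit_tangent g x = sgn (g1 x)"
  by (simp add: unit_tangent_def C2_velocity)

lemma C2_norm_unit_tangent: "x \<in> {0..1} \<Longrightarrow> norm (unit_tangent g x) = 1"
  using C2_nonzero[of x] by (simp add: C2_unit_tangent norm_sgn)

lemma C2_unit_tangent_derivative:
  assumes "x \<in> {0..1}"
  shows "(unit_tangent g has_vector_derivative
     (g2 x /\<^sub>R norm (g1 x) - ((g1 x \<bullet> g2 x) / norm (g1 x) ^ 3) *\<^sub>R g1 x)) (at x within {0..1})"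
proof -
  have "((\<lambda>x. sgn (g1 x)) has_vector_derivative
     (g2 x /\<^sub>R norm (g1 x) - ((g1 x \<bullet> g2 x) / norm (g1 x) ^ 3) *\<^sub>R g1 x)) (at x within {0..1})"
    using C2 assms unfolding C2_data_def by (intro has_vector_derivative_sgn) auto
  then show ?thesis
    by (rule has_vector_derivative_transform[OF assms, rotated]) (simp add: C2_unit_tangent)
qed

lemma C2_curvature:
  assumes "x \<in> {0..1}"
  shows "curvature_vector g x = (1 / norm (g1 x)) *\<^sub>R
     (g2 x /\<^sub>R norm (g1 x) - ((g1 x \<bullet> g2 x) / norm (g1 x) ^ 3) *\<^sub>R g1 x)"
  using vector_derivative_within_unit[OF C2_unit_tangent_derivative[OF assms] assms] assms
  by (simp add: curvature_vector_def C2_velocity)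

lemma C2_unit_tangent_derivative':
  assumes "x \<in> {0..1}"
  shows "(unit_tangent g has_vector_derivative norm (g1 x) *\<^sub>R curvature_vector g x)
     (at x within {0..1})"
  using C2_unit_tangent_derivative[OF assms] C2_nonzero[OF assms]
  by (simp add: C2_curvature[OF assms])

lemma C2_continuous_curvature: "continuous_on {0..1} (curvature_vector g)"
  by (subst continuous_on_cong[OF refl C2_curvature])
     (auto intro!: continuous_intros C2_continuous simp: C2_nonzero)

lemma C2_continuous_unit_tangent: "continuous_on {0..1} (unit_tangent g)"
  by (subst continuous_on_cong[OF refl C2_unit_tangent])
     (auto intro!: continuous_intros C2_continuous simp: C2_nonzero)

lemma C2_curvature_orthogonal:
  assumes "x \<in> {0..1}"
  shows "curvature_vector g x \<bullet> unit_tangent g x = 0"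
proof -
  have n: "norm (g1 x) \<noteq> 0" using C2_nonzero[OF assms] by simp
  have "g1 x \<bullet> g1 x = norm (g1 x) * norm (g1 x)"
    by (simp add: power2_norm_eq_inner[symmetric] power2_eq_square)
  then have "(g2 x /\<^sub>R norm (g1 x) - ((g1 x \<bullet> g2 x) / norm (g1 x) ^ 3) *\<^sub>R g1 x) \<bullet> g1 x
      = (g2 x \<bullet> g1 x) / norm (g1 x) - (g1 x \<bullet> g2 x) / norm (g1 x) ^ 3 * (norm (g1 x) * norm (g1 x))"
    by (simp add: inner_diff_left inverse_eq_divide)
  also have "\<dots> = 0"
    using n by (simp add: power3_eq_cube inner_commute)
  finally have "(g2 x /\<^sub>R norm (g1 x) - ((g1 x \<bullet> g2 x) / norm (g1 x) ^ 3) *\<^sub>R g1 x) \<bullet> g1 x = 0" .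
  then show ?thesis
    by (simp add: C2_curvature[OF assms] C2_unit_tangent[OF assms] sgn_div_norm)
qed

lemma C2_arc_integral:
  assumes "continuous_on {0..1} F"
  shows "arc_integral g F = integral {0..1} (\<lambda>x. F x * norm (g1 x))"
proof -
  have c: "continuous_on {0..1} (\<lambda>x. F x * norm (g1 x))"
    by (intro continuous_intros assms C2_continuous)
  have "arc_integral g F = (LINT x|lebesgue_on {0..1}. F x * norm (g1 x))"
    unfolding arc_integral_def
    by (rule Bochner_Integration.integral_cong) (auto simp: C2_velocity)
  also have "\<dots> = integral {0..1} (\<lambda>x. F x * norm (g1 x))"
    by (rule lebesgue_integral_eq_integral) (auto intro!: continuous_imp_integrable_real c)
  finally show ?thesis .
qed

end

definition unit_speed :: "real \<Rightarrow> (real \<Rightarrow> plane) \<Rightarrow> (real \<Rightarrow> plane) \<Rightarrow> (real \<Rightarrow> plane) \<Rightarrow> bool" where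
  "unit_speed l G U K \<longleftrightarrow> 0 < l \<and> continuous_on {0..l} K \<and>
     (\<forall>s\<in>{0..l}. (G has_vector_derivative U s) (at s within {0..l}) \<and>
        (U has_vector_derivative K s) (at s within {0..l}) \<and> norm (U s) = 1)"

definition arclength_param :: "(real \<Rightarrow> plane) \<Rightarrow> real \<Rightarrow> (real \<Rightarrow> real) \<Rightarrow> bool" where
  "arclength_param g l \<psi> \<longleftrightarrow> 0 < l \<and> \<psi> 0 = 0 \<and> \<psi> l = 1 \<and> \<psi> ` {0..l} = {0..1} \<and>
     strict_mono_on {0..l} \<psi> \<and>
     (\<forall>s\<in>{0..l}. (\<psi> has_real_derivative 1 / norm (velocity g (\<psi> s))) (at s within {0..l}))"

lemma arclength_reparametrization:
  fixes v :: "real \<Rightarrow> real"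
  assumes v: "continuous_on {0..1} v" and pos': "\<forall>x\<in>{0..1}. 0 < v x"
  shows "\<exists>l \<psi>. (0 < l \<and> \<psi> 0 = 0 \<and> \<psi> l = 1 \<and> \<psi> ` {0..l} = {0..1} \<and> strict_mono_on {0..l} \<psi>) \<and>
    (\<forall>s\<in>{0..l}. (\<psi> has_real_derivative 1 / v (\<psi> s)) (at s within {0..l})) \<and>
    (\<forall>F. continuous_on {0..1} F \<longrightarrow> integral {0..l} (\<lambda>s. F (\<psi> s)) = integral {0..1} (\<lambda>x. F x * v x :: real))"
proof -
  have pos: "0 < v x" if "x \<in> {0..1}" for x using pos' that by blast
  define w where "w x = v (max 0 (min 1 x))" for x
  have w: "continuous_on A w" for A
    unfolding w_def by (rule continuous_on_compose2[OF v]) (auto intro!: continuous_intros)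
  have wpos: "0 < w x" for x unfolding w_def by (rule pos) auto
  have wv: "w x = v x" if "x \<in> {0..1}" for x using that by (simp add: w_def)
  define \<sigma> where "\<sigma> x = integral {-1..x} w - integral {-1..0} w" for x
  have d: "(\<sigma> has_real_derivative w x) (at x within {-1..2})" if "x \<in> {-1..2}" for x
    using integral_has_real_derivative[OF w that]
    unfolding \<sigma>_def by (auto intro!: derivative_eq_intros)
  have d': "(\<sigma> has_real_derivative w x) (at x)" if "x \<in> {-1<..<2}" for x
    using d[of x] that at_within_interior[of x "{-1..2}"] by auto
  have cont: "continuous_on {-1..2} \<sigma>"
    using d by (meson DERIV_continuous_on)
  have mono: "\<sigma> x < \<sigma> y" if "-1 \<le> x" "x < y" "y \<le> 2" for x y
  proof (rule DERIV_pos_imp_increasing_open[OF \<open>x < y\<close>])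
    show "\<exists>y. (\<sigma> has_real_derivative y) (at z) \<and> 0 < y" if "x < z" "z < y" for z
      using d'[of z] wpos \<open>-1 \<le> x\<close> \<open>y \<le> 2\<close> that by auto
    show "continuous_on {x..y} \<sigma>" using cont by (rule continuous_on_subset) (use that in auto)
  qed
  have sm: "strict_mono_on {-1..2} \<sigma>" by (auto intro!: strict_mono_onI mono)
  have inj: "inj_on \<sigma> {-1..2}" using sm by (rule strict_mono_on_imp_inj_on)
  define \<psi> where "\<psi> = inv_into {-1..2} \<sigma>"
  have \<psi>\<sigma>: "\<psi> (\<sigma> x) = x" if "x \<in> {-1..2}" for x
    unfolding \<psi>_def by (rule inv_into_f_f[OF inj that])
  define l where "l = \<sigma> 1"
  have \<sigma>0: "\<sigma> 0 = 0" by (simp add: \<sigma>_def)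
  have img: "\<sigma> ` {x..y} = {\<sigma> x..\<sigma> y}" if "-1 \<le> x" "x \<le> y" "y \<le> 2" for x y
  proof (rule antisym)
    show "\<sigma> ` {x..y} \<subseteq> {\<sigma> x..\<sigma> y}"
      using that by (auto intro!: strict_mono_on_leD[OF sm])
    show "{\<sigma> x..\<sigma> y} \<subseteq> \<sigma> ` {x..y}"
    proof
      fix s assume s: "s \<in> {\<sigma> x..\<sigma> y}"
      have "continuous_on {x..y} \<sigma>"
        by (rule continuous_on_subset[OF cont]) (use that in auto)
      then have "\<exists>z\<ge>x. z \<le> y \<and> \<sigma> z = s"
        using s that by (intro IVT') auto
      then show "s \<in> \<sigma> ` {x..y}" by auto
    qed
  qed
  have lpos: "0 < l" using mono[of 0 1] \<sigma>0 by (simp add: l_def)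
  have img01: "\<sigma> ` {0..1} = {0..l}" using img[of 0 1] \<sigma>0 by (simp add: l_def)
  have ex: "\<exists>x\<in>{0..1}. \<sigma> x = s" if "s \<in> {0..l}" for s
    using that unfolding img01[symmetric] by auto
  have p1: "\<psi> ` {0..l} = {0..1}"
    unfolding img01[symmetric] image_image by (simp add: \<psi>\<sigma>)
  have p2: "strict_mono_on {0..l} \<psi>"
  proof (rule strict_mono_onI)
    fix r s assume "r \<in> {0..l}" "s \<in> {0..l}" "r < s"
    then obtain x y where "x \<in> {0..1}" "y \<in> {0..1}" "\<sigma> x = r" "\<sigma> y = s" using ex by metis
    moreover have "x < y"
      using calculation \<open>r < s\<close> strict_mono_on_leD[OF sm, of y x] by force
    ultimately show "\<psi> r < \<psi> s" using \<psi>\<sigma>[of x] \<psi>\<sigma>[of y] by auto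
  qed
  have sel: "\<sigma> (\<psi> s) = s" if "s \<in> {\<sigma> (-1)..\<sigma> 2}" for s
    unfolding \<psi>_def by (rule f_inv_into_f) (use img[of "-1" 2] that in auto)
  have neg: "\<sigma> (-1) < 0" using mono[of "-1" 0] \<sigma>0 by simp
  have big: "l < \<sigma> 2" using mono[of 1 2] by (simp add: l_def)
  have c\<psi>: "continuous_on {\<sigma> (-1)..\<sigma> 2} \<psi>"
    using continuous_on_inv[OF cont compact_Icc, of \<psi>] \<psi>\<sigma> img[of "-1" 2] by auto
  have p3: "(\<psi> has_real_derivative 1 / v (\<psi> s)) (at s within {0..l})" if "s \<in> {0..l}" for s
  proof -
    have s: "s \<in> {\<sigma> (-1)<..<\<sigma> 2}" using that neg big by auto
    have "\<psi> s \<in> {0..1}" using p1 that by blast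
    then have "(\<sigma> has_real_derivative v (\<psi> s)) (at (\<psi> s))" using d'[of "\<psi> s"] wv by auto
    moreover have "v (\<psi> s) \<noteq> 0" using pos[OF \<open>\<psi> s \<in> {0..1}\<close>] by simp
    moreover have "isCont \<psi> s"
      using continuous_on_interior[OF c\<psi>] s by simp
    ultimately have "(\<psi> has_real_derivative inverse (v (\<psi> s))) (at s)"
      using s by (intro DERIV_inverse_function[where a="\<sigma> (-1)" and b="\<sigma> 2"]) (auto intro!: sel)
    then show ?thesis by (simp add: inverse_eq_divide has_field_derivative_at_within)
  qed
  have p4: "integral {0..l} (\<lambda>s. F (\<psi> s)) = integral {0..1} (\<lambda>x. F x * v x)"
    if F: "continuous_on {0..1} F" for F :: "real \<Rightarrow> real"
  proof -
    have "((\<lambda>x. w x *\<^sub>R F (\<psi> (\<sigma> x))) has_integral integral {\<sigma> 0..\<sigma> 1} (\<lambda>s. F (\<psi> s))) {0..1}"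
    proof (rule has_integral_substitution[where c=0 and d=l and g=\<sigma> and f="\<lambda>s. F (\<psi> s)"])
      show "continuous_on {0..l} (\<lambda>s. F (\<psi> s))"
        by (rule continuous_on_compose2[OF F])
           (use p1 neg big in \<open>auto intro!: continuous_on_subset[OF c\<psi>]\<close>)
      show "(\<sigma> has_real_derivative w x) (at x within {0..1})" if "x \<in> {0..1}" for x
        by (rule has_field_derivative_at_within, rule d') (use that in auto)
    qed (use lpos \<sigma>0 l_def img01 in auto)
    moreover have "w x *\<^sub>R F (\<psi> (\<sigma> x)) = F x * v x" if "x \<in> {0..1}" for x
      using that by (simp add: \<psi>\<sigma> wv)
    ultimately have "((\<lambda>x. F x * v x) has_integral integral {\<sigma> 0..\<sigma> 1} (\<lambda>s. F (\<psi> s))) {0..1}"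
      by (metis (no_types, lifting) has_integral_cong)
    then show ?thesis using \<sigma>0 l_def by (simp add: integral_unique)
  qed
  show ?thesis
    by (rule exI[of _ l], rule exI[of _ \<psi>], intro conjI ballI allI impI)
       (use \<psi>\<sigma>[of 0] \<psi>\<sigma>[of 1] \<sigma>0 lpos p1 p2 p3 p4 in \<open>simp_all add: l_def\<close>)
qed

lemma unit_speed_reparametrization:
  assumes C2: "C2_data g g1 g2"
  obtains l \<psi> where "arclength_param g l \<psi>"
    "unit_speed l (\<lambda>s. g (\<psi> s)) (\<lambda>s. unit_tangent g (\<psi> s)) (\<lambda>s. curvature_vector g (\<psi> s))"
    "\<And>F. continuous_on {0..1} F \<Longrightarrow> integral {0..l} (\<lambda>s. F (\<psi> s)) = arc_integral g F"
proof -
  have c: "continuous_on {0..1} (\<lambda>x. norm (velocity g x))"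
    by (subst continuous_on_cong[OF refl, of _ _ "\<lambda>x. norm (g1 x)"])
       (auto intro!: continuous_intros C2_continuous[OF C2] simp: C2_velocity[OF C2])
  have pos: "\<forall>x\<in>{0..1}. 0 < norm (velocity g x)"
    using C2_nonzero[OF C2] C2_velocity[OF C2] by simp
  from arclength_reparametrization[OF c pos] obtain l \<psi> where
    l\<psi>: "(0 < l \<and> \<psi> 0 = 0 \<and> \<psi> l = 1 \<and> \<psi> ` {0..l} = {0..1} \<and> strict_mono_on {0..l} \<psi>) \<and>
    (\<forall>s\<in>{0..l}. (\<psi> has_real_derivative 1 / norm (velocity g (\<psi> s))) (at s within {0..l})) \<and>
    (\<forall>F. continuous_on {0..1} F \<longrightarrow>
      integral {0..l} (\<lambda>s. F (\<psi> s)) = integral {0..1} (\<lambda>x. F x * norm (velocity g x)))"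
    by (elim exE)
  then have l: "0 < l" "\<psi> 0 = 0" "\<psi> l = 1" "\<psi> ` {0..l} = {0..1}" "strict_mono_on {0..l} \<psi>"
    by simp_all
  have d: "(\<psi> has_real_derivative 1 / norm (velocity g (\<psi> s))) (at s within {0..l})" if "s \<in> {0..l}" for s
    using l\<psi> that by blast
  have i: "integral {0..l} (\<lambda>s. F (\<psi> s)) = integral {0..1} (\<lambda>x. F x * norm (velocity g x))"
    if "continuous_on {0..1} F" for F
    using l\<psi> that by blast
  have ran: "\<psi> s \<in> {0..1}" if "s \<in> {0..l}" for s using l(4) that by blast
  have cont\<psi>: "continuous_on {0..l} \<psi>" using d by (meson DERIV_continuous_on)
  have chain: "((\<lambda>s. f (\<psi> s)) has_vector_derivative (1 / norm (velocity g (\<psi> s))) *\<^sub>R f') (at s within {0..l})"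
    if "(f has_vector_derivative f') (at (\<psi> s) within {0..1})" "s \<in> {0..l}" for f :: "real \<Rightarrow> plane" and f' s
    using vector_diff_chain_within[of \<psi> _ s "{0..l}" f f'] d[OF that(2)] that(1) l(4)
    by (simp add: o_def real_derivative_iff_vector)
  have us: "unit_speed l (\<lambda>s. g (\<psi> s)) (\<lambda>s. unit_tangent g (\<psi> s)) (\<lambda>s. curvature_vector g (\<psi> s))"
    unfolding unit_speed_def
  proof (intro conjI ballI)
    show "continuous_on {0..l} (\<lambda>s. curvature_vector g (\<psi> s))"
      by (rule continuous_on_compose2[OF C2_continuous_curvature[OF C2] cont\<psi>]) (use ran in auto)
    fix s assume s: "s \<in> {0..l}"
    note r = ran[OF s]
    have "(g has_vector_derivative g1 (\<psi> s)) (at (\<psi> s) within {0..1})"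
      using C2 r by (auto simp: C2_data_def)
    from chain[OF this s] show "((\<lambda>s. g (\<psi> s)) has_vector_derivative unit_tangent g (\<psi> s)) (at s within {0..l})"
      using C2_velocity[OF C2 r] C2_unit_tangent[OF C2 r] by (simp add: sgn_div_norm inverse_eq_divide)
    from chain[OF C2_unit_tangent_derivative'[OF C2 r] s]
    show "((\<lambda>s. unit_tangent g (\<psi> s)) has_vector_derivative curvature_vector g (\<psi> s)) (at s within {0..l})"
      using C2_velocity[OF C2 r] C2_nonzero[OF C2 r] by simp
    show "norm (unit_tangent g (\<psi> s)) = 1" by (rule C2_norm_unit_tangent[OF C2 r])
  qed (use l in auto)
  have "integral {0..l} (\<lambda>s. F (\<psi> s)) = arc_integral g F" if "continuous_on {0..1} F" for F
    unfolding i[OF that] C2_arc_integral[OF C2 that]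
    by (rule integral_cong) (simp add: C2_velocity[OF C2])
  then show ?thesis using that us l d unfolding arclength_param_def by blast
qed

section \<open>First variation of weighted length\<close>

lemma continuous_on_compose_pair:
  assumes "continuous_on (S \<times> X) (\<lambda>(t, x). f t x)"
    and "continuous_on A a" "continuous_on A b"
    and "\<And>z. z \<in> A \<Longrightarrow> a z \<in> S" "\<And>z. z \<in> A \<Longrightarrow> b z \<in> X"
  shows "continuous_on A (\<lambda>z. f (a z) (b z))"
proof -
  have "continuous_on A (\<lambda>z. (\<lambda>(t, x). f t x) (a z, b z))"
    by (rule continuous_on_compose2[OF assms(1)]) (use assms in \<open>auto intro!: continuous_intros\<close>)
  then show ?thesis by simp
qed

lemma continuous_on_integral_param:
  fixes f :: "'a::topological_space \<Rightarrow> real \<Rightarrow> 'b::banach"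
  assumes "continuous_on (U \<times> {a..b}) (\<lambda>(u, x). f u x)"
  shows "continuous_on U (\<lambda>u. integral {a..b} (f u))"
  using integral_continuous_on_param[of U a b f] assms by simp

definition C12_data ::
  "real \<Rightarrow> (real \<Rightarrow> real \<Rightarrow> plane) \<Rightarrow> (real \<Rightarrow> real \<Rightarrow> plane) \<Rightarrow> (real \<Rightarrow> real \<Rightarrow> plane) \<Rightarrow>
     (real \<Rightarrow> real \<Rightarrow> plane) \<Rightarrow> bool" where
  "C12_data T g gt gx gxx \<longleftrightarrow>
     (\<forall>t\<in>{0..<T}. C2_data (g t) (gx t) (gxx t) \<and>
        (\<forall>x\<in>{0..1}. ((\<lambda>s. g s x) has_vector_derivative gt t x) (at t within {0..<T}))) \<and>
     continuous_on ({0..<T} \<times> {0..1}) (\<lambda>(t, x). g t x) \<and>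
     continuous_on ({0..<T} \<times> {0..1}) (\<lambda>(t, x). gt t x) \<and>
     continuous_on ({0..<T} \<times> {0..1}) (\<lambda>(t, x). gx t x) \<and>
     continuous_on ({0..<T} \<times> {0..1}) (\<lambda>(t, x). gxx t x)"

lemma difference_quotient_integral:
  fixes f ft :: "real \<Rightarrow> 'a::real_normed_vector \<Rightarrow> 'b::banach"
  assumes f: "\<And>t x. t \<in> S \<Longrightarrow> x \<in> X \<Longrightarrow>
      ((\<lambda>s. f s x) has_vector_derivative ft t x) (at t within S)"
    and ft: "continuous_on (S \<times> X) (\<lambda>(t, x). ft t x)" and t0: "t0 \<in> S" and S: "convex S"
  obtains Q where "continuous_on (S \<times> X) (\<lambda>(t, x). Q t x)"
    "\<And>x. x \<in> X \<Longrightarrow> Q t0 x = ft t0 x"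
    "\<And>t x. t \<in> S \<Longrightarrow> x \<in> X \<Longrightarrow> f t x - f t0 x = (t - t0) *\<^sub>R Q t x"
proof
  define Q where "Q t x = integral {0..1} (\<lambda>r. ft (t0 + r * (t - t0)) x)" for t x
  have inI: "t0 + r * (t - t0) \<in> S" if "t \<in> S" "r \<in> {0..1}" for t r
  proof -
    have "t0 + r * (t - t0) = (1 - r) *\<^sub>R t0 + r *\<^sub>R t" by (simp add: algebra_simps)
    also have "\<dots> \<in> S"
      using convexD[OF S t0, of t "1 - r" r] that by auto
    finally show ?thesis .
  qed
  have "continuous_on (S \<times> X) (\<lambda>z. integral {0..1} (\<lambda>r. ft (t0 + r * (fst z - t0)) (snd z)))"
    unfolding split_beta
    by (rule continuous_on_integral_param, unfold split_beta,
        rule continuous_on_compose_pair[OF ft])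
       (use inI in \<open>auto intro!: continuous_intros\<close>)
  then show "continuous_on (S \<times> X) (\<lambda>(t, x). Q t x)" by (simp add: Q_def split_beta)
  show "Q t0 x = ft t0 x" for x by (simp add: Q_def)
  fix t x assume t: "t \<in> S" and x: "x \<in> X"
  have "((\<lambda>r. (t - t0) *\<^sub>R ft (t0 + r * (t - t0)) x) has_integral
      f (t0 + 1 * (t - t0)) x - f (t0 + 0 * (t - t0)) x) {0..1}"
  proof (rule fundamental_theorem_of_calculus)
    fix r :: real assume r: "r \<in> {0..1}"
    have 1: "((\<lambda>r. t0 + r * (t - t0)) has_vector_derivative (t - t0)) (at r within {0..1})"
      unfolding real_derivative_iff_vector[symmetric]
      by (auto intro!: derivative_eq_intros)
    have 2: "((\<lambda>s. f s x) has_vector_derivative ft (t0 + r * (t - t0)) x)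
       (at (t0 + r * (t - t0)) within (\<lambda>r. t0 + r * (t - t0)) ` {0..1})"
      by (rule has_vector_derivative_within_subset[OF f[OF inI[OF t r] x]]) (use inI[OF t] in blast)
    have "(((\<lambda>s. f s x) \<circ> (\<lambda>r. t0 + r * (t - t0))) has_vector_derivative
        (t - t0) *\<^sub>R ft (t0 + r * (t - t0)) x) (at r within {0..1})"
      by (rule vector_diff_chain_within[OF 1 2])
    then show "((\<lambda>r. f (t0 + r * (t - t0)) x) has_vector_derivative
        (t - t0) *\<^sub>R ft (t0 + r * (t - t0)) x) (at r within {0..1})"
      by (simp add: o_def)
  qed simp
  moreover have "t0 + 1 * (t - t0) = t" "t0 + 0 * (t - t0) = t0" by simp_all
  ultimately have "integral {0..1} (\<lambda>r. (t - t0) *\<^sub>R ft (t0 + r * (t - t0)) x) = f t x - f t0 x"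
    by (simp only: integral_unique)
  then show "f t x - f t0 x = (t - t0) *\<^sub>R Q t x"
    by (simp only: integral_cmul Q_def)
qed

lemma has_derivative_squeeze:
  fixes P m M :: "real \<Rightarrow> real"
  assumes t0: "t0 \<in> S" and m: "continuous_on S m" "m t0 = D" and M: "continuous_on S M" "M t0 = D"
    and lo: "\<And>t. t \<in> S \<Longrightarrow> (t - t0) * m t \<le> P t - P t0"
    and hi: "\<And>t. t \<in> S \<Longrightarrow> P t - P t0 \<le> (t - t0) * M t"
  shows "(P has_real_derivative D) (at t0 within S)"
proof -
  have "(m \<longlongrightarrow> D) (at t0 within S)" "(M \<longlongrightarrow> D) (at t0 within S)"
    using m M t0 by (auto simp: continuous_on_def)
  then have lim: "((\<lambda>t. min (m t) (M t)) \<longlongrightarrow> D) (at t0 within S)"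
    "((\<lambda>t. max (m t) (M t)) \<longlongrightarrow> D) (at t0 within S)"
    using tendsto_min[of m D _ M D] tendsto_max[of m D _ M D] by auto
  have b: "min (m t) (M t) \<le> (P t - P t0) / (t - t0) \<and> (P t - P t0) / (t - t0) \<le> max (m t) (M t)"
    if "t \<in> S" "t \<noteq> t0" for t
  proof (cases "t0 < t")
    case True
    then have "m t \<le> (P t - P t0) / (t - t0)" "(P t - P t0) / (t - t0) \<le> M t"
      using lo[OF that(1)] hi[OF that(1)] by (simp_all add: field_simps)
    then show ?thesis by auto
  next
    case False
    then have "t < t0" using that by simp
    then have "(P t - P t0) / (t - t0) \<le> m t" "M t \<le> (P t - P t0) / (t - t0)"
      using lo[OF that(1)] hi[OF that(1)] by (simp_all add: field_simps)
    then show ?thesis by auto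
  qed
  have "((\<lambda>t. (P t - P t0) / (t - t0)) \<longlongrightarrow> D) (at t0 within S)"
    by (rule tendsto_sandwich[OF _ _ lim]) (auto simp: eventually_at_filter b)
  then show ?thesis by (simp add: has_field_derivative_iff)
qed

lemma norm_diff_bounds:
  fixes a b :: "'a::real_inner"
  assumes "a \<noteq> 0" "b \<noteq> 0"
  shows "sgn a \<bullet> (b - a) \<le> norm b - norm a" "norm b - norm a \<le> sgn b \<bullet> (b - a)"
proof -
  have e: "sgn c \<bullet> c = norm c" for c :: 'a
    by (cases "c = 0") (simp_all add: sgn_div_norm power2_norm_eq_inner[symmetric] power2_eq_square)
  have s: "sgn c \<bullet> d \<le> norm d" for c d :: 'a
    using norm_cauchy_schwarz[of "sgn c" d] by (cases "c = 0") (simp_all add: norm_sgn)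
  show "sgn a \<bullet> (b - a) \<le> norm b - norm a" "norm b - norm a \<le> sgn b \<bullet> (b - a)"
    using e[of a] e[of b] s[of a b] s[of b a] by (simp_all add: inner_diff_right)
qed

context
  fixes T g gt gx gxx
  assumes C12: "C12_data T g gt gx gxx"
begin

lemma C12_C2: "t \<in> {0..<T} \<Longrightarrow> C2_data (g t) (gx t) (gxx t)"
  using C12 by (auto simp: C12_data_def)

lemma C12_compose:
  assumes "continuous_on A a" "continuous_on A b"
    and "\<And>z. z \<in> A \<Longrightarrow> a z \<in> {0..<T}" "\<And>z. z \<in> A \<Longrightarrow> b z \<in> {0..1}"
  shows "continuous_on A (\<lambda>z. g (a z) (b z))" "continuous_on A (\<lambda>z. gt (a z) (b z))"
    "continuous_on A (\<lambda>z. gx (a z) (b z))" "continuous_on A (\<lambda>z. gxx (a z) (b z))"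
    "continuous_on A (\<lambda>z. unit_tangent (g (a z)) (b z))"
    "continuous_on A (\<lambda>z. curvature_vector (g (a z)) (b z))"
proof -
  have "continuous_on ({0..<T} \<times> {0..1}) (\<lambda>(t, x). g t x)"
     "continuous_on ({0..<T} \<times> {0..1}) (\<lambda>(t, x). gt t x)"
     "continuous_on ({0..<T} \<times> {0..1}) (\<lambda>(t, x). gx t x)"
     "continuous_on ({0..<T} \<times> {0..1}) (\<lambda>(t, x). gxx t x)"
    using C12 by (auto simp: C12_data_def)
  then show *: "continuous_on A (\<lambda>z. g (a z) (b z))" "continuous_on A (\<lambda>z. gt (a z) (b z))"
    "continuous_on A (\<lambda>z. gx (a z) (b z))" "continuous_on A (\<lambda>z. gxx (a z) (b z))"
    using continuous_on_compose_pair[OF _ assms] by blast+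
  have nz: "gx (a z) (b z) \<noteq> 0" if "z \<in> A" for z
    using C2_nonzero[OF C12_C2] assms(3,4)[OF that] by blast
  have 1: "unit_tangent (g (a z)) (b z) = sgn (gx (a z) (b z))" if "z \<in> A" for z
    using C2_unit_tangent[OF C12_C2] assms(3,4)[OF that] by blast
  show "continuous_on A (\<lambda>z. unit_tangent (g (a z)) (b z))"
    by (subst continuous_on_cong[OF refl 1]) (auto intro!: continuous_intros * dest: nz)
  have 2: "curvature_vector (g (a z)) (b z) = (1 / norm (gx (a z) (b z))) *\<^sub>R
     (gxx (a z) (b z) /\<^sub>R norm (gx (a z) (b z)) -
      ((gx (a z) (b z) \<bullet> gxx (a z) (b z)) / norm (gx (a z) (b z)) ^ 3) *\<^sub>R gx (a z) (b z))"
    if "z \<in> A" for z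
    using C2_curvature[OF C12_C2] assms(3,4)[OF that] by blast
  show "continuous_on A (\<lambda>z. curvature_vector (g (a z)) (b z))"
    by (subst continuous_on_cong[OF refl 2]) (auto intro!: continuous_intros * dest: nz)
qed

lemma first_variation:
  assumes t0: "t0 \<in> {0..<T}"
    and Wt: "\<And>t x. t \<in> {0..<T} \<Longrightarrow> x \<in> {0..1} \<Longrightarrow>
      ((\<lambda>s. W s x) has_vector_derivative Wt t x) (at t within {0..<T})"
    and Wx: "\<And>t x. t \<in> {0..<T} \<Longrightarrow> x \<in> {0..1} \<Longrightarrow>
      (W t has_vector_derivative Wx t x) (at x within {0..1})"
    and cont: "continuous_on ({0..<T} \<times> {0..1}) (\<lambda>(t, x). Wt t x)"
      "continuous_on ({0..<T} \<times> {0..1}) (\<lambda>(t, x). Wx t x)"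
    and pos: "\<And>t x. t \<in> {0..<T} \<Longrightarrow> x \<in> {0..1} \<Longrightarrow> 0 \<le> W t x"
  shows "((\<lambda>t. integral {0..1} (\<lambda>x. W t x * norm (gx t x))) has_real_derivative
     (integral {0..1} (\<lambda>x. Wt t0 x * norm (gx t0 x))
      + (W t0 1 * (unit_tangent (g t0) 1 \<bullet> gt t0 1) - W t0 0 * (unit_tangent (g t0) 0 \<bullet> gt t0 0))
      - integral {0..1} (\<lambda>x. (Wx t0 x *\<^sub>R unit_tangent (g t0) x +
           (W t0 x * norm (gx t0 x)) *\<^sub>R curvature_vector (g t0) x) \<bullet> gt t0 x)))
     (at t0 within {0..<T})"
proof -
  have gtd: "\<And>t x. t \<in> {0..<T} \<Longrightarrow> x \<in> {0..1} \<Longrightarrow>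
      ((\<lambda>s. g s x) has_vector_derivative gt t x) (at t within {0..<T})"
    and gtc: "continuous_on ({0..<T} \<times> {0..1}) (\<lambda>(t, x). gt t x)"
    using C12 by (auto simp: C12_data_def)
  obtain Q where Qc: "continuous_on ({0..<T} \<times> {0..1}) (\<lambda>(t, x). Q t x)"
    and Q0: "\<And>x. x \<in> {0..1} \<Longrightarrow> Q t0 x = gt t0 x"
    and Q: "\<And>t x. t \<in> {0..<T} \<Longrightarrow> x \<in> {0..1} \<Longrightarrow> g t x - g t0 x = (t - t0) *\<^sub>R Q t x"
    using difference_quotient_integral[OF gtd gtc t0 convex_real_interval(7)] by metis
  obtain R where Rc: "continuous_on ({0..<T} \<times> {0..1}) (\<lambda>(t, x). R t x)"
    and R0: "\<And>x. x \<in> {0..1} \<Longrightarrow> R t0 x = Wt t0 x"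
    and R: "\<And>t x. t \<in> {0..<T} \<Longrightarrow> x \<in> {0..1} \<Longrightarrow> W t x - W t0 x = (t - t0) *\<^sub>R R t x"
    using difference_quotient_integral[OF Wt cont(1) t0 convex_real_interval(7)] by metis
  note pair = continuous_on_compose_pair
  have Wc: "continuous_on {0..1} (W t)" if "t \<in> {0..<T}" for t
    using Wx[OF that] by (rule continuous_on_vector_derivative)
  have Wxc: "continuous_on {0..1} (Wx t)" if "t \<in> {0..<T}" for t
    by (rule pair[OF cont(2), of _ "\<lambda>_. t" "\<lambda>x. x"]) (use that in \<open>auto intro!: continuous_intros\<close>)
  define N where "N s t = integral {0..1} (\<lambda>x. R t x * norm (gx t x))
      + (W t0 1 * (unit_tangent (g s) 1 \<bullet> Q t 1) - W t0 0 * (unit_tangent (g s) 0 \<bullet> Q t 0))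
      - integral {0..1} (\<lambda>x. (Wx t0 x *\<^sub>R unit_tangent (g s) x +
           (W t0 x * norm (gx s x)) *\<^sub>R curvature_vector (g s) x) \<bullet> Q t x)" for s t
  have Nc: "continuous_on {0..<T} (\<lambda>t. N (s t) t)"
    if s: "continuous_on {0..<T} s" "\<And>t. t \<in> {0..<T} \<Longrightarrow> s t \<in> {0..<T}" for s
  proof -
    have s1: "continuous_on ({0..<T} \<times> {0..1}) (\<lambda>z. s (fst z))"
      by (rule continuous_on_compose2[OF s(1)]) (auto intro!: continuous_intros)
    have W1: "continuous_on ({0..<T} \<times> {0..1}) (\<lambda>z. W t0 (snd z))"
      by (rule continuous_on_compose2[OF Wc[OF t0]]) (auto intro!: continuous_intros)
    have W2: "continuous_on ({0..<T} \<times> {0..1}) (\<lambda>z. Wx t0 (snd z))"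
      by (rule continuous_on_compose2[OF Wxc[OF t0]]) (auto intro!: continuous_intros)
    have "continuous_on {0..<T} (\<lambda>t. integral {0..1} (\<lambda>x. R t x * norm (gx t x)))"
      by (rule continuous_on_integral_param, unfold split_beta)
         (auto intro!: continuous_intros pair[OF Rc] C12_compose)
    moreover have "continuous_on {0..<T} (\<lambda>t. integral {0..1} (\<lambda>x. (Wx t0 x *\<^sub>R unit_tangent (g (s t)) x +
           (W t0 x * norm (gx (s t) x)) *\<^sub>R curvature_vector (g (s t)) x) \<bullet> Q t x))"
      by (rule continuous_on_integral_param, unfold split_beta)
         (auto intro!: continuous_intros pair[OF Qc] C12_compose s1 W1 W2 s(2))
    ultimately show ?thesis unfolding N_def
      by (auto intro!: continuous_intros pair[OF Qc] C12_compose s)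
  qed
  have ibp: "integral {0..1} (\<lambda>x. W t0 x * (unit_tangent (g s) x \<bullet> (gx t x - gx t0 x)))
     = (t - t0) * (N s t - integral {0..1} (\<lambda>x. R t x * norm (gx t x)))"
    if s: "s \<in> {0..<T}" and t: "t \<in> {0..<T}" for s t
  proof -
    let ?h = "\<lambda>x. W t0 x * (unit_tangent (g s) x \<bullet> (g t x - g t0 x))"
    let ?a = "\<lambda>x. (Wx t0 x *\<^sub>R unit_tangent (g s) x +
           (W t0 x * norm (gx s x)) *\<^sub>R curvature_vector (g s) x) \<bullet> (g t x - g t0 x)"
    let ?b = "\<lambda>x. W t0 x * (unit_tangent (g s) x \<bullet> (gx t x - gx t0 x))"
    have "((\<lambda>x. ?a x + ?b x) has_integral ?h 1 - ?h 0) {0..1}"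
    proof (rule fundamental_theorem_of_calculus)
      fix x :: real assume x: "x \<in> {0..1}"
      have d: "(g u has_vector_derivative gx u x) (at x within {0..1})" if "u \<in> {0..<T}" for u
        using C12_C2[OF that] x by (auto simp: C2_data_def)
      have u: "(unit_tangent (g s) has_vector_derivative norm (gx s x) *\<^sub>R curvature_vector (g s) x)
          (at x within {0..1})"
        by (rule C2_unit_tangent_derivative'[OF C12_C2[OF s] x])
      have W: "(W t0 has_real_derivative Wx t0 x) (at x within {0..1})"
        using Wx[OF t0 x] by (simp add: real_derivative_iff_vector)
      have "((\<lambda>x. unit_tangent (g s) x \<bullet> (g t x - g t0 x)) has_vector_derivative
          unit_tangent (g s) x \<bullet> (gx t x - gx t0 x) +
          (norm (gx s x) *\<^sub>R curvature_vector (g s) x) \<bullet> (g t x - g t0 x)) (at x within {0..1})"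
        by (rule bounded_bilinear.has_vector_derivative[OF bounded_bilinear_inner u
              has_vector_derivative_diff[OF d[OF t] d[OF t0]]])
      from has_vector_derivative_scaleR[OF W this]
      show "(?h has_vector_derivative ?a x + ?b x) (at x within {0..1})"
        by (simp add: inner_add_left algebra_simps)
    qed simp
    then have "?h 1 - ?h 0 = integral {0..1} (\<lambda>x. ?a x + ?b x)" by (simp add: integral_unique)
    also have "\<dots> = integral {0..1} ?a + integral {0..1} ?b"
      by (rule integral_add)
         (use s t t0 in \<open>auto intro!: integrable_continuous_real continuous_intros C12_compose Wc Wxc\<close>)
    also have "integral {0..1} ?a = integral {0..1} (\<lambda>x. (t - t0) * ((Wx t0 x *\<^sub>R unit_tangent (g s) x +
           (W t0 x * norm (gx s x)) *\<^sub>R curvature_vector (g s) x) \<bullet> Q t x))"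
      by (rule integral_cong) (simp add: Q[OF t])
    also have "\<dots> = (t - t0) * integral {0..1} (\<lambda>x. (Wx t0 x *\<^sub>R unit_tangent (g s) x +
           (W t0 x * norm (gx s x)) *\<^sub>R curvature_vector (g s) x) \<bullet> Q t x)" (is "_ = _ * ?J")
      by (rule integral_mult_right)
    finally have 1: "?h 1 - ?h 0 = (t - t0) * ?J + integral {0..1} ?b" .
    have 2: "?h 1 - ?h 0 = (t - t0) * (W t0 1 * (unit_tangent (g s) 1 \<bullet> Q t 1)
        - W t0 0 * (unit_tangent (g s) 0 \<bullet> Q t 0))" (is "_ = _ * ?B")
      by (simp add: Q[OF t] right_diff_distrib)
    have 3: "N s t - integral {0..1} (\<lambda>x. R t x * norm (gx t x)) = ?B - ?J"
      by (simp add: N_def)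
    have "integral {0..1} ?b = (t - t0) * ?B - (t - t0) * ?J" using 1 2 by linarith
    then show ?thesis unfolding 3 by (simp only: right_diff_distrib)
  qed
  have diff: "integral {0..1} (\<lambda>x. W t x * norm (gx t x)) - integral {0..1} (\<lambda>x. W t0 x * norm (gx t0 x))
      = (t - t0) * integral {0..1} (\<lambda>x. R t x * norm (gx t x))
        + integral {0..1} (\<lambda>x. W t0 x * (norm (gx t x) - norm (gx t0 x)))" if t: "t \<in> {0..<T}" for t
  proof -
    have "integral {0..1} (\<lambda>x. W t x * norm (gx t x)) - integral {0..1} (\<lambda>x. W t0 x * norm (gx t0 x))
      = integral {0..1} (\<lambda>x. W t x * norm (gx t x) - W t0 x * norm (gx t0 x))"
      by (rule integral_diff[symmetric])
         (use t t0 in \<open>auto intro!: integrable_continuous_real continuous_intros C12_compose Wc\<close>)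
    also have "\<dots> = integral {0..1} (\<lambda>x. (t - t0) * (R t x * norm (gx t x)) +
        W t0 x * (norm (gx t x) - norm (gx t0 x)))"
    proof (rule integral_cong)
      fix x :: real assume "x \<in> {0..1}"
      then have "W t x = W t0 x + (t - t0) * R t x" using R[OF t, of x] by simp
      show "W t x * norm (gx t x) - W t0 x * norm (gx t0 x) =
        (t - t0) * (R t x * norm (gx t x)) + W t0 x * (norm (gx t x) - norm (gx t0 x))"
        unfolding \<open>W t x = _\<close> by (simp add: algebra_simps)
    qed
    also have "\<dots> = integral {0..1} (\<lambda>x. (t - t0) * (R t x * norm (gx t x))) +
        integral {0..1} (\<lambda>x. W t0 x * (norm (gx t x) - norm (gx t0 x)))"
      by (rule integral_add)
         (use t t0 in \<open>auto intro!: integrable_continuous_real continuous_intros C12_compose Wc pair[OF Rc]\<close>)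
    finally show ?thesis by simp
  qed
  have bounds: "integral {0..1} (\<lambda>x. W t0 x * (unit_tangent (g t0) x \<bullet> (gx t x - gx t0 x)))
      \<le> integral {0..1} (\<lambda>x. W t0 x * (norm (gx t x) - norm (gx t0 x)))"
     "integral {0..1} (\<lambda>x. W t0 x * (norm (gx t x) - norm (gx t0 x)))
      \<le> integral {0..1} (\<lambda>x. W t0 x * (unit_tangent (g t) x \<bullet> (gx t x - gx t0 x)))"
    if t: "t \<in> {0..<T}" for t
  proof -
    have "W t0 x * (unit_tangent (g t0) x \<bullet> (gx t x - gx t0 x)) \<le> W t0 x * (norm (gx t x) - norm (gx t0 x))"
      "W t0 x * (norm (gx t x) - norm (gx t0 x)) \<le> W t0 x * (unit_tangent (g t) x \<bullet> (gx t x - gx t0 x))"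
      if "x \<in> {0..1}" for x
      using norm_diff_bounds[OF C2_nonzero[OF C12_C2[OF t0] that] C2_nonzero[OF C12_C2[OF t] that]]
        pos[OF t0 that] C2_unit_tangent[OF C12_C2[OF t0] that] C2_unit_tangent[OF C12_C2[OF t] that]
      by (auto intro!: mult_left_mono)
    then show "integral {0..1} (\<lambda>x. W t0 x * (unit_tangent (g t0) x \<bullet> (gx t x - gx t0 x)))
      \<le> integral {0..1} (\<lambda>x. W t0 x * (norm (gx t x) - norm (gx t0 x)))"
     "integral {0..1} (\<lambda>x. W t0 x * (norm (gx t x) - norm (gx t0 x)))
      \<le> integral {0..1} (\<lambda>x. W t0 x * (unit_tangent (g t) x \<bullet> (gx t x - gx t0 x)))"
      by (auto intro!: integral_le integrable_continuous_real continuous_intros C12_compose Wc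
            simp: t t0[simplified] t[simplified])
  qed
  have N0: "N t0 t0 = integral {0..1} (\<lambda>x. Wt t0 x * norm (gx t0 x))
      + (W t0 1 * (unit_tangent (g t0) 1 \<bullet> gt t0 1) - W t0 0 * (unit_tangent (g t0) 0 \<bullet> gt t0 0))
      - integral {0..1} (\<lambda>x. (Wx t0 x *\<^sub>R unit_tangent (g t0) x +
           (W t0 x * norm (gx t0 x)) *\<^sub>R curvature_vector (g t0) x) \<bullet> gt t0 x)"
  proof -
    have "integral {0..1} (\<lambda>x. R t0 x * norm (gx t0 x)) = integral {0..1} (\<lambda>x. Wt t0 x * norm (gx t0 x))"
      by (rule integral_cong) (simp add: R0)
    moreover have "integral {0..1} (\<lambda>x. (Wx t0 x *\<^sub>R unit_tangent (g t0) x +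
           (W t0 x * norm (gx t0 x)) *\<^sub>R curvature_vector (g t0) x) \<bullet> Q t0 x) =
      integral {0..1} (\<lambda>x. (Wx t0 x *\<^sub>R unit_tangent (g t0) x +
           (W t0 x * norm (gx t0 x)) *\<^sub>R curvature_vector (g t0) x) \<bullet> gt t0 x)"
      by (rule integral_cong) (simp add: Q0)
    ultimately show ?thesis by (simp add: N_def Q0)
  qed
  show ?thesis
    unfolding N0[symmetric]
  proof (rule has_derivative_squeeze[OF t0, of "\<lambda>t. N t0 t" _ "\<lambda>t. N t t"])
    show "continuous_on {0..<T} (\<lambda>t. N t0 t)" "continuous_on {0..<T} (\<lambda>t. N t t)"
      by (rule Nc; use t0 in \<open>auto intro!: continuous_intros\<close>)+
    fix t assume t: "t \<in> {0..<T}"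
    show "(t - t0) * N t0 t \<le> integral {0..1} (\<lambda>x. W t x * norm (gx t x)) -
         integral {0..1} (\<lambda>x. W t0 x * norm (gx t0 x))"
      using bounds(1)[OF t] diff[OF t] ibp[OF t0 t] by (simp add: algebra_simps)
    show "integral {0..1} (\<lambda>x. W t x * norm (gx t x)) -
         integral {0..1} (\<lambda>x. W t0 x * norm (gx t0 x)) \<le> (t - t0) * N t t"
      using bounds(2)[OF t] diff[OF t] ibp[OF t t] by (simp add: algebra_simps)
  qed auto
qed

end

section \<open>Huisken's monotonicity formula\<close>

lemma has_vector_derivative_norm_squared:
  fixes f :: "real \<Rightarrow> 'a::real_inner"
  assumes "(f has_vector_derivative f') (at x within A)"
  shows "((\<lambda>x. (norm (f x - c))\<^sup>2) has_real_derivative 2 * ((f x - c) \<bullet> f')) (at x within A)"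
proof -
  have d: "((\<lambda>x. f x - c) has_vector_derivative f') (at x within A)"
    using has_vector_derivative_diff[OF assms has_vector_derivative_const[of c]] by simp
  have "((\<lambda>x. (f x - c) \<bullet> (f x - c)) has_vector_derivative
     (f x - c) \<bullet> f' + f' \<bullet> (f x - c)) (at x within A)"
    by (rule bounded_bilinear.has_vector_derivative[OF bounded_bilinear_inner d d])
  then show ?thesis
    by (simp add: real_derivative_iff_vector power2_norm_eq_inner inner_commute)
qed

lemma backward_heat_kernel_pos: "t < S \<Longrightarrow> 0 < backward_heat_kernel S x0 t x"
  by (simp add: backward_heat_kernel_def)

lemma backward_heat_kernel_time_derivative:
  assumes d: "(f has_vector_derivative f') (at t within A)" and S: "t < S"
  shows "((\<lambda>s. backward_heat_kernel S x0 s (f s)) has_real_derivative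
     backward_heat_kernel S x0 t (f t) *
       (1 / (2 * (S - t)) - ((f t - x0) \<bullet> f') / (2 * (S - t)) - (norm (f t - x0))\<^sup>2 / (4 * (S - t)\<^sup>2)))
     (at t within A)"
proof -
  define u where "u s = (norm (f s - x0))\<^sup>2" for s
  have u: "(u has_real_derivative 2 * ((f t - x0) \<bullet> f')) (at t within A)"
    unfolding u_def by (rule has_vector_derivative_norm_squared[OF d])
  define r where "r = sqrt (4 * pi * (S - t))"
  have r: "0 < r" "4 * pi * (S - t) = r * r" using S by (simp_all add: r_def)
  have e: "((\<lambda>s. exp (- u s / (4 * (S - s)))) has_real_derivative
     exp (- u t / (4 * (S - t))) * (- ((f t - x0) \<bullet> f') / (2 * (S - t)) - u t / (4 * (S - t)\<^sup>2))) (at t within A)"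
  proof -
    have "((\<lambda>s. - u s / (4 * (S - s))) has_real_derivative
       (- (2 * ((f t - x0) \<bullet> f')) * (4 * (S - t)) - (- u t) * (- 4)) / ((4 * (S - t)) * (4 * (S - t)))) (at t within A)"
      by (rule DERIV_divide[OF DERIV_minus[OF u]]) (use S in \<open>auto intro!: derivative_eq_intros\<close>)
    moreover have "(- (2 * c) * (4 * s) - (- v) * (- 4)) / ((4 * s) * (4 * s)) = - c / (2 * s) - v / (4 * s\<^sup>2)"
      if "s > 0" for c v s :: real
      using that by (simp add: field_simps power2_eq_square)
    ultimately have "((\<lambda>s. - u s / (4 * (S - s))) has_real_derivative
       - ((f t - x0) \<bullet> f') / (2 * (S - t)) - u t / (4 * (S - t)\<^sup>2)) (at t within A)"
      by (rule DERIV_cong) (use S in simp)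
    from DERIV_chain2[OF DERIV_exp this] show ?thesis by simp
  qed
  have q: "((\<lambda>s. inverse (sqrt (4 * pi * (S - s)))) has_real_derivative
      inverse r * (1 / (2 * (S - t)))) (at t within A)"
  proof -
    have "((\<lambda>s. sqrt (4 * pi * (S - s))) has_real_derivative (inverse r / 2) * (- (4 * pi))) (at t within A)"
      using S unfolding r_def
      by (intro DERIV_chain2[where f=sqrt] DERIV_real_sqrt) (auto intro!: derivative_eq_intros)
    from DERIV_inverse'[OF this] r(1)
    have "((\<lambda>s. inverse (sqrt (4 * pi * (S - s)))) has_real_derivative
      - (inverse r * ((inverse r / 2) * (- (4 * pi))) * inverse r)) (at t within A)"
      unfolding r_def[symmetric] by simp
    moreover have "- (i * ((i / 2) * (- (4 * p))) * i) = i * (1 / (2 * s))"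
      if "4 * p * s * (i * i) = 1" "s > 0" for i p s :: real
    proof -
      have "1 / (2 * s) = 2 * p * (i * i)" using that by (simp add: field_simps)
      then show ?thesis by simp
    qed
    ultimately show ?thesis
    proof (rule DERIV_cong)
      have "r * r * (inverse r * inverse r) = 1" using r(1) by (simp add: field_simps)
      then show "4 * pi * (S - t) * (inverse r * inverse r) = 1" by (simp only: r(2))
    qed (use S in simp)
  qed
  have k: "backward_heat_kernel S x0 s (f s) = exp (- u s / (4 * (S - s))) * inverse (sqrt (4 * pi * (S - s)))" for s
    by (simp only: backward_heat_kernel_def u_def divide_inverse)
  have "E * (- c / s - v) * i + i * (1 / s) * E = E * i * (1 / s - c / s - v)" for E c s v i :: real
    by (simp add: algebra_simps)
  from DERIV_cong[OF DERIV_mult[OF e q[unfolded r_def]] this]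
  show ?thesis unfolding k u_def[of t, symmetric] .
qed

lemma backward_heat_kernel_space_derivative:
  assumes d: "(f has_vector_derivative f') (at x within A)" and S: "t < S"
  shows "((\<lambda>x. backward_heat_kernel S x0 t (f x)) has_real_derivative
     backward_heat_kernel S x0 t (f x) * (- ((f x - x0) \<bullet> f') / (2 * (S - t)))) (at x within A)"
proof -
  have "((\<lambda>x. - (norm (f x - x0))\<^sup>2 / (4 * (S - t))) has_real_derivative
     - (2 * ((f x - x0) \<bullet> f')) / (4 * (S - t))) (at x within A)"
    by (intro DERIV_cdivide DERIV_minus has_vector_derivative_norm_squared[OF d])
  from DERIV_cdivide[OF DERIV_chain2[OF DERIV_exp this], of "sqrt (4 * pi * (S - t))"]
  have "((\<lambda>x. backward_heat_kernel S x0 t (f x)) has_real_derivative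
     exp (- (norm (f x - x0))\<^sup>2 / (4 * (S - t))) * (- (2 * ((f x - x0) \<bullet> f')) / (4 * (S - t)))
       / sqrt (4 * pi * (S - t))) (at x within A)"
    by (simp only: backward_heat_kernel_def)
  moreover have "e * (- (2 * c) / (4 * s)) / q = e / q * (- c / (2 * s))" for e c s q :: real
    by (simp add: field_simps)
  ultimately show ?thesis unfolding backward_heat_kernel_def[of S x0 t "f x"] by (rule DERIV_cong)
qed

lemma continuous_on_backward_heat_kernel [continuous_intros]:
  assumes "continuous_on A t" "continuous_on A f" "\<And>z. z \<in> A \<Longrightarrow> t z < S"
  shows "continuous_on A (\<lambda>z. backward_heat_kernel S x0 (t z) (f z))"
  unfolding backward_heat_kernel_def
  by (intro continuous_intros assms) (use assms(3) in force)+

definition shrinker_defect :: "real \<Rightarrow> plane \<Rightarrow> (real \<Rightarrow> plane) \<Rightarrow> real \<Rightarrow> real" where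
  "shrinker_defect \<sigma> x0 g x = curvature_vector g x \<bullet> unit_normal g x
     + ((g x - x0) \<bullet> unit_normal g x) / (2 * \<sigma>)"

lemma monotonicity_integrand:
  fixes y u k gt :: plane
  assumes u: "norm u = 1" and k: "k \<bullet> u = 0" and gt: "(gt \<bullet> rot90 u) *\<^sub>R rot90 u = k" and s: "s > 0"
  shows "1 / (2 * s) - (y \<bullet> gt) / (2 * s) - (norm y)\<^sup>2 / (4 * s\<^sup>2)
       + (y \<bullet> u) / (2 * s) * (u \<bullet> gt) - k \<bullet> gt
     = - (k \<bullet> rot90 u + (y \<bullet> rot90 u) / (2 * s))\<^sup>2
       + (1 - (y \<bullet> u)\<^sup>2 / (2 * s) + y \<bullet> k) / (2 * s)"
proof -
  have n: "norm (rot90 u) = 1" using u by simp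
  have kn: "k \<bullet> rot90 u = gt \<bullet> rot90 u"
    unfolding gt[symmetric] using n by (simp add: norm_eq_1)
  have 1: "y \<bullet> gt = (y \<bullet> u) * (gt \<bullet> u) + (y \<bullet> rot90 u) * (k \<bullet> rot90 u)"
    using inner_decomp[OF u, of y gt] kn by simp
  have 2: "k \<bullet> gt = (k \<bullet> rot90 u)\<^sup>2"
    using inner_decomp[OF u, of k gt] k kn by (simp add: power2_eq_square)
  have 3: "y \<bullet> k = (y \<bullet> rot90 u) * (k \<bullet> rot90 u)"
    using inner_decomp[OF u, of y k] k by simp
  show ?thesis
    unfolding 1 2 3 norm_decomp[OF u, of y] inner_commute[of u gt] using s
    by (simp add: field_simps power2_eq_square)
qed

lemma curve_monotonicity:
  assumes C12: "C12_data T g gt gx gxx" and S: "T \<le> S" and t0: "t0 \<in> {0..<T}"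
    and normal: "\<And>x. x \<in> {0..1} \<Longrightarrow>
      (gt t0 x \<bullet> unit_normal (g t0) x) *\<^sub>R unit_normal (g t0) x = curvature_vector (g t0) x"
  shows "((\<lambda>t. arc_integral (g t) (\<lambda>x. backward_heat_kernel S x0 t (g t x))) has_real_derivative
     - arc_integral (g t0) (\<lambda>x. backward_heat_kernel S x0 t0 (g t0 x) * (shrinker_defect (S - t0) x0 (g t0) x)\<^sup>2)
     + (backward_heat_kernel S x0 t0 (g t0 1) *
          (unit_tangent (g t0) 1 \<bullet> (gt t0 1 + (g t0 1 - x0) /\<^sub>R (2 * (S - t0))))
      - backward_heat_kernel S x0 t0 (g t0 0) *
          (unit_tangent (g t0) 0 \<bullet> (gt t0 0 + (g t0 0 - x0) /\<^sub>R (2 * (S - t0))))))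
     (at t0 within {0..<T})"
proof -
  define W where "W t x = backward_heat_kernel S x0 t (g t x)" for t x
  define Wt where "Wt t x = W t x * (1 / (2 * (S - t)) - ((g t x - x0) \<bullet> gt t x) / (2 * (S - t))
      - (norm (g t x - x0))\<^sup>2 / (4 * (S - t)\<^sup>2))" for t x
  define Wx where "Wx t x = W t x * (- ((g t x - x0) \<bullet> gx t x) / (2 * (S - t)))" for t x
  note comp = C12_compose[OF C12]
  note C2 = C12_C2[OF C12]
  have gtd: "((\<lambda>s. g s x) has_vector_derivative gt t x) (at t within {0..<T})"
    and gxd: "(g t has_vector_derivative gx t x) (at x within {0..1})"
    if "t \<in> {0..<T}" "x \<in> {0..1}" for t x
    using C12 C2[OF that(1)] that by (auto simp: C12_data_def C2_data_def)
  have fv: "((\<lambda>t. integral {0..1} (\<lambda>x. W t x * norm (gx t x))) has_real_derivative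
     (integral {0..1} (\<lambda>x. Wt t0 x * norm (gx t0 x))
      + (W t0 1 * (unit_tangent (g t0) 1 \<bullet> gt t0 1) - W t0 0 * (unit_tangent (g t0) 0 \<bullet> gt t0 0))
      - integral {0..1} (\<lambda>x. (Wx t0 x *\<^sub>R unit_tangent (g t0) x +
           (W t0 x * norm (gx t0 x)) *\<^sub>R curvature_vector (g t0) x) \<bullet> gt t0 x)))
     (at t0 within {0..<T})"
  proof (rule first_variation[OF C12 t0])
    fix t x :: real assume t: "t \<in> {0..<T}" and x: "x \<in> {0..1}"
    then have tS: "t < S" using S by auto
    show "((\<lambda>s. W s x) has_vector_derivative Wt t x) (at t within {0..<T})"
      using backward_heat_kernel_time_derivative[OF gtd[OF t x] tS]
      unfolding W_def Wt_def real_derivative_iff_vector .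
    show "(W t has_vector_derivative Wx t x) (at x within {0..1})"
      using backward_heat_kernel_space_derivative[OF gxd[OF t x] tS]
      unfolding W_def Wx_def real_derivative_iff_vector .
    show "0 \<le> W t x" using backward_heat_kernel_pos[OF tS] unfolding W_def by (rule less_imp_le)
  next
    show "continuous_on ({0..<T} \<times> {0..1}) (\<lambda>(t, x). Wt t x)"
      "continuous_on ({0..<T} \<times> {0..1}) (\<lambda>(t, x). Wx t x)"
      unfolding split_beta Wt_def Wx_def W_def
      by (intro continuous_intros comp; use S in auto)+
  qed
  let ?\<sigma> = "S - t0"
  have \<sigma>: "?\<sigma> > 0" using S t0 by auto
  let ?U = "unit_tangent (g t0)" and ?K = "curvature_vector (g t0)" and ?y = "\<lambda>x. g t0 x - x0"
  let ?v = "\<lambda>x. norm (gx t0 x)"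
  let ?D = "\<lambda>x. W t0 x * (shrinker_defect ?\<sigma> x0 (g t0) x)\<^sup>2 * ?v x"
  let ?dP = "\<lambda>x. W t0 x * ((1 - (?y x \<bullet> ?U x)\<^sup>2 / (2 * ?\<sigma>) + ?y x \<bullet> ?K x) / (2 * ?\<sigma>)) * ?v x"
  let ?P = "\<lambda>x. W t0 x * ((?y x \<bullet> ?U x) / (2 * ?\<sigma>))"
  have cW: "continuous_on {0..1} (W t0)"
    unfolding W_def by (intro continuous_intros comp) (use t0 S in auto)
  have cU: "continuous_on {0..1} ?U" "continuous_on {0..1} ?K" "continuous_on {0..1} (gx t0)"
    "continuous_on {0..1} (g t0)" "continuous_on {0..1} (gt t0)"
    by (intro comp continuous_intros; use t0 in auto)+
  have cWt: "continuous_on {0..1} (Wt t0)" "continuous_on {0..1} (Wx t0)"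
    unfolding Wt_def Wx_def by (intro continuous_intros cW cU; use \<sigma> in auto)+
  have cN: "continuous_on {0..1} (\<lambda>x. rot90 (?U x))"
    by (rule bounded_linear.continuous_on[OF bounded_linear_rot90 cU(1)])
  have cD: "continuous_on {0..1} (\<lambda>x. (shrinker_defect ?\<sigma> x0 (g t0) x)\<^sup>2)"
    unfolding shrinker_defect_def unit_normal_def
    by (intro continuous_intros cU cN) (use \<sigma> in auto)
  have cdP: "continuous_on {0..1} ?dP" by (intro continuous_intros cU cW) (use \<sigma> in auto)
  have gx: "gx t0 x = ?v x *\<^sub>R ?U x" if "x \<in> {0..1}" for x
    using C2_nonzero[OF C2[OF t0] that] by (simp add: C2_unit_tangent[OF C2[OF t0] that] sgn_div_norm)
  have arg: "w * (- (v * a) / (2 * s)) * (a / (2 * s)) + v * (b + 1) / (2 * s) * w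
      = w * ((1 - a\<^sup>2 / (2 * s) + b) / (2 * s)) * v" if "s > 0" for a b v w s :: real
    using that by (simp add: field_simps power2_eq_square)
  have "(?dP has_integral ?P 1 - ?P 0) {0..1}"
  proof (rule fundamental_theorem_of_calculus)
    fix x :: real assume x: "x \<in> {0..1}"
    have W: "(W t0 has_real_derivative Wx t0 x) (at x within {0..1})"
      using backward_heat_kernel_space_derivative[OF gxd[OF t0 x], of t0 S x0] \<sigma>
      unfolding W_def Wx_def by simp
    have "((\<lambda>x. ?y x \<bullet> ?U x) has_vector_derivative (?y x \<bullet> (?v x *\<^sub>R ?K x) + gx t0 x \<bullet> ?U x))
        (at x within {0..1})"
      by (rule bounded_bilinear.has_vector_derivative[OF bounded_bilinear_inner _
            C2_unit_tangent_derivative'[OF C2[OF t0] x]])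
         (use has_vector_derivative_diff[OF gxd[OF t0 x] has_vector_derivative_const[of x0]] in simp)
    then have yU: "((\<lambda>x. ?y x \<bullet> ?U x) has_real_derivative ?v x * (?y x \<bullet> ?K x + 1)) (at x within {0..1})"
      using C2_norm_unit_tangent[OF C2[OF t0] x]
      by (subst (asm) (2) gx[OF x]) (simp add: real_derivative_iff_vector norm_eq_1 algebra_simps)
    have "(?P has_real_derivative (Wx t0 x * ((?y x \<bullet> ?U x) / (2 * ?\<sigma>)) +
       (?v x * (?y x \<bullet> ?K x + 1)) / (2 * ?\<sigma>) * W t0 x)) (at x within {0..1})"
      by (rule DERIV_mult[OF W DERIV_cdivide[OF yU]])
    moreover have "Wx t0 x = W t0 x * (- (?v x * (?y x \<bullet> ?U x)) / (2 * ?\<sigma>))"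
      unfolding Wx_def by (subst gx[OF x]) simp
    ultimately show "(?P has_vector_derivative ?dP x) (at x within {0..1})"
      using arg[OF \<sigma>] by (simp add: real_derivative_iff_vector)
  qed simp
  then have P: "integral {0..1} ?dP = ?P 1 - ?P 0" by (rule integral_unique)
  have "integral {0..1} (\<lambda>x. Wt t0 x * ?v x) - integral {0..1} (\<lambda>x. (Wx t0 x *\<^sub>R ?U x +
           (W t0 x * ?v x) *\<^sub>R ?K x) \<bullet> gt t0 x)
     = integral {0..1} (\<lambda>x. Wt t0 x * ?v x - (Wx t0 x *\<^sub>R ?U x + (W t0 x * ?v x) *\<^sub>R ?K x) \<bullet> gt t0 x)"
    by (rule integral_diff[symmetric])
       (auto intro!: integrable_continuous_real continuous_intros cWt cU cW)
  also have "\<dots> = integral {0..1} (\<lambda>x. - ?D x + ?dP x)"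
  proof (rule integral_cong)
    fix x :: real assume x: "x \<in> {0..1}"
    have "Wt t0 x * ?v x - (Wx t0 x *\<^sub>R ?U x + (W t0 x * ?v x) *\<^sub>R ?K x) \<bullet> gt t0 x =
      W t0 x * ?v x * (1 / (2 * ?\<sigma>) - (?y x \<bullet> gt t0 x) / (2 * ?\<sigma>) - (norm (?y x))\<^sup>2 / (4 * ?\<sigma>\<^sup>2)
       + (?y x \<bullet> ?U x) / (2 * ?\<sigma>) * (?U x \<bullet> gt t0 x) - ?K x \<bullet> gt t0 x)"
    proof -
      have "Wx t0 x = - (W t0 x * ?v x * ((?y x \<bullet> ?U x) / (2 * ?\<sigma>)))"
        unfolding Wx_def by (subst gx[OF x]) simp
      then show ?thesis by (simp add: Wt_def inner_add_left algebra_simps)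
    qed
    also have "\<dots> = W t0 x * ?v x * (- (shrinker_defect ?\<sigma> x0 (g t0) x)\<^sup>2
        + (1 - (?y x \<bullet> ?U x)\<^sup>2 / (2 * ?\<sigma>) + ?y x \<bullet> ?K x) / (2 * ?\<sigma>))"
      using monotonicity_integrand[of "?U x" "?K x" "gt t0 x" ?\<sigma> "?y x"]
        C2_norm_unit_tangent[OF C2[OF t0] x] C2_curvature_orthogonal[OF C2[OF t0] x] normal[OF x] \<sigma>
      by (simp add: unit_normal_def shrinker_defect_def)
    also have "w * v * (- d + q) = - (w * d * v) + w * q * v" for w v d q :: real
      by (simp add: algebra_simps)
    finally show "Wt t0 x * ?v x - (Wx t0 x *\<^sub>R ?U x + (W t0 x * ?v x) *\<^sub>R ?K x) \<bullet> gt t0 x = - ?D x + ?dP x"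
      .
  qed
  also have "\<dots> = integral {0..1} (\<lambda>x. - ?D x) + integral {0..1} ?dP"
    by (rule integral_add)
       (intro integrable_continuous_real cdP continuous_intros cU cW cD)+
  also have "\<dots> = - integral {0..1} ?D + (?P 1 - ?P 0)" unfolding P by simp
  finally have eq: "integral {0..1} (\<lambda>x. Wt t0 x * ?v x) - integral {0..1} (\<lambda>x. (Wx t0 x *\<^sub>R ?U x +
           (W t0 x * ?v x) *\<^sub>R ?K x) \<bullet> gt t0 x) = - integral {0..1} ?D + (?P 1 - ?P 0)" .
  have D: "arc_integral (g t0) (\<lambda>x. W t0 x * (shrinker_defect ?\<sigma> x0 (g t0) x)\<^sup>2) = integral {0..1} ?D"
    by (rule C2_arc_integral[OF C2[OF t0]]) (intro continuous_intros cW cD)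
  have L: "arc_integral (g t) (\<lambda>x. W t x) = integral {0..1} (\<lambda>x. W t x * norm (gx t x))"
    if "t \<in> {0..<T}" for t
    unfolding W_def by (rule C2_arc_integral[OF C2[OF that]])
       (intro continuous_intros comp; use that S in auto)
  have "(integral {0..1} (\<lambda>x. Wt t0 x * norm (gx t0 x))
      + (W t0 1 * (unit_tangent (g t0) 1 \<bullet> gt t0 1) - W t0 0 * (unit_tangent (g t0) 0 \<bullet> gt t0 0))
      - integral {0..1} (\<lambda>x. (Wx t0 x *\<^sub>R unit_tangent (g t0) x +
           (W t0 x * norm (gx t0 x)) *\<^sub>R curvature_vector (g t0) x) \<bullet> gt t0 x))
    = - arc_integral (g t0) (\<lambda>x. W t0 x * (shrinker_defect ?\<sigma> x0 (g t0) x)\<^sup>2) +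
      (W t0 1 * (?U 1 \<bullet> (gt t0 1 + ?y 1 /\<^sub>R (2 * ?\<sigma>))) - W t0 0 * (?U 0 \<bullet> (gt t0 0 + ?y 0 /\<^sub>R (2 * ?\<sigma>))))"
    unfolding D using eq by (simp add: inner_add_right divide_inverse inner_commute algebra_simps)
  with fv have "((\<lambda>t. integral {0..1} (\<lambda>x. W t x * norm (gx t x))) has_real_derivative
      - arc_integral (g t0) (\<lambda>x. W t0 x * (shrinker_defect ?\<sigma> x0 (g t0) x)\<^sup>2) +
      (W t0 1 * (?U 1 \<bullet> (gt t0 1 + ?y 1 /\<^sub>R (2 * ?\<sigma>))) - W t0 0 * (?U 0 \<bullet> (gt t0 0 + ?y 0 /\<^sub>R (2 * ?\<sigma>)))))
      (at t0 within {0..<T})" by simp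
  then show ?thesis
    unfolding W_def[symmetric]
    unfolding real_derivative_iff_vector
    by (rule has_vector_derivative_transform[OF t0, rotated]) (simp add: L)
qed

lemma at_within_Ico_nontrivial: "t \<in> {0..<T} \<Longrightarrow> at t within {0..<T} \<noteq> bot" for t T :: real
proof -
  assume t: "t \<in> {0..<T}"
  have "(t + T) / 2 \<in> {0..<T}" "(t + T) / 2 \<noteq> t" using t by auto
  then have "{0..<T} \<noteq> {t}" by blast
  then have "t islimpt {0..<T}"
    using connected_imp_perfect[of "{0..<T}" t] t by simp
  then show ?thesis by (simp add: trivial_limit_within)
qed

lemma heat_kernel_boundary_bound:
  assumes d: "0 < d" and s: "0 < s" "s \<le> S"
  shows "exp (- d\<^sup>2 / (4 * s)) / sqrt (4 * pi * s) * (d / (2 * s)) \<le> 16 * sqrt S / d ^ 3"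
proof -
  define z where "z = d\<^sup>2 / (4 * s)"
  have z: "0 < z" using d s by (simp add: z_def)
  have "z\<^sup>2 / 2 \<le> exp z" using exp_lower_Taylor_quadratic[of z] z by simp
  then have "exp (- z) \<le> 2 / z\<^sup>2"
    using z by (simp add: exp_minus field_simps)
  also have "\<dots> = 32 * s\<^sup>2 / d ^ 4"
    using d s by (simp add: z_def field_simps power2_eq_square eval_nat_numeral)
  finally have e: "exp (- d\<^sup>2 / (4 * s)) \<le> 32 * s\<^sup>2 / d ^ 4" by (simp add: z_def)
  have "1 * s \<le> 4 * pi * s" using pi_gt3 s by (intro mult_right_mono) auto
  then have q: "sqrt s \<le> sqrt (4 * pi * s)" by simp
  have "exp (- d\<^sup>2 / (4 * s)) / sqrt (4 * pi * s) \<le> (32 * s\<^sup>2 / d ^ 4) / sqrt s"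
    by (rule frac_le) (use e q s in auto)
  then have "exp (- d\<^sup>2 / (4 * s)) / sqrt (4 * pi * s) * (d / (2 * s)) \<le> (32 * s\<^sup>2 / d ^ 4) / sqrt s * (d / (2 * s))"
    using d s by (intro mult_right_mono) auto
  also have "\<dots> = 16 * (s / sqrt s) / d ^ 3"
    using d s by (simp add: field_simps power2_eq_square eval_nat_numeral)
  also have "s / sqrt s = sqrt s" using s by (simp add: real_div_sqrt)
  also have "16 * sqrt s / d ^ 3 \<le> 16 * sqrt S / d ^ 3"
    using s d by (simp add: divide_right_mono)
  finally show ?thesis .
qed

locale flow =
  fixes \<Omega> :: "plane set" and T :: real and n :: nat and \<gamma> gt gx gxx :: "nat \<Rightarrow> real \<Rightarrow> real \<Rightarrow> plane"
  assumes T_pos: "0 < T" and flow: "network_flow \<Omega> T n \<gamma>"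
    and C12: "\<And>i. i < n \<Longrightarrow> C12_data T (\<gamma> i) (gt i) (gx i) (gxx i)"
begin

lemma C2: "i < n \<Longrightarrow> t \<in> {0..<T} \<Longrightarrow> C2_data (\<gamma> i t) (gx i t) (gxx i t)"
  using C12_C2[OF C12] .

lemma regular: "t \<in> {0..<T} \<Longrightarrow> regular_network \<Omega> n (\<lambda>i. \<gamma> i t)"
  using flow by (auto simp: network_flow_def)

lemma net: "t \<in> {0..<T} \<Longrightarrow> network \<Omega> n (\<lambda>i. \<gamma> i t)"
  using regular by (auto simp: regular_network_def)

lemma time_derivative:
  "i < n \<Longrightarrow> t \<in> {0..<T} \<Longrightarrow> x \<in> {0..1} \<Longrightarrow>
     ((\<lambda>s. \<gamma> i s x) has_vector_derivative gt i t x) (at t within {0..<T})"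
  using C12[of i] by (auto simp: C12_data_def)

lemma vector_derivative_time:
  assumes "i < n" "t \<in> {0..<T}" "x \<in> {0..1}"
  shows "vector_derivative (\<lambda>s. \<gamma> i s x) (at t within {0..<T}) = gt i t x"
  using vector_derivative_within[OF at_within_Ico_nontrivial[OF assms(2)] time_derivative[OF assms]] .

lemma normal:
  assumes "i < n" "t \<in> {0..<T}" "x \<in> {0..1}"
  shows "(gt i t x \<bullet> unit_normal (\<gamma> i t) x) *\<^sub>R unit_normal (\<gamma> i t) x = curvature_vector (\<gamma> i t) x"
proof -
  have "normal_velocity T (\<gamma> i) t x = curvature_vector (\<gamma> i t) x"
    using flow assms by (auto simp: network_flow_def)
  then show ?thesis
    unfolding normal_velocity_def vector_derivative_time[OF assms] .
qed

lemma concurrent: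
  assumes "i < n" "j < n" "e \<in> {0, 1}" "e' \<in> {0, 1}" "s \<in> {0..<T}" "t \<in> {0..<T}" "\<gamma> i s e = \<gamma> j s e'"
  shows "\<gamma> i t e = \<gamma> j t e'"
  using flow assms unfolding network_flow_def by blast

lemma curve_ends_time:
  assumes "s \<in> {0..<T}" "t \<in> {0..<T}" "i < n" "e \<in> {0, 1}"
  shows "curve_ends n (\<lambda>i. \<gamma> i s) (\<gamma> i s e) = curve_ends n (\<lambda>i. \<gamma> i t) (\<gamma> i t e)"
  using concurrent[of _ i _ e s t] concurrent[of _ i _ e t s] assms unfolding curve_ends_def by blast

lemma frontier_fixed:
  assumes "i < n" "e \<in> {0, 1}" "s \<in> {0..<T}" "t \<in> {0..<T}" "\<gamma> i s e \<in> frontier \<Omega>"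
  shows "\<gamma> i t e = \<gamma> i s e"
  using flow assms unfolding network_flow_def by blast

lemma concurrent_velocity:
  assumes i: "i < n" and j: "j < n" and e: "e \<in> {0, 1}" "e' \<in> {0, 1}" and t: "t \<in> {0..<T}"
    and eq: "\<gamma> i t e = \<gamma> j t e'"
  shows "gt i t e = gt j t e'"
proof -
  have "((\<lambda>s. \<gamma> j s e') has_vector_derivative gt i t e) (at t within {0..<T})"
    by (rule has_vector_derivative_transform[OF t _ time_derivative[OF i t]])
       (use concurrent[OF i j e t _ eq] e in auto)
  from vector_derivative_within[OF at_within_Ico_nontrivial[OF t] this]
  show ?thesis
    using vector_derivative_time[OF j t, of e'] e by auto
qed

lemma frontier_velocity:
  assumes i: "i < n" and e: "e \<in> {0, 1}" and t: "t \<in> {0..<T}" and f: "\<gamma> i t e \<in> frontier \<Omega>"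
  shows "gt i t e = 0"
proof -
  have "((\<lambda>s. \<gamma> i s e) has_vector_derivative 0) (at t within {0..<T})"
    by (rule has_vector_derivative_transform[OF t _ has_vector_derivative_const[of "\<gamma> i t e"]])
       (use frontier_fixed[OF i e t _ f] in auto)
  from vector_derivative_within[OF at_within_Ico_nontrivial[OF t] this]
  show ?thesis
    using vector_derivative_time[OF i t, of e] e by auto
qed

definition ends :: "(nat \<times> real) set" where "ends = {..<n} \<times> {0, 1}"

lemma finite_ends [simp]: "finite ends" by (simp add: ends_def)

lemma curve_ends_eq: "curve_ends n G p = {(i, e) \<in> ends. G i e = p}"
  by (auto simp: curve_ends_def ends_def)

lemma finite_curve_ends [simp]: "finite (curve_ends n G p)"
  by (rule finite_subset[OF _ finite_ends]) (auto simp: curve_ends_eq)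

lemma vertex_cases:
  assumes t: "t \<in> {0..<T}" and ie: "(i, e) \<in> ends"
  obtains (boundary) "curve_ends n (\<lambda>i. \<gamma> i t) (\<gamma> i t e) = {(i, e)}" "\<gamma> i t e \<in> frontier \<Omega>"
  | (triple) "card (curve_ends n (\<lambda>i. \<gamma> i t) (\<gamma> i t e)) = 3"
      "(\<Sum>(j, e')\<in>curve_ends n (\<lambda>i. \<gamma> i t) (\<gamma> i t e). outward_tangent (\<gamma> j t) e') = 0"
      "\<gamma> i t e \<notin> frontier \<Omega>"
proof -
  let ?C = "curve_ends n (\<lambda>i. \<gamma> i t) (\<gamma> i t e)"
  have mem: "(i, e) \<in> ?C" using ie by (auto simp: curve_ends_eq)
  then have "card ?C \<noteq> 0" by auto
  then consider "card ?C = 1" | "card ?C > 1" by linarith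
  then show ?thesis
  proof cases
    case 1
    then have "?C = {(i, e)}" using mem by (metis card_1_singletonE singletonD)
    moreover have "\<gamma> i t e \<in> frontier \<Omega>" using net[OF t] 1 by (auto simp: network_def)
    ultimately show ?thesis by (rule boundary)
  next
    case 2
    have "\<gamma> i t e \<notin> frontier \<Omega>" using net[OF t] 2 by (force simp: network_def)
    then show ?thesis using regular[OF t] 2 triple unfolding regular_network_def by blast
  qed
qed

definition weighted_length :: "real \<Rightarrow> plane \<Rightarrow> real \<Rightarrow> real" where
  "weighted_length S x0 t = (\<Sum>i<n. arc_integral (\<gamma> i t) (\<lambda>x. backward_heat_kernel S x0 t (\<gamma> i t x)))"

definition dissipation :: "real \<Rightarrow> plane \<Rightarrow> real \<Rightarrow> real" where
  "dissipation S x0 t = (\<Sum>i<n. arc_integral (\<gamma> i t)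
     (\<lambda>x. backward_heat_kernel S x0 t (\<gamma> i t x) * (shrinker_defect (S - t) x0 (\<gamma> i t) x)\<^sup>2))"

lemma sum_ends_by_vertex:
  "(\<Sum>\<epsilon>\<in>ends. f \<epsilon>) = (\<Sum>p\<in>(\<lambda>(i, e). G i e) ` ends. \<Sum>\<epsilon>\<in>curve_ends n G p. f \<epsilon>)" for f :: "_ \<Rightarrow> real"
proof -
  have "curve_ends n G p = {\<epsilon> \<in> ends. (\<lambda>(i, e). G i e) \<epsilon> = p}" for p
    by (auto simp: curve_ends_eq)
  then show ?thesis using sum.image_gen[OF finite_ends, of f "\<lambda>(i, e). G i e"] by simp
qed

lemma monotonicity:
  "\<exists>B\<ge>0. \<forall>S\<in>{T..2 * T}. \<forall>t\<in>{0..<T}. \<exists>D\<le>B - dissipation S x0 t.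
     (weighted_length S x0 has_real_derivative D) (at t within {0..<T})"
proof -
  define b where "b \<epsilon> = (if \<gamma> (fst \<epsilon>) 0 (snd \<epsilon>) = x0 then 0
     else 16 * sqrt (2 * T) / norm (\<gamma> (fst \<epsilon>) 0 (snd \<epsilon>) - x0) ^ 3)" for \<epsilon>
  have b0: "0 \<le> b \<epsilon>" for \<epsilon> using T_pos by (simp add: b_def)
  have main: "\<exists>D\<le>sum b ends - dissipation S x0 t.
     (weighted_length S x0 has_real_derivative D) (at t within {0..<T})"
    if S: "S \<in> {T..2 * T}" and t: "t \<in> {0..<T}" for S t
  proof -
    define W where "W i e = backward_heat_kernel S x0 t (\<gamma> i t e)" for i e
    define X where "X i e = gt i t e + (\<gamma> i t e - x0) /\<^sub>R (2 * (S - t))" for i e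
    define f where "f \<epsilon> = W (fst \<epsilon>) (snd \<epsilon>) * (outward_tangent (\<gamma> (fst \<epsilon>) t) (snd \<epsilon>) \<bullet> X (fst \<epsilon>) (snd \<epsilon>))" for \<epsilon>
    have s: "0 < S - t" "S - t \<le> 2 * T" using S t by auto
    have "(weighted_length S x0 has_real_derivative
       (\<Sum>i<n. - arc_integral (\<gamma> i t) (\<lambda>x. backward_heat_kernel S x0 t (\<gamma> i t x) *
              (shrinker_defect (S - t) x0 (\<gamma> i t) x)\<^sup>2)
          + (W i 1 * (unit_tangent (\<gamma> i t) 1 \<bullet> X i 1) - W i 0 * (unit_tangent (\<gamma> i t) 0 \<bullet> X i 0))))
       (at t within {0..<T})"
      unfolding weighted_length_def W_def X_def
      by (intro DERIV_sum curve_monotonicity[OF C12 _ t]) (use S normal t in auto)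
    moreover have "(\<Sum>i<n. - arc_integral (\<gamma> i t) (\<lambda>x. backward_heat_kernel S x0 t (\<gamma> i t x) *
              (shrinker_defect (S - t) x0 (\<gamma> i t) x)\<^sup>2)
          + (W i 1 * (unit_tangent (\<gamma> i t) 1 \<bullet> X i 1) - W i 0 * (unit_tangent (\<gamma> i t) 0 \<bullet> X i 0)))
        = - dissipation S x0 t + (\<Sum>\<epsilon>\<in>ends. f \<epsilon>)"
    proof -
      have "(\<Sum>\<epsilon>\<in>ends. f \<epsilon>) = (\<Sum>i<n. \<Sum>e\<in>{0, 1}. f (i, e))"
        unfolding ends_def
        using sum.cartesian_product[of "\<lambda>i e. f (i, e)" "{0, 1}" "{..<n}"] by (simp add: split_beta)
      also have "\<dots> = (\<Sum>i<n. W i 1 * (unit_tangent (\<gamma> i t) 1 \<bullet> X i 1) - W i 0 * (unit_tangent (\<gamma> i t) 0 \<bullet> X i 0))"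
        by (rule sum.cong) (simp_all add: f_def outward_tangent_def)
      finally show ?thesis
        by (simp only: sum.distrib sum_negf dissipation_def)
    qed
    moreover have "(\<Sum>\<epsilon>\<in>ends. f \<epsilon>) \<le> sum b ends"
      unfolding sum_ends_by_vertex[of _ "\<lambda>i. \<gamma> i t"]
    proof (rule sum_mono)
      fix p assume "p \<in> (\<lambda>(i, e). \<gamma> i t e) ` ends"
      then obtain i e where ie: "(i, e) \<in> ends" and p: "p = \<gamma> i t e" by auto
      then have i: "i < n" and e: "e \<in> {0, 1}" by (auto simp: ends_def)
      from t ie show "sum f (curve_ends n (\<lambda>i. \<gamma> i t) p) \<le> sum b (curve_ends n (\<lambda>i. \<gamma> i t) p)"
      proof (cases rule: vertex_cases)
        case boundary
        let ?y = "\<gamma> i t e - x0"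
        have fix0: "\<gamma> i 0 e = \<gamma> i t e"
          using frontier_fixed[OF i e t _ boundary(2)] T_pos by simp
        have "f (i, e) = W i e * (outward_tangent (\<gamma> i t) e \<bullet> ?y / (2 * (S - t)))"
          using frontier_velocity[OF i e t boundary(2)] by (simp add: f_def X_def divide_inverse)
        also have "\<dots> \<le> W i e * (norm ?y / (2 * (S - t)))"
        proof -
          have "norm (outward_tangent (\<gamma> i t) e) = 1"
            using C2_norm_unit_tangent[OF C2[OF i t], of e] e by (auto simp: outward_tangent_def)
          then have "outward_tangent (\<gamma> i t) e \<bullet> ?y \<le> norm ?y"
            using norm_cauchy_schwarz[of "outward_tangent (\<gamma> i t) e" ?y] by simp
          moreover have "0 < W i e" unfolding W_def using s by (intro backward_heat_kernel_pos) simp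
          ultimately show ?thesis using s by (intro mult_left_mono divide_right_mono) auto
        qed
        also have "\<dots> \<le> b (i, e)"
        proof (cases "?y = 0")
          case False
          then show ?thesis
            using heat_kernel_boundary_bound[of "norm ?y" "S - t" "2 * T"] s
            by (simp add: b_def fix0 W_def backward_heat_kernel_def)
        qed (simp add: b_def fix0)
        finally show ?thesis unfolding p boundary(1) by simp
      next
        case triple
        have "f (j, e') = W i e * (outward_tangent (\<gamma> j t) e' \<bullet> X i e)"
          if "(j, e') \<in> curve_ends n (\<lambda>i. \<gamma> i t) p" for j e'
        proof -
          have j: "j < n" "e' \<in> {0, 1}" "\<gamma> j t e' = \<gamma> i t e" using that by (auto simp: curve_ends_def p)
          then show ?thesis
            using concurrent_velocity[OF j(1) i j(2) e t j(3)] by (simp add: f_def W_def X_def)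
        qed
        then have "sum f (curve_ends n (\<lambda>i. \<gamma> i t) p) =
           (\<Sum>\<epsilon>\<in>curve_ends n (\<lambda>i. \<gamma> i t) p. W i e * ((\<lambda>(j, e'). outward_tangent (\<gamma> j t) e') \<epsilon> \<bullet> X i e))"
          by (intro sum.cong) auto
        also have "\<dots> = W i e * ((\<Sum>(j, e')\<in>curve_ends n (\<lambda>i. \<gamma> i t) p. outward_tangent (\<gamma> j t) e') \<bullet> X i e)"
          by (simp only: sum_distrib_left[symmetric] inner_sum_left)
        also have "\<dots> = 0" using triple(2) p by simp
        also have "0 \<le> sum b (curve_ends n (\<lambda>i. \<gamma> i t) p)" by (intro sum_nonneg b0)
        finally show ?thesis .
      qed
    qed
    ultimately show ?thesis
      by (intro exI[of _ "- dissipation S x0 t + (\<Sum>\<epsilon>\<in>ends. f \<epsilon>)"]) auto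
  qed
  show ?thesis
    by (rule exI[of _ "sum b ends"]) (use main b0 in \<open>auto intro!: sum_nonneg\<close>)
qed

lemma weighted_length_nonneg: "t \<in> {0..<T} \<Longrightarrow> T \<le> S \<Longrightarrow> 0 \<le> weighted_length S x0 t"
  unfolding weighted_length_def arc_integral_def
  by (intro sum_nonneg Bochner_Integration.integral_nonneg mult_nonneg_nonneg norm_ge_zero
        less_imp_le[OF backward_heat_kernel_pos]) auto

lemma dissipation_nonneg: "t \<in> {0..<T} \<Longrightarrow> T \<le> S \<Longrightarrow> 0 \<le> dissipation S x0 t"
  unfolding dissipation_def arc_integral_def
  by (intro sum_nonneg Bochner_Integration.integral_nonneg mult_nonneg_nonneg norm_ge_zero zero_le_power2
        less_imp_le[OF backward_heat_kernel_pos]) auto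

lemma weighted_length_almost_decreasing:
  "\<exists>B\<ge>0. \<forall>S\<in>{T..2 * T}. \<forall>s\<in>{0..<T}. \<forall>t\<in>{0..<T}. s \<le> t \<longrightarrow>
     weighted_length S x0 t - B * t \<le> weighted_length S x0 s - B * s"
proof -
  obtain B where B: "B \<ge> 0" "\<And>S t. S \<in> {T..2 * T} \<Longrightarrow> t \<in> {0..<T} \<Longrightarrow> \<exists>D\<le>B - dissipation S x0 t.
     (weighted_length S x0 has_real_derivative D) (at t within {0..<T})"
    using monotonicity by metis
  have "weighted_length S x0 t - B * t \<le> weighted_length S x0 s - B * s"
    if S: "S \<in> {T..2 * T}" and st: "s \<in> {0..<T}" "t \<in> {0..<T}" "s \<le> t" for S s t
  proof -
    have "\<exists>D. ((\<lambda>t. weighted_length S x0 t - B * t) has_real_derivative D) (at u within {s..t}) \<and> D \<le> 0"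
      if u: "s \<le> u" "u \<le> t" for u
    proof -
      have u': "u \<in> {0..<T}" using u st by auto
      obtain D where D: "D \<le> B - dissipation S x0 u"
        "(weighted_length S x0 has_real_derivative D) (at u within {0..<T})" using B(2)[OF S u'] by auto
      have "(weighted_length S x0 has_real_derivative D) (at u within {s..t})"
        by (rule DERIV_subset[OF D(2)]) (use st in auto)
      then have "((\<lambda>t. weighted_length S x0 t - B * t) has_real_derivative D - B) (at u within {s..t})"
        by (auto intro!: derivative_eq_intros)
      moreover have "D - B \<le> 0" using D(1) dissipation_nonneg[OF u', of S x0] S by auto
      ultimately show ?thesis by blast
    qed
    then obtain g where g: "\<And>u. u \<in> {s..t} \<Longrightarrow>
       ((\<lambda>t. weighted_length S x0 t - B * t) has_vector_derivative g u) (at u within {s..t})"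
       "\<And>u. u \<in> {s..t} \<Longrightarrow> g u \<le> 0"
      unfolding real_derivative_iff_vector by (metis atLeastAtMost_iff)
    have "(g has_integral (weighted_length S x0 t - B * t) - (weighted_length S x0 s - B * s)) {s..t}"
      by (rule fundamental_theorem_of_calculus[OF st(3) g(1)])
    moreover have "((\<lambda>_. 0) has_integral (0::real)) {s..t}" by simp
    ultimately have "(weighted_length S x0 t - B * t) - (weighted_length S x0 s - B * s) \<le> 0"
      by (rule has_integral_le) (use g(2) in auto)
    then show ?thesis by simp
  qed
  then show ?thesis using B(1) by blast
qed

end

lemma exists_sequence_integrand_tendsto_0:
  fixes F W :: "real \<Rightarrow> real"
  assumes F: "\<And>x. a \<le> x \<Longrightarrow> (F has_real_derivative - W x) (at x within {a..})"
    and W: "\<And>x. a \<le> x \<Longrightarrow> 0 \<le> W x" and C: "\<And>x. a \<le> x \<Longrightarrow> C \<le> F x"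
    and I: "I \<subseteq> {a..}" "I \<in> sets lebesgue" "emeasure lebesgue I = \<infinity>"
  shows "\<exists>\<tau> :: nat \<Rightarrow> real. filterlim \<tau> at_top sequentially \<and> (\<forall>j. \<tau> j \<in> I) \<and> (\<lambda>j. W (\<tau> j)) \<longlonglongrightarrow> 0"
proof -
  have ex: "\<exists>x\<in>I. real N \<le> x \<and> W x < 1 / real (Suc N)" for N
  proof (rule ccontr)
    assume neg: "\<not> ?thesis"
    define \<epsilon> where "\<epsilon> = 1 / real (Suc N)"
    have \<epsilon>: "0 < \<epsilon>" by (simp add: \<epsilon>_def)
    define K where "K = max (real N) a"
    have big: "\<epsilon> \<le> W x" if "x \<in> I" "K \<le> x" for x
      using neg that by (auto simp: \<epsilon>_def K_def)
    have le: "emeasure lebesgue (I \<inter> {K..M}) \<le> ennreal ((F K - C) / \<epsilon>)" if M: "K \<le> M" for M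
    proof -
      have "I \<inter> {K..M} \<in> lmeasurable"
        using fmeasurable_Int_fmeasurable[of "{K..M}" lebesgue I] I(2) by (simp add: Int_commute)
      then have "((indicat_real (I \<inter> {K..M})) has_integral measure lebesgue (I \<inter> {K..M})) UNIV"
        using lmeasurable_iff_indicator_has_integral[of "I \<inter> {K..M}"] by auto
      from has_integral_mult_right[OF this, of \<epsilon>]
      have 1: "((\<lambda>x. \<epsilon> * indicat_real (I \<inter> {K..M}) x) has_integral \<epsilon> * measure lebesgue (I \<inter> {K..M})) UNIV" .
      have "((\<lambda>x. - W x) has_integral F M - F K) {K..M}"
      proof (rule fundamental_theorem_of_calculus[OF M])
        fix x assume "x \<in> {K..M}"
        then have "a \<le> x" by (simp add: K_def)
        then show "(F has_vector_derivative - W x) (at x within {K..M})"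
          using DERIV_subset[OF F, of x "{K..M}"]
          by (auto simp: K_def real_derivative_iff_vector)
      qed
      from has_integral_neg[OF this]
      have "((\<lambda>x. if x \<in> {K..M} then W x else 0) has_integral F K - F M) UNIV"
        unfolding has_integral_restrict_UNIV by simp
      with 1 have "\<epsilon> * measure lebesgue (I \<inter> {K..M}) \<le> F K - F M"
        by (rule has_integral_le) (use big W in \<open>auto simp: indicator_def K_def\<close>)
      also have "\<dots> \<le> F K - C" using C[of M] M by (simp add: K_def)
      finally have "measure lebesgue (I \<inter> {K..M}) \<le> (F K - C) / \<epsilon>" using \<epsilon> by (simp add: field_simps)
      then show ?thesis
        using \<open>I \<inter> {K..M} \<in> lmeasurable\<close> by (simp add: emeasure_eq_measure2 ennreal_leI)
    qed
    have "(\<Union>m. I \<inter> {K..K + real m}) = I \<inter> {K..}"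
    proof -
      have "\<exists>m. x \<le> K + real m" for x using real_arch_simple[of "x - K"] by (auto simp: algebra_simps)
      then show ?thesis by auto
    qed
    moreover have "(SUP m. emeasure lebesgue (I \<inter> {K..K + real m})) = emeasure lebesgue (\<Union>m. I \<inter> {K..K + real m})"
      by (rule SUP_emeasure_incseq) (use I(2) in \<open>auto simp: incseq_def\<close>)
    moreover have "(SUP m. emeasure lebesgue (I \<inter> {K..K + real m})) \<le> ennreal ((F K - C) / \<epsilon>)"
      by (rule SUP_least) (rule le, simp)
    ultimately have "emeasure lebesgue (I \<inter> {K..}) \<le> ennreal ((F K - C) / \<epsilon>)" by simp
    then have fin: "emeasure lebesgue (I \<inter> {K..}) < \<infinity>"
      by (simp add: order.strict_trans1)
    have m: "I \<inter> {K..} \<in> sets lebesgue" "{a..K} \<union> (I \<inter> {K..}) \<in> sets lebesgue"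
      using I(2) by (intro sets.Un sets.Int; simp)+
    have "emeasure lebesgue I \<le> emeasure lebesgue ({a..K} \<union> (I \<inter> {K..}))"
      by (rule emeasure_mono[OF _ m(2)]) (use I in auto)
    also have "\<dots> \<le> emeasure lebesgue {a..K} + emeasure lebesgue (I \<inter> {K..})"
      by (rule emeasure_subadditive[OF _ m(1)]) simp
    also have "\<dots> < \<infinity>" using fin by (simp add: emeasure_lborel_Icc_eq)
    finally show False using I(3) by simp
  qed
  then obtain \<tau> where \<tau>: "\<And>N. \<tau> N \<in> I" "\<And>N. real N \<le> \<tau> N" "\<And>N. W (\<tau> N) < 1 / real (Suc N)" by metis
  have "filterlim \<tau> at_top sequentially"
    by (rule filterlim_at_top_mono[OF filterlim_real_sequentially]) (simp add: \<tau>(2))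
  moreover have "(\<lambda>j. W (\<tau> j)) \<longlonglongrightarrow> 0"
  proof (rule tendsto_sandwich[of "\<lambda>_. 0" _ _ "\<lambda>j. 1 / real (Suc j)"])
    show "\<forall>\<^sub>F j in sequentially. 0 \<le> W (\<tau> j)" using \<tau>(1) I(1) W by (intro always_eventually) blast
    show "\<forall>\<^sub>F j in sequentially. W (\<tau> j) \<le> 1 / real (Suc j)"
      using \<tau>(3) less_imp_le by (intro always_eventually) blast
    show "(\<lambda>j. 1 / real (Suc j)) \<longlonglongrightarrow> 0" using LIMSEQ_inverse_real_of_nat by (simp add: inverse_eq_divide)
  qed simp
  ultimately show ?thesis using \<tau>(1) by blast
qed

lemma antimono_bounded_tendsto_at_left:
  fixes f :: "real \<Rightarrow> real"
  assumes T: "a < T" and mono: "\<And>s t. a \<le> s \<Longrightarrow> s \<le> t \<Longrightarrow> t < T \<Longrightarrow> f t \<le> f s"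
    and bdd: "\<And>t. a \<le> t \<Longrightarrow> t < T \<Longrightarrow> C \<le> f t"
  shows "\<exists>L. (f \<longlongrightarrow> L) (at_left T)"
proof
  let ?L = "Inf (f ` {a..<T})"
  have bb: "bdd_below (f ` {a..<T})" using bdd by (auto intro!: bdd_belowI)
  have ev: "\<forall>\<^sub>F t in at_left T. s < t \<and> t < T" if "s < T" for s
    using that by (auto simp: eventually_at_left_field intro!: exI[of _ s])
  show "(f \<longlongrightarrow> ?L) (at_left T)"
  proof (rule order_tendstoI)
    fix c assume "c < ?L"
    have "?L \<le> f t" if "a < t \<and> t < T" for t using that by (intro cInf_lower bb) auto
    with \<open>c < ?L\<close> show "\<forall>\<^sub>F t in at_left T. c < f t"
      by (intro eventually_mono[OF ev[OF T]]) (meson less_le_trans)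
  next
    fix c assume "?L < c"
    moreover have "f ` {a..<T} \<noteq> {}" using T by auto
    ultimately obtain s where s: "a \<le> s" "s < T" "f s < c"
      using cInf_lessD[of "f ` {a..<T}" c] by auto
    show "\<forall>\<^sub>F t in at_left T. f t < c"
      by (rule eventually_mono[OF ev[OF s(2)]]) (use mono[OF s(1)] s(3) in \<open>meson le_less_trans less_imp_le\<close>)
  qed
qed

context
  fixes g g1 g2 :: "real \<Rightarrow> plane" and r :: real and x0 :: plane
  assumes C2: "C2_data g g1 g2" and r: "0 < r"
begin

lemma C2_rescale: "C2_data (\<lambda>x. (g x - x0) /\<^sub>R r) (\<lambda>x. g1 x /\<^sub>R r) (\<lambda>x. g2 x /\<^sub>R r)"
proof -
  have "((\<lambda>x. (g x - x0) /\<^sub>R r) has_vector_derivative g1 x /\<^sub>R r) (at x within {0..1})"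
    if "(g has_vector_derivative g1 x) (at x within {0..1})" for x
    by (rule bounded_linear.has_vector_derivative[OF bounded_linear_scaleR_right])
       (use has_vector_derivative_diff[OF that has_vector_derivative_const[of x0]] in simp)
  moreover have "((\<lambda>x. g1 x /\<^sub>R r) has_vector_derivative g2 x /\<^sub>R r) (at x within {0..1})"
    if "(g1 has_vector_derivative g2 x) (at x within {0..1})" for x
    by (rule bounded_linear.has_vector_derivative[OF bounded_linear_scaleR_right that])
  ultimately show ?thesis
    using C2 r unfolding C2_data_def by (auto intro!: continuous_intros)
qed

lemma unit_tangent_rescale:
  "x \<in> {0..1} \<Longrightarrow> unit_tangent (\<lambda>x. (g x - x0) /\<^sub>R r) x = unit_tangent g x"
  using r C2_nonzero[OF C2, of x]
  by (simp add: C2_unit_tangent[OF C2] C2_unit_tangent[OF C2_rescale] sgn_scaleR)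

lemma curvature_rescale:
  assumes x: "x \<in> {0..1}"
  shows "curvature_vector (\<lambda>x. (g x - x0) /\<^sub>R r) x = r *\<^sub>R curvature_vector g x"
proof -
  have "(unit_tangent (\<lambda>x. (g x - x0) /\<^sub>R r) has_vector_derivative norm (g1 x) *\<^sub>R curvature_vector g x)
      (at x within {0..1})"
    by (rule has_vector_derivative_transform[OF x _ C2_unit_tangent_derivative'[OF C2 x]])
       (rule unit_tangent_rescale)
  note vd = vector_derivative_within_unit[OF this x]
  have v: "norm (velocity (\<lambda>x. (g x - x0) /\<^sub>R r) x) = norm (g1 x) / r"
    using r by (simp only: C2_velocity[OF C2_rescale x]) (simp add: divide_inverse)
  show ?thesis
    unfolding curvature_vector_def[of "\<lambda>x. (g x - x0) /\<^sub>R r"] vd v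
    using r C2_nonzero[OF C2 x] by simp
qed

lemma arc_integral_rescale:
  "arc_integral (\<lambda>x. (g x - x0) /\<^sub>R r) F = arc_integral g F / r"
proof -
  have v: "norm (velocity (\<lambda>x. (g x - x0) /\<^sub>R r) x) = norm (velocity g x) / r" if "x \<in> {0..1}" for x
    using r by (simp only: C2_velocity[OF C2_rescale that] C2_velocity[OF C2 that]) (simp add: divide_inverse)
  have "arc_integral (\<lambda>x. (g x - x0) /\<^sub>R r) F = (LINT x|lebesgue_on {0..1}. (F x * norm (velocity g x)) / r)"
    unfolding arc_integral_def
    by (rule Bochner_Integration.integral_cong)
       (simp_all only: space_lebesgue_on v times_divide_eq_right)
  then show ?thesis by (simp add: arc_integral_def)
qed

end

lemma arc_integral_cong:
  assumes "\<And>x. x \<in> {0..1} \<Longrightarrow> F x = G x" shows "arc_integral g F = arc_integral g G"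
  unfolding arc_integral_def by (rule Bochner_Integration.integral_cong) (use assms in auto)

lemma arc_integral_mult: "arc_integral g (\<lambda>x. c * F x) = c * arc_integral g F"
  by (simp add: arc_integral_def mult.assoc)

context flow
begin

context
  fixes \<tau> :: real
  assumes tau: "- (1/2) * ln T \<le> \<tau>"
begin

abbreviation (input) "tm \<equiv> T - exp (- 2 * \<tau>)"
abbreviation (input) "rs \<equiv> sqrt (2 * exp (- 2 * \<tau>))"

lemma tm: "tm \<in> {0..<T}"
proof -
  have "- 2 * \<tau> \<le> ln T" using tau by simp
  then have "exp (- 2 * \<tau>) \<le> exp (ln T)" by (simp only: exp_le_cancel_iff)
  then show ?thesis using T_pos by simp
qed

lemma rs_pos: "0 < rs" by simp

lemma rescaled_eq: "rescaled_network \<gamma> T x0 \<tau> i = (\<lambda>x. (\<gamma> i tm x - x0) /\<^sub>R rs)"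
  by (simp add: rescaled_network_def fun_eq_iff)

lemma rescaled_C2:
  "i < n \<Longrightarrow> C2_data (rescaled_network \<gamma> T x0 \<tau> i) (\<lambda>x. gx i tm x /\<^sub>R rs) (\<lambda>x. gxx i tm x /\<^sub>R rs)"
  unfolding rescaled_eq by (rule C2_rescale[OF C2[OF _ tm] rs_pos])

lemma sum_arc_integral_rescaled:
  assumes S: "S - tm = m * exp (- 2 * \<tau>)" "0 < m"
    and eq: "\<And>i x. i < n \<Longrightarrow> x \<in> {0..1} \<Longrightarrow>
       F i x = exp (- (norm (rescaled_network \<gamma> T x0 \<tau> i x))\<^sup>2 / (2 * m)) * H i x"
  shows "(\<Sum>i<n. arc_integral (rescaled_network \<gamma> T x0 \<tau> i) (F i)) =
    sqrt (2 * pi * m) * (\<Sum>i<n. arc_integral (\<gamma> i tm) (\<lambda>x. backward_heat_kernel S x0 tm (\<gamma> i tm x) * H i x))"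
proof -
  have k: "exp (- (norm (rescaled_network \<gamma> T x0 \<tau> i x))\<^sup>2 / (2 * m)) =
     sqrt (2 * pi * m) * rs * backward_heat_kernel S x0 tm (\<gamma> i tm x)" for i x
  proof -
    have n: "(norm (rescaled_network \<gamma> T x0 \<tau> i x))\<^sup>2 = (norm (\<gamma> i tm x - x0))\<^sup>2 / (2 * exp (- 2 * \<tau>))"
    proof -
      have "(norm (v /\<^sub>R q))\<^sup>2 = (norm v)\<^sup>2 / q\<^sup>2" for v :: plane and q
        by (simp add: power_mult_distrib power_inverse divide_inverse)
      note this[where v="\<gamma> i tm x - x0" and q=rs]
      then show ?thesis unfolding rescaled_eq by (simp only: real_sqrt_pow2 exp_ge_zero mult_nonneg_nonneg zero_le_numeral)
    qed
    have q: "sqrt (2 * pi * m) * rs = sqrt (4 * pi * (S - tm))"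
      unfolding S real_sqrt_mult[symmetric] by (simp add: mult_ac)
    have "sqrt (4 * pi * (S - tm)) \<noteq> 0" unfolding S using S(2) by simp
    then show ?thesis
      unfolding q backward_heat_kernel_def n unfolding S by (simp add: field_simps)
  qed
  have "arc_integral (rescaled_network \<gamma> T x0 \<tau> i) (F i) = sqrt (2 * pi * m) *
     arc_integral (\<gamma> i tm) (\<lambda>x. backward_heat_kernel S x0 tm (\<gamma> i tm x) * H i x)" if i: "i < n" for i
  proof -
    have "arc_integral (rescaled_network \<gamma> T x0 \<tau> i) (F i) = arc_integral (\<gamma> i tm) (F i) / rs"
      using arc_integral_rescale[OF C2[OF i tm] rs_pos, of x0 "F i"] unfolding rescaled_eq .
    also have "arc_integral (\<gamma> i tm) (F i) = arc_integral (\<gamma> i tm)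
        (\<lambda>x. (sqrt (2 * pi * m) * rs) * (backward_heat_kernel S x0 tm (\<gamma> i tm x) * H i x))"
      by (rule arc_integral_cong) (simp only: eq[OF i] k mult.assoc)
    also have "\<dots> = (sqrt (2 * pi * m) * rs) * arc_integral (\<gamma> i tm) (\<lambda>x. backward_heat_kernel S x0 tm (\<gamma> i tm x) * H i x)"
      by (rule arc_integral_mult)
    finally show ?thesis using rs_pos by simp
  qed
  then show ?thesis by (simp add: sum_distrib_left)
qed

lemma rescaled_density:
  "(\<Sum>i<n. gaussian_length (rescaled_network \<gamma> T x0 \<tau> i)) = sqrt (2 * pi) * weighted_length T x0 tm"
  unfolding weighted_length_def
  by (subst sum_arc_integral_rescaled[where m=1 and S=T and H="\<lambda>_ _. 1"]) simp_all

lemma rescaled_density_wide: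
  "(\<Sum>i<n. wide_gaussian_length (rescaled_network \<gamma> T x0 \<tau> i)) =
   sqrt (4 * pi) * weighted_length (T + exp (- 2 * \<tau>)) x0 tm"
  unfolding weighted_length_def
  by (subst sum_arc_integral_rescaled[where m=2 and S="T + exp (- 2 * \<tau>)" and H="\<lambda>_ _. 1"]) simp_all

lemma rescaled_dissipation:
  "(\<Sum>i<n. shrinker_energy (rescaled_network \<gamma> T x0 \<tau> i)) =
   sqrt (2 * pi) * (2 * exp (- 2 * \<tau>) * dissipation T x0 tm)"
proof -
  have "((curvature_vector (rescaled_network \<gamma> T x0 \<tau> i) x + rescaled_network \<gamma> T x0 \<tau> i x)
           \<bullet> unit_normal (rescaled_network \<gamma> T x0 \<tau> i) x)\<^sup>2
      = (shrinker_defect (T - tm) x0 (\<gamma> i tm) x)\<^sup>2 * (2 * exp (- 2 * \<tau>))" if i: "i < n" and x: "x \<in> {0..1}" for i x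
  proof -
    let ?g = "\<gamma> i tm" let ?N = "unit_normal ?g x"
    have "unit_normal (rescaled_network \<gamma> T x0 \<tau> i) x = ?N"
      unfolding unit_normal_def rescaled_eq using unit_tangent_rescale[OF C2[OF i tm] rs_pos x, of x0] by simp
    moreover have "curvature_vector (rescaled_network \<gamma> T x0 \<tau> i) x = rs *\<^sub>R curvature_vector ?g x"
      unfolding rescaled_eq by (rule curvature_rescale[OF C2[OF i tm] rs_pos x])
    moreover have "q *\<^sub>R k + y /\<^sub>R q = q *\<^sub>R (k + y /\<^sub>R (q * q))" if "0 < q" for q and k y :: plane
      using that by (simp add: scaleR_right_distrib)
    note this[OF rs_pos]
    ultimately have "(curvature_vector (rescaled_network \<gamma> T x0 \<tau> i) x + rescaled_network \<gamma> T x0 \<tau> i x)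
           \<bullet> unit_normal (rescaled_network \<gamma> T x0 \<tau> i) x
       = rs * ((curvature_vector ?g x + (?g x - x0) /\<^sub>R (rs * rs)) \<bullet> ?N)"
      unfolding rescaled_eq by simp
    also have "(curvature_vector ?g x + (?g x - x0) /\<^sub>R (rs * rs)) \<bullet> ?N = shrinker_defect (T - tm) x0 ?g x"
    proof -
      have "rs * rs = 2 * (T - tm)" by simp
      then show ?thesis
        unfolding shrinker_defect_def
        by (simp only: inner_add_left inner_scaleR_left divide_inverse mult.commute)
    qed
    finally show ?thesis by (simp add: power_mult_distrib)
  qed
  then have "(\<Sum>i<n. shrinker_energy (rescaled_network \<gamma> T x0 \<tau> i)) =
    sqrt (2 * pi * 1) * (\<Sum>i<n. arc_integral (\<gamma> i tm) (\<lambda>x. backward_heat_kernel T x0 tm (\<gamma> i tm x) *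
       ((shrinker_defect (T - tm) x0 (\<gamma> i tm) x)\<^sup>2 * (2 * exp (- 2 * \<tau>)))))"
    by (intro sum_arc_integral_rescaled) auto
  also have "(\<Sum>i<n. arc_integral (\<gamma> i tm) (\<lambda>x. backward_heat_kernel T x0 tm (\<gamma> i tm x) *
       ((shrinker_defect (T - tm) x0 (\<gamma> i tm) x)\<^sup>2 * (2 * exp (- 2 * \<tau>)))))
    = (\<Sum>i<n. (2 * exp (- 2 * \<tau>)) * arc_integral (\<gamma> i tm) (\<lambda>x. backward_heat_kernel T x0 tm (\<gamma> i tm x) *
       (shrinker_defect (T - tm) x0 (\<gamma> i tm) x)\<^sup>2))"
    unfolding arc_integral_mult[symmetric] by (simp only: mult_ac)
  finally show ?thesis by (simp only: sum_distrib_left[symmetric] dissipation_def mult_1_right)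
qed

end

lemma rescaled_density_wide_bounded:
  "\<exists>C\<ge>0. \<forall>\<tau>\<ge>- (1/2) * ln T. (\<Sum>i<n. wide_gaussian_length (rescaled_network \<gamma> T x0 \<tau> i)) \<le> C"
proof -
  obtain B where B: "B \<ge> 0" and dec: "\<And>S s t. S \<in> {T..2 * T} \<Longrightarrow> s \<in> {0..<T} \<Longrightarrow> t \<in> {0..<T} \<Longrightarrow> s \<le> t \<Longrightarrow>
     weighted_length S x0 t - B * t \<le> weighted_length S x0 s - B * s"
    using weighted_length_almost_decreasing by metis
  define L where "L = (\<Sum>i<n. curve_length (\<gamma> i 0)) / sqrt (4 * pi * T)"
  have L0: "0 \<le> L" unfolding L_def curve_length_def arc_integral_def using T_pos
    by (auto intro!: divide_nonneg_nonneg sum_nonneg Bochner_Integration.integral_nonneg)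
  have init: "weighted_length S x0 0 \<le> L" if S: "T \<le> S" for S
  proof -
    have t0: "0 \<in> {0..<T}" using T_pos by simp
    have "arc_integral (\<gamma> i 0) (\<lambda>x. backward_heat_kernel S x0 0 (\<gamma> i 0 x))
       \<le> arc_integral (\<gamma> i 0) (\<lambda>x. 1 / sqrt (4 * pi * T) * 1)" if i: "i < n" for i
    proof -
      note c = C2_continuous[OF C2[OF i t0]]
      have "backward_heat_kernel S x0 0 y \<le> 1 / sqrt (4 * pi * T)" for y
        unfolding backward_heat_kernel_def
        by (rule frac_le) (use S T_pos in auto)
      then have "integral {0..1} (\<lambda>x. backward_heat_kernel S x0 0 (\<gamma> i 0 x) * norm (gx i 0 x))
         \<le> integral {0..1} (\<lambda>x. (1 / sqrt (4 * pi * T) * 1) * norm (gx i 0 x))"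
        using S T_pos
        by (intro integral_le integrable_continuous_real continuous_intros c mult_right_mono) auto
      moreover have "arc_integral (\<gamma> i 0) (\<lambda>x. backward_heat_kernel S x0 0 (\<gamma> i 0 x)) =
          integral {0..1} (\<lambda>x. backward_heat_kernel S x0 0 (\<gamma> i 0 x) * norm (gx i 0 x))"
        by (rule C2_arc_integral[OF C2[OF i t0]]) (use S T_pos in \<open>auto intro!: continuous_intros c\<close>)
      moreover have "arc_integral (\<gamma> i 0) (\<lambda>x. 1 / sqrt (4 * pi * T) * 1) =
          integral {0..1} (\<lambda>x. (1 / sqrt (4 * pi * T) * 1) * norm (gx i 0 x))"
        by (rule C2_arc_integral[OF C2[OF i t0]]) (rule continuous_on_const)
      ultimately show ?thesis by simp
    qed
    then have "weighted_length S x0 0 \<le> (\<Sum>i<n. arc_integral (\<gamma> i 0) (\<lambda>x. 1 / sqrt (4 * pi * T) * 1))"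
      unfolding weighted_length_def by (intro sum_mono) auto
    then show ?thesis
      unfolding arc_integral_mult L_def curve_length_def by (simp add: sum_divide_distrib)
  qed
  have "sqrt (4 * pi) * weighted_length (T + exp (- 2 * \<tau>)) x0 (T - exp (- 2 * \<tau>)) \<le> sqrt (4 * pi) * (L + B * T)"
    if \<tau>: "- (1/2) * ln T \<le> \<tau>" for \<tau>
  proof -
    have t: "T - exp (- 2 * \<tau>) \<in> {0..<T}" by (rule tm[OF \<tau>])
    have S: "T + exp (- 2 * \<tau>) \<in> {T..2 * T}" using t by auto
    have "weighted_length (T + exp (- 2 * \<tau>)) x0 (T - exp (- 2 * \<tau>)) \<le> L + B * (T - exp (- 2 * \<tau>))"
      using dec[OF S _ t, of 0] init[of "T + exp (- 2 * \<tau>)"] S t T_pos by auto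
    also have "\<dots> \<le> L + B * T" using B by (intro add_left_mono mult_left_mono) auto
    finally show ?thesis by (intro mult_left_mono) auto
  qed
  then show ?thesis
    using B L0 T_pos
    by (intro exI[of _ "sqrt (4 * pi) * (L + B * T)"] conjI allI impI, simp)
       (subst rescaled_density_wide; blast)
qed

lemma limit_density_exists:
  "\<exists>\<theta>. (weighted_length T x0 \<longlongrightarrow> \<theta>) (at_left T)"
proof -
  obtain B where B: "B \<ge> 0" and dec: "\<And>S s t. S \<in> {T..2 * T} \<Longrightarrow> s \<in> {0..<T} \<Longrightarrow> t \<in> {0..<T} \<Longrightarrow> s \<le> t \<Longrightarrow>
     weighted_length S x0 t - B * t \<le> weighted_length S x0 s - B * s"
    using weighted_length_almost_decreasing by metis
  have "\<exists>L. ((\<lambda>t. weighted_length T x0 t - B * t) \<longlongrightarrow> L) (at_left T)"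
  proof (rule antimono_bounded_tendsto_at_left[OF T_pos])
    show "- B * T \<le> weighted_length T x0 t - B * t" if "0 \<le> t" "t < T" for t
      using weighted_length_nonneg[of t T x0] mult_left_mono[of t T B] B that by auto
  qed (use dec[of T] T_pos in auto)
  then obtain L where "((\<lambda>t. weighted_length T x0 t - B * t) \<longlongrightarrow> L) (at_left T)" by blast
  then have "((\<lambda>t. (weighted_length T x0 t - B * t) + B * t) \<longlongrightarrow> L + B * T) (at_left T)"
    by (intro tendsto_intros)
  then show ?thesis by auto
qed

lemma dissipation_sequence:
  assumes I: "I \<subseteq> {- (1/2) * ln T ..}" "I \<in> sets lebesgue" "emeasure lebesgue I = \<infinity>"
  shows "\<exists>\<tau> :: nat \<Rightarrow> real. filterlim \<tau> at_top sequentially \<and> (\<forall>j. \<tau> j \<in> I) \<and>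
    (\<lambda>j. 2 * exp (- 2 * \<tau> j) * dissipation T x0 (T - exp (- 2 * \<tau> j))) \<longlonglongrightarrow> 0"
proof -
  let ?a = "- (1/2) * ln T"
  obtain B where B: "B \<ge> 0" "\<And>S t. S \<in> {T..2 * T} \<Longrightarrow> t \<in> {0..<T} \<Longrightarrow> \<exists>D\<le>B - dissipation S x0 t.
     (weighted_length S x0 has_real_derivative D) (at t within {0..<T})"
    using monotonicity by metis
  obtain D where D: "\<And>t. t \<in> {0..<T} \<Longrightarrow> D t \<le> B - dissipation T x0 t"
     "\<And>t. t \<in> {0..<T} \<Longrightarrow> (weighted_length T x0 has_real_derivative D t) (at t within {0..<T})"
    using B(2)[of T] T_pos by (metis atLeastAtMost_iff mult_2 le_add_same_cancel1 less_imp_le order_refl)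
  define t where "t \<tau> = T - exp (- 2 * \<tau>)" for \<tau> :: real
  have t: "t \<tau> \<in> {0..<T}" if "?a \<le> \<tau>" for \<tau> using tm[OF that] by (simp add: t_def)
  define W where "W \<tau> = 2 * exp (- 2 * \<tau>) * (B - D (t \<tau>))" for \<tau>
  define F where "F \<tau> = weighted_length T x0 (t \<tau>) - B * t \<tau>" for \<tau>
  have WE: "2 * exp (- 2 * \<tau>) * dissipation T x0 (t \<tau>) \<le> W \<tau>" if "?a \<le> \<tau>" for \<tau>
    unfolding W_def using D(1)[OF t[OF that]] by (intro mult_left_mono) auto
  have E0: "0 \<le> 2 * exp (- 2 * \<tau>) * dissipation T x0 (t \<tau>)" if "?a \<le> \<tau>" for \<tau>
    using dissipation_nonneg[OF t[OF that], of T x0] by simp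
  have "\<exists>\<tau> :: nat \<Rightarrow> real. filterlim \<tau> at_top sequentially \<and> (\<forall>j. \<tau> j \<in> I) \<and> (\<lambda>j. W (\<tau> j)) \<longlonglongrightarrow> 0"
  proof (rule exists_sequence_integrand_tendsto_0[where F=F and a="?a" and C="- B * T", OF _ _ _ I])
    fix \<tau> assume \<tau>: "?a \<le> \<tau>"
    have td: "(t has_real_derivative 2 * exp (- 2 * \<tau>)) (at \<tau> within {?a..})"
      unfolding t_def by (auto intro!: derivative_eq_intros)
    have "((\<lambda>\<tau>. weighted_length T x0 (t \<tau>)) has_real_derivative D (t \<tau>) * (2 * exp (- 2 * \<tau>))) (at \<tau> within {?a..})"
      by (rule DERIV_image_chain[OF DERIV_subset[OF D(2)[OF t[OF \<tau>]]] td, unfolded o_def]) (use t in auto)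
    from DERIV_diff[OF this DERIV_cmult[OF td, of B]]
    show "(F has_real_derivative - W \<tau>) (at \<tau> within {?a..})"
      unfolding F_def W_def by (simp add: algebra_simps)
    show "0 \<le> W \<tau>" using E0[OF \<tau>] WE[OF \<tau>] by (rule order_trans)
    show "- B * T \<le> F \<tau>"
      using weighted_length_nonneg[OF t[OF \<tau>], of T x0] mult_left_mono[of "t \<tau>" T B] B t[OF \<tau>]
      by (auto simp: F_def)
  qed
  then obtain \<tau> :: "nat \<Rightarrow> real" where \<tau>: "filterlim \<tau> at_top sequentially" "\<And>j. \<tau> j \<in> I" "(\<lambda>j. W (\<tau> j)) \<longlonglongrightarrow> 0"
    by blast
  have a: "?a \<le> \<tau> j" for j using \<tau>(2) I(1) by auto
  have "(\<lambda>j. 2 * exp (- 2 * \<tau> j) * dissipation T x0 (t (\<tau> j))) \<longlonglongrightarrow> 0"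
    by (rule tendsto_sandwich[OF always_eventually always_eventually tendsto_const \<tau>(3)])
       (use WE[OF a] E0[OF a] in auto)
  then show ?thesis using \<tau>(1,2) unfolding t_def by blast
qed

end

section \<open>Maximum principle and Hopf lemma\<close>

lemma derivative_nonneg_left_min:
  assumes "(f has_real_derivative D) (at x within S)" "x < y" "{x..y} \<subseteq> S"
    and "\<And>z. z \<in> {x..y} \<Longrightarrow> f x \<le> f z"
  shows "0 \<le> D"
proof (rule ccontr)
  assume "\<not> 0 \<le> D"
  then obtain d where d: "d > 0" "\<And>h. h > 0 \<Longrightarrow> x + h \<in> S \<Longrightarrow> h < d \<Longrightarrow> f (x + h) < f x"
    using has_real_derivative_neg_dec_right[OF assms(1)] by auto
  define h where "h = min (d / 2) (y - x)"
  have "h > 0" "h < d" "x + h \<in> {x..y}" using d(1) assms(2) by (auto simp: h_def)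
  then show False using d(2)[of h] assms(3) assms(4)[of "x + h"] by fastforce
qed

lemma derivative_nonpos_right_min:
  assumes "(f has_real_derivative D) (at x within S)" "y < x" "{y..x} \<subseteq> S"
    and "\<And>z. z \<in> {y..x} \<Longrightarrow> f x \<le> f z"
  shows "D \<le> 0"
proof (rule ccontr)
  assume "\<not> D \<le> 0"
  then obtain d where d: "d > 0" "\<And>h. h > 0 \<Longrightarrow> x - h \<in> S \<Longrightarrow> h < d \<Longrightarrow> f (x - h) < f x"
    using has_real_derivative_pos_inc_left[OF assms(1)] by auto
  define h where "h = min (d / 2) (x - y)"
  have "h > 0" "h < d" "x - h \<in> {y..x}" using d(1) assms(2) by (auto simp: h_def)
  then show False using d(2)[of h] assms(3) assms(4)[of "x - h"] by fastforce
qed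

lemma interior_min_derivatives:
  fixes f :: "real \<Rightarrow> real"
  assumes f: "\<And>y. y \<in> {a..b} \<Longrightarrow> (f has_real_derivative f1 y) (at y within {a..b})"
    and f1: "(f1 has_real_derivative D) (at x within {a..b})"
    and x: "x \<in> {a<..<b}" and min: "\<And>y. y \<in> {a..b} \<Longrightarrow> f x \<le> f y"
  shows "f1 x = 0" "0 \<le> D"
proof -
  have "0 \<le> f1 x" using derivative_nonneg_left_min[OF f, of x b] x min by auto
  moreover have "f1 x \<le> 0" using derivative_nonpos_right_min[OF f, of x a] x min by auto
  ultimately show z: "f1 x = 0" by simp
  show "0 \<le> D"
  proof (rule ccontr)
    assume "\<not> 0 \<le> D"
    then obtain d where d: "d > 0" "\<And>h. h > 0 \<Longrightarrow> x + h \<in> {a..b} \<Longrightarrow> h < d \<Longrightarrow> f1 (x + h) < f1 x"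
      using has_real_derivative_neg_dec_right[OF f1] by auto
    define y where "y = x + min (d / 2) (b - x)"
    have y: "x < y" "y \<le> b" "y - x < d" using d(1) x by (auto simp: y_def)
    have "f y < f x"
    proof (rule DERIV_neg_imp_decreasing_open[OF y(1)])
      fix w assume w: "x < w" "w < y"
      have "(f has_real_derivative f1 w) (at w)"
        using f[of w] w y x at_within_interior[of w "{a..b}"] by auto
      moreover have "f1 w < 0" using d(2)[of "w - x"] w y x z by auto
      ultimately show "\<exists>D. (f has_real_derivative D) (at w) \<and> D < 0" by blast
    next
      have "continuous_on {a..b} f" using f by (meson DERIV_continuous_on)
      then show "continuous_on {x..y} f" by (rule continuous_on_subset) (use x y in auto)
    qed
    then show False using min[of y] x y by auto
  qed
qed

text \<open>The barrier is a wave that starts out nonpositive on \<open>[0, 1/2]\<close> and travels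
  towards the boundary, which it reaches at time \<open>t1\<close> with positive slope.\<close>

lemma hopf_boundary_lemma:
  fixes u ut ux uxx a b :: "real \<Rightarrow> real \<Rightarrow> real"
  assumes t01: "t0 < t1"
    and ut: "\<And>t x. t \<in> {t0..t1} \<Longrightarrow> x \<in> {0..1} \<Longrightarrow> ((\<lambda>s. u s x) has_real_derivative ut t x) (at t within {t0..t1})"
    and ux: "\<And>t x. t \<in> {t0..t1} \<Longrightarrow> x \<in> {0..1} \<Longrightarrow> (u t has_real_derivative ux t x) (at x within {0..1})"
    and uxx: "\<And>t x. t \<in> {t0..t1} \<Longrightarrow> x \<in> {0..1} \<Longrightarrow> (ux t has_real_derivative uxx t x) (at x within {0..1})"
    and cont: "continuous_on ({t0..t1} \<times> {0..1}) (\<lambda>(t, x). u t x)"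
    and eq: "\<And>t x. t \<in> {t0..t1} \<Longrightarrow> x \<in> {0..1} \<Longrightarrow> ut t x = a t x * uxx t x + b t x * ux t x"
    and a: "0 < a0" "\<And>t x. t \<in> {t0..t1} \<Longrightarrow> x \<in> {0..1} \<Longrightarrow> a0 \<le> a t x"
    and b: "\<And>t x. t \<in> {t0..t1} \<Longrightarrow> x \<in> {0..1} \<Longrightarrow> \<bar>b t x\<bar> \<le> b1"
    and u0: "\<And>t. t \<in> {t0..t1} \<Longrightarrow> u t 0 = 0"
    and pos: "\<And>t x. t \<in> {t0..t1} \<Longrightarrow> 0 < x \<Longrightarrow> x \<le> 1 \<Longrightarrow> 0 < u t x"
  shows "0 < ux t1 0"
proof -
  define M where "M = (1/2) / (t1 - t0)"
  have M: "0 < M" "M * (t1 - t0) = 1/2" using t01 by (simp_all add: M_def)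
  have b1: "0 \<le> b1" using b[of t0 0] t01 by auto
  define K where "K = (M + b1) / a0 + 1"
  have K0: "0 < K" using M b1 a by (simp add: K_def add_nonneg_pos)
  have KM: "M < a0 * K - b1"
  proof -
    have "a0 * K = M + b1 + a0" using a(1) by (simp add: K_def field_simps)
    then show ?thesis using a(1) by simp
  qed
  have "continuous_on {t0..t1} (\<lambda>t. u t (1/2))"
    by (rule continuous_on_compose_pair[OF cont]) (auto intro!: continuous_intros)
  then obtain ts where ts: "ts \<in> {t0..t1}" "\<And>t. t \<in> {t0..t1} \<Longrightarrow> u ts (1/2) \<le> u t (1/2)"
    using continuous_attains_inf[of "{t0..t1}" "\<lambda>t. u t (1/2)"] t01 by auto
  define \<epsilon> where "\<epsilon> = u ts (1/2) / exp (K / 2)"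
  have \<epsilon>: "0 < \<epsilon>" using pos[OF ts(1), of "1/2"] by (simp add: \<epsilon>_def)
  define E where "E t x = exp (K * (x - M * (t1 - t)))" for t x
  define z where "z t x = u t x - \<epsilon> * (E t x - 1)" for t x
  let ?R = "{t0..t1} \<times> {0..1/2::real}"
  have "continuous_on ?R (\<lambda>(t, x). z t x)"
    unfolding z_def E_def split_beta
    by (intro continuous_intros continuous_on_compose_pair[OF cont]) auto
  then obtain q where q: "q \<in> ?R" "\<And>p. p \<in> ?R \<Longrightarrow> (\<lambda>(t, x). z t x) q \<le> (\<lambda>(t, x). z t x) p"
    using continuous_attains_inf[of ?R "\<lambda>(t, x). z t x"] compact_Times[OF compact_Icc compact_Icc] t01 by auto
  obtain t x where tx: "q = (t, x)" by (cases q)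
  have t: "t \<in> {t0..t1}" and x: "x \<in> {0..1/2}" and min: "\<And>s y. s \<in> {t0..t1} \<Longrightarrow> y \<in> {0..1/2} \<Longrightarrow> z t x \<le> z s y"
    using q unfolding tx by auto
  have u_nonneg: "0 \<le> u s y" if "s \<in> {t0..t1}" "y \<in> {0..1}" for s y
    using pos[OF that(1), of y] u0[OF that(1)] that(2) by (cases "y = 0") auto
  have E1: "E s y \<le> 1" if "y \<le> M * (t1 - s)" for s y
    using that K0 by (simp add: E_def mult_le_0_iff)
  have "0 \<le> z t x"
  proof (rule ccontr)
    assume "\<not> 0 \<le> z t x"
    then have neg: "z t x < 0" by simp
    have w_le: "0 \<le> z t x" if "E t x \<le> 1"
    proof -
      have "\<epsilon> * (E t x - 1) \<le> 0" using that \<epsilon> by (simp add: mult_le_0_iff)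
      moreover have "0 \<le> u t x" using u_nonneg[OF t, of x] x by auto
      ultimately show ?thesis by (simp add: z_def)
    qed
    have "t \<noteq> t0" using w_le E1[of x t0] x M neg by auto
    have "x \<noteq> 0" using w_le E1[of 0 t] t M neg by auto
    have "x \<noteq> 1/2"
    proof
      assume x2: "x = 1/2"
      have "E t x \<le> exp (K / 2)" using K0 M(1) t by (simp add: E_def x2)
      then have "\<epsilon> * (E t x - 1) \<le> \<epsilon> * (exp (K / 2) - 1)" using \<epsilon> by simp
      also have "\<dots> \<le> u ts (1/2)" using \<epsilon> by (simp add: \<epsilon>_def field_simps)
      also have "\<dots> \<le> u t x" using ts(2)[OF t] by (simp add: x2)
      finally show False using neg by (simp add: z_def)
    qed
    have xi: "x \<in> {0<..<1/2}" "x \<in> {0..1}" using x \<open>x \<noteq> 0\<close> \<open>x \<noteq> 1/2\<close> by auto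
    have ti: "t0 < t" using t \<open>t \<noteq> t0\<close> by auto
    have Et: "((\<lambda>s. E s x) has_real_derivative K * M * E t x) (at t within {t0..t1})"
      unfolding E_def by (auto intro!: derivative_eq_intros)
    have Ex: "(E s has_real_derivative K * E s y) (at y within A)" for s y A
      unfolding E_def[abs_def] by (auto intro!: derivative_eq_intros)
    have "((\<lambda>s. z s x) has_real_derivative ut t x - \<epsilon> * (K * M * E t x)) (at t within {t0..t1})"
      unfolding z_def by (auto intro!: derivative_eq_intros ut[OF t xi(2)] Et)
    then have 1: "ut t x - \<epsilon> * (K * M * E t x) \<le> 0"
      by (rule derivative_nonpos_right_min[OF _ ti]) (use t x min in auto)
    have zx: "(z t has_real_derivative ux t y - \<epsilon> * (K * E t y)) (at y within {0..1/2})" if "y \<in> {0..1/2}" for y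
      unfolding z_def[abs_def]
      by (auto intro!: derivative_eq_intros DERIV_subset[OF ux[OF t]] Ex) (use that in auto)
    have zxx: "((\<lambda>y. ux t y - \<epsilon> * (K * E t y)) has_real_derivative uxx t x - \<epsilon> * (K * (K * E t x))) (at x within {0..1/2})"
      by (auto intro!: derivative_eq_intros DERIV_subset[OF uxx[OF t]] Ex) (use xi in auto)
    have 2: "ux t x = \<epsilon> * (K * E t x)" "\<epsilon> * (K * (K * E t x)) \<le> uxx t x"
      using interior_min_derivatives[OF zx zxx xi(1) min[OF t]] by auto
    have E0: "0 < E t x" by (simp add: E_def)
    define c where "c = \<epsilon> * (K * E t x)"
    have c: "0 < c" using \<epsilon> K0 E0 by (simp add: c_def)
    have "a0 * (K * c) \<le> a t x * uxx t x"
      using a(2)[OF t xi(2)] 2(2) c K0 a(1) by (intro mult_mono) (auto simp: c_def mult_ac)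
    moreover have "- (b1 * c) \<le> b t x * ux t x"
      using b[OF t xi(2)] c 2(1) mult_right_mono[of "- b1" "b t x" c] by (auto simp: c_def)
    ultimately have "c * (a0 * K - b1) \<le> ut t x" unfolding eq[OF t xi(2)] by (simp add: algebra_simps)
    moreover have "c * M < c * (a0 * K - b1)" using c KM by simp
    moreover have "ut t x \<le> c * M" using 1 by (simp add: c_def mult_ac)
    ultimately show False by simp
  qed
  have low: "\<epsilon> * K * y \<le> u t1 y" if y: "y \<in> {0..1/2}" for y
  proof -
    have "0 \<le> z t1 y" using \<open>0 \<le> z t x\<close> min[of t1 y] y t01 by auto
    then have "\<epsilon> * (exp (K * y) - 1) \<le> u t1 y" by (simp add: z_def E_def)
    moreover have "K * y \<le> exp (K * y) - 1" using exp_ge_add_one_self[of "K * y"] by linarith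
    then have "\<epsilon> * (K * y) \<le> \<epsilon> * (exp (K * y) - 1)" using \<epsilon> by simp
    ultimately show ?thesis by (simp add: mult_ac)
  qed
  have t1: "t1 \<in> {t0..t1}" using t01 by auto
  have "((\<lambda>y. u t1 y - \<epsilon> * K * y) has_real_derivative ux t1 0 - \<epsilon> * K) (at 0 within {0..1})"
    by (auto intro!: derivative_eq_intros ux[OF t1])
  then have "0 \<le> ux t1 0 - \<epsilon> * K"
    by (rule derivative_nonneg_left_min[where y="1/2"]) (use low u0[OF t1] in auto)
  moreover have "0 < \<epsilon> * K" using \<epsilon> K0 by simp
  ultimately show ?thesis by simp
qed

lemma triple_not_collinear:
  fixes w :: "'b \<Rightarrow> plane"
  assumes C: "card C = 3" and sum: "(\<Sum>k\<in>C. w k) = 0" and unit: "\<And>k. k \<in> C \<Longrightarrow> norm (w k) = 1"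
    and perp: "\<And>k. k \<in> C \<Longrightarrow> w k \<bullet> a = 0"
  shows "a = 0"
proof (rule ccontr)
  assume "a \<noteq> 0"
  define d where "d = a /\<^sub>R norm a"
  have d: "norm d = 1" using \<open>a \<noteq> 0\<close> by (simp add: d_def)
  define c where "c k = w k \<bullet> rot90 d" for k
  have w: "w k = c k *\<^sub>R rot90 d" if "k \<in> C" for k
    unfolding c_def by (rule orthogonal_unit_parallel[OF d]) (simp add: d_def perp[OF that])
  have c1: "\<bar>c k\<bar> = 1" if "k \<in> C" for k
    using unit[OF that] w[OF that] d by simp
  have "(\<Sum>k\<in>C. c k) = (\<Sum>k\<in>C. w k) \<bullet> rot90 d" by (simp add: c_def inner_sum_left)
  then have "(\<Sum>k\<in>C. c k) = 0" using sum by simp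
  moreover obtain x y z where "C = {x, y, z}" "x \<noteq> y" "x \<noteq> z" "y \<noteq> z"
    using C unfolding card_3_iff by blast
  ultimately have "c x + c y + c z = 0" "\<bar>c x\<bar> = 1" "\<bar>c y\<bar> = 1" "\<bar>c z\<bar> = 1" using c1 by auto
  then show False by linarith
qed

context flow
begin

definition tangential_coeff :: "nat \<Rightarrow> real \<Rightarrow> real \<Rightarrow> real" where
  "tangential_coeff i t x = (gt i t x \<bullet> gx i t x) / (norm (gx i t x))\<^sup>2
      - (gx i t x \<bullet> gxx i t x) / (norm (gx i t x)) ^ 4"

lemma parabolic_equation:
  assumes i: "i < n" and t: "t \<in> {0..<T}" and x: "x \<in> {0..1}"
  shows "gt i t x = (1 / (norm (gx i t x))\<^sup>2) *\<^sub>R gxx i t x + tangential_coeff i t x *\<^sub>R gx i t x"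
proof -
  let ?v = "norm (gx i t x)" and ?u = "unit_tangent (\<gamma> i t) x"
  have v: "?v \<noteq> 0" using C2_nonzero[OF C2[OF i t] x] by simp
  have u: "?u = gx i t x /\<^sub>R ?v" by (simp add: C2_unit_tangent[OF C2[OF i t] x] sgn_div_norm)
  have "gt i t x = (gt i t x \<bullet> ?u) *\<^sub>R ?u + curvature_vector (\<gamma> i t) x"
    using plane_decomp[OF C2_norm_unit_tangent[OF C2[OF i t] x], of "gt i t x"] normal[OF i t x]
    by (simp add: unit_normal_def)
  also have "(gt i t x \<bullet> ?u) *\<^sub>R ?u = ((gt i t x \<bullet> gx i t x) / ?v\<^sup>2) *\<^sub>R gx i t x"
    unfolding u by (simp add: power2_eq_square divide_inverse)
  also have "curvature_vector (\<gamma> i t) x = (1 / ?v\<^sup>2) *\<^sub>R gxx i t x - ((gx i t x \<bullet> gxx i t x) / ?v ^ 4) *\<^sub>R gx i t x"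
    unfolding C2_curvature[OF C2[OF i t] x] using v
    by (simp add: scaleR_diff_right power2_eq_square divide_inverse eval_nat_numeral)
  finally show ?thesis by (simp add: tangential_coeff_def scaleR_diff_left algebra_simps)
qed

lemma space_derivatives:
  assumes "i < n" "t \<in> {0..<T}" "x \<in> {0..1}"
  shows "(\<gamma> i t has_vector_derivative gx i t x) (at x within {0..1})"
    "(gx i t has_vector_derivative gxx i t x) (at x within {0..1})"
  using C2[OF assms(1,2)] assms(3) by (auto simp: C2_data_def)

lemma inner_derivative:
  fixes f :: "real \<Rightarrow> plane"
  assumes "(f has_vector_derivative f') F"
  shows "((\<lambda>x. (f x - p) \<bullet> a) has_vector_derivative f' \<bullet> a) F" "((\<lambda>x. f x \<bullet> a) has_vector_derivative f' \<bullet> a) F"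
proof -
  show "((\<lambda>x. f x \<bullet> a) has_vector_derivative f' \<bullet> a) F"
    by (rule bounded_linear.has_vector_derivative[OF bounded_linear_inner_left assms])
  from has_vector_derivative_diff[OF this has_vector_derivative_const[of "p \<bullet> a"]]
  show "((\<lambda>x. (f x - p) \<bullet> a) has_vector_derivative f' \<bullet> a) F" by (simp add: inner_diff_left)
qed

lemma norm_outward_tangent:
  assumes "(i, e) \<in> ends" "t \<in> {0..<T}" shows "norm (outward_tangent (\<gamma> i t) e) = 1"
  using C2_norm_unit_tangent[OF C2, of i t e] assms by (auto simp: outward_tangent_def ends_def)

lemma halfplane_preserved:
  assumes t1: "t1 \<in> {0..<T}"
    and init: "\<And>i x. i < n \<Longrightarrow> x \<in> {0..1} \<Longrightarrow> 0 \<le> (\<gamma> i t1 x - p) \<bullet> a"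
    and t2: "t2 \<in> {t1..<T}" and i: "i < n" and x: "x \<in> {0..1}"
  shows "0 \<le> (\<gamma> i t2 x - p) \<bullet> a"
proof (rule ccontr)
  assume "\<not> ?thesis"
  then have neg: "(\<gamma> i t2 x - p) \<bullet> a < 0" by simp
  then have "a \<noteq> 0" by auto
  have t12: "t1 < t2" using init[OF i x] neg t2 by (cases "t1 = t2") auto
  define \<eta> where "\<eta> = - ((\<gamma> i t2 x - p) \<bullet> a) / (2 * (t2 - t1))"
  have \<eta>: "0 < \<eta>" unfolding \<eta>_def using neg t12 by (intro divide_pos_pos) auto
  define w where "w j t y = (\<gamma> j t y - p) \<bullet> a + \<eta> * (t - t1)" for j t y
  have w0: "w i t2 x < 0" using neg t12 by (simp add: w_def \<eta>_def field_simps)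
  let ?R = "{t1..t2} \<times> {0..1::real}"
  have sub: "s \<in> {0..<T}" if "s \<in> {t1..t2}" for s using that t1 t2 by auto
  let ?S = "\<Union>j<n. (\<lambda>(t, y). w j t y) ` ?R"
  have "compact ((\<lambda>(t, y). w j t y) ` ?R)" if "j < n" for j
  proof (rule compact_continuous_image)
    show "continuous_on ?R (\<lambda>(t, y). w j t y)"
      unfolding w_def split_beta
      by (intro continuous_intros C12_compose[OF C12[OF that]]) (use sub in auto)
  qed (auto intro: compact_Times)
  then have "compact ?S" by (intro compact_UN) auto
  moreover have "w i t2 x \<in> ?S" using i x t12 by force
  ultimately obtain m where m: "m \<in> ?S" "\<And>y. y \<in> ?S \<Longrightarrow> m \<le> y"
    using compact_attains_inf[of ?S] by blast
  then obtain j t y where j: "j < n" and t: "t \<in> {t1..t2}" and y: "y \<in> {0..1}" and mw: "m = w j t y" by auto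
  have min: "w j t y \<le> w j' t' y'" if "j' < n" "t' \<in> {t1..t2}" "y' \<in> {0..1}" for j' t' y'
  proof -
    have "w j' t' y' \<in> ?S" using that by (intro UN_I[of j']) (auto intro!: image_eqI[of _ _ "(t', y')"])
    then show ?thesis using m(2) mw by blast
  qed
  have wneg: "w j t y < 0" using m(2)[OF \<open>w i t2 x \<in> ?S\<close>] w0 mw by simp
  have "t \<noteq> t1" using wneg init[OF j y] by (auto simp: w_def)
  then have tt: "t1 < t" using t by auto
  note t' = sub[OF t]
  have dw: "(w k t has_real_derivative gx k t z \<bullet> a) (at z within {0..1})" if "k < n" "z \<in> {0..1}" for k z
    unfolding w_def[abs_def] real_derivative_iff_vector
    using has_vector_derivative_add[OF inner_derivative(1)[OF space_derivatives(1)[OF that(1) t' that(2)]]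
        has_vector_derivative_const[of "\<eta> * (t - t1)"]] by simp
  have "((\<lambda>s. w j s y) has_real_derivative gt j t y \<bullet> a + \<eta>) (at t within {0..<T})"
  proof -
    have "((\<lambda>s. (\<gamma> j s y - p) \<bullet> a) has_real_derivative gt j t y \<bullet> a) (at t within {0..<T})"
      using inner_derivative(1)[OF time_derivative[OF j t' y]]
      by (simp add: real_derivative_iff_vector)
    then show ?thesis unfolding w_def by (auto intro!: derivative_eq_intros)
  qed
  then have td: "gt j t y \<bullet> a + \<eta> \<le> 0"
    by (rule derivative_nonpos_right_min[OF _ tt]) (use t1 t2 t j y min in auto)
  consider "y \<in> {0<..<1}" | "y \<in> {0, 1}" using y by force
  then show False
  proof cases
    case 1
    have "((\<lambda>z. gx j t z \<bullet> a) has_real_derivative gxx j t y \<bullet> a) (at y within {0..1})"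
      using inner_derivative(2)[OF space_derivatives(2)[OF j t' y]]
      by (simp add: real_derivative_iff_vector)
    from interior_min_derivatives[OF dw[OF j] this 1 min[OF j t]]
    have "gx j t y \<bullet> a = 0" "0 \<le> gxx j t y \<bullet> a" by auto
    moreover have "gt j t y \<bullet> a = (1 / (norm (gx j t y))\<^sup>2) * (gxx j t y \<bullet> a) + tangential_coeff j t y * (gx j t y \<bullet> a)"
      by (subst parabolic_equation[OF j t' y]) (simp add: inner_add_left)
    ultimately have "0 \<le> gt j t y \<bullet> a" by simp
    then show False using td \<eta> by simp
  next
    case 2
    then have jy: "(j, y) \<in> ends" using j by (simp add: ends_def)
    from t' jy show False
    proof (cases rule: vertex_cases)
      case boundary
      have "\<gamma> j t1 y = \<gamma> j t y" by (rule frontier_fixed[OF j 2 t' t1 boundary(2)])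
      then have "0 \<le> w j t y" using init[OF j y] \<eta> tt by (simp add: w_def)
      then show False using wneg by simp
    next
      case triple
      let ?C = "curve_ends n (\<lambda>i. \<gamma> i t) (\<gamma> j t y)" and ?o = "\<lambda>(k, e). outward_tangent (\<gamma> k t) e"
      have le: "?o \<epsilon> \<bullet> a \<le> 0" if mem: "\<epsilon> \<in> ?C" for \<epsilon>
      proof -
        obtain k e where ke: "\<epsilon> = (k, e)" "k < n" "e \<in> {0, 1}" "\<gamma> k t e = \<gamma> j t y"
          using mem unfolding curve_ends_def by blast
        then have e01: "e \<in> {0..1}" by auto
        have weq: "w k t e = w j t y" by (simp add: w_def ke(4))
        then have mn: "w k t e \<le> w k t z" if "z \<in> {0..1}" for z using min[OF ke(2) t that] by simp
        have v: "0 < norm (gx k t e)" using C2_nonzero[OF C2[OF ke(2) t'] e01] by simp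
        have tn: "unit_tangent (\<gamma> k t) e \<bullet> a = (gx k t e \<bullet> a) / norm (gx k t e)"
          by (simp add: C2_unit_tangent[OF C2[OF ke(2) t'] e01] sgn_div_norm divide_inverse mult.commute)
        show ?thesis
        proof (cases "e = 0")
          case True
          have "0 \<le> gx k t e \<bullet> a"
            by (rule derivative_nonneg_left_min[OF dw[OF ke(2) e01], of 1]) (use True mn in auto)
          then show ?thesis using v tn True by (simp add: ke(1) outward_tangent_def)
        next
          case False
          then have e1: "e = 1" using ke(3) by simp
          have "gx k t e \<bullet> a \<le> 0"
            by (rule derivative_nonpos_right_min[OF dw[OF ke(2) e01], of 0]) (use e1 mn in auto)
          then show ?thesis using v tn e1 by (simp add: ke(1) outward_tangent_def divide_le_0_iff)
        qed
      qed
      have "(\<Sum>\<epsilon>\<in>?C. - (?o \<epsilon> \<bullet> a)) = - ((\<Sum>\<epsilon>\<in>?C. ?o \<epsilon>) \<bullet> a)" by (simp add: inner_sum_left sum_negf)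
      also have "\<dots> = 0" using triple(2) by simp
      finally have "\<forall>\<epsilon>\<in>?C. - (?o \<epsilon> \<bullet> a) = 0"
        by (subst (asm) sum_nonneg_eq_0_iff) (use le in auto)
      then have "a = 0"
        using triple_not_collinear[OF triple(1,2), of a] norm_outward_tangent[OF _ t']
        by (force simp: curve_ends_eq)
      then show False using \<open>a \<noteq> 0\<close> by simp
    qed
  qed
qed

end

section \<open>The network near a fixed end-point\<close>

lemma strictly_convex_support:
  assumes op: "open \<Omega>" and sc: "strictly_convex_domain \<Omega>" and P: "P \<in> frontier \<Omega>"
  obtains a where "\<And>y. y \<in> closure \<Omega> \<Longrightarrow> y \<noteq> P \<Longrightarrow> 0 < (y - P) \<bullet> a"
proof -
  have seg: "open_segment x y \<subseteq> \<Omega>" if "x \<in> closure \<Omega>" "y \<in> closure \<Omega>" "x \<noteq> y" for x y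
    using sc that unfolding strictly_convex_domain_def by blast
  have "convex \<Omega>"
    unfolding convex_contains_open_segment
    using seg closure_subset by (metis empty_subsetI open_segment_idem subsetD)
  then have "convex ((\<lambda>x. x - P) ` \<Omega>)" by (rule convex_translation_subtract)
  moreover have Pn: "P \<notin> \<Omega>" "P \<in> closure \<Omega>" using P op by (auto simp: frontier_def interior_open)
  then have "0 \<notin> (\<lambda>x. x - P) ` \<Omega>" by auto
  ultimately obtain a where a: "a \<noteq> 0" "\<forall>z\<in>(\<lambda>x. x - P) ` \<Omega>. 0 \<le> a \<bullet> z"
    using separating_hyperplane_set_0 by blast
  have "0 < (z - P) \<bullet> a" if z: "z \<in> \<Omega>" for z
  proof -
    obtain r where r: "0 < r" "cball z r \<subseteq> \<Omega>" using op z open_contains_cball by blast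
    have "z - (r / norm a) *\<^sub>R a \<in> \<Omega>"
      using r a(1) by (intro subsetD[OF r(2)]) (simp add: dist_norm)
    then have "0 \<le> a \<bullet> (z - (r / norm a) *\<^sub>R a - P)" using a(2) by auto
    moreover have "0 < r / norm a * (a \<bullet> a)" using r a(1) by simp
    ultimately show ?thesis by (simp add: inner_diff_right inner_diff_left inner_commute)
  qed
  moreover have "(1/2) *\<^sub>R (y + P) \<in> \<Omega>" if y: "y \<in> closure \<Omega>" "y \<noteq> P" for y
    using seg[OF y(1) Pn(2) y(2)] midpoint_in_open_segment[of y P] y(2) by (auto simp: midpoint_def)
  moreover have "((1/2) *\<^sub>R (y + P) - P) \<bullet> a = (1/2) * ((y - P) \<bullet> a)" for y
    by (simp add: inner_diff_left inner_add_left)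
  ultimately have "0 < (y - P) \<bullet> a" if "y \<in> closure \<Omega>" "y \<noteq> P" for y
    using that by (metis zero_less_mult_pos half_gt_zero_iff zero_less_divide_1_iff zero_less_numeral)
  then show ?thesis using that by blast
qed

lemma uniform_cone:
  fixes Q :: "real \<Rightarrow> plane"
  assumes Q: "continuous_on {0..1} Q" and pos: "\<And>x. x \<in> {0..1} \<Longrightarrow> 0 < Q x \<bullet> a"
  shows "\<exists>c>0. \<forall>x\<in>{0..1}. c * norm (Q x) \<le> Q x \<bullet> a"
proof -
  have nz: "Q x \<noteq> 0" if "x \<in> {0..1}" for x using pos[OF that] by auto
  have "continuous_on {0..1} (\<lambda>x. (Q x \<bullet> a) / norm (Q x))"
    by (intro continuous_intros Q) (use nz in auto)
  then obtain z where z: "z \<in> {0..1}" "\<And>x. x \<in> {0..1} \<Longrightarrow> (Q z \<bullet> a) / norm (Q z) \<le> (Q x \<bullet> a) / norm (Q x)"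
    using continuous_attains_inf[of "{0..1}" "\<lambda>x. (Q x \<bullet> a) / norm (Q x)"] by auto
  then show ?thesis
    using pos[OF z(1)] nz by (intro exI[of _ "(Q z \<bullet> a) / norm (Q z)"]) (auto simp: field_simps)
qed

context flow
begin

lemma meets_frontier_point_once:
  assumes t: "t \<in> {0..<T}" and ie: "(i, e) \<in> ends" and P: "\<gamma> i t e = P" "P \<in> frontier \<Omega>"
    and j: "j < n" "x \<in> {0..1}" "\<gamma> j t x = P"
  shows "j = i \<and> x = e"
proof -
  have "x \<in> {0, 1}" using net[OF t] j P unfolding network_def by blast
  then have jx: "(j, x) \<in> curve_ends n (\<lambda>i. \<gamma> i t) P" using j by (auto simp: curve_ends_def)
  have "(i, e) \<in> curve_ends n (\<lambda>i. \<gamma> i t) P" using ie P by (auto simp: curve_ends_eq)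
  moreover have "card (curve_ends n (\<lambda>i. \<gamma> i t) P) \<le> 1" using net[OF t] P unfolding network_def by blast
  ultimately have "(j, x) = (i, e)" using jx card_le_Suc0_iff_eq[OF finite_curve_ends, of "\<lambda>i. \<gamma> i t" P] by auto
  then show ?thesis by simp
qed

lemma in_closure: "t \<in> {0..<T} \<Longrightarrow> i < n \<Longrightarrow> x \<in> {0..1} \<Longrightarrow> \<gamma> i t x \<in> closure \<Omega>"
  using net[of t] unfolding network_def by blast

lemma end_slope_positive:
  assumes ie: "(i, e) \<in> ends" and P: "\<gamma> i 0 e = P" "P \<in> frontier \<Omega>"
    and a: "\<And>y. y \<in> closure \<Omega> \<Longrightarrow> y \<noteq> P \<Longrightarrow> 0 < (y - P) \<bullet> a"
    and t1: "t1 \<in> {0<..<T}"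
  shows "0 < - (outward_tangent (\<gamma> i t1) e \<bullet> a)"
proof -
  have i: "i < n" and e: "e \<in> {0, 1}" "e \<in> {0..1}" using ie by (auto simp: ends_def)
  have fixed: "\<gamma> i t e = P" if "t \<in> {0..<T}" for t
    using frontier_fixed[OF i e(1) _ that] P T_pos by auto
  define \<sigma> where "\<sigma> = (if e = 0 then 1 else -1 :: real)"
  define \<phi> where "\<phi> x = e + \<sigma> * x" for x
  have \<phi>: "\<phi> x \<in> {0..1}" if "x \<in> {0..1}" for x using that e by (auto simp: \<phi>_def \<sigma>_def)
  have sub: "t \<in> {0..<T}" if "t \<in> {0..t1}" for t using that t1 by auto
  then have subs: "{0..t1} \<subseteq> {0..<T}" by blast
  let ?R = "{0..t1} \<times> {0..1::real}"
  have R: "compact ?R" by (intro compact_Times) auto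
  note cc = C12_compose[OF C12[OF i], of ?R fst "\<lambda>z. \<phi> (snd z)"]
  have c\<phi>: "continuous_on A (\<lambda>z. \<phi> (snd z))" for A :: "(real \<times> real) set"
    unfolding \<phi>_def by (intro continuous_intros)
  have cont: "continuous_on ?R (\<lambda>z. \<gamma> i (fst z) (\<phi> (snd z)))" "continuous_on ?R (\<lambda>z. gt i (fst z) (\<phi> (snd z)))"
    "continuous_on ?R (\<lambda>z. gx i (fst z) (\<phi> (snd z)))" "continuous_on ?R (\<lambda>z. gxx i (fst z) (\<phi> (snd z)))"
    by (rule cc; use sub \<phi> in \<open>auto intro!: continuous_intros c\<phi>\<close>)+
  have nz: "gx i t (\<phi> x) \<noteq> 0" if "t \<in> {0..t1}" "x \<in> {0..1}" for t x
    using C2_nonzero[OF C2[OF i sub[OF that(1)]] \<phi>[OF that(2)]] .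
  have "continuous_on ?R (\<lambda>z. tangential_coeff i (fst z) (\<phi> (snd z)))"
    unfolding tangential_coeff_def by (intro continuous_intros cont) (use nz in auto)
  then have "bounded ((\<lambda>z. tangential_coeff i (fst z) (\<phi> (snd z))) ` ?R)"
    by (intro compact_imp_bounded compact_continuous_image R)
  then obtain b1 where b1: "\<And>t x. t \<in> {0..t1} \<Longrightarrow> x \<in> {0..1} \<Longrightarrow> \<bar>tangential_coeff i t (\<phi> x)\<bar> \<le> b1"
    unfolding bounded_iff by fastforce
  have "bounded ((\<lambda>z. gx i (fst z) (\<phi> (snd z))) ` ?R)"
    by (intro compact_imp_bounded compact_continuous_image R cont)
  then obtain V where V: "0 < V" "\<And>t x. t \<in> {0..t1} \<Longrightarrow> x \<in> {0..1} \<Longrightarrow> norm (gx i t (\<phi> x)) \<le> V"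
    unfolding bounded_pos by fastforce
  have \<phi>d: "(\<phi> has_vector_derivative \<sigma>) (at x within {0..1})" for x
    unfolding \<phi>_def[abs_def] real_derivative_iff_vector[symmetric]
    by (auto intro!: derivative_eq_intros)
  have \<phi>img: "\<phi> ` {0..1} \<subseteq> {0..1}" using \<phi> by blast
  have chain: "((\<lambda>x. f (\<phi> x)) has_vector_derivative \<sigma> *\<^sub>R f') (at x within {0..1})"
    if "(f has_vector_derivative f') (at (\<phi> x) within {0..1})" for f :: "real \<Rightarrow> plane" and f' x
    using vector_diff_chain_within[OF \<phi>d has_vector_derivative_within_subset[OF that \<phi>img]] by (simp add: o_def)
  have \<sigma>2: "\<sigma> * \<sigma> = 1" by (simp add: \<sigma>_def)
  have "0 < \<sigma> * (gx i t1 (\<phi> 0) \<bullet> a)"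
  proof (rule hopf_boundary_lemma[where ?t0.0=0 and ?t1.0=t1 and u="\<lambda>t x. (\<gamma> i t (\<phi> x) - P) \<bullet> a"
        and ut="\<lambda>t x. gt i t (\<phi> x) \<bullet> a" and ux="\<lambda>t x. \<sigma> * (gx i t (\<phi> x) \<bullet> a)"
        and uxx="\<lambda>t x. gxx i t (\<phi> x) \<bullet> a" and a="\<lambda>t x. 1 / (norm (gx i t (\<phi> x)))\<^sup>2"
        and b="\<lambda>t x. \<sigma> * tangential_coeff i t (\<phi> x)" and ?a0.0="1 / V\<^sup>2" and ?b1.0=b1])
    show "0 < t1" using t1 by simp
    show "continuous_on ?R (\<lambda>(t, x). (\<gamma> i t (\<phi> x) - P) \<bullet> a)"
      unfolding split_beta by (intro continuous_intros cont)
    show "0 < 1 / V\<^sup>2" using V by simp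
    fix t assume t: "t \<in> {0..t1}"
    note t' = sub[OF t]
    show "(\<gamma> i t (\<phi> 0) - P) \<bullet> a = 0" using fixed[OF t'] by (simp add: \<phi>_def)
    fix x :: real
    {
      assume x: "0 < x" "x \<le> 1"
      then have px: "\<phi> x \<in> {0..1}" "\<phi> x \<noteq> e" using \<phi>[of x] by (auto simp: \<phi>_def \<sigma>_def split: if_splits)
      then have "\<gamma> i t (\<phi> x) \<noteq> P" using meets_frontier_point_once[OF t' ie fixed[OF t'] P(2) i px(1)] by auto
      then show "0 < (\<gamma> i t (\<phi> x) - P) \<bullet> a" by (rule a[OF in_closure[OF t' i px(1)]])
    }
    assume x: "x \<in> {0..1}"
    note px = \<phi>[OF x]
    show "((\<lambda>s. (\<gamma> i s (\<phi> x) - P) \<bullet> a) has_real_derivative gt i t (\<phi> x) \<bullet> a) (at t within {0..t1})"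
      using inner_derivative(1)[OF has_vector_derivative_within_subset[OF time_derivative[OF i t' px] subs]]
      by (simp add: real_derivative_iff_vector)
    show "((\<lambda>x. (\<gamma> i t (\<phi> x) - P) \<bullet> a) has_real_derivative \<sigma> * (gx i t (\<phi> x) \<bullet> a)) (at x within {0..1})"
      using inner_derivative(1)[OF chain[OF space_derivatives(1)[OF i t' px]]]
      by (simp add: real_derivative_iff_vector)
    have "((\<lambda>x. gx i t (\<phi> x) \<bullet> a) has_real_derivative \<sigma> * (gxx i t (\<phi> x) \<bullet> a)) (at x within {0..1})"
      using inner_derivative(2)[OF chain[OF space_derivatives(2)[OF i t' px]]]
      by (simp add: real_derivative_iff_vector)
    from DERIV_cmult[OF this, of \<sigma>]
    show "((\<lambda>x. \<sigma> * (gx i t (\<phi> x) \<bullet> a)) has_real_derivative gxx i t (\<phi> x) \<bullet> a) (at x within {0..1})"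
      using \<sigma>2 by (simp add: mult.assoc[symmetric])
    show "gt i t (\<phi> x) \<bullet> a = 1 / (norm (gx i t (\<phi> x)))\<^sup>2 * (gxx i t (\<phi> x) \<bullet> a)
        + \<sigma> * tangential_coeff i t (\<phi> x) * (\<sigma> * (gx i t (\<phi> x) \<bullet> a))"
      using \<sigma>2 by (subst parabolic_equation[OF i t' px]) (simp add: inner_add_left \<sigma>_def)
    have "0 < norm (gx i t (\<phi> x))" using nz[OF t x] by simp
    then show "1 / V\<^sup>2 \<le> 1 / (norm (gx i t (\<phi> x)))\<^sup>2"
      using V(2)[OF t x] V(1) by (intro divide_left_mono power_mono) auto
    show "\<bar>\<sigma> * tangential_coeff i t (\<phi> x)\<bar> \<le> b1" using b1[OF t x] by (simp add: abs_mult \<sigma>_def)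
  qed
  moreover have t1': "t1 \<in> {0..<T}" using t1 by simp
  have "- (outward_tangent (\<gamma> i t1) e \<bullet> a) = \<sigma> * (gx i t1 e \<bullet> a) / norm (gx i t1 e)"
    using C2_unit_tangent[OF C2[OF i t1'] e(2)]
    by (auto simp: outward_tangent_def \<sigma>_def sgn_div_norm divide_inverse)
  moreover have "0 < norm (gx i t1 e)" using C2_nonzero[OF C2[OF i t1'] e(2)] by simp
  ultimately show ?thesis by (simp add: \<phi>_def)
qed

lemma cone_at_frontier_end:
  assumes op: "open \<Omega>" and sc: "strictly_convex_domain \<Omega>"
    and ie: "(i, e) \<in> ends" and P: "\<gamma> i 0 e = P" "P \<in> frontier \<Omega>"
  shows "\<exists>c>0. \<exists>a. \<exists>t1\<in>{0..<T}. \<forall>t\<in>{t1..<T}. \<forall>j<n. \<forall>x\<in>{0..1}.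
     c * norm (\<gamma> j t x - P) \<le> (\<gamma> j t x - P) \<bullet> a"
proof -
  have i: "i < n" and e: "e \<in> {0, 1}" "e \<in> {0..1}" using ie by (auto simp: ends_def)
  obtain a where a: "\<And>y. y \<in> closure \<Omega> \<Longrightarrow> y \<noteq> P \<Longrightarrow> 0 < (y - P) \<bullet> a"
    using strictly_convex_support[OF op sc P(2)] by blast
  define t1 where "t1 = T / 2"
  have t1: "t1 \<in> {0<..<T}" "t1 \<in> {0..<T}" using T_pos by (auto simp: t1_def)
  have fixed: "\<gamma> i t1 e = P" using frontier_fixed[OF i e(1) _ t1(2)] P T_pos by auto
  have Pne: "\<gamma> j t1 x \<noteq> P" if "j < n" "x \<in> {0..1}" "j \<noteq> i \<or> x \<noteq> e" for j x
    using meets_frontier_point_once[OF t1(2) ie fixed P(2) that(1,2)] that(3) by auto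
  have ex: "\<exists>c>0. \<forall>x\<in>{0..1}. c * norm (\<gamma> j t1 x - P) \<le> (\<gamma> j t1 x - P) \<bullet> a" if j: "j < n" for j
  proof (cases "j = i")
    case False
    show ?thesis
      by (rule uniform_cone)
         (use False j Pne in \<open>auto intro!: continuous_intros C2_continuous[OF C2[OF j t1(2)]] a in_closure[OF t1(2) j]\<close>)
  next
    case True
    have gxc: "continuous_on ({0..1} \<times> UNIV) (\<lambda>(x, y :: real). gx i t1 x)"
      unfolding split_beta
      by (rule continuous_on_compose2[OF C2_continuous(2)[OF C2[OF i t1(2)]]]) (auto intro!: continuous_intros)
    obtain Q where Q: "continuous_on ({0..1} \<times> UNIV) (\<lambda>(x, y :: real). Q x y)"
      "\<And>y. Q e y = gx i t1 e" "\<And>x y. x \<in> {0..1} \<Longrightarrow> \<gamma> i t1 x - \<gamma> i t1 e = (x - e) *\<^sub>R Q x y"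
      using difference_quotient_integral[where f="\<lambda>x y. \<gamma> i t1 x" and ft="\<lambda>x y. gx i t1 x" and X=UNIV,
          OF space_derivatives(1)[OF i t1(2)] gxc e(2) convex_real_interval(5)] by (metis UNIV_I)
    define \<sigma> where "\<sigma> = (if e = 0 then 1 else -1 :: real)"
    define q where "q x = \<sigma> *\<^sub>R Q x 0" for x
    have cq: "continuous_on {0..1} q"
      unfolding q_def by (intro continuous_intros continuous_on_compose_pair[OF Q(1)]) auto
    have y: "\<gamma> i t1 x - P = \<bar>x - e\<bar> *\<^sub>R q x" if "x \<in> {0..1}" for x
      using Q(3)[OF that, of 0] that e(1) unfolding fixed q_def \<sigma>_def by (auto simp: abs_if)
    have qpos: "0 < q x \<bullet> a" if x: "x \<in> {0..1}" for x
    proof (cases "x = e")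
      case True
      have "- outward_tangent (\<gamma> i t1) e = \<sigma> *\<^sub>R (gx i t1 e /\<^sub>R norm (gx i t1 e))"
        using C2_unit_tangent[OF C2[OF i t1(2)] e(2)]
        by (auto simp: outward_tangent_def \<sigma>_def sgn_div_norm)
      then have "0 < (\<sigma> *\<^sub>R (gx i t1 e /\<^sub>R norm (gx i t1 e))) \<bullet> a"
        using end_slope_positive[OF ie P a t1(1)] by (metis inner_minus_left)
      then show ?thesis using C2_nonzero[OF C2[OF i t1(2)] e(2)]
        by (simp add: q_def True Q(2) zero_less_mult_iff mult_less_0_iff)
    next
      case False
      have "0 < (\<gamma> i t1 x - P) \<bullet> a" by (rule a[OF in_closure[OF t1(2) i x] Pne[OF i x]]) (use False in simp)
      then show ?thesis unfolding y[OF x] by (simp add: zero_less_mult_iff)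
    qed
    obtain c where c: "0 < c" "\<And>x. x \<in> {0..1} \<Longrightarrow> c * norm (q x) \<le> q x \<bullet> a"
      using uniform_cone[OF cq qpos] by blast
    have "c * norm (\<gamma> i t1 x - P) \<le> (\<gamma> i t1 x - P) \<bullet> a" if x: "x \<in> {0..1}" for x
      using mult_left_mono[OF c(2)[OF x], of "\<bar>x - e\<bar>"] unfolding y[OF x] by (simp add: mult_ac)
    then show ?thesis using c(1) True by blast
  qed
  then obtain c where c: "\<And>j. j < n \<Longrightarrow> 0 < c j"
    "\<And>j x. j < n \<Longrightarrow> x \<in> {0..1} \<Longrightarrow> c j * norm (\<gamma> j t1 x - P) \<le> (\<gamma> j t1 x - P) \<bullet> a" by metis
  define m where "m = Min (c ` {..<n})"
  have m0: "0 < m" unfolding m_def by (subst Min_gr_iff) (use c(1) i in auto)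
  have m: "m \<le> c j" if "j < n" for j unfolding m_def by (rule Min_le) (use that in auto)
  have "m * norm (\<gamma> j t x - P) \<le> (\<gamma> j t x - P) \<bullet> a" if t: "t \<in> {t1..<T}" and j: "j < n" and x: "x \<in> {0..1}" for t j x
  proof -
    define w where "w = sgn (\<gamma> j t x - P)"
    have w1: "norm w \<le> 1" by (simp add: w_def norm_sgn)
    have "0 \<le> (\<gamma> k t1 y - P) \<bullet> (a - m *\<^sub>R w)" if k: "k < n" "y \<in> {0..1}" for k y
    proof -
      have "(\<gamma> k t1 y - P) \<bullet> w \<le> norm (\<gamma> k t1 y - P)"
        using norm_cauchy_schwarz[of "\<gamma> k t1 y - P" w] mult_left_mono[OF w1, of "norm (\<gamma> k t1 y - P)"] by simp
      then have "m * ((\<gamma> k t1 y - P) \<bullet> w) \<le> m * norm (\<gamma> k t1 y - P)" using m0 by simp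
      also have "\<dots> \<le> c k * norm (\<gamma> k t1 y - P)" by (intro mult_right_mono m k) simp
      also have "\<dots> \<le> (\<gamma> k t1 y - P) \<bullet> a" by (rule c(2)[OF k])
      finally show ?thesis by (simp add: inner_diff_right)
    qed
    from halfplane_preserved[OF t1(2) this t j x]
    have "0 \<le> (\<gamma> j t x - P) \<bullet> (a - m *\<^sub>R w)" .
    moreover have "(\<gamma> j t x - P) \<bullet> w = norm (\<gamma> j t x - P)"
      by (cases "\<gamma> j t x = P") (simp_all add: w_def sgn_div_norm power2_norm_eq_inner[symmetric] power2_eq_square)
    ultimately show ?thesis by (simp add: inner_diff_right)
  qed
  then show ?thesis using m0 t1(2) by blast
qed

end

section \<open>Curves with small shrinker defect\<close>

lemma integral_norm_squared_bound:
  fixes f :: "real \<Rightarrow> plane"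
  assumes f: "continuous_on {a..b} f" and ab: "a \<le> b"
  shows "(integral {a..b} (\<lambda>x. norm (f x)))\<^sup>2 \<le> (b - a) * integral {a..b} (\<lambda>x. (norm (f x))\<^sup>2)"
proof (cases "a = b")
  case False
  then have ab': "0 < b - a" using ab by simp
  define m where "m = integral {a..b} (\<lambda>x. norm (f x))"
  define c where "c = m / (b - a)"
  have i: "(\<lambda>x. norm (f x)) integrable_on {a..b}" "(\<lambda>x. (norm (f x))\<^sup>2) integrable_on {a..b}"
    "(\<lambda>x. (norm (f x) - c)\<^sup>2) integrable_on {a..b}"
    by (intro integrable_continuous_real continuous_intros f)+
  have "0 \<le> integral {a..b} (\<lambda>x. (norm (f x) - c)\<^sup>2)" by (rule integral_nonneg[OF i(3)]) simp
  also have "integral {a..b} (\<lambda>x. (norm (f x) - c)\<^sup>2)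
      = integral {a..b} (\<lambda>x. ((norm (f x))\<^sup>2 - (2 * c) * norm (f x)) + c\<^sup>2)"
    by (rule integral_cong) (simp add: power2_diff)
  also have "\<dots> = integral {a..b} (\<lambda>x. (norm (f x))\<^sup>2 - (2 * c) * norm (f x)) + integral {a..b} (\<lambda>x. c\<^sup>2)"
    by (rule integral_add) (intro integrable_continuous_real continuous_intros f)+
  also have "integral {a..b} (\<lambda>x. (norm (f x))\<^sup>2 - (2 * c) * norm (f x))
      = integral {a..b} (\<lambda>x. (norm (f x))\<^sup>2) - integral {a..b} (\<lambda>x. (2 * c) * norm (f x))"
    by (rule integral_diff) (intro integrable_continuous_real continuous_intros f)+
  also have "integral {a..b} (\<lambda>x. (2 * c) * norm (f x)) = (2 * c) * m" unfolding m_def by (rule integral_mult_right)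
  also have "integral {a..b} (\<lambda>x. c\<^sup>2) = (b - a) * c\<^sup>2" using ab by simp
  also have "integral {a..b} (\<lambda>x. (norm (f x))\<^sup>2) - (2 * c) * m + (b - a) * c\<^sup>2
      = integral {a..b} (\<lambda>x. (norm (f x))\<^sup>2) - m\<^sup>2 / (b - a)"
  proof -
    have "(2 * (m / d)) * m - d * (m / d)\<^sup>2 = m\<^sup>2 / d" if "0 < d" for d :: real
      using that by (simp add: field_simps power2_eq_square)
    from this[OF ab'] show ?thesis unfolding c_def by linarith
  qed
  finally have "0 \<le> integral {a..b} (\<lambda>x. (norm (f x))\<^sup>2) - m\<^sup>2 / (b - a)" .
  then show ?thesis using ab' unfolding m_def by (simp add: field_simps)
qed simp

lemma unit_speedD:
  assumes "unit_speed l G U K"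
  shows "0 < l" "continuous_on {0..l} K" "continuous_on {0..l} U" "continuous_on {0..l} G"
    "\<And>s. s \<in> {0..l} \<Longrightarrow> (G has_vector_derivative U s) (at s within {0..l})"
    "\<And>s. s \<in> {0..l} \<Longrightarrow> (U has_vector_derivative K s) (at s within {0..l})"
    "\<And>s. s \<in> {0..l} \<Longrightarrow> norm (U s) = 1"
  using assms unfolding unit_speed_def by (auto intro!: continuous_on_vector_derivative)

lemma FTC_norm_bound:
  fixes f :: "real \<Rightarrow> 'a::banach"
  assumes "a \<le> b" and f: "\<And>x. x \<in> {a..b} \<Longrightarrow> (f has_vector_derivative f' x) (at x within {a..b})"
    and g: "continuous_on {a..b} g" and fg: "\<And>x. x \<in> {a..b} \<Longrightarrow> norm (f' x) \<le> g x"
  shows "norm (f b - f a) \<le> integral {a..b} g"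
proof -
  have h: "(f' has_integral f b - f a) {a..b}" by (rule fundamental_theorem_of_calculus[OF assms(1) f])
  then have "norm (integral {a..b} f') \<le> integral {a..b} g"
    using fg by (intro integral_norm_bound_integral integrable_continuous_real g has_integral_integrable) auto
  then show ?thesis using integral_unique[OF h] by simp
qed

context
  fixes l G U K
  assumes us: "unit_speed l G U K" and orth: "\<And>s. s \<in> {0..l} \<Longrightarrow> K s \<bullet> U s = 0"
begin

abbreviation (input) "defect_density s \<equiv> exp (- (norm (G s))\<^sup>2 / 2) * ((K s + G s) \<bullet> rot90 (U s))\<^sup>2"

lemma continuous_rot_U: "continuous_on {0..l} (\<lambda>s. rot90 (U s))"
  by (rule bounded_linear.continuous_on[OF bounded_linear_rot90 unit_speedD(3)[OF us]])

lemma continuous_defect: "continuous_on {0..l} (\<lambda>s. defect_density s)"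
  by (intro continuous_intros continuous_rot_U unit_speedD[OF us]) simp

lemma continuous_weight: "continuous_on {0..l} (\<lambda>s. exp (- (norm (G s))\<^sup>2 / 4))"
  by (intro continuous_intros unit_speedD[OF us]) simp

lemma curvature_parallel: "s \<in> {0..l} \<Longrightarrow> K s = (K s \<bullet> rot90 (U s)) *\<^sub>R rot90 (U s)"
  by (rule orthogonal_unit_parallel[OF unit_speedD(7)[OF us]]) (auto simp: orth)

lemma norm_curvature: "s \<in> {0..l} \<Longrightarrow> (norm (K s))\<^sup>2 = (K s \<bullet> rot90 (U s))\<^sup>2"
  using norm_decomp[OF unit_speedD(7)[OF us], of s "K s"] orth by simp

lemma support_function_variation:
  assumes st: "s \<in> {0..l}" "t \<in> {0..l}" "s \<le> t" and \<mu>: "0 < \<mu>"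
  shows "\<bar>(G t \<bullet> rot90 (U t)) * exp (- (norm (G t))\<^sup>2 / 2) - (G s \<bullet> rot90 (U s)) * exp (- (norm (G s))\<^sup>2 / 2)\<bar>
     \<le> integral {0..l} (\<lambda>s. defect_density s) / (2 * \<mu>) + 2 * \<mu> * integral {0..l} (\<lambda>s. exp (- (norm (G s))\<^sup>2 / 4))"
proof -
  define h where "h r = (G r \<bullet> rot90 (U r)) * exp (- (norm (G r))\<^sup>2 / 2)" for r
  define h' where "h' r = - (G r \<bullet> U r) * ((K r + G r) \<bullet> rot90 (U r)) * exp (- (norm (G r))\<^sup>2 / 2)" for r
  define M where "M r = defect_density r / (2 * \<mu>) + 2 * \<mu> * exp (- (norm (G r))\<^sup>2 / 4)" for r
  have sub: "{s..t} \<subseteq> {0..l}" using st by auto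
  have cM: "continuous_on {0..l} M"
    unfolding M_def using \<mu> by (intro continuous_intros continuous_defect continuous_weight) auto
  have "norm (h t - h s) \<le> integral {s..t} M"
  proof (rule FTC_norm_bound[OF st(3)])
    show "continuous_on {s..t} M" by (rule continuous_on_subset[OF cM sub])
    fix r assume r: "r \<in> {s..t}"
    then have r': "r \<in> {0..l}" using sub by blast
    have dG: "(G has_vector_derivative U r) (at r within {s..t})"
      and dU: "(U has_vector_derivative K r) (at r within {s..t})"
      using has_vector_derivative_within_subset[OF _ sub] unit_speedD(5,6)[OF us r'] by blast+
    have dN: "((\<lambda>r. rot90 (U r)) has_vector_derivative rot90 (K r)) (at r within {s..t})"
      by (rule bounded_linear.has_vector_derivative[OF bounded_linear_rot90 dU])
    have "((\<lambda>r. G r \<bullet> rot90 (U r)) has_vector_derivative G r \<bullet> rot90 (K r) + U r \<bullet> rot90 (U r)) (at r within {s..t})"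
      by (rule bounded_bilinear.has_vector_derivative[OF bounded_bilinear_inner dG dN])
    moreover have "G r \<bullet> rot90 (K r) + U r \<bullet> rot90 (U r) = - ((K r \<bullet> rot90 (U r)) * (G r \<bullet> U r))"
    proof -
      have "rot90 (rot90 (U r)) = - U r" by (simp add: plane_eq_iff)
      then have "rot90 (K r) = - ((K r \<bullet> rot90 (U r)) *\<^sub>R U r)" by (subst curvature_parallel[OF r']) simp
      then show ?thesis by simp
    qed
    ultimately have 1: "((\<lambda>r. G r \<bullet> rot90 (U r)) has_real_derivative - ((K r \<bullet> rot90 (U r)) * (G r \<bullet> U r))) (at r within {s..t})"
      by (simp add: real_derivative_iff_vector)
    have "((\<lambda>r. - (norm (G r))\<^sup>2 / 2) has_real_derivative - (G r \<bullet> U r)) (at r within {s..t})"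
      using DERIV_cdivide[OF DERIV_minus[OF has_vector_derivative_norm_squared[OF dG, of 0]], of 2] by simp
    from DERIV_mult[OF 1 DERIV_chain2[OF DERIV_exp this]]
    have "(h has_real_derivative - ((K r \<bullet> rot90 (U r)) * (G r \<bullet> U r)) * exp (- (norm (G r))\<^sup>2 / 2)
       + exp (- (norm (G r))\<^sup>2 / 2) * - (G r \<bullet> U r) * (G r \<bullet> rot90 (U r))) (at r within {s..t})"
      by (simp add: h_def[abs_def])
    moreover have "- ((K r \<bullet> rot90 (U r)) * (G r \<bullet> U r)) * exp (- (norm (G r))\<^sup>2 / 2)
       + exp (- (norm (G r))\<^sup>2 / 2) * - (G r \<bullet> U r) * (G r \<bullet> rot90 (U r)) = h' r"
      unfolding h'_def inner_add_left by (simp only: ring_distribs) (simp add: mult_ac)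
    ultimately show "(h has_vector_derivative h' r) (at r within {s..t})"
      by (simp add: real_derivative_iff_vector)
    define y where "y = norm (G r)" define f where "f = \<bar>(K r + G r) \<bullet> rot90 (U r)\<bar>"
    define E where "E = exp (- y\<^sup>2 / 4)"
    have E: "0 < E" "E \<le> 1" "exp (- y\<^sup>2 / 2) = E * E"
      by (simp_all add: E_def exp_add[symmetric])
    have "\<bar>G r \<bullet> U r\<bar> \<le> y" using Cauchy_Schwarz_ineq2[of "G r" "U r"] unit_speedD(7)[OF us r'] by (simp add: y_def)
    then have "norm (h' r) \<le> y * f * exp (- y\<^sup>2 / 2)"
      by (simp add: h'_def abs_mult f_def y_def mult_right_mono)
    also have "y * f \<le> f\<^sup>2 / (2 * \<mu>) + \<mu> / 2 * y\<^sup>2"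
    proof -
      have "0 \<le> (f - \<mu> * y)\<^sup>2" by simp
      then show ?thesis using \<mu> by (simp add: field_simps power2_eq_square)
    qed
    then have "y * f * exp (- y\<^sup>2 / 2) \<le> (f\<^sup>2 / (2 * \<mu>) + \<mu> / 2 * y\<^sup>2) * exp (- y\<^sup>2 / 2)" by (intro mult_right_mono) auto
    also have "\<dots> = exp (- y\<^sup>2 / 2) * f\<^sup>2 / (2 * \<mu>) + \<mu> / 2 * (y\<^sup>2 * E) * E"
      unfolding E(3) by (simp add: algebra_simps)
    also have "y\<^sup>2 * E \<le> 4"
    proof -
      have "y\<^sup>2 / 4 \<le> exp (y\<^sup>2 / 4)" using exp_ge_add_one_self[of "y\<^sup>2 / 4"] by linarith
      then show ?thesis by (simp add: E_def exp_minus field_simps)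
    qed
    then have "\<mu> / 2 * (y\<^sup>2 * E) * E \<le> \<mu> / 2 * 4 * E" using \<mu> E by (intro mult_right_mono mult_left_mono) auto
    finally show "norm (h' r) \<le> M r" by (simp add: M_def f_def y_def E_def)
  qed
  also have "\<dots> \<le> integral {0..l} M"
    by (rule integral_subset_le[OF sub])
       (use \<mu> in \<open>auto intro!: integrable_continuous_real cM continuous_on_subset[OF cM sub]
          simp: M_def intro: sub[THEN subsetD]\<close>)
  also have "\<dots> = integral {0..l} (\<lambda>s. defect_density s) / (2 * \<mu>) + 2 * \<mu> * integral {0..l} (\<lambda>s. exp (- (norm (G s))\<^sup>2 / 4))"
  proof -
    have "(\<lambda>s. defect_density s / (2 * \<mu>)) integrable_on {0..l}"
      "(\<lambda>s. 2 * \<mu> * exp (- (norm (G s))\<^sup>2 / 4)) integrable_on {0..l}"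
      using \<mu> by (intro integrable_continuous_real continuous_on_divide continuous_on_mult_left
          continuous_defect continuous_weight continuous_on_const; simp)+
    from integral_add[OF this] show ?thesis unfolding M_def by simp
  qed
  finally show ?thesis by (simp add: h_def)
qed

lemma support_function_bound:
  assumes \<mu>: "0 < \<mu>" and R: "0 < R" and C: "integral {0..l} (\<lambda>s. exp (- (norm (G s))\<^sup>2 / 4)) \<le> C"
    and long: "C < l * exp (- R\<^sup>2 / 4)" and d: "integral {0..l} (\<lambda>s. defect_density s) \<le> d"
    and s: "s \<in> {0..l}"
  shows "\<bar>G s \<bullet> rot90 (U s)\<bar> * exp (- (norm (G s))\<^sup>2 / 2) \<le> 2 / R + d / (2 * \<mu>) + 2 * \<mu> * C"
proof -
  have "\<exists>t\<in>{0..l}. R < norm (G t)"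
  proof (rule ccontr)
    assume "\<not> ?thesis"
    then have le: "norm (G t) \<le> R" if "t \<in> {0..l}" for t using that by (meson not_le)
    have "integral {0..l} (\<lambda>_. exp (- R\<^sup>2 / 4)) \<le> integral {0..l} (\<lambda>s. exp (- (norm (G s))\<^sup>2 / 4))"
      by (rule integral_le[OF _ integrable_continuous_real[OF continuous_weight]])
         (use le in \<open>auto intro!: power_mono\<close>)
    then show False using C long unit_speedD(1)[OF us] by (simp add: mult.commute)
  qed
  then obtain t where t: "t \<in> {0..l}" "R < norm (G t)" by blast
  define h where "h r = (G r \<bullet> rot90 (U r)) * exp (- (norm (G r))\<^sup>2 / 2)" for r
  have "\<bar>h t - h s\<bar> \<le> integral {0..l} (\<lambda>s. defect_density s) / (2 * \<mu>) + 2 * \<mu> * integral {0..l} (\<lambda>s. exp (- (norm (G s))\<^sup>2 / 4))"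
    using support_function_variation[OF s t(1) _ \<mu>] support_function_variation[OF t(1) s _ \<mu>]
    by (cases "s \<le> t") (auto simp: h_def abs_minus_commute)
  also have "\<dots> \<le> d / (2 * \<mu>) + 2 * \<mu> * C"
    using d C \<mu> by (intro add_mono divide_right_mono mult_left_mono) auto
  finally have 1: "\<bar>h t - h s\<bar> \<le> d / (2 * \<mu>) + 2 * \<mu> * C" .
  have "\<bar>h t\<bar> \<le> 2 / R"
  proof -
    define y where "y = norm (G t)"
    have y: "0 < y" "R < y" using t R by (auto simp: y_def)
    have "\<bar>G t \<bullet> rot90 (U t)\<bar> \<le> y"
      using Cauchy_Schwarz_ineq2[of "G t" "rot90 (U t)"] unit_speedD(7)[OF us t(1)] by (simp add: y_def)
    then have "\<bar>h t\<bar> \<le> y * exp (- y\<^sup>2 / 2)" by (simp add: h_def abs_mult y_def mult_right_mono)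
    also have "\<dots> \<le> 2 / y"
    proof -
      have "y\<^sup>2 / 2 \<le> exp (y\<^sup>2 / 2)" using exp_ge_add_one_self[of "y\<^sup>2 / 2"] by linarith
      then show ?thesis using y by (simp add: exp_minus field_simps power2_eq_square)
    qed
    also have "\<dots> \<le> 2 / R" using y R by (simp add: frac_le)
    finally show ?thesis .
  qed
  then have "\<bar>h s\<bar> \<le> 2 / R + d / (2 * \<mu>) + 2 * \<mu> * C" using 1 by linarith
  then show ?thesis by (simp add: h_def abs_mult)
qed

end

definition straight ::
  "real \<Rightarrow> real \<Rightarrow> real \<Rightarrow> (real \<Rightarrow> plane) \<Rightarrow> (real \<Rightarrow> plane) \<Rightarrow> (real \<Rightarrow> plane) \<Rightarrow> bool" where
  "straight L \<eta> l G U K \<longleftrightarrow> 4 * L \<le> l \<and>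
     (\<forall>s0\<in>{0..l}. norm (G s0) \<le> L \<longrightarrow>
        (\<forall>s\<in>{0..l}. \<forall>t\<in>{0..l}. \<bar>s - s0\<bar> \<le> L \<and> \<bar>t - s0\<bar> \<le> L \<and> s \<le> t \<longrightarrow>
           norm (U t - U s) \<le> \<eta> \<and> \<bar>G t \<bullet> U t - G s \<bullet> U s - (t - s)\<bar> \<le> \<eta> \<and>
           integral {s..t} (\<lambda>r. (norm (K r))\<^sup>2) \<le> \<eta> \<and> \<bar>G s \<bullet> rot90 (U s)\<bar> \<le> \<eta>))"

lemma norm_diff_le_of_unit_speed:
  assumes us: "unit_speed l G U K" and st: "s \<in> {0..l}" "t \<in> {0..l}"
  shows "norm (G t - G s) \<le> \<bar>t - s\<bar>"
proof -
  have *: "norm (G t - G s) \<le> t - s" if "s \<in> {0..l}" "t \<in> {0..l}" "s \<le> t" for s t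
  proof -
    have sub: "{s..t} \<subseteq> {0..l}" using that by auto
    have "norm (G t - G s) \<le> integral {s..t} (\<lambda>_. 1)"
    proof (rule FTC_norm_bound[OF that(3)])
      fix x assume "x \<in> {s..t}"
      then show "(G has_vector_derivative U x) (at x within {s..t})" "norm (U x) \<le> 1"
        using has_vector_derivative_within_subset[OF unit_speedD(5)[OF us] sub] unit_speedD(7)[OF us, of x] sub by auto
    qed simp
    then show ?thesis using that by simp
  qed
  show ?thesis using *[OF st] *[OF st(2) st(1)] by (cases "s \<le> t") (auto simp: norm_minus_commute)
qed

lemma straight_if_small_defect:
  assumes us: "unit_speed l G U K" and orth: "\<And>s. s \<in> {0..l} \<Longrightarrow> K s \<bullet> U s = 0"
    and L: "1 \<le> L" and long: "4 * L \<le> l" and \<eta>: "0 < \<eta>"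
    and d: "integral {0..l} (\<lambda>s. exp (- (norm (G s))\<^sup>2 / 2) * ((K s + G s) \<bullet> rot90 (U s))\<^sup>2) \<le> d"
    and h: "\<And>s. s \<in> {0..l} \<Longrightarrow> \<bar>G s \<bullet> rot90 (U s)\<bar> * exp (- (norm (G s))\<^sup>2 / 2) \<le> \<epsilon>"
    and \<epsilon>: "\<epsilon> * exp (2 * L\<^sup>2) \<le> \<eta>"
    and \<kappa>: "2 * exp (2 * L\<^sup>2) * d + 4 * L * (\<epsilon> * exp (2 * L\<^sup>2))\<^sup>2 \<le> \<kappa>" "\<kappa> \<le> \<eta>" "2 * L * sqrt (2 * L * \<kappa>) \<le> \<eta>"
  shows "straight L \<eta> l G U K"
  unfolding straight_def
proof (intro conjI long ballI impI; (elim conjE)?)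
  fix s0 s t assume s0: "s0 \<in> {0..l}" "norm (G s0) \<le> L" and s: "s \<in> {0..l}" and t: "t \<in> {0..l}"
    and near: "\<bar>s - s0\<bar> \<le> L" "\<bar>t - s0\<bar> \<le> L" and st: "s \<le> t"
  have sub: "{s..t} \<subseteq> {0..l}" using s t by auto
  have G2: "norm (G r) \<le> 2 * L" if "r \<in> {0..l}" "\<bar>r - s0\<bar> \<le> L" for r
    using norm_diff_le_of_unit_speed[OF us s0(1) that(1)] s0(2) that(2) norm_triangle_sub[of "G r" "G s0"] by linarith
  have N: "\<bar>G r \<bullet> rot90 (U r)\<bar> \<le> \<epsilon> * exp (2 * L\<^sup>2)" if r: "r \<in> {0..l}" "\<bar>r - s0\<bar> \<le> L" for r
  proof -
    have "(norm (G r))\<^sup>2 \<le> (2 * L)\<^sup>2" by (rule power_mono[OF G2[OF r]]) simp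
    then have e: "exp ((norm (G r))\<^sup>2 / 2) \<le> exp (2 * L\<^sup>2)" by (simp add: power_mult_distrib)
    have "\<bar>G r \<bullet> rot90 (U r)\<bar> = (\<bar>G r \<bullet> rot90 (U r)\<bar> * exp (- (norm (G r))\<^sup>2 / 2)) * exp ((norm (G r))\<^sup>2 / 2)"
      by (simp add: mult.assoc exp_add[symmetric])
    also have "\<dots> \<le> \<epsilon> * exp (2 * L\<^sup>2)"
    proof (rule mult_mono[OF h[OF r(1)] e])
      show "0 \<le> \<epsilon>" using h[OF r(1)] by (meson abs_ge_zero exp_ge_zero mult_nonneg_nonneg order_trans)
    qed simp
    finally show ?thesis .
  qed
  let ?f = "\<lambda>r. (K r + G r) \<bullet> rot90 (U r)"
  let ?D = "\<lambda>r. exp (- (norm (G r))\<^sup>2 / 2) * (?f r)\<^sup>2"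
  have cD: "continuous_on {0..l} ?D" by (rule continuous_defect[OF us orth])
  have cK: "continuous_on {s..t} K" by (rule continuous_on_subset[OF unit_speedD(2)[OF us] sub])
  have K2: "integral {s..t} (\<lambda>r. (norm (K r))\<^sup>2) \<le> \<kappa>"
  proof -
    let ?c = "\<epsilon> * exp (2 * L\<^sup>2)"
    have "integral {s..t} (\<lambda>r. (norm (K r))\<^sup>2) \<le> integral {s..t} (\<lambda>r. 2 * exp (2 * L\<^sup>2) * ?D r + 2 * ?c\<^sup>2)"
    proof (rule integral_le)
      show "(\<lambda>r. (norm (K r))\<^sup>2) integrable_on {s..t}" by (intro integrable_continuous_real continuous_intros cK)
      show "(\<lambda>r. 2 * exp (2 * L\<^sup>2) * ?D r + 2 * ?c\<^sup>2) integrable_on {s..t}"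
        by (intro integrable_continuous_real continuous_intros continuous_on_subset[OF cD sub])
      fix r assume r: "r \<in> {s..t}"
      then have r': "r \<in> {0..l}" "\<bar>r - s0\<bar> \<le> L" using sub near by auto
      have "(norm (K r))\<^sup>2 = (?f r - G r \<bullet> rot90 (U r))\<^sup>2"
        using norm_curvature[OF us _ r'(1)] orth by (simp add: inner_add_left)
      also have "\<dots> \<le> 2 * (?f r)\<^sup>2 + 2 * (G r \<bullet> rot90 (U r))\<^sup>2"
      proof -
        have "0 \<le> (?f r + G r \<bullet> rot90 (U r))\<^sup>2" by simp
        then show ?thesis by (simp add: power2_sum power2_diff)
      qed
      also have "(G r \<bullet> rot90 (U r))\<^sup>2 \<le> ?c\<^sup>2" using N[OF r'] by (rule abs_le_square_iff[THEN iffD1, OF order_trans[OF _ abs_ge_self]])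
      also have "(?f r)\<^sup>2 \<le> exp (2 * L\<^sup>2) * ?D r"
      proof -
        have "(norm (G r))\<^sup>2 \<le> (2 * L)\<^sup>2" by (rule power_mono[OF G2[OF r']]) simp
        then have "1 \<le> exp (2 * L\<^sup>2) * exp (- (norm (G r))\<^sup>2 / 2)"
          by (simp add: exp_add[symmetric] power_mult_distrib)
        from mult_right_mono[OF this, of "(?f r)\<^sup>2"] show ?thesis by (simp add: mult.assoc)
      qed
      finally show "(norm (K r))\<^sup>2 \<le> 2 * exp (2 * L\<^sup>2) * ?D r + 2 * ?c\<^sup>2" by (simp add: mult.assoc)
    qed
    also have "\<dots> = 2 * exp (2 * L\<^sup>2) * integral {s..t} ?D + (t - s) * (2 * ?c\<^sup>2)"
    proof -
      have "(\<lambda>r. 2 * exp (2 * L\<^sup>2) * ?D r) integrable_on {s..t}" "(\<lambda>r. 2 * ?c\<^sup>2) integrable_on {s..t}"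
        by (intro integrable_continuous_real continuous_on_mult_left continuous_on_const continuous_on_subset[OF cD sub])+
      from integral_add[OF this] show ?thesis using st by simp
    qed
    also have "integral {s..t} ?D \<le> d"
    proof (rule order_trans[OF _ d])
      show "integral {s..t} ?D \<le> integral {0..l} ?D"
        by (rule integral_subset_le[OF sub integrable_continuous_real[OF continuous_on_subset[OF cD sub]]
              integrable_continuous_real[OF cD]]) simp
    qed
    also have "(t - s) * (2 * ?c\<^sup>2) \<le> (2 * L) * (2 * ?c\<^sup>2)" using near by (intro mult_right_mono) auto
    finally show ?thesis using \<kappa>(1) by (simp add: mult.assoc)
  qed
  have K0: "0 \<le> \<kappa>"
  proof (rule order_trans[OF _ K2])
    have "(\<lambda>r. (norm (K r))\<^sup>2) integrable_on {s..t}" by (intro integrable_continuous_real continuous_intros cK)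
    then show "0 \<le> integral {s..t} (\<lambda>r. (norm (K r))\<^sup>2)" by (rule integral_nonneg) simp
  qed
  have K1: "integral {s..t} (\<lambda>r. norm (K r)) \<le> sqrt (2 * L * \<kappa>)"
  proof (rule real_le_rsqrt)
    have "(integral {s..t} (\<lambda>r. norm (K r)))\<^sup>2 \<le> (t - s) * integral {s..t} (\<lambda>r. (norm (K r))\<^sup>2)"
      by (rule integral_norm_squared_bound[OF cK st])
    also have "\<dots> \<le> 2 * L * \<kappa>" using K2 K0 near st L
      by (intro mult_mono integral_nonneg integrable_continuous_real continuous_intros cK) auto
    finally show "(integral {s..t} (\<lambda>r. norm (K r)))\<^sup>2 \<le> 2 * L * \<kappa>" .
  qed
  have sq: "sqrt (2 * L * \<kappa>) \<le> 2 * L * sqrt (2 * L * \<kappa>)"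
    using L K0 mult_right_mono[of 1 "2 * L" "sqrt (2 * L * \<kappa>)"] by simp
  have dd: "(G has_vector_derivative U r) (at r within {s..t})" "(U has_vector_derivative K r) (at r within {s..t})"
    if "r \<in> {s..t}" for r
    using has_vector_derivative_within_subset[OF _ sub] unit_speedD(5,6)[OF us, of r] that sub by blast+
  have "norm (U t - U s) \<le> integral {s..t} (\<lambda>r. norm (K r))"
    by (rule FTC_norm_bound[OF st dd(2)]) (auto intro!: continuous_intros cK)
  then show "norm (U t - U s) \<le> \<eta>" using K1 sq \<kappa>(3) by linarith
  have "norm ((G t \<bullet> U t - t) - (G s \<bullet> U s - s)) \<le> integral {s..t} (\<lambda>r. 2 * L * norm (K r))"
  proof (rule FTC_norm_bound[OF st])
    fix r assume r: "r \<in> {s..t}"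
    then have r': "r \<in> {0..l}" "\<bar>r - s0\<bar> \<le> L" using sub near by auto
    have "((\<lambda>r. G r \<bullet> U r) has_vector_derivative G r \<bullet> K r + U r \<bullet> U r) (at r within {s..t})"
      by (rule bounded_bilinear.has_vector_derivative[OF bounded_bilinear_inner dd[OF r]])
    from has_vector_derivative_diff[OF this has_vector_derivative_id]
    show "((\<lambda>r. G r \<bullet> U r - r) has_vector_derivative G r \<bullet> K r) (at r within {s..t})"
      using unit_speedD(7)[OF us r'(1)] by (simp add: norm_eq_1)
    have "\<bar>G r \<bullet> K r\<bar> \<le> norm (G r) * norm (K r)" by (rule Cauchy_Schwarz_ineq2)
    also have "\<dots> \<le> 2 * L * norm (K r)" using G2[OF r'] by (intro mult_right_mono) auto
    finally show "norm (G r \<bullet> K r) \<le> 2 * L * norm (K r)" by simp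
  qed (auto intro!: continuous_intros cK)
  also have "\<dots> = 2 * L * integral {s..t} (\<lambda>r. norm (K r))" by (rule integral_mult_right)
  also have "\<dots> \<le> 2 * L * sqrt (2 * L * \<kappa>)" using K1 L by (intro mult_left_mono) auto
  finally show "\<bar>G t \<bullet> U t - G s \<bullet> U s - (t - s)\<bar> \<le> \<eta>" using \<kappa>(3) by (simp add: algebra_simps)
  show "integral {s..t} (\<lambda>r. (norm (K r))\<^sup>2) \<le> \<eta>" using K2 \<kappa>(2) by simp
  show "\<bar>G s \<bullet> rot90 (U s)\<bar> \<le> \<eta>" using N[OF s near(1)] \<epsilon> by simp
qed

section \<open>Crossing arguments in the plane\<close>

lemma graph_side:
  fixes A B :: "real \<Rightarrow> plane"
  assumes A: "continuous_on {a1..a2} A" and a: "a1 \<le> a2"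
    and mono: "\<And>s t. a1 \<le> s \<Longrightarrow> s < t \<Longrightarrow> t \<le> a2 \<Longrightarrow> A s \<bullet> e < A t \<bullet> e"
    and B: "continuous_on {b1..b2} B"
    and strip: "\<And>t. t \<in> {b1..b2} \<Longrightarrow> A a1 \<bullet> e \<le> B t \<bullet> e \<and> B t \<bullet> e \<le> A a2 \<bullet> e"
    and nomeet: "\<And>s t. s \<in> {a1..a2} \<Longrightarrow> t \<in> {b1..b2} \<Longrightarrow> A s \<noteq> B t"
    and e: "norm e = 1"
    and t0: "t0 \<in> {b1..b2}" and t1: "t1 \<in> {b1..b2}"
    and s0: "s0 \<in> {a1..a2}" "A s0 \<bullet> e = B t0 \<bullet> e" "0 < c * (B t0 \<bullet> rot90 e - A s0 \<bullet> rot90 e)"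
  shows "\<exists>s\<in>{a1..a2}. A s \<bullet> e = B t1 \<bullet> e \<and> 0 < c * (B t1 \<bullet> rot90 e - A s \<bullet> rot90 e)"
proof -
  define f where "f s = A s \<bullet> e" for s
  have fc: "continuous_on {a1..a2} f" unfolding f_def by (intro continuous_intros A)
  have sm: "strict_mono_on {a1..a2} f" by (rule strict_mono_onI) (use mono in \<open>auto simp: f_def\<close>)
  have inj: "inj_on f {a1..a2}" by (rule strict_mono_on_imp_inj_on[OF sm])
  define p where "p = inv_into {a1..a2} f"
  have pf: "p (f s) = s" if "s \<in> {a1..a2}" for s unfolding p_def by (rule inv_into_f_f[OF inj that])
  have img: "{f a1..f a2} \<subseteq> f ` {a1..a2}"
  proof
    fix y assume "y \<in> {f a1..f a2}"
    then have "\<exists>s\<ge>a1. s \<le> a2 \<and> f s = y" by (intro IVT') (use a fc in auto)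
    then show "y \<in> f ` {a1..a2}" by auto
  qed
  have pc: "continuous_on (f ` {a1..a2}) p"
    by (rule continuous_on_inv[OF fc compact_Icc]) (simp add: pf)
  have Bf: "B t \<bullet> e \<in> f ` {a1..a2}" if "t \<in> {b1..b2}" for t using strip[OF that] img by (auto simp: f_def)
  have pB: "p (B t \<bullet> e) \<in> {a1..a2}" "A (p (B t \<bullet> e)) \<bullet> e = B t \<bullet> e" if "t \<in> {b1..b2}" for t
    using Bf[OF that] pf by (auto simp: f_def)
  define D where "D t = c * (B t \<bullet> rot90 e - A (p (B t \<bullet> e)) \<bullet> rot90 e)" for t
  have "continuous_on {b1..b2} (\<lambda>t. p (B t \<bullet> e))"
    by (rule continuous_on_compose2[OF pc]) (use Bf in \<open>auto intro!: continuous_intros B\<close>)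
  then have "continuous_on {b1..b2} (\<lambda>t. A (p (B t \<bullet> e)))"
    by (rule continuous_on_compose2[OF A]) (use pB in auto)
  then have Dc: "continuous_on {b1..b2} D" unfolding D_def by (intro continuous_intros B)
  have c0: "c \<noteq> 0" using s0(3) by auto
  have Dn: "D t \<noteq> 0" if t: "t \<in> {b1..b2}" for t
  proof
    assume "D t = 0"
    then have "A (p (B t \<bullet> e)) \<bullet> rot90 e = B t \<bullet> rot90 e" using c0 by (simp add: D_def)
    then have "A (p (B t \<bullet> e)) = B t"
      using pB(2)[OF t] plane_decomp[OF e, of "B t"] plane_decomp[OF e, of "A (p (B t \<bullet> e))"] by simp
    then show False using nomeet[OF pB(1)[OF t] t] by simp
  qed
  have "p (B t0 \<bullet> e) = s0" using pf[OF s0(1)] s0(2) by (simp add: f_def)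
  then have D0: "0 < D t0" using s0(3) by (simp add: D_def)
  have "0 < D t1"
  proof (rule ccontr)
    assume "\<not> 0 < D t1"
    then have D1: "D t1 \<le> 0" by simp
    have "\<exists>t\<in>{b1..b2}. D t = 0"
    proof (cases "t0 \<le> t1")
      case True
      have "\<exists>t\<ge>t0. t \<le> t1 \<and> D t = 0"
        by (rule IVT2') (use D0 D1 True continuous_on_subset[OF Dc] t0 t1 in auto)
      then show ?thesis using t0 t1 by auto
    next
      case False
      have "\<exists>t\<ge>t1. t \<le> t0 \<and> D t = 0"
        by (rule IVT') (use D0 D1 False continuous_on_subset[OF Dc] t0 t1 in auto)
      then show ?thesis using t0 t1 by auto
    qed
    then show False using Dn by blast
  qed
  then show ?thesis using pB[OF t1] by (auto simp: D_def)
qed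

definition nearly_linear :: "real \<Rightarrow> plane \<Rightarrow> real \<Rightarrow> real \<Rightarrow> (real \<Rightarrow> plane) \<Rightarrow> bool" where
  "nearly_linear \<eta> u a b A \<longleftrightarrow>
     (\<forall>s\<in>{a..b}. \<forall>t\<in>{a..b}. norm (A t - A s - (t - s) *\<^sub>R u) \<le> \<eta> * \<bar>t - s\<bar>)"

lemma nearly_linear_inner:
  assumes "nearly_linear \<eta> u a b A" "s \<in> {a..b}" "t \<in> {a..b}" "norm w = 1"
  shows "\<bar>A t \<bullet> w - A s \<bullet> w - (t - s) * (u \<bullet> w)\<bar> \<le> \<eta> * \<bar>t - s\<bar>"
proof -
  have "\<bar>(A t - A s - (t - s) *\<^sub>R u) \<bullet> w\<bar> \<le> norm (A t - A s - (t - s) *\<^sub>R u)"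
    using Cauchy_Schwarz_ineq2[of "A t - A s - (t - s) *\<^sub>R u" w] assms(4) by simp
  also have "\<dots> \<le> \<eta> * \<bar>t - s\<bar>" using assms(1-3) by (auto simp: nearly_linear_def)
  finally show ?thesis by (simp add: inner_diff_left)
qed

lemma nearly_linear_continuous:
  assumes A: "nearly_linear \<eta> u a b A" and u: "norm u = 1" and \<eta>: "0 \<le> \<eta>"
  shows "continuous_on {a..b} A"
proof -
  have "(\<eta> + 1)-lipschitz_on {a..b} A"
  proof (rule lipschitz_onI)
    fix s t assume st: "s \<in> {a..b}" "t \<in> {a..b}"
    have "norm (A s - A t) \<le> norm (A s - A t - (s - t) *\<^sub>R u) + norm ((s - t) *\<^sub>R u)"
      using norm_triangle_sub[of "A s - A t" "(s - t) *\<^sub>R u"] by simp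
    also have "\<dots> \<le> \<eta> * \<bar>s - t\<bar> + \<bar>s - t\<bar>" using A st u by (auto simp: nearly_linear_def)
    finally show "dist (A s) (A t) \<le> (\<eta> + 1) * dist s t" by (simp add: dist_norm dist_real_def algebra_simps)
  qed (use \<eta> in simp)
  then show ?thesis by (rule lipschitz_on_continuous_on)
qed

lemma nearly_linear_start:
  assumes "nearly_linear \<eta> u 0 b A" "t \<in> {0..b}"
  shows "norm (A t - A 0 - t *\<^sub>R u) \<le> \<eta> * t"
proof -
  have "0 \<in> {0..b}" using assms(2) by auto
  then have "norm (A t - A 0 - (t - 0) *\<^sub>R u) \<le> \<eta> * \<bar>t - 0\<bar>"
    using assms unfolding nearly_linear_def by blast
  then show ?thesis using assms(2) by simp
qed

lemma inner_unit_le: "norm w = 1 \<Longrightarrow> \<bar>x \<bullet> w\<bar> \<le> norm x" for x w :: "'a::real_inner"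
  using Cauchy_Schwarz_ineq2[of x w] by simp

text \<open>A nearly straight arc through a point near the origin, seen as a graph over its
  direction \<open>v\<close>.\<close>

lemma line_graph:
  assumes A: "nearly_linear \<eta> v (-3) 3 A" and A0: "norm (A 0) \<le> \<eta>" and v: "norm v = 1"
    and \<eta>: "0 \<le> \<eta>" "\<eta> \<le> 1/10"
  shows "\<And>s t. -3 \<le> s \<Longrightarrow> s < t \<Longrightarrow> t \<le> 3 \<Longrightarrow> A s \<bullet> v < A t \<bullet> v"
    "A (-3) \<bullet> v \<le> -2" "2 \<le> A 3 \<bullet> v"
    "\<And>s. s \<in> {-3..3} \<Longrightarrow> \<bar>A s \<bullet> rot90 v\<bar> \<le> 4 * \<eta>"
proof -
  have vv: "v \<bullet> v = 1" using v by (simp add: norm_eq_1)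
  show "A s \<bullet> v < A t \<bullet> v" if "-3 \<le> s" "s < t" "t \<le> 3" for s t
  proof -
    have "\<bar>A t \<bullet> v - A s \<bullet> v - (t - s)\<bar> \<le> \<eta> * (t - s)"
      using nearly_linear_inner[OF A _ _ v, of s t] that vv by simp
    also have "\<dots> \<le> 1/10 * (t - s)" using \<eta> that by (intro mult_right_mono) auto
    finally have "- (A t \<bullet> v - A s \<bullet> v - (t - s)) \<le> 1/10 * (t - s)" by (rule abs_le_D2)
    then show ?thesis using that by (simp add: field_simps)
  qed
  have a0: "\<bar>A 0 \<bullet> v\<bar> \<le> \<eta>" "\<bar>A 0 \<bullet> rot90 v\<bar> \<le> \<eta>" using inner_unit_le[of v "A 0"] inner_unit_le[of "rot90 v" "A 0"] A0 v by auto
  show "A (-3) \<bullet> v \<le> -2" "2 \<le> A 3 \<bullet> v"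
    using nearly_linear_inner[OF A _ _ v, of 0 "-3"] nearly_linear_inner[OF A _ _ v, of 0 3] a0 vv \<eta> by auto
  fix s :: real assume s: "s \<in> {-3..3}"
  have "\<bar>A s \<bullet> rot90 v - A 0 \<bullet> rot90 v\<bar> \<le> \<eta> * \<bar>s\<bar>"
    using nearly_linear_inner[OF A _ s, of 0 "rot90 v"] v by simp
  also have "\<dots> \<le> \<eta> * 3" using s \<eta> by (intro mult_left_mono) auto
  finally show "\<bar>A s \<bullet> rot90 v\<bar> \<le> 4 * \<eta>" using a0 by linarith
qed

lemma disjoint_lines_parallel:
  assumes A: "nearly_linear \<eta> v (-3) 3 A" "norm (A 0) \<le> \<eta>" "norm v = 1"
    and B: "nearly_linear \<eta> w (-3) 3 B" "norm (B 0) \<le> \<eta>" "norm w = 1"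
    and \<eta>: "0 \<le> \<eta>" "\<eta> \<le> 1/10"
    and nomeet: "\<And>s t. s \<in> {-3..3} \<Longrightarrow> t \<in> {-3..3} \<Longrightarrow> A s \<noteq> B t"
  shows "\<bar>w \<bullet> rot90 v\<bar> \<le> 6 * \<eta>"
proof (rule ccontr)
  assume neg: "\<not> ?thesis"
  define c where "c = sgn (w \<bullet> rot90 v)"
  have c: "c * (w \<bullet> rot90 v) = \<bar>w \<bullet> rot90 v\<bar>" "\<bar>c\<bar> = 1" using neg \<eta> by (auto simp: c_def sgn_if)
  note gA = line_graph[OF A \<eta>]
  have b0: "\<bar>B 0 \<bullet> v\<bar> \<le> \<eta>" "\<bar>B 0 \<bullet> rot90 v\<bar> \<le> \<eta>"
    using inner_unit_le[of v "B 0"] inner_unit_le[of "rot90 v" "B 0"] B A(3) by auto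
  have Bt: "\<bar>B t \<bullet> u - B 0 \<bullet> u - t * (w \<bullet> u)\<bar> \<le> \<eta>" if "t \<in> {-1..1}" "norm u = 1" for t u
  proof -
    have "\<bar>B t \<bullet> u - B 0 \<bullet> u - t * (w \<bullet> u)\<bar> \<le> \<eta> * \<bar>t\<bar>"
      using nearly_linear_inner[OF B(1) _ _ that(2), of 0 t] that by simp
    also have "\<dots> \<le> \<eta> * 1" using that \<eta> by (intro mult_left_mono) auto
    finally show ?thesis by simp
  qed
  have strip: "\<bar>B t \<bullet> v\<bar> \<le> 2" if t: "t \<in> {-1..1}" for t
  proof -
    have "\<bar>t * (w \<bullet> v)\<bar> \<le> 1 * 1"
      unfolding abs_mult using t inner_unit_le[OF A(3), of w] B(3) by (intro mult_mono) auto
    then show ?thesis using Bt[OF t A(3)] b0 \<eta> by linarith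
  qed
  have sgn: "0 < t * c * (B t \<bullet> rot90 v - y)" if t: "t = 1 \<or> t = -1" and y: "\<bar>y\<bar> \<le> 4 * \<eta>" for t y
  proof -
    have "\<bar>B t \<bullet> rot90 v - t * (w \<bullet> rot90 v)\<bar> \<le> 2 * \<eta>" using Bt[of t "rot90 v"] t A(3) b0 by auto
    then have "\<bar>(B t \<bullet> rot90 v - y) - t * (w \<bullet> rot90 v)\<bar> \<le> 6 * \<eta>" using y by linarith
    moreover have "(t * c) * (t * (w \<bullet> rot90 v)) = \<bar>w \<bullet> rot90 v\<bar>" using c t by auto
    moreover have "\<bar>(t * c) * ((B t \<bullet> rot90 v - y) - t * (w \<bullet> rot90 v))\<bar> = \<bar>(B t \<bullet> rot90 v - y) - t * (w \<bullet> rot90 v)\<bar>"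
      using c(2) t by (auto simp: abs_mult)
    ultimately have "\<bar>(t * c) * (B t \<bullet> rot90 v - y) - \<bar>w \<bullet> rot90 v\<bar>\<bar> \<le> 6 * \<eta>"
      by (simp only: right_diff_distrib)
    then show ?thesis using neg by linarith
  qed
  have "continuous_on {-3..3} A" "continuous_on {-1..1} B"
    using nearly_linear_continuous[OF A(1,3) \<eta>(1)] continuous_on_subset[OF nearly_linear_continuous[OF B(1,3) \<eta>(1)]] by auto
  note cont = this
  have ex: "\<exists>s\<in>{-3..3}. A s \<bullet> v = B 1 \<bullet> v"
  proof -
    have "\<exists>s\<ge>-3. s \<le> 3 \<and> A s \<bullet> v = B 1 \<bullet> v"
      using strip[of 1] gA(2,3) by (intro IVT') (auto intro!: continuous_intros cont(1))
    then show ?thesis by auto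
  qed
  then obtain s where s: "s \<in> {-3..3}" "A s \<bullet> v = B 1 \<bullet> v" by blast
  have "\<exists>s\<in>{-3..3}. A s \<bullet> v = B (-1) \<bullet> v \<and> 0 < c * (B (-1) \<bullet> rot90 v - A s \<bullet> rot90 v)"
  proof (rule graph_side[where A=A and B=B and c=c and e=v and ?b1.0="-1" and ?b2.0=1 and ?t0.0=1, OF cont(1) _ _ cont(2) _ _ A(3) _ _ s])
    show "A s \<bullet> v < A t \<bullet> v" if "-3 \<le> s" "s < t" "t \<le> 3" for s t using gA(1)[OF that] .
    show "A (-3) \<bullet> v \<le> B t \<bullet> v \<and> B t \<bullet> v \<le> A 3 \<bullet> v" if "t \<in> {-1..1}" for t
      using strip[OF that] gA(2,3) by linarith
    show "0 < c * (B 1 \<bullet> rot90 v - A s \<bullet> rot90 v)" using sgn[of 1 "A s \<bullet> rot90 v"] gA(4)[OF s(1)] by simp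
    show "A s \<noteq> B t" if "s \<in> {-3..3}" "t \<in> {-1..1}" for s t
      by (rule nomeet) (use that in simp_all)
  qed simp_all
  then obtain r where r: "r \<in> {-3..3}" "0 < c * (B (-1) \<bullet> rot90 v - A r \<bullet> rot90 v)" by blast
  then show False using sgn[of "-1" "A r \<bullet> rot90 v"] gA(4)[OF r(1)] by auto
qed

lemma triple_inner:
  fixes w :: "'k \<Rightarrow> plane"
  assumes C: "card C = 3" and sum: "(\<Sum>k\<in>C. w k) = 0" and unit: "\<And>k. k \<in> C \<Longrightarrow> norm (w k) = 1"
    and kl: "k \<in> C" "l \<in> C" "k \<noteq> l"
  shows "w k \<bullet> w l = - 1/2"
proof -
  obtain x y z where xyz: "C = {x, y, z}" "x \<noteq> y" "x \<noteq> z" "y \<noteq> z"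
    using C unfolding card_3_iff by blast
  have s: "w x + w y + w z = 0" using sum xyz by (simp add: add.assoc)
  have *: "a \<bullet> b = - 1/2" if "a + b + c = 0" "norm a = 1" "norm b = 1" "norm c = 1" for a b c :: plane
  proof -
    have "c = - (a + b)" unfolding eq_neg_iff_add_eq_0 using that(1) by (simp add: ac_simps)
    then have "c \<bullet> c = a \<bullet> a + 2 * (a \<bullet> b) + b \<bullet> b"
      by (simp add: inner_diff_left inner_diff_right inner_add_left inner_add_right inner_commute)
    then show ?thesis using that by (simp add: norm_eq_1)
  qed
  have n: "norm (w x) = 1" "norm (w y) = 1" "norm (w z) = 1" using unit xyz by auto
  have "w y + w z + w x = 0" "w z + w x + w y = 0" using s by (simp_all add: ac_simps)
  from *[OF s n] *[OF this(1) n(2,3,1)] *[OF this(2) n(3,1,2)]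
  have "w x \<bullet> w y = - 1/2" "w y \<bullet> w z = - 1/2" "w z \<bullet> w x = - 1/2" .
  then show ?thesis using kl xyz by (auto simp: inner_commute)
qed

lemma triple_decomposition:
  fixes w :: "'k \<Rightarrow> plane"
  assumes C: "card C = 3" and sum: "(\<Sum>k\<in>C. w k) = 0" and unit: "\<And>k. k \<in> C \<Longrightarrow> norm (w k) = 1"
  obtains k l \<alpha> \<beta> where "k \<in> C" "l \<in> C" "k \<noteq> l" "0 \<le> \<alpha>" "0 \<le> \<beta>" "D = \<alpha> *\<^sub>R w k + \<beta> *\<^sub>R w l"
proof -
  obtain x y z where xyz: "C = {x, y, z}" "x \<noteq> y" "x \<noteq> z" "y \<noteq> z"
    and min: "D \<bullet> w z \<le> D \<bullet> w x" "D \<bullet> w z \<le> D \<bullet> w y"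
  proof -
    obtain x y z where *: "C = {x, y, z}" "x \<noteq> y" "x \<noteq> z" "y \<noteq> z"
      using C unfolding card_3_iff by blast
    have p: "C = {y, z, x}" "C = {x, z, y}" using * by auto
    consider "D \<bullet> w z \<le> D \<bullet> w x" "D \<bullet> w z \<le> D \<bullet> w y" | "D \<bullet> w x \<le> D \<bullet> w y" "D \<bullet> w x \<le> D \<bullet> w z"
      | "D \<bullet> w y \<le> D \<bullet> w x" "D \<bullet> w y \<le> D \<bullet> w z" by linarith
    then show ?thesis
    proof cases
      case 1 show ?thesis by (rule that[OF * 1])
    next
      case 2 show ?thesis by (rule that[OF p(1) *(4) *(2)[symmetric] *(3)[symmetric] 2])
    next
      case 3 show ?thesis by (rule that[OF p(2) *(3) *(2) *(4)[symmetric] 3])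
    qed
  qed
  have xy: "w x \<bullet> w y = - 1/2" by (rule triple_inner[OF C sum unit]) (use xyz in auto)
  have s: "w z = - (w x + w y)" unfolding eq_neg_iff_add_eq_0 using sum xyz by (simp add: ac_simps)
  define \<alpha> where "\<alpha> = (2/3) * (D \<bullet> w x - D \<bullet> w z)"
  define \<beta> where "\<beta> = (2/3) * (D \<bullet> w y - D \<bullet> w z)"
  have u: "norm (w x) = 1" "norm (w y) = 1" using unit xyz by auto
  define E where "E = D - (\<alpha> *\<^sub>R w x + \<beta> *\<^sub>R w y)"
  have "E \<bullet> w x = 0" "E \<bullet> w y = 0"
    using u xy by (simp_all add: E_def \<alpha>_def \<beta>_def s inner_diff_left inner_add_left inner_add_right norm_eq_1 inner_commute algebra_simps)
  moreover have "E \<bullet> w z = 0" unfolding s using calculation by (simp add: inner_diff_right)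
  ultimately have "E = 0"
  proof (intro triple_not_collinear[OF C sum unit])
    fix k assume "k \<in> C"
    then have "k = x \<or> k = y \<or> k = z" using xyz(1) by simp
    then show "w k \<bullet> E = 0" using \<open>E \<bullet> w x = 0\<close> \<open>E \<bullet> w y = 0\<close> \<open>E \<bullet> w z = 0\<close>
      by (elim disjE) (simp_all add: inner_commute)
  qed
  then have "D = \<alpha> *\<^sub>R w x + \<beta> *\<^sub>R w y" by (simp add: E_def)
  moreover have "0 \<le> \<alpha>" "0 \<le> \<beta>" using min by (simp_all add: \<alpha>_def \<beta>_def)
  moreover have "x \<in> C" "y \<in> C" using xyz(1) by auto
  ultimately show ?thesis using xyz(2) by (intro that)
qed

text \<open>Two arms of a nearly standard triod form the graph of a nearly V-shaped function over
  the direction orthogonal to the third arm.\<close>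

lemma triod_sector_oriented:
  fixes A :: "'k \<Rightarrow> real \<Rightarrow> plane" and B :: "'m \<Rightarrow> real \<Rightarrow> plane"
  assumes C: "card C = 3" "(\<Sum>k\<in>C. u k) = 0" "\<And>k. k \<in> C \<Longrightarrow> norm (u k) = 1"
    and A: "\<And>k. k \<in> C \<Longrightarrow> nearly_linear \<eta> (u k) 0 3 (A k)" "\<And>k. k \<in> C \<Longrightarrow> A k 0 = p"
    and C': "card C' = 3" "(\<Sum>m\<in>C'. v m) = 0" "\<And>m. m \<in> C' \<Longrightarrow> norm (v m) = 1"
    and B: "\<And>m. m \<in> C' \<Longrightarrow> nearly_linear \<eta> (v m) 0 3 (B m)" "\<And>m. m \<in> C' \<Longrightarrow> B m 0 = p'"
    and \<eta>: "0 < \<eta>" "\<eta> \<le> 1/100" and pp: "norm p \<le> \<eta>" "norm p' \<le> \<eta>"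
    and nomeet: "\<And>k m s t. k \<in> C \<Longrightarrow> m \<in> C' \<Longrightarrow> s \<in> {0..3} \<Longrightarrow> t \<in> {0..3} \<Longrightarrow> A k s \<noteq> B m t"
    and kl: "k \<in> C" "l \<in> C" "k \<noteq> l" "0 < - (u k \<bullet> rot90 (u l))"
    and X: "m \<in> C'" "t \<in> {0..1}" "B m t - p = \<alpha> *\<^sub>R u k + \<beta> *\<^sub>R u l" "0 \<le> \<alpha>" "0 \<le> \<beta>"
  shows "\<alpha> \<le> 3 * \<eta> * (\<alpha> + \<beta>) \<or> \<beta> \<le> 3 * \<eta> * (\<alpha> + \<beta>)"
proof (rule ccontr)
  assume neg: "\<not> ?thesis"
  have kl_inner: "u k \<bullet> u l = - 1/2" by (rule triple_inner[OF C kl(1-3)])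
  have uu: "u k \<bullet> u k = 1" "u l \<bullet> u l = 1" using C(3) kl by (simp_all add: norm_eq_1[symmetric])
  define h where "h = u k + u l"
  define e where "e = - rot90 h"
  define c where "c = - (u k \<bullet> rot90 (u l))"
  have rr: "rot90 (rot90 x) = - x" for x by (simp add: plane_eq_iff)
  have re: "rot90 e = h" by (simp add: e_def rr)
  have hh: "norm h = 1" by (simp add: norm_eq_1 h_def inner_add_left inner_add_right inner_commute kl_inner uu)
  have e1: "norm e = 1" by (simp add: e_def hh)
  have uh: "u k \<bullet> h = 1/2" "u l \<bullet> h = 1/2"
    using kl_inner uu by (simp_all add: h_def inner_add_right inner_commute[of "u l" "u k"])
  have ue: "u k \<bullet> e = c" "u l \<bullet> e = - c"
    using inner_rot90_swap[of "u l" "u k"]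
    by (simp_all add: e_def h_def c_def inner_add_right inner_diff_right inner_commute)
  have c0: "0 < c" using kl(4) by (simp add: c_def)
  have c2: "c\<^sup>2 = 3/4"
    using norm_decomp[OF e1, of "u k"] C(3)[OF kl(1)] ue(1) uh(1) re by (simp add: power2_eq_square)
  have c45: "4/5 \<le> c"
  proof (rule power2_le_imp_le) show "(4/5)\<^sup>2 \<le> c\<^sup>2" unfolding c2 by (simp add: power2_eq_square) qed (use c0 in simp)
  have c910: "c \<le> 9/10"
  proof (rule power2_le_imp_le) show "c\<^sup>2 \<le> (9/10)\<^sup>2" unfolding c2 by (simp add: power2_eq_square) qed simp
  define V where "V s = (if s \<le> 0 then A l (- s) else A k s)" for s :: real
  have Vmem: "\<exists>k\<in>C. \<exists>r\<in>{0..3}. V s = A k r" if "s \<in> {-3..3}" for s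
    using that kl unfolding V_def by (cases "s \<le> 0") force+
  have Alin: "\<bar>A i s \<bullet> w - p \<bullet> w - s * (u i \<bullet> w)\<bar> \<le> \<eta> * s" if "i \<in> C" "s \<in> {0..3}" "norm w = 1" for i s w
    using nearly_linear_inner[OF A(1)[OF that(1)] _ that(2,3), of 0] A(2)[OF that(1)] that by simp
  have Ve: "\<bar>V s \<bullet> e - p \<bullet> e - s * c\<bar> \<le> \<eta> * \<bar>s\<bar>" and Vh: "\<bar>V s \<bullet> h - p \<bullet> h - \<bar>s\<bar> / 2\<bar> \<le> \<eta> * \<bar>s\<bar>"
    if "s \<in> {-3..3}" for s
    using Alin[OF kl(1) _ e1, of s] Alin[OF kl(2) _ e1, of "- s"] Alin[OF kl(1) _ hh, of s] Alin[OF kl(2) _ hh, of "- s"] that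
    by (auto simp: V_def ue uh)
  have Vc: "continuous_on {-3..3} V"
    unfolding V_def
  proof (rule continuous_on_cases_le)
    show "continuous_on {t \<in> {-3..3}. t \<le> 0} (\<lambda>s. A l (- s))"
      by (rule continuous_on_compose2[OF nearly_linear_continuous[OF A(1)[OF kl(2)] C(3)[OF kl(2)]]])
         (use \<eta> in \<open>auto intro!: continuous_intros\<close>)
    show "continuous_on {t \<in> {-3..3}. 0 \<le> t} (A k)"
      by (rule continuous_on_subset[OF nearly_linear_continuous[OF A(1)[OF kl(1)] C(3)[OF kl(1)]]])
         (use \<eta> in auto)
  qed (auto intro!: continuous_intros simp: A(2)[OF kl(1)] A(2)[OF kl(2)])
  have step: "a \<bullet> e < b \<bullet> e" if "\<bar>b \<bullet> e - a \<bullet> e - r * c\<bar> \<le> \<eta> * r" "0 < r" for a b r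
  proof -
    have "\<eta> * r \<le> (1/100) * r" using \<eta> that(2) by (intro mult_right_mono) auto
    moreover have "r * (4/5) \<le> r * c" using c45 that(2) by (intro mult_left_mono) auto
    moreover have "- (b \<bullet> e - a \<bullet> e - r * c) \<le> \<eta> * r" using that(1) by (rule abs_le_D2)
    ultimately show ?thesis using that(2) by linarith
  qed
  have mono: "V s \<bullet> e < V r \<bullet> e" if sr: "-3 \<le> s" "s < r" "r \<le> 3" for s r
  proof -
    have nonneg: "V s \<bullet> e < V r \<bullet> e" if "0 \<le> s" "s < r" "r \<le> 3" for s r
    proof (rule step)
      have "V s = A k s" "V r = A k r" using that A(2)[OF kl(1)] A(2)[OF kl(2)] by (auto simp: V_def)
      then show "\<bar>V r \<bullet> e - V s \<bullet> e - (r - s) * c\<bar> \<le> \<eta> * (r - s)"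
        using nearly_linear_inner[OF A(1)[OF kl(1)] _ _ e1, of s r] that by (simp add: ue)
    qed (use that in simp)
    have nonpos: "V s \<bullet> e < V r \<bullet> e" if "-3 \<le> s" "s < r" "r \<le> 0" for s r
    proof (rule step)
      have "V s = A l (- s)" "V r = A l (- r)" using that by (auto simp: V_def)
      then show "\<bar>V r \<bullet> e - V s \<bullet> e - (r - s) * c\<bar> \<le> \<eta> * (r - s)"
        using nearly_linear_inner[OF A(1)[OF kl(2)] _ _ e1, of "- s" "- r"] that by (simp add: ue algebra_simps)
    qed (use that in simp)
    show ?thesis
    proof (cases "0 \<le> s \<or> r \<le> 0")
      case False
      then show ?thesis using nonpos[of s 0] nonneg[of 0 r] sr by simp
    qed (use nonneg nonpos sr in auto)
  qed
  have pe: "norm (p' - p) \<le> 2 * \<eta>" using norm_triangle_ineq4[of p' p] pp by simp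
  have Bnear: "norm (B i r - p - r *\<^sub>R v i) \<le> 3 * \<eta>" if "i \<in> C'" "r \<in> {0..1}" for i r
  proof -
    have "norm (B i r - p' - r *\<^sub>R v i) \<le> \<eta> * r"
      using nearly_linear_start[OF B(1)[OF that(1)], of r] B(2)[OF that(1)] that(2) by simp
    also have "\<dots> \<le> \<eta> * 1" using that \<eta> by (intro mult_left_mono) auto
    finally show ?thesis using pe norm_triangle_ineq[of "B i r - p' - r *\<^sub>R v i" "p' - p"] by (simp add: algebra_simps)
  qed
  have strip: "V (-3) \<bullet> e \<le> B i r \<bullet> e \<and> B i r \<bullet> e \<le> V 3 \<bullet> e" if "i \<in> C'" "r \<in> {0..1}" for i r
  proof -
    have "norm (B i r - p) \<le> 3 * \<eta> + norm (r *\<^sub>R v i)"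
      using norm_triangle_sub[of "B i r - p" "r *\<^sub>R v i"] Bnear[OF that] by linarith
    also have "\<dots> \<le> 2" using C'(3)[OF that(1)] that(2) \<eta> by simp
    finally have "\<bar>(B i r - p) \<bullet> e\<bar> \<le> 2" using inner_unit_le[OF e1, of "B i r - p"] by linarith
    then have "\<bar>B i r \<bullet> e - p \<bullet> e\<bar> \<le> 2" by (simp add: inner_diff_left)
    moreover have "\<bar>V 3 \<bullet> e - p \<bullet> e - 3 * c\<bar> \<le> \<eta> * 3" "\<bar>V (-3) \<bullet> e - p \<bullet> e + 3 * c\<bar> \<le> \<eta> * 3"
      using Ve[of 3] Ve[of "-3"] by auto
    ultimately show ?thesis using c45 \<eta> by (simp only: abs_le_iff) linarith
  qed
  have ex: "\<exists>s\<in>{-3..3}. V s \<bullet> e = B i r \<bullet> e" if "i \<in> C'" "r \<in> {0..1}" for i r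
  proof -
    have "\<exists>s\<ge>-3. s \<le> 3 \<and> V s \<bullet> e = B i r \<bullet> e"
      using strip[OF that] by (intro IVT') (auto intro!: continuous_intros Vc)
    then show ?thesis by auto
  qed
  let ?above = "\<lambda>Y. \<exists>s\<in>{-3..3}. V s \<bullet> e = Y \<bullet> e \<and> 0 < 1 * (Y \<bullet> rot90 e - V s \<bullet> rot90 e)"
  have transport: "?above (B i r')" if i: "i \<in> C'" and r: "r \<in> {0..1}" "r' \<in> {0..1}" and ab: "?above (B i r)" for i r r'
  proof -
    obtain s where s: "s \<in> {-3..3}" "V s \<bullet> e = B i r \<bullet> e" "0 < 1 * (B i r \<bullet> rot90 e - V s \<bullet> rot90 e)" using ab by blast
    show ?thesis
    proof (rule graph_side[where A=V and B="B i" and e=e and ?b1.0=0 and ?b2.0=1, OF Vc _ _ _ _ _ e1 r s])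
      show "V s \<bullet> e < V t \<bullet> e" if "-3 \<le> s" "s < t" "t \<le> 3" for s t using mono[OF that] .
      show "continuous_on {0..1} (B i)"
        by (rule continuous_on_subset[OF nearly_linear_continuous[OF B(1)[OF i] C'(3)[OF i]]]) (use \<eta> in auto)
      show "V (-3) \<bullet> e \<le> B i t \<bullet> e \<and> B i t \<bullet> e \<le> V 3 \<bullet> e" if "t \<in> {0..1}" for t using strip[OF i that] .
      show "V s \<noteq> B i t" if st: "s \<in> {-3..3}" "t \<in> {0..1}" for s t
      proof -
        obtain k r where kr: "k \<in> C" "r \<in> {0..3}" "V s = A k r" using Vmem[OF st(1)] by blast
        show ?thesis unfolding kr(3) by (rule nomeet[OF kr(1) i kr(2)]) (use st in simp)
      qed
    qed simp
  qed
  have "?above (B m t)"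
  proof -
    obtain s where s: "s \<in> {-3..3}" "V s \<bullet> e = B m t \<bullet> e" using ex[OF X(1,2)] by blast
    have Xe: "B m t \<bullet> e - p \<bullet> e = (\<alpha> - \<beta>) * c" and Xh: "B m t \<bullet> h - p \<bullet> h = (\<alpha> + \<beta>) / 2"
      using arg_cong[OF X(3), of "\<lambda>y. y \<bullet> e"] arg_cong[OF X(3), of "\<lambda>y. y \<bullet> h"]
      by (simp_all add: inner_diff_left inner_add_left ue uh algebra_simps)
    have "\<bar>(\<alpha> - \<beta>) * c - s * c\<bar> \<le> \<eta> * \<bar>s\<bar>" using Ve[OF s(1)] Xe s(2) by simp
    moreover have "\<bar>s * c\<bar> - \<bar>(\<alpha> - \<beta>) * c\<bar> \<le> \<bar>(\<alpha> - \<beta>) * c - s * c\<bar>" by linarith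
    moreover have "\<bar>s * c\<bar> = \<bar>s\<bar> * c" "\<bar>(\<alpha> - \<beta>) * c\<bar> = \<bar>\<alpha> - \<beta>\<bar> * c"
      using c0 by (simp_all add: abs_mult)
    ultimately have "\<bar>s\<bar> * c - \<bar>s\<bar> * \<eta> \<le> \<bar>\<alpha> - \<beta>\<bar> * c" by (simp add: mult.commute[of \<eta>])
    then have 1: "\<bar>s\<bar> * (c - \<eta>) \<le> \<bar>\<alpha> - \<beta>\<bar> * c" by (simp only: right_diff_distrib)
    have "c \<le> (1 + 2 * \<eta>) * (c - \<eta>)"
    proof -
      have "\<eta> * (4/5) \<le> \<eta> * c" "\<eta> * \<eta> \<le> \<eta> * (1/100)" using c45 \<eta> by (auto intro!: mult_left_mono)
      moreover have "(1 + 2 * \<eta>) * (c - \<eta>) = c - \<eta> + 2 * (\<eta> * c) - 2 * (\<eta> * \<eta>)" by (simp add: algebra_simps)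
      ultimately show ?thesis using \<eta> by linarith
    qed
    then have "\<bar>\<alpha> - \<beta>\<bar> * c \<le> \<bar>\<alpha> - \<beta>\<bar> * ((1 + 2 * \<eta>) * (c - \<eta>))" by (intro mult_left_mono) auto
    with 1 have "\<bar>s\<bar> * (c - \<eta>) \<le> (\<bar>\<alpha> - \<beta>\<bar> * (1 + 2 * \<eta>)) * (c - \<eta>)" by (simp add: mult.assoc)
    then have s2: "\<bar>s\<bar> \<le> \<bar>\<alpha> - \<beta>\<bar> * (1 + 2 * \<eta>)" using c45 \<eta> by (subst (asm) mult_le_cancel_right) auto
    have "V s \<bullet> h - p \<bullet> h \<le> \<bar>s\<bar> * (1/2 + \<eta>)" using Vh[OF s(1)] by (simp add: abs_le_iff algebra_simps)
    also have "\<dots> \<le> (\<bar>\<alpha> - \<beta>\<bar> * (1 + 2 * \<eta>)) * (1/2 + \<eta>)" using s2 \<eta> by (intro mult_right_mono) auto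
    also have "\<dots> = \<bar>\<alpha> - \<beta>\<bar> * ((1 + 2 * \<eta>) * (1/2 + \<eta>))" by (simp only: mult.assoc)
    also have "\<dots> \<le> \<bar>\<alpha> - \<beta>\<bar> * (1/2 + 3 * \<eta>)"
    proof (rule mult_left_mono)
      have "\<eta> * \<eta> \<le> \<eta> * (1/100)" using \<eta> by (intro mult_left_mono) auto
      then show "(1 + 2 * \<eta>) * (1/2 + \<eta>) \<le> 1/2 + 3 * \<eta>" using \<eta> by (simp add: algebra_simps)
    qed simp
    also have "\<dots> < (\<alpha> + \<beta>) / 2"
    proof -
      have "3 * \<eta> * \<bar>\<alpha> - \<beta>\<bar> \<le> 3 * \<eta> * (\<alpha> + \<beta>)" using \<eta> X(4,5) by (intro mult_left_mono) auto
      moreover have "\<bar>\<alpha> - \<beta>\<bar> * (1/2 + 3 * \<eta>) = \<bar>\<alpha> - \<beta>\<bar> / 2 + 3 * \<eta> * \<bar>\<alpha> - \<beta>\<bar>" by (simp add: algebra_simps)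
      moreover have "3 * \<eta> * (\<alpha> + \<beta>) < \<alpha>" "3 * \<eta> * (\<alpha> + \<beta>) < \<beta>" using neg by auto
      moreover have "a / 2 + y < (\<alpha> + \<beta>) / 2" if "y < \<alpha>" "y < \<beta>" "a = \<bar>\<alpha> - \<beta>\<bar>" for a y
        using that by (auto simp: abs_if)
      ultimately show ?thesis by (metis order_le_less_trans)
    qed
    finally have "V s \<bullet> h < B m t \<bullet> h" using Xh by linarith
    then show ?thesis using s by (auto simp: re)
  qed
  from transport[OF X(1,2) _ this, of 0] have "?above p'" using B(2)[OF X(1)] by simp
  then have all: "?above (B i 1)" if "i \<in> C'" for i using transport[OF that, of 0 1] B(2)[OF that] by simp
  have key: "\<bar>v i \<bullet> e\<bar> / 2 - 5 * \<eta> \<le> v i \<bullet> h" if i: "i \<in> C'" for i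
  proof -
    obtain s where s: "s \<in> {-3..3}" "V s \<bullet> e = B i 1 \<bullet> e" "V s \<bullet> h < B i 1 \<bullet> h" using all[OF i] by (auto simp: re)
    have near: "\<bar>B i 1 \<bullet> w - p \<bullet> w - v i \<bullet> w\<bar> \<le> 3 * \<eta>" if "norm w = 1" for w
      using Bnear[OF i, of 1] inner_unit_le[OF that, of "B i 1 - p - 1 *\<^sub>R v i"] by (simp add: inner_diff_left)
    have 1: "\<bar>B i 1 \<bullet> e - p \<bullet> e\<bar> \<le> \<bar>s\<bar> * (c + \<eta>)"
    proof -
      have "\<bar>B i 1 \<bullet> e - p \<bullet> e\<bar> \<le> \<bar>s * c\<bar> + \<eta> * \<bar>s\<bar>" using Ve[OF s(1)] s(2) by linarith
      then show ?thesis using c0 by (simp add: abs_mult algebra_simps)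
    qed
    have "\<bar>s\<bar> * (c + \<eta>) / 2 \<le> \<bar>s\<bar> * (1/2 - \<eta>)"
    proof -
      have "\<bar>s\<bar> * ((c + \<eta>) / 2) \<le> \<bar>s\<bar> * (1/2 - \<eta>)" using c910 \<eta> by (intro mult_left_mono) auto
      then show ?thesis by simp
    qed
    also have "\<dots> \<le> V s \<bullet> h - p \<bullet> h" using Vh[OF s(1)] by (simp add: abs_le_iff algebra_simps)
    also have "\<dots> \<le> B i 1 \<bullet> h - p \<bullet> h" using s(3) by simp
    finally have "\<bar>s\<bar> * (c + \<eta>) / 2 \<le> B i 1 \<bullet> h - p \<bullet> h" .
    with divide_right_mono[OF 1, of 2] have "\<bar>B i 1 \<bullet> e - p \<bullet> e\<bar> / 2 \<le> B i 1 \<bullet> h - p \<bullet> h"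
      by (meson order_trans zero_le_numeral)
    moreover have "\<bar>v i \<bullet> e\<bar> \<le> \<bar>B i 1 \<bullet> e - p \<bullet> e\<bar> + 3 * \<eta>"
      using near[OF e1] abs_triangle_ineq2[of "v i \<bullet> e" "B i 1 \<bullet> e - p \<bullet> e"] by (simp add: abs_minus_commute)
    moreover have "B i 1 \<bullet> h - p \<bullet> h - v i \<bullet> h \<le> 3 * \<eta>" using near[OF hh] by (rule abs_le_D1)
    moreover have "y / 2 - 5 * \<eta> \<le> d" if "a / 2 \<le> b" "y \<le> a + 3 * \<eta>" "b - d \<le> 3 * \<eta>" for a b y d
      using that \<eta>(1) by (simp add: field_simps)
    ultimately show ?thesis by blast
  qed
  obtain x y z where xyz: "C' = {x, y, z}" "x \<noteq> y" "x \<noteq> z" "y \<noteq> z"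
    using C'(1) unfolding card_3_iff by blast
  have "v x \<bullet> h + v y \<bullet> h + v z \<bullet> h = 0"
    using arg_cong[OF C'(2), of "\<lambda>y. y \<bullet> h"] xyz by (simp add: inner_add_left add.assoc)
  moreover have k: "\<bar>v x \<bullet> e\<bar> / 2 - 5 * \<eta> \<le> v x \<bullet> h" "\<bar>v y \<bullet> e\<bar> / 2 - 5 * \<eta> \<le> v y \<bullet> h" "\<bar>v z \<bullet> e\<bar> / 2 - 5 * \<eta> \<le> v z \<bullet> h"
    using key xyz by auto
  ultimately have "\<bar>v x \<bullet> e\<bar> \<le> 30 * \<eta>" "\<bar>v x \<bullet> h\<bar> \<le> 10 * \<eta>" using \<eta> by linarith+
  moreover have "1 \<le> \<bar>v x \<bullet> e\<bar> + \<bar>v x \<bullet> h\<bar>"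
    using norm_le_decomp[OF e1, of "v x"] C'(3)[of x] xyz re by simp
  ultimately show False using \<eta> by linarith
qed

lemma triple_cross_nonzero:
  fixes u :: "'k \<Rightarrow> plane"
  assumes C: "card C = 3" "(\<Sum>k\<in>C. u k) = 0" "\<And>k. k \<in> C \<Longrightarrow> norm (u k) = 1"
    and kl: "k \<in> C" "l \<in> C" "k \<noteq> l"
  shows "u k \<bullet> rot90 (u l) \<noteq> 0"
proof
  assume "u k \<bullet> rot90 (u l) = 0"
  then have "(norm (u k))\<^sup>2 = (u k \<bullet> u l)\<^sup>2" using norm_decomp[OF C(3)[OF kl(2)], of "u k"] by simp
  then show False using triple_inner[OF C kl] C(3)[OF kl(1)] by (simp add: power2_eq_square)
qed

lemma triod_near_ray:
  fixes A :: "'k \<Rightarrow> real \<Rightarrow> plane" and B :: "'m \<Rightarrow> real \<Rightarrow> plane"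
  assumes C: "card C = 3" "(\<Sum>k\<in>C. u k) = 0" "\<And>k. k \<in> C \<Longrightarrow> norm (u k) = 1"
    and A: "\<And>k. k \<in> C \<Longrightarrow> nearly_linear \<eta> (u k) 0 3 (A k)" "\<And>k. k \<in> C \<Longrightarrow> A k 0 = p"
    and C': "card C' = 3" "(\<Sum>m\<in>C'. v m) = 0" "\<And>m. m \<in> C' \<Longrightarrow> norm (v m) = 1"
    and B: "\<And>m. m \<in> C' \<Longrightarrow> nearly_linear \<eta> (v m) 0 3 (B m)" "\<And>m. m \<in> C' \<Longrightarrow> B m 0 = p'"
    and \<eta>: "0 < \<eta>" "\<eta> \<le> 1/100" and pp: "norm p \<le> \<eta>" "norm p' \<le> \<eta>"
    and nomeet: "\<And>k m s t. k \<in> C \<Longrightarrow> m \<in> C' \<Longrightarrow> s \<in> {0..3} \<Longrightarrow> t \<in> {0..3} \<Longrightarrow> A k s \<noteq> B m t"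
    and m: "m \<in> C'" "t \<in> {0..1}"
  shows "\<exists>k\<in>C. \<exists>N\<ge>0. norm (B m t - p - N *\<^sub>R u k) \<le> 6 * \<eta> * N"
proof -
  obtain k l \<alpha> \<beta> where kl: "k \<in> C" "l \<in> C" "k \<noteq> l" and ab: "0 \<le> \<alpha>" "0 \<le> \<beta>"
    and D: "B m t - p = \<alpha> *\<^sub>R u k + \<beta> *\<^sub>R u l"
    using triple_decomposition[OF C, of "B m t - p"] by metis
  have "\<alpha> \<le> 3 * \<eta> * (\<alpha> + \<beta>) \<or> \<beta> \<le> 3 * \<eta> * (\<alpha> + \<beta>)"
  proof (cases "0 < - (u k \<bullet> rot90 (u l))")
    case True
    show ?thesis
      by (rule triod_sector_oriented[where A=A and B=B and u=u and v=v and C=C and C'=C' and p=p and p'=p'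
            and k=k and l=l and m=m and t=t])
         (fact C A C' B \<eta> pp nomeet kl True m D ab)+
  next
    case False
    have sw: "u l \<bullet> rot90 (u k) = - (u k \<bullet> rot90 (u l))"
      using inner_rot90_swap[of "u k" "u l"] by (simp add: inner_commute)
    then have lk: "0 < - (u l \<bullet> rot90 (u k))" using triple_cross_nonzero[OF C kl] False by simp
    have D': "B m t - p = \<beta> *\<^sub>R u l + \<alpha> *\<^sub>R u k" using D by (simp add: add.commute)
    have "\<beta> \<le> 3 * \<eta> * (\<beta> + \<alpha>) \<or> \<alpha> \<le> 3 * \<eta> * (\<beta> + \<alpha>)"
      by (rule triod_sector_oriented[where A=A and B=B and u=u and v=v and C=C and C'=C' and p=p and p'=p'
            and k=l and l=k and m=m and t=t])
         (fact C A C' B \<eta> pp nomeet kl kl(3)[symmetric] lk m D' ab)+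
    then show ?thesis by (auto simp: add.commute)
  qed
  moreover have ray: "norm (B m t - p - (a + b) *\<^sub>R u i) \<le> 6 * \<eta> * (a + b)"
    if "B m t - p = a *\<^sub>R u i + b *\<^sub>R u j" "0 \<le> b" "i \<in> C" "j \<in> C" "b \<le> 3 * \<eta> * (a + b)" for a b i j
  proof -
    have "B m t - p - (a + b) *\<^sub>R u i = b *\<^sub>R (u j - u i)" unfolding that(1) by (simp add: algebra_simps)
    then have "norm (B m t - p - (a + b) *\<^sub>R u i) = b * norm (u j - u i)" using that(2) by simp
    also have "\<dots> \<le> b * 2" using norm_triangle_ineq4[of "u j" "u i"] C(3) that by (intro mult_left_mono) auto
    finally show ?thesis using that(5) by linarith
  qed
  ultimately show ?thesis
    using ray[OF D ab(2) kl(1,2)] ray[of \<beta> l \<alpha> k] D ab kl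
    by (metis add.commute add_nonneg_nonneg)
qed

lemma two_triods_meet:
  fixes A :: "'k \<Rightarrow> real \<Rightarrow> plane" and B :: "'m \<Rightarrow> real \<Rightarrow> plane"
  assumes C: "card C = 3" "(\<Sum>k\<in>C. u k) = 0" "\<And>k. k \<in> C \<Longrightarrow> norm (u k) = 1"
    and A: "\<And>k. k \<in> C \<Longrightarrow> nearly_linear \<eta> (u k) 0 3 (A k)" "\<And>k. k \<in> C \<Longrightarrow> A k 0 = p"
    and C': "card C' = 3" "(\<Sum>m\<in>C'. v m) = 0" "\<And>m. m \<in> C' \<Longrightarrow> norm (v m) = 1"
    and B: "\<And>m. m \<in> C' \<Longrightarrow> nearly_linear \<eta> (v m) 0 3 (B m)" "\<And>m. m \<in> C' \<Longrightarrow> B m 0 = p'"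
    and \<eta>: "0 < \<eta>" "\<eta> \<le> 1/100" and pp: "norm p \<le> \<eta>" "norm p' \<le> \<eta>" "p \<noteq> p'"
  shows "\<exists>k\<in>C. \<exists>m\<in>C'. \<exists>s\<in>{0..3}. \<exists>t\<in>{0..3}. A k s = B m t"
proof (rule ccontr)
  assume neg: "\<not> ?thesis"
  then have nomeet: "A k s \<noteq> B m t" and nomeet': "B m t \<noteq> A k s"
    if "k \<in> C" "m \<in> C'" "s \<in> {0..3}" "t \<in> {0..3}" for k m s t using that by (blast, metis)
  obtain k0 m0 where km: "k0 \<in> C" "m0 \<in> C'" using C(1) C'(1) by fastforce
  have "\<exists>k\<in>C. \<exists>N\<ge>0. norm (B m0 0 - p - N *\<^sub>R u k) \<le> 6 * \<eta> * N"
    by (rule triod_near_ray[OF C A C' B \<eta> pp(1,2) nomeet km(2)]) auto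
  then obtain k N where k: "k \<in> C" "0 \<le> N" "norm (p' - p - N *\<^sub>R u k) \<le> 6 * \<eta> * N" using B(2)[OF km(2)] by auto
  have "\<exists>m\<in>C'. \<exists>N\<ge>0. norm (A k0 0 - p' - N *\<^sub>R v m) \<le> 6 * \<eta> * N"
    by (rule triod_near_ray[OF C' B C A \<eta> pp(2,1) nomeet' km(1)]) auto
  then obtain m N' where m: "m \<in> C'" "0 \<le> N'" "norm (p - p' - N' *\<^sub>R v m) \<le> 6 * \<eta> * N'" using A(2)[OF km(1)] by auto
  have "\<exists>k\<in>C. \<exists>N\<ge>0. norm (B m 1 - p - N *\<^sub>R u k) \<le> 6 * \<eta> * N"
    by (rule triod_near_ray[OF C A C' B \<eta> pp(1,2) nomeet m(1)]) auto
  then obtain j M where j: "j \<in> C" "0 \<le> M" "norm (B m 1 - p - M *\<^sub>R u j) \<le> 6 * \<eta> * M" by auto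
  have N: "0 < N"
  proof (rule ccontr)
    assume "\<not> 0 < N" then have "N = 0" using k(2) by simp
    then show False using k(3) pp(3) by simp
  qed
  have "norm (B m 1 - p' - v m) \<le> \<eta>"
    using nearly_linear_start[OF B(1)[OF m(1)], of 1] B(2)[OF m(1)] by simp
  then have vm: "norm (B m 1 - p - v m) \<le> 3 * \<eta>"
    using norm_triangle_ineq[of "B m 1 - p' - v m" "p' - p"] norm_triangle_ineq4[of p' p] pp by (simp add: algebra_simps)
  have Mv: "norm (M *\<^sub>R u j - v m) \<le> 3 * \<eta> + 6 * \<eta> * M"
    using norm_triangle_ineq4[of "B m 1 - p - v m" "B m 1 - p - M *\<^sub>R u j"] vm j(3) by (simp add: algebra_simps)
  have nMu: "norm (M *\<^sub>R u j) = M" "norm (v m) = 1" using C(3)[OF j(1)] C'(3)[OF m(1)] j(2) by auto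
  have "M - 1 \<le> 3 * \<eta> + 6 * \<eta> * M" "1 - M \<le> 3 * \<eta> + 6 * \<eta> * M"
    using norm_triangle_ineq2[of "M *\<^sub>R u j" "v m"] norm_triangle_ineq2[of "v m" "M *\<^sub>R u j"] Mv nMu
    by (auto simp: norm_minus_commute)
  moreover have "6 * \<eta> * M \<le> 6 / 100 * M" using \<eta> j(2) by (intro mult_right_mono) auto
  ultimately have M: "M \<le> 11/10" "9/10 \<le> M" using \<eta> by linarith+
  have "6 * \<eta> * M \<le> 6 * \<eta> * (11/10)" using \<eta> M by (intro mult_left_mono) auto
  then have Mv': "norm (v m - M *\<^sub>R u j) \<le> 10 * \<eta>" unfolding norm_minus_commute[of "v m"] using Mv \<eta> by linarith
  have "N *\<^sub>R u k + (N' * M) *\<^sub>R u j = - (p' - p - N *\<^sub>R u k) - (p - p' - N' *\<^sub>R v m) - N' *\<^sub>R (v m - M *\<^sub>R u j)"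
    by (simp add: algebra_simps)
  also have "norm \<dots> \<le> norm (p' - p - N *\<^sub>R u k) + norm (p - p' - N' *\<^sub>R v m) + norm (N' *\<^sub>R (v m - M *\<^sub>R u j))"
    by (metis (no_types, opaque_lifting) add_right_mono norm_minus_cancel norm_triangle_ineq4 order_trans)
  also have "norm (N' *\<^sub>R (v m - M *\<^sub>R u j)) \<le> N' * (10 * \<eta>)" using Mv' m(2) by (simp add: mult_left_mono)
  finally have up: "norm (N *\<^sub>R u k + (N' * M) *\<^sub>R u j) \<le> 6 * \<eta> * N + 16 * \<eta> * N'" using k(3) m(3) by (simp add: algebra_simps)
  have NM: "0 \<le> N' * M" using m(2) j(2) by simp
  have low: "(N + N' * M) / 2 \<le> norm (N *\<^sub>R u k + (N' * M) *\<^sub>R u j)"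
  proof (cases "k = j")
    case True
    then have "N *\<^sub>R u k + (N' * M) *\<^sub>R u j = (N + N' * M) *\<^sub>R u k" by (simp add: algebra_simps)
    then have "norm (N *\<^sub>R u k + (N' * M) *\<^sub>R u j) = \<bar>N + N' * M\<bar>"
      by (simp only: norm_scaleR C(3)[OF k(1)] mult_1_right)
    moreover have "(N + q) / 2 \<le> \<bar>N + q\<bar>" if "0 \<le> q" for q using that N by simp
    ultimately show ?thesis using NM by metis
  next
    case False
    have kj: "u k \<bullet> u j = - 1/2" by (rule triple_inner[OF C k(1) j(1) False])
    have uu: "u k \<bullet> u k = 1" "u j \<bullet> u j = 1" using C(3) k j by (simp_all add: norm_eq_1[symmetric])
    have "norm (u k + u j) = 1"
      using kj by (simp add: norm_eq_1 inner_add_left inner_add_right inner_commute[of "u j" "u k"] uu)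
    moreover have "(N *\<^sub>R u k + (N' * M) *\<^sub>R u j) \<bullet> (u k + u j) = (N + N' * M) / 2"
      by (simp add: inner_add_left inner_add_right inner_commute[of "u j" "u k"] kj uu algebra_simps)
    ultimately show ?thesis using norm_cauchy_schwarz[of "N *\<^sub>R u k + (N' * M) *\<^sub>R u j" "u k + u j"] by simp
  qed
  have "6 * \<eta> * N \<le> 6 / 100 * N" "16 * \<eta> * N' \<le> 16 / 100 * N'"
    using mult_right_mono[of "6 * \<eta>" "6 / 100" N] mult_right_mono[of "16 * \<eta>" "16 / 100" N'] \<eta> N m(2) by linarith+
  moreover have "N' * (9/10) \<le> N' * M" using M(2) m(2) by (intro mult_left_mono) auto
  moreover have False if "a \<le> 6 / 100 * N" "b \<le> 16 / 100 * N'" "N' * (9/10) \<le> q" "x \<le> a + b" "(N + q) / 2 \<le> x"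
    for a b q x
  proof -
    have "100 * a \<le> 6 * N" "100 * b \<le> 16 * N'" "9 * N' \<le> 10 * q" "N + q \<le> 2 * x"
      using that by simp_all
    then show False using that(4) N m(2) by linarith
  qed
  ultimately show False using up low by blast
qed

lemma triple_direction:
  fixes w :: "'k \<Rightarrow> plane"
  assumes C: "card C = 3" "(\<Sum>k\<in>C. w k) = 0" "\<And>k. k \<in> C \<Longrightarrow> norm (w k) = 1" and a: "norm a = 1"
  shows "\<exists>k\<in>C. 1/2 \<le> a \<bullet> w k"
proof -
  obtain k l \<alpha> \<beta> where kl: "k \<in> C" "l \<in> C" "k \<noteq> l" and ab: "0 \<le> \<alpha>" "0 \<le> \<beta>" and D: "a = \<alpha> *\<^sub>R w k + \<beta> *\<^sub>R w l"
    using triple_decomposition[OF C, of a] by metis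
  have wkl: "w k \<bullet> w l = - 1/2" by (rule triple_inner[OF C kl])
  have ww: "w k \<bullet> w k = 1" "w l \<bullet> w l = 1" using C(3) kl by (simp_all add: norm_eq_1[symmetric])
  have i: "a \<bullet> w k = \<alpha> - \<beta> / 2" "a \<bullet> w l = \<beta> - \<alpha> / 2"
    by (simp_all add: D inner_add_left ww wkl inner_commute[of "w l" "w k"])
  have "a \<bullet> a = 1" using a by (simp add: norm_eq_1)
  then have one: "\<alpha> * (\<alpha> - \<beta> / 2) + \<beta> * (\<beta> - \<alpha> / 2) = 1"
    using i by (subst (asm) (2) D) (simp add: inner_add_right)
  show ?thesis
  proof (cases "\<beta> \<le> \<alpha>")
    case True
    have "\<beta> * \<beta> \<le> \<alpha> * \<beta>" using True ab by (intro mult_right_mono) auto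
    then have "1 \<le> \<alpha>\<^sup>2" using one by (simp add: algebra_simps power2_eq_square)
    then have "1 \<le> \<alpha>" using ab(1) by (metis one_power2 power2_le_imp_le)
    then show ?thesis using i(1) True kl(1) by (intro bexI[of _ k]) auto
  next
    case False
    have "\<alpha> * \<alpha> \<le> \<beta> * \<alpha>" using False ab by (intro mult_right_mono) auto
    then have "1 \<le> \<beta>\<^sup>2" using one by (simp add: algebra_simps power2_eq_square)
    then have "1 \<le> \<beta>" using ab(2) by (metis one_power2 power2_le_imp_le)
    then show ?thesis using i(2) False kl(2) by (intro bexI[of _ l]) auto
  qed
qed

lemma line_triod_meet:
  fixes B :: "'m \<Rightarrow> real \<Rightarrow> plane"
  assumes A: "nearly_linear \<eta> v (-3) 3 A" "norm (A 0) \<le> \<eta>" "norm v = 1"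
    and C: "card C = 3" "(\<Sum>m\<in>C. w m) = 0" "\<And>m. m \<in> C \<Longrightarrow> norm (w m) = 1"
    and B: "\<And>m. m \<in> C \<Longrightarrow> nearly_linear \<eta> (w m) 0 3 (B m)" "\<And>m. m \<in> C \<Longrightarrow> B m 0 = p"
    and \<eta>: "0 < \<eta>" "\<eta> \<le> 1/100" and p: "norm p \<le> \<eta>"
  shows "\<exists>m\<in>C. \<exists>s\<in>{-3..3}. \<exists>t\<in>{0..1}. A s = B m t"
proof (rule ccontr)
  assume neg: "\<not> ?thesis"
  have \<eta>': "0 \<le> \<eta>" "\<eta> \<le> 1/10" using \<eta> by auto
  note gA = line_graph[OF A \<eta>']
  have Ac: "continuous_on {-3..3} A" by (rule nearly_linear_continuous[OF A(1,3) \<eta>'(1)])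
  have Bt: "norm (B m t - p - t *\<^sub>R w m) \<le> \<eta>" if "m \<in> C" "t \<in> {0..1}" for m t
  proof -
    have "norm (B m t - p - t *\<^sub>R w m) \<le> \<eta> * t"
      using nearly_linear_start[OF B(1)[OF that(1)], of t] B(2)[OF that(1)] that(2) by simp
    also have "\<dots> \<le> \<eta> * 1" using that \<eta> by (intro mult_left_mono) auto
    finally show ?thesis by simp
  qed
  have strip: "\<bar>B m t \<bullet> v\<bar> \<le> 2" if m: "m \<in> C" "t \<in> {0..1}" for m t
  proof -
    have "norm (B m t) \<le> norm (B m t - p - t *\<^sub>R w m) + norm p + norm (t *\<^sub>R w m)"
      using norm_triangle_ineq[of "B m t - p - t *\<^sub>R w m" "p + t *\<^sub>R w m"] norm_triangle_ineq[of p "t *\<^sub>R w m"] by simp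
    also have "\<dots> \<le> 2" using Bt[OF m] C(3)[OF m(1)] m(2) p \<eta> by simp
    finally show ?thesis using inner_unit_le[OF A(3), of "B m t"] by linarith
  qed
  obtain m0 where m0: "m0 \<in> C" using C(1) by fastforce
  have "\<exists>s\<ge>-3. s \<le> 3 \<and> A s \<bullet> v = p \<bullet> v"
    using strip[OF m0, of 0] B(2)[OF m0] gA(2,3) by (intro IVT') (auto intro!: continuous_intros Ac)
  then obtain s where s: "s \<in> {-3..3}" "A s \<bullet> v = p \<bullet> v" by auto
  have "A s \<noteq> p" using neg s(1) m0 B(2)[OF m0] by force
  then have ne: "A s \<bullet> rot90 v \<noteq> p \<bullet> rot90 v"
    using s(2) plane_decomp[OF A(3), of "A s"] plane_decomp[OF A(3), of p] by auto
  define c where "c = sgn (p \<bullet> rot90 v - A s \<bullet> rot90 v)"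
  have c: "c = 1 \<or> c = -1" "0 < c * (p \<bullet> rot90 v - A s \<bullet> rot90 v)" using ne by (auto simp: c_def sgn_if)
  obtain m where m: "m \<in> C" "1/2 \<le> (- c *\<^sub>R rot90 v) \<bullet> w m"
    using triple_direction[OF C, of "- c *\<^sub>R rot90 v"] A(3) c(1) by auto
  have "\<exists>s\<in>{-3..3}. A s \<bullet> v = B m 1 \<bullet> v \<and> 0 < c * (B m 1 \<bullet> rot90 v - A s \<bullet> rot90 v)"
  proof (rule graph_side[where A=A and B="B m" and c=c and e=v and ?b1.0=0 and ?b2.0=1 and ?t0.0=0, OF Ac _ _ _ _ _ A(3) _ _ s(1)])
    show "A s \<bullet> v < A t \<bullet> v" if "-3 \<le> s" "s < t" "t \<le> 3" for s t using gA(1)[OF that] .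
    show "A (-3) \<bullet> v \<le> B m t \<bullet> v \<and> B m t \<bullet> v \<le> A 3 \<bullet> v" if "t \<in> {0..1}" for t
      using strip[OF m(1) that] gA(2,3) by linarith
    show "continuous_on {0..1} (B m)"
      by (rule continuous_on_subset[OF nearly_linear_continuous[OF B(1)[OF m(1)] C(3)[OF m(1)] \<eta>'(1)]]) auto
    show "A s \<noteq> B m t" if "s \<in> {-3..3}" "t \<in> {0..1}" for s t using neg m(1) that by blast
  qed (use s(2) c(2) B(2)[OF m(1)] in auto)
  then obtain r where r: "r \<in> {-3..3}" "0 < c * (B m 1 \<bullet> rot90 v - A r \<bullet> rot90 v)" by blast
  have "\<bar>B m 1 \<bullet> rot90 v - w m \<bullet> rot90 v\<bar> \<le> 2 * \<eta>"
    using inner_unit_le[of "rot90 v" "B m 1 - p - 1 *\<^sub>R w m"] Bt[OF m(1), of 1] inner_unit_le[of "rot90 v" p] p A(3)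
    by (simp add: inner_diff_left abs_le_iff)
  moreover have "1/2 \<le> - c * (w m \<bullet> rot90 v)" using m(2) by (simp add: inner_commute)
  ultimately show False using r(2) gA(4)[OF r(1)] c(1) \<eta> by auto
qed

section \<open>Convergence of arcs to straight lines\<close>

lemma vector_derivative_within_Icc:
  fixes f :: "real \<Rightarrow> 'a::euclidean_space"
  assumes "a < b" "x \<in> {a..b}" "(f has_vector_derivative f') (at x within {a..b})"
  shows "vector_derivative f (at x within {a..b}) = f'"
  using vector_derivative_within_cbox[of a b x f f'] assms by simp

lemma lebesgue_integral_continuous:
  fixes f :: "real \<Rightarrow> 'a::euclidean_space"
  assumes "continuous_on {a..b} f"
  shows "(LINT s|lebesgue_on {a..b}. f s) = integral {a..b} f"
  by (rule lebesgue_integral_eq_integral) (auto intro!: continuous_imp_integrable_real assms)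

lemma L2_on_continuous: "continuous_on {a..b} f \<Longrightarrow> L2_on a b f"
  unfolding L2_on_def
  by (intro conjI continuous_imp_integrable_real borel_measurable_integrable continuous_intros)

lemma weak_derivative_on_classical:
  assumes ab: "a < b" and f: "\<And>x. x \<in> {a..b} \<Longrightarrow> (f has_vector_derivative f' x) (at x within {a..b})"
    and f': "continuous_on {a..b} f'"
  shows "weak_derivative_on a b f f'"
  unfolding weak_derivative_on_def
proof (intro allI impI)
  fix \<psi> assume "test_function a b \<psi>"
  then obtain a' b' where sm: "smooth_fun \<psi>" and ab': "a < a'" "b' < b" and supp: "\<And>s. s \<notin> {a'..b'} \<Longrightarrow> \<psi> s = 0"
    unfolding test_function_def by blast
  have d: "(\<psi> has_real_derivative deriv \<psi> s) (at s)" for s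
    using sm[unfolded smooth_fun_def, rule_format, of 0 s] by (simp add: field_differentiable_derivI)
  have "deriv \<psi> field_differentiable at s" for s
    using sm[unfolded smooth_fun_def, rule_format, of 1 s] by simp
  then have cd: "continuous_on A (deriv \<psi>)" for A
    by (intro continuous_at_imp_continuous_on ballI field_differentiable_imp_continuous_at)
  have c\<psi>: "continuous_on A \<psi>" for A using d by (meson DERIV_isCont continuous_at_imp_continuous_on)
  have cf: "continuous_on {a..b} f" using f by (rule continuous_on_vector_derivative)
  have "((\<lambda>s. \<psi> s *\<^sub>R f' s + deriv \<psi> s *\<^sub>R f s) has_integral \<psi> b *\<^sub>R f b - \<psi> a *\<^sub>R f a) {a..b}"
    by (rule fundamental_theorem_of_calculus)
       (use ab in \<open>auto intro!: has_vector_derivative_scaleR f has_field_derivative_at_within[OF d]\<close>)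
  moreover have "\<psi> a = 0" "\<psi> b = 0" using supp ab' by auto
  ultimately have "integral {a..b} (\<lambda>s. \<psi> s *\<^sub>R f' s + deriv \<psi> s *\<^sub>R f s) = 0" by (simp add: integral_unique)
  then have "integral {a..b} (\<lambda>s. \<psi> s *\<^sub>R f' s) + integral {a..b} (\<lambda>s. deriv \<psi> s *\<^sub>R f s) = 0"
    by (subst (asm) integral_add)
       (auto intro!: integrable_continuous_real continuous_intros cf f' cd c\<psi>)
  moreover have "(LINT s|lebesgue_on {a..b}. deriv \<psi> s *\<^sub>R f s) = integral {a..b} (\<lambda>s. deriv \<psi> s *\<^sub>R f s)"
    "(LINT s|lebesgue_on {a..b}. \<psi> s *\<^sub>R f' s) = integral {a..b} (\<lambda>s. \<psi> s *\<^sub>R f' s)"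
    by (intro lebesgue_integral_continuous continuous_intros cf f' cd c\<psi>)+
  ultimately show "(LINT s|lebesgue_on {a..b}. deriv \<psi> s *\<^sub>R f s) = - (LINT s|lebesgue_on {a..b}. \<psi> s *\<^sub>R f' s)"
    by (simp add: eq_neg_iff_add_eq_0 add.commute)
qed

definition C2_arc :: "real \<Rightarrow> real \<Rightarrow> (real \<Rightarrow> plane) \<Rightarrow> (real \<Rightarrow> plane) \<Rightarrow> (real \<Rightarrow> plane) \<Rightarrow> bool" where
  "C2_arc a b F F1 F2 \<longleftrightarrow> continuous_on {a..b} F2 \<and>
     (\<forall>s\<in>{a..b}. (F has_vector_derivative F1 s) (at s within {a..b}) \<and>
        (F1 has_vector_derivative F2 s) (at s within {a..b}))"

lemma C2_arcD:
  assumes "C2_arc a b F F1 F2"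
  shows "continuous_on {a..b} F" "continuous_on {a..b} F1" "continuous_on {a..b} F2"
    "\<And>s. s \<in> {a..b} \<Longrightarrow> (F has_vector_derivative F1 s) (at s within {a..b})"
    "\<And>s. s \<in> {a..b} \<Longrightarrow> (F1 has_vector_derivative F2 s) (at s within {a..b})"
  using assms unfolding C2_arc_def by (auto intro!: continuous_on_vector_derivative)

lemma W22_on_C2_arc:
  assumes "a < b" "C2_arc a b F F1 F2" shows "W22_on a b F F1 F2"
  unfolding W22_on_def
  by (intro conjI L2_on_continuous weak_derivative_on_classical C2_arcD[OF assms(2)] assms(1))

lemma C2_arc_line: "C2_arc a b (\<lambda>s. s *\<^sub>R v) (\<lambda>_. v) (\<lambda>_. 0)"
  unfolding C2_arc_def by (auto intro!: derivative_eq_intros)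

text \<open>An \<open>L\<^sup>2\<close> bound on the second derivative makes the first derivative Hoelder
  continuous with exponent \<open>1/2\<close>, which leaves room for a small factor at exponents below.\<close>

lemma C2_arc_variation:
  assumes F: "C2_arc a b F F1 F2" and k: "integral {a..b} (\<lambda>s. (norm (F2 s))\<^sup>2) \<le> k"
    and st: "s \<in> {a..b}" "t \<in> {a..b}"
  shows "norm (F1 t - F1 s) \<le> sqrt (\<bar>t - s\<bar> * k)"
proof -
  have *: "norm (F1 t - F1 s) \<le> sqrt ((t - s) * k)" if st: "s \<in> {a..b}" "t \<in> {a..b}" "s \<le> t" for s t
  proof -
    have sub: "{s..t} \<subseteq> {a..b}" using st by auto
    have c: "continuous_on {s..t} F2" by (rule continuous_on_subset[OF C2_arcD(3)[OF F] sub])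
    have "norm (F1 t - F1 s) \<le> integral {s..t} (\<lambda>r. norm (F2 r))"
    proof (rule FTC_norm_bound[OF st(3)])
      show "(F1 has_vector_derivative F2 r) (at r within {s..t})" if "r \<in> {s..t}" for r
        using has_vector_derivative_within_subset[OF C2_arcD(5)[OF F] sub] that sub by blast
    qed (auto intro!: continuous_intros c)
    also have "\<dots> \<le> sqrt ((t - s) * k)"
    proof (rule real_le_rsqrt)
      have "(integral {s..t} (\<lambda>r. norm (F2 r)))\<^sup>2 \<le> (t - s) * integral {s..t} (\<lambda>r. (norm (F2 r))\<^sup>2)"
        by (rule integral_norm_squared_bound[OF c st(3)])
      also have "integral {s..t} (\<lambda>r. (norm (F2 r))\<^sup>2) \<le> integral {a..b} (\<lambda>r. (norm (F2 r))\<^sup>2)"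
        by (rule integral_subset_le[OF sub])
           (auto intro!: integrable_continuous_real continuous_intros c C2_arcD(3)[OF F])
      also note k
      finally show "(integral {s..t} (\<lambda>r. norm (F2 r)))\<^sup>2 \<le> (t - s) * k" using st(3) by (simp add: mult_left_mono)
    qed
    finally show ?thesis .
  qed
  show ?thesis using *[OF st] *[OF st(2,1)] by (cases "s \<le> t") (auto simp: norm_minus_commute)
qed

lemma sqrt_le_powr:
  assumes "0 < \<alpha>" "\<alpha> < 1/2" "0 \<le> x" "x \<le> d"
  shows "sqrt x \<le> d powr (1/2 - \<alpha>) * x powr \<alpha>"
proof (cases "x = 0")
  case False
  then have x: "0 < x" using assms by simp
  have "sqrt x = x powr (1/2)" using x by (simp add: powr_half_sqrt)
  also have "\<dots> = x powr (1/2 - \<alpha>) * x powr \<alpha>" by (simp add: powr_add[symmetric])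
  also have "\<dots> \<le> d powr (1/2 - \<alpha>) * x powr \<alpha>"
    using assms x by (intro mult_right_mono powr_mono2) auto
  finally show ?thesis .
qed simp

lemma integral_norm_squared_le:
  fixes f :: "real \<Rightarrow> plane"
  assumes ab: "a \<le> b" and f: "continuous_on {a..b} f" and le: "\<And>s. s \<in> {a..b} \<Longrightarrow> norm (f s) \<le> d"
  shows "L2_norm_on a b f \<le> sqrt (b - a) * d"
proof -
  have d: "0 \<le> d" using le[of a] ab norm_ge_zero order_trans by (metis atLeastAtMost_iff order_refl)
  have "(LINT s|lebesgue_on {a..b}. (norm (f s))\<^sup>2) = integral {a..b} (\<lambda>s. (norm (f s))\<^sup>2)"
    by (intro lebesgue_integral_continuous continuous_intros f)
  also have "\<dots> \<le> integral {a..b} (\<lambda>s. d\<^sup>2)"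
    by (rule integral_le) (auto intro!: integrable_continuous_real continuous_intros f power_mono le)
  also have "\<dots> = (b - a) * d\<^sup>2" using ab by simp
  finally show ?thesis unfolding L2_norm_on_def using d by (metis real_sqrt_le_mono real_sqrt_mult real_sqrt_abs abs_of_nonneg)
qed

lemma arcs_converge_to_line:
  fixes F F1 F2 :: "nat \<Rightarrow> real \<Rightarrow> plane"
  assumes ab: "a \<le> 0" "0 \<le> b" "a < b" and \<alpha>: "0 < \<alpha>" "\<alpha> < 1/2"
    and F: "\<forall>\<^sub>F j in sequentially. C2_arc a b (F j) (F1 j) (F2 j)"
    and F0: "(\<lambda>j. F j 0) \<longlonglongrightarrow> 0" and F10: "(\<lambda>j. F1 j 0) \<longlonglongrightarrow> v"
    and small: "\<And>\<epsilon>. 0 < \<epsilon> \<Longrightarrow> \<forall>\<^sub>F j in sequentially. integral {a..b} (\<lambda>s. (norm (F2 j s))\<^sup>2) \<le> \<epsilon>"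
  shows "C1_hoelder_tendsto \<alpha> a b F (\<lambda>s. s *\<^sub>R v)" "W22_tendsto a b F (\<lambda>s. s *\<^sub>R v)"
    "\<And>\<epsilon>. 0 < \<epsilon> \<Longrightarrow> \<forall>\<^sub>F j in sequentially. \<forall>s\<in>{a..b}. norm (F j s - s *\<^sub>R v) \<le> \<epsilon>"
proof -
  define d where "d = b - a"
  have d: "0 < d" using ab by (simp add: d_def)
  have close: "\<forall>\<^sub>F j in sequentially. C2_arc a b (F j) (F1 j) (F2 j) \<and>
      (\<forall>s\<in>{a..b}. norm (F j s - s *\<^sub>R v) \<le> \<epsilon> \<and> norm (F1 j s - v) \<le> \<epsilon>) \<and>
      (\<forall>s\<in>{a..b}. \<forall>t\<in>{a..b}. norm (F1 j s - F1 j t) \<le> \<epsilon> * \<bar>s - t\<bar> powr \<alpha>) \<and>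
      integral {a..b} (\<lambda>s. (norm (F2 j s))\<^sup>2) \<le> \<epsilon>\<^sup>2" if \<epsilon>: "0 < \<epsilon>" for \<epsilon>
  proof -
    define \<delta> where "\<delta> = \<epsilon> / (2 * (1 + d))"
    have \<delta>: "0 < \<delta>" "\<delta> * (2 * (1 + d)) = \<epsilon>" using \<epsilon> d by (simp_all add: \<delta>_def)
    define p where "p = d powr (1/2 - \<alpha>)"
    have p: "0 < p" using d by (simp add: p_def)
    define k where "k = min (\<epsilon>\<^sup>2) (min (\<delta>\<^sup>2 / d) ((\<epsilon> / p)\<^sup>2))"
    have k: "0 < k" "k \<le> \<epsilon>\<^sup>2" "k \<le> \<delta>\<^sup>2 / d" "k \<le> (\<epsilon> / p)\<^sup>2" using \<epsilon> \<delta> d p by (simp_all add: k_def)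
    have 0: "\<forall>\<^sub>F j in sequentially. norm (F j 0) < \<delta>" "\<forall>\<^sub>F j in sequentially. norm (F1 j 0 - v) < \<delta>"
      using tendstoD[OF F0 \<delta>(1)] tendstoD[OF F10 \<delta>(1)] by (simp_all add: dist_norm)
    from F 0 small[OF k(1)] show ?thesis
    proof eventually_elim
      case (elim j)
      note var = C2_arc_variation[OF elim(1) elim(4)]
      have z: "0 \<in> {a..b}" using ab by simp
      have F1: "norm (F1 j s - v) \<le> 2 * \<delta>" if s: "s \<in> {a..b}" for s
      proof -
        have "norm (F1 j s - F1 j 0) \<le> sqrt (\<bar>s - 0\<bar> * k)" by (rule var[OF z s])
        also have "\<dots> \<le> sqrt (d * (\<delta>\<^sup>2 / d))"
          using s z k d by (intro real_sqrt_le_mono mult_mono) (auto simp: d_def)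
        also have "\<dots> = \<delta>" using d \<delta> by simp
        finally show ?thesis using elim(3) norm_triangle_ineq[of "F1 j s - F1 j 0" "F1 j 0 - v"] by simp
      qed
      have FF: "norm (F j s - s *\<^sub>R v) \<le> \<delta> * (2 * (1 + d))" if s: "s \<in> {a..b}" for s
      proof -
        have dG: "((\<lambda>s. F j s - s *\<^sub>R v) has_vector_derivative F1 j r - v) (at r within {a..b})" if "r \<in> {a..b}" for r
          using has_vector_derivative_diff[OF C2_arcD(4)[OF elim(1) that] C2_arcD(4)[OF C2_arc_line that]] .
        have "norm ((F j s - s *\<^sub>R v) - (F j 0 - 0 *\<^sub>R v)) \<le> (2 * \<delta>) * norm (s - 0)"
        proof (rule differentiable_bound[OF convex_real_interval(5), of a b _ "\<lambda>r t. t *\<^sub>R (F1 j r - v)"])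
          fix r assume r: "r \<in> {a..b}"
          show "((\<lambda>s. F j s - s *\<^sub>R v) has_derivative (\<lambda>t. t *\<^sub>R (F1 j r - v))) (at r within {a..b})"
            using dG[OF r] by (simp add: has_vector_derivative_def)
          show "onorm (\<lambda>t. t *\<^sub>R (F1 j r - v)) \<le> 2 * \<delta>"
          proof (rule onorm_bound)
            show "norm (t *\<^sub>R (F1 j r - v)) \<le> 2 * \<delta> * norm t" for t :: real
              using mult_left_mono[OF F1[OF r], of "\<bar>t\<bar>"] by (simp add: mult.commute)
          qed (use \<delta> in simp)
        qed (use s z in auto)
        also have "\<dots> \<le> (2 * \<delta>) * d" using s z \<delta> by (intro mult_left_mono) (auto simp: d_def)
        finally show ?thesis
          using elim(2) norm_triangle_sub[of "F j s - s *\<^sub>R v" "F j 0"] \<delta>(1) by (simp add: algebra_simps)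
      qed
      have "norm (F1 j s - F1 j t) \<le> \<epsilon> * \<bar>s - t\<bar> powr \<alpha>" if st: "s \<in> {a..b}" "t \<in> {a..b}" for s t
      proof -
        have "norm (F1 j s - F1 j t) \<le> sqrt (\<bar>s - t\<bar> * k)" by (rule var[OF st(2,1)])
        also have "\<dots> = sqrt k * sqrt \<bar>s - t\<bar>" by (simp add: real_sqrt_mult)
        also have "\<dots> \<le> (\<epsilon> / p) * (p * \<bar>s - t\<bar> powr \<alpha>)"
        proof (rule mult_mono)
          show "sqrt k \<le> \<epsilon> / p" using real_sqrt_le_mono[OF k(4)] \<epsilon> p by simp
          show "sqrt \<bar>s - t\<bar> \<le> p * \<bar>s - t\<bar> powr \<alpha>"
            unfolding p_def using st by (intro sqrt_le_powr \<alpha>) (auto simp: d_def)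
        qed (use \<epsilon> p in auto)
        finally show ?thesis using p by simp
      qed
      moreover have "2 * \<delta> \<le> \<epsilon>" using \<delta> d mult_left_mono[of 1 "1 + d" "2 * \<delta>"] by (simp add: algebra_simps)
      then have "norm (F1 j s - v) \<le> \<epsilon>" if "s \<in> {a..b}" for s using F1[OF that] by linarith
      moreover have "integral {a..b} (\<lambda>s. (norm (F2 j s))\<^sup>2) \<le> \<epsilon>\<^sup>2" using elim(4) k(2) by linarith
      ultimately show ?case using elim(1) FF unfolding \<delta>(2) by blast
    qed
  qed
  have vd: "vector_derivative (F j) (at s within {a..b}) = F1 j s" if "C2_arc a b (F j) (F1 j) (F2 j)" "s \<in> {a..b}" for j s
    by (rule vector_derivative_within_Icc[OF ab(3) that(2) C2_arcD(4)[OF that]])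
  have vdl: "vector_derivative (\<lambda>s. s *\<^sub>R v) (at s within {a..b}) = v" if "s \<in> {a..b}" for s
    by (rule vector_derivative_within_Icc[OF ab(3) that C2_arcD(4)[OF C2_arc_line that]])
  have hl: "C1_hoelder_on \<alpha> a b (\<lambda>s. s *\<^sub>R v)"
    unfolding C1_hoelder_on_def C1_on_def
    using C2_arcD(2,4)[OF C2_arc_line[of a b v]]
    by (intro conjI exI[of _ "\<lambda>_. v"] exI[of _ "0::real"]) (auto simp: vdl)
  show "C1_hoelder_tendsto \<alpha> a b F (\<lambda>s. s *\<^sub>R v)"
    unfolding C1_hoelder_tendsto_def
  proof (intro conjI hl allI impI)
    show "\<forall>\<^sub>F j in sequentially. C1_hoelder_on \<alpha> a b (F j)"
      using close[of 1]
    proof (rule eventually_mono)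
      fix j assume j: "C2_arc a b (F j) (F1 j) (F2 j) \<and>
        (\<forall>s\<in>{a..b}. norm (F j s - s *\<^sub>R v) \<le> 1 \<and> norm (F1 j s - v) \<le> 1) \<and>
        (\<forall>s\<in>{a..b}. \<forall>t\<in>{a..b}. norm (F1 j s - F1 j t) \<le> 1 * \<bar>s - t\<bar> powr \<alpha>) \<and>
        integral {a..b} (\<lambda>s. (norm (F2 j s))\<^sup>2) \<le> 1\<^sup>2"
      then have C: "C2_arc a b (F j) (F1 j) (F2 j)" by blast
      show "C1_hoelder_on \<alpha> a b (F j)"
        unfolding C1_hoelder_on_def C1_on_def
        using C2_arcD(2,4)[OF C] j
        by (intro conjI exI[of _ "F1 j"] exI[of _ "1::real"]) (auto simp: vd[OF C])
    qed simp
    fix \<epsilon> :: real assume "0 < \<epsilon>"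
    from close[OF this]
    show "\<forall>\<^sub>F j in sequentially. let D = (\<lambda>s. vector_derivative (F j) (at s within {a..b})
                     - vector_derivative (\<lambda>s. s *\<^sub>R v) (at s within {a..b}))
        in (\<forall>s\<in>{a..b}. norm (F j s - s *\<^sub>R v) \<le> \<epsilon> \<and> norm (D s) \<le> \<epsilon>) \<and>
           (\<forall>s\<in>{a..b}. \<forall>s'\<in>{a..b}. norm (D s - D s') \<le> \<epsilon> * \<bar>s - s'\<bar> powr \<alpha>)"
    proof (rule eventually_mono)
      fix j assume j: "C2_arc a b (F j) (F1 j) (F2 j) \<and>
      (\<forall>s\<in>{a..b}. norm (F j s - s *\<^sub>R v) \<le> \<epsilon> \<and> norm (F1 j s - v) \<le> \<epsilon>) \<and>
      (\<forall>s\<in>{a..b}. \<forall>t\<in>{a..b}. norm (F1 j s - F1 j t) \<le> \<epsilon> * \<bar>s - t\<bar> powr \<alpha>) \<and>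
      integral {a..b} (\<lambda>s. (norm (F2 j s))\<^sup>2) \<le> \<epsilon>\<^sup>2"
      then have C: "C2_arc a b (F j) (F1 j) (F2 j)" by blast
      show "let D = (\<lambda>s. vector_derivative (F j) (at s within {a..b})
                     - vector_derivative (\<lambda>s. s *\<^sub>R v) (at s within {a..b}))
        in (\<forall>s\<in>{a..b}. norm (F j s - s *\<^sub>R v) \<le> \<epsilon> \<and> norm (D s) \<le> \<epsilon>) \<and>
           (\<forall>s\<in>{a..b}. \<forall>s'\<in>{a..b}. norm (D s - D s') \<le> \<epsilon> * \<bar>s - s'\<bar> powr \<alpha>)"
        using j by (auto simp: Let_def vd[OF C] vdl)
    qed
  qed
  show "\<forall>\<^sub>F j in sequentially. \<forall>s\<in>{a..b}. norm (F j s - s *\<^sub>R v) \<le> \<epsilon>" if "0 < \<epsilon>" for \<epsilon>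
    using close[OF that] by (rule eventually_mono) blast
  have tendsto0: "x \<longlonglongrightarrow> 0" if "\<And>\<epsilon>. 0 < \<epsilon> \<Longrightarrow> \<forall>\<^sub>F j in sequentially. x j \<le> (sqrt d + 1) * \<epsilon>" "\<And>j. 0 \<le> x j"
    for x :: "nat \<Rightarrow> real"
  proof (rule tendstoI)
    fix e :: real assume e: "0 < e"
    have q: "0 < sqrt d + 1" using d by (simp add: add_pos_pos)
    have "\<forall>\<^sub>F j in sequentially. x j \<le> (sqrt d + 1) * (e / (2 * (sqrt d + 1)))" by (rule that(1)) (use e q in simp)
    then show "\<forall>\<^sub>F j in sequentially. dist (x j) 0 < e"
    proof (rule eventually_mono)
      fix j assume "x j \<le> (sqrt d + 1) * (e / (2 * (sqrt d + 1)))"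
      moreover have "w * (e / (2 * w)) = e / 2" if "0 < w" for w using that by simp
      note this[OF q]
      ultimately have "x j \<le> e / 2" by (simp only:)
      then show "dist (x j) 0 < e" using that(2)[of j] e by simp
    qed
  qed
  have L2pos: "0 \<le> L2_norm_on a b f" for f
    by (simp add: L2_norm_on_def Bochner_Integration.integral_nonneg)
  have mono: "sqrt (b - a) * \<epsilon> \<le> (sqrt d + 1) * \<epsilon>" "\<epsilon> \<le> (sqrt d + 1) * \<epsilon>" if "0 < \<epsilon>" for \<epsilon>
    using that d by (simp_all add: d_def algebra_simps)
  show "W22_tendsto a b F (\<lambda>s. s *\<^sub>R v)"
    unfolding W22_tendsto_def
  proof (intro exI conjI)
    show "W22_on a b (\<lambda>s. s *\<^sub>R v) (\<lambda>_. v) (\<lambda>_. 0)" by (rule W22_on_C2_arc[OF ab(3) C2_arc_line])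
    show "\<forall>\<^sub>F j in sequentially. W22_on a b (F j) (F1 j) (F2 j)"
      using F by (rule eventually_mono) (rule W22_on_C2_arc[OF ab(3)])
    show "(\<lambda>j. L2_norm_on a b (\<lambda>s. F j s - s *\<^sub>R v)) \<longlonglongrightarrow> 0"
    proof (rule tendsto0[OF _ L2pos])
      fix \<epsilon> :: real assume e: "0 < \<epsilon>"
      show "\<forall>\<^sub>F j in sequentially. L2_norm_on a b (\<lambda>s. F j s - s *\<^sub>R v) \<le> (sqrt d + 1) * \<epsilon>"
        using close[OF e]
      proof eventually_elim
        case (elim j)
        have "L2_norm_on a b (\<lambda>s. F j s - s *\<^sub>R v) \<le> sqrt (b - a) * \<epsilon>"
        proof (rule integral_norm_squared_le)
          have "C2_arc a b (F j) (F1 j) (F2 j)" using elim by blast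
          from C2_arcD(1)[OF this] show "continuous_on {a..b} (\<lambda>s. F j s - s *\<^sub>R v)" by (intro continuous_intros)
        qed (use elim ab in auto)
        then show ?case using mono(1)[OF e] by linarith
      qed
    qed
    show "(\<lambda>j. L2_norm_on a b (\<lambda>s. F1 j s - v)) \<longlonglongrightarrow> 0"
    proof (rule tendsto0[OF _ L2pos])
      fix \<epsilon> :: real assume e: "0 < \<epsilon>"
      show "\<forall>\<^sub>F j in sequentially. L2_norm_on a b (\<lambda>s. F1 j s - v) \<le> (sqrt d + 1) * \<epsilon>"
        using close[OF e]
      proof eventually_elim
        case (elim j)
        have "L2_norm_on a b (\<lambda>s. F1 j s - v) \<le> sqrt (b - a) * \<epsilon>"
        proof (rule integral_norm_squared_le)
          have "C2_arc a b (F j) (F1 j) (F2 j)" using elim by blast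
          from C2_arcD(2)[OF this] show "continuous_on {a..b} (\<lambda>s. F1 j s - v)" by (intro continuous_intros)
        qed (use elim ab in auto)
        then show ?case using mono(1)[OF e] by linarith
      qed
    qed
    show "(\<lambda>j. L2_norm_on a b (\<lambda>s. F2 j s - 0)) \<longlonglongrightarrow> 0"
    proof (rule tendsto0[OF _ L2pos])
      fix \<epsilon> :: real assume e: "0 < \<epsilon>"
      show "\<forall>\<^sub>F j in sequentially. L2_norm_on a b (\<lambda>s. F2 j s - 0) \<le> (sqrt d + 1) * \<epsilon>"
        using close[OF e]
      proof eventually_elim
        case (elim j)
        have "(LINT s|lebesgue_on {a..b}. (norm (F2 j s - 0))\<^sup>2) = integral {a..b} (\<lambda>s. (norm (F2 j s - 0))\<^sup>2)"
          by (intro lebesgue_integral_continuous continuous_intros C2_arcD(3)) (use elim in blast)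
        then have "L2_norm_on a b (\<lambda>s. F2 j s - 0) \<le> sqrt (\<epsilon>\<^sup>2)"
          unfolding L2_norm_on_def using elim by (intro real_sqrt_le_mono) simp
        moreover have "sqrt (\<epsilon>\<^sup>2) = \<epsilon>" using e by simp
        ultimately show ?case using mono(2)[OF e] by linarith
      qed
    qed
  qed
qed

section \<open>Sequences of networks with vanishing shrinker defect\<close>

lemma finite_ball_eventually:
  assumes "\<And>i. i < n \<Longrightarrow> eventually (P i) F"
  shows "\<forall>\<^sub>F x in F. \<forall>i<(n::nat). P i x"
proof -
  have "\<forall>\<^sub>F x in F. \<forall>i\<in>{..<n}. P i x"
    by (rule eventually_ball_finite) (use assms in auto)
  then show ?thesis by (rule eventually_mono) auto
qed

locale slices =
  fixes n :: nat and g g1 g2 :: "nat \<Rightarrow> nat \<Rightarrow> real \<Rightarrow> plane" and l :: "nat \<Rightarrow> nat \<Rightarrow> real"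
    and \<psi> :: "nat \<Rightarrow> nat \<Rightarrow> real \<Rightarrow> real" and C :: real
  assumes C2: "\<And>j i. i < n \<Longrightarrow> C2_data (g j i) (g1 j i) (g2 j i)"
    and param: "\<And>j i. i < n \<Longrightarrow> arclength_param (g j i) (l j i) (\<psi> j i)"
    and us: "\<And>j i. i < n \<Longrightarrow> unit_speed (l j i) (\<lambda>s. g j i (\<psi> j i s)) (\<lambda>s. unit_tangent (g j i) (\<psi> j i s))
       (\<lambda>s. curvature_vector (g j i) (\<psi> j i s))"
    and arc_int: "\<And>j i F. i < n \<Longrightarrow> continuous_on {0..1} F \<Longrightarrow>
       integral {0..l j i} (\<lambda>s. F (\<psi> j i s)) = arc_integral (g j i) F"
    and embedded: "\<And>j i i' x x'. i < n \<Longrightarrow> i' < n \<Longrightarrow> x \<in> {0..1} \<Longrightarrow> x' \<in> {0..1} \<Longrightarrow> g j i x = g j i' x' \<Longrightarrow>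
       (i = i' \<and> x = x') \<or> (x \<in> {0, 1} \<and> x' \<in> {0, 1})"
    and long: "\<And>i. i < n \<Longrightarrow> filterlim (\<lambda>j. l j i) at_top sequentially"
    and wide: "\<And>j. (\<Sum>i<n. wide_gaussian_length (g j i)) \<le> C"
    and defect: "(\<lambda>j. \<Sum>i<n. shrinker_energy (g j i)) \<longlonglongrightarrow> 0"
begin

abbreviation (input) "G j i s \<equiv> g j i (\<psi> j i s)"
abbreviation (input) "U j i s \<equiv> unit_tangent (g j i) (\<psi> j i s)"
abbreviation (input) "K j i s \<equiv> curvature_vector (g j i) (\<psi> j i s)"

lemma l_pos: "i < n \<Longrightarrow> 0 < l j i"
  using param unfolding arclength_param_def by blast

lemma \<psi>_range: "i < n \<Longrightarrow> s \<in> {0..l j i} \<Longrightarrow> \<psi> j i s \<in> {0..1}"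
  using param[of i j] unfolding arclength_param_def by blast

lemma \<psi>_inj: "i < n \<Longrightarrow> s \<in> {0..l j i} \<Longrightarrow> t \<in> {0..l j i} \<Longrightarrow> \<psi> j i s = \<psi> j i t \<longleftrightarrow> s = t"
  using param[of i j] strict_mono_on_eqD unfolding arclength_param_def by metis

lemma \<psi>_ends: "i < n \<Longrightarrow> \<psi> j i 0 = 0" "i < n \<Longrightarrow> \<psi> j i (l j i) = 1"
  using param[of i j] unfolding arclength_param_def by auto

lemma \<psi>_end_iff: "i < n \<Longrightarrow> s \<in> {0..l j i} \<Longrightarrow> \<psi> j i s \<in> {0, 1} \<longleftrightarrow> s = 0 \<or> s = l j i"
  using \<psi>_inj[of i s j 0] \<psi>_inj[of i s j "l j i"] \<psi>_ends[of i j] l_pos[of i j] by auto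

lemma orth: "i < n \<Longrightarrow> s \<in> {0..l j i} \<Longrightarrow> K j i s \<bullet> U j i s = 0"
  by (rule C2_curvature_orthogonal[OF C2 \<psi>_range])

lemma embedded_arclength:
  assumes "i < n" "i' < n" "s \<in> {0..l j i}" "s' \<in> {0..l j i'}" "G j i s = G j i' s'"
  shows "(i = i' \<and> s = s') \<or> ((s = 0 \<or> s = l j i) \<and> (s' = 0 \<or> s' = l j i'))"
  using embedded[OF assms(1,2) \<psi>_range[OF assms(1,3)] \<psi>_range[OF assms(2,4)] assms(5)]
    \<psi>_inj[OF assms(1,3)] \<psi>_end_iff[OF assms(1,3)] \<psi>_end_iff[OF assms(2,4)] assms by metis

lemma integral_weight:
  assumes "i < n"
  shows "integral {0..l j i} (\<lambda>s. exp (- (norm (G j i s))\<^sup>2 / 4)) = wide_gaussian_length (g j i)"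
    "integral {0..l j i} (\<lambda>s. exp (- (norm (G j i s))\<^sup>2 / 2)) = gaussian_length (g j i)"
    "integral {0..l j i} (\<lambda>s. exp (- (norm (G j i s))\<^sup>2 / 2) * ((K j i s + G j i s) \<bullet> rot90 (U j i s))\<^sup>2) =
     shrinker_energy (g j i)"
proof -
  have c: "continuous_on {0..1} (g j i)" "continuous_on {0..1} (curvature_vector (g j i))"
    "continuous_on {0..1} (unit_normal (g j i))"
    using C2_continuous(1)[OF C2[OF assms]] C2_continuous_curvature[OF C2[OF assms]]
      bounded_linear.continuous_on[OF bounded_linear_rot90 C2_continuous_unit_tangent[OF C2[OF assms]]]
    by (auto simp: unit_normal_def[abs_def])
  show "integral {0..l j i} (\<lambda>s. exp (- (norm (G j i s))\<^sup>2 / 4)) = wide_gaussian_length (g j i)"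
    "integral {0..l j i} (\<lambda>s. exp (- (norm (G j i s))\<^sup>2 / 2)) = gaussian_length (g j i)"
    by (rule arc_int[OF assms, of "\<lambda>x. exp (- (norm (g j i x))\<^sup>2 / 4)"]
        arc_int[OF assms, of "\<lambda>x. exp (- (norm (g j i x))\<^sup>2 / 2)"]; intro continuous_intros c; simp)+
  show "integral {0..l j i} (\<lambda>s. exp (- (norm (G j i s))\<^sup>2 / 2) * ((K j i s + G j i s) \<bullet> rot90 (U j i s))\<^sup>2) =
     shrinker_energy (g j i)"
    using arc_int[OF assms, of "\<lambda>x. exp (- (norm (g j i x))\<^sup>2 / 2) *
        ((curvature_vector (g j i) x + g j i x) \<bullet> unit_normal (g j i) x)\<^sup>2" j]
    unfolding unit_normal_def by (simp add: continuous_intros c[unfolded unit_normal_def[abs_def]])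
qed

lemma arc_integral_nonneg: "(\<And>x. x \<in> {0..1} \<Longrightarrow> 0 \<le> F x) \<Longrightarrow> 0 \<le> arc_integral h F"
  unfolding arc_integral_def by (rule Bochner_Integration.integral_nonneg) auto

lemma wide_single:
  assumes "i < n" shows "integral {0..l j i} (\<lambda>s. exp (- (norm (G j i s))\<^sup>2 / 4)) \<le> C"
proof -
  have "wide_gaussian_length (g j i)
     \<le> (\<Sum>i<n. wide_gaussian_length (g j i))"
    by (rule member_le_sum) (use assms in \<open>auto intro!: arc_integral_nonneg\<close>)
  then show ?thesis using wide[of j] by (simp only: integral_weight(1)[OF assms])
qed

lemma C_nonneg: "0 \<le> C"
  using wide[of 0] sum_nonneg[of "{..<n}" "\<lambda>i. wide_gaussian_length (g 0 i)"]
  by (force intro: arc_integral_nonneg)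

lemma defect_eventually:
  assumes "0 < \<epsilon>"
  shows "\<forall>\<^sub>F j in sequentially. \<forall>i<n.
    integral {0..l j i} (\<lambda>s. exp (- (norm (G j i s))\<^sup>2 / 2) * ((K j i s + G j i s) \<bullet> rot90 (U j i s))\<^sup>2) \<le> \<epsilon>"
  using order_tendstoD(2)[OF defect assms]
proof (rule eventually_mono, intro allI impI)
  fix j i assume j: "(\<Sum>i<n. shrinker_energy (g j i)) < \<epsilon>" and i: "i < n"
  have "shrinker_energy (g j i) \<le>
     (\<Sum>i<n. shrinker_energy (g j i))"
    by (rule member_le_sum) (use i in \<open>auto intro!: arc_integral_nonneg\<close>)
  then show "integral {0..l j i} (\<lambda>s. exp (- (norm (G j i s))\<^sup>2 / 2) * ((K j i s + G j i s) \<bullet> rot90 (U j i s))\<^sup>2) \<le> \<epsilon>"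
    using j by (simp only: integral_weight(3)[OF i])
qed

lemma long_eventually: "\<forall>\<^sub>F j in sequentially. \<forall>i<n. L \<le> l j i"
  by (rule finite_ball_eventually) (use long in \<open>unfold filterlim_at_top, blast\<close>)

lemma support_function_eventually:
  assumes \<epsilon>: "0 < \<epsilon>"
  shows "\<forall>\<^sub>F j in sequentially. \<forall>i<n. \<forall>s\<in>{0..l j i}.
     \<bar>G j i s \<bullet> rot90 (U j i s)\<bar> * exp (- (norm (G j i s))\<^sup>2 / 2) \<le> \<epsilon>"
proof -
  define R where "R = 6 / \<epsilon>"
  define \<mu> where "\<mu> = \<epsilon> / (6 * (C + 1))"
  define d where "d = 2 * \<mu> * (\<epsilon> / 3)"
  have \<mu>: "0 < \<mu>" using \<epsilon> C_nonneg by (simp add: \<mu>_def)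
  have R: "0 < R" using \<epsilon> by (simp add: R_def)
  have d: "0 < d" using \<mu> \<epsilon> by (simp add: d_def)
  have "2 * \<mu> * C \<le> \<epsilon> / 3"
  proof -
    have "\<mu> * (6 * (C + 1)) = \<epsilon>" using C_nonneg by (simp add: \<mu>_def)
    then show ?thesis using \<mu> by (simp add: algebra_simps)
  qed
  moreover have "2 / R = \<epsilon> / 3" "d / (2 * \<mu>) = \<epsilon> / 3" using \<epsilon> \<mu> by (simp_all add: R_def d_def)
  ultimately have sum: "2 / R + d / (2 * \<mu>) + 2 * \<mu> * C \<le> \<epsilon>" by linarith
  from defect_eventually[OF d] long_eventually[of "(C + 1) * exp (R\<^sup>2 / 4)"] show ?thesis
  proof eventually_elim
    case (elim j)
    show ?case
    proof (intro allI impI ballI)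
      fix i s assume i: "i < n" and s: "s \<in> {0..l j i}"
      have "(C + 1) * exp (R\<^sup>2 / 4) * exp (- R\<^sup>2 / 4) \<le> l j i * exp (- R\<^sup>2 / 4)"
        using elim(2) i by (intro mult_right_mono) auto
      then have lg: "C < l j i * exp (- R\<^sup>2 / 4)" by (simp add: mult.assoc exp_add[symmetric])
      have "\<bar>G j i s \<bullet> rot90 (U j i s)\<bar> * exp (- (norm (G j i s))\<^sup>2 / 2) \<le> 2 / R + d / (2 * \<mu>) + 2 * \<mu> * C"
        by (rule support_function_bound[OF us[OF i] orth[OF i] \<mu> R wide_single[OF i] lg _ s])
           (use elim(1) i in auto)
      then show "\<bar>G j i s \<bullet> rot90 (U j i s)\<bar> * exp (- (norm (G j i s))\<^sup>2 / 2) \<le> \<epsilon>" using sum by linarith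
    qed
  qed
qed

abbreviation (input) "straight_at L \<eta> j \<equiv> (\<forall>i<n. straight L \<eta> (l j i) (\<lambda>s. G j i s) (\<lambda>s. U j i s) (\<lambda>s. K j i s))"

lemma straight_eventually:
  assumes L: "1 \<le> L" and \<eta>: "0 < \<eta>"
  shows "\<forall>\<^sub>F j in sequentially. straight_at L \<eta> j"
proof -
  define \<kappa> where "\<kappa> = min \<eta> ((\<eta> / (2 * L))\<^sup>2 / (2 * L))"
  have \<kappa>: "0 < \<kappa>" "\<kappa> \<le> \<eta>" using \<eta> L by (simp_all add: \<kappa>_def)
  have k3: "2 * L * sqrt (2 * L * \<kappa>) \<le> \<eta>"
  proof -
    have "2 * L * \<kappa> \<le> (\<eta> / (2 * L))\<^sup>2" using L by (simp add: \<kappa>_def min_def field_simps)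
    then have "sqrt (2 * L * \<kappa>) \<le> \<eta> / (2 * L)" using \<eta> L real_sqrt_le_mono by fastforce
    then show ?thesis using L by (simp add: field_simps)
  qed
  define c where "c = min \<eta> (min 1 (\<kappa> / (8 * L)))"
  have c: "0 < c" "c \<le> \<eta>" "c \<le> 1" "c \<le> \<kappa> / (8 * L)" using \<eta> \<kappa> L by (simp_all add: c_def)
  define \<epsilon> where "\<epsilon> = c * exp (- 2 * L\<^sup>2)"
  have \<epsilon>: "0 < \<epsilon>" "\<epsilon> * exp (2 * L\<^sup>2) = c" using c by (simp_all add: \<epsilon>_def mult.assoc exp_add[symmetric])
  define d where "d = \<kappa> / 2 * exp (- 2 * L\<^sup>2) / 2"
  have d: "0 < d" "2 * exp (2 * L\<^sup>2) * d = \<kappa> / 2" using \<kappa> by (simp_all add: d_def exp_minus field_simps)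
  have k1: "2 * exp (2 * L\<^sup>2) * d + 4 * L * (\<epsilon> * exp (2 * L\<^sup>2))\<^sup>2 \<le> \<kappa>"
  proof -
    have "c\<^sup>2 \<le> c * 1" unfolding power2_eq_square using c by (intro mult_left_mono) auto
    then have "4 * L * c\<^sup>2 \<le> 4 * L * (\<kappa> / (8 * L))" using c L by (intro mult_left_mono) auto
    then show ?thesis unfolding \<epsilon>(2) d(2) using L by simp
  qed
  from defect_eventually[OF d(1)] long_eventually[of "4 * L"] support_function_eventually[OF \<epsilon>(1)] show ?thesis
  proof eventually_elim
    case (elim j)
    show ?case
    proof (intro allI impI)
      fix i assume i: "i < n"
      show "straight L \<eta> (l j i) (\<lambda>s. G j i s) (\<lambda>s. U j i s) (\<lambda>s. K j i s)"
        by (rule straight_if_small_defect[where d=d and \<epsilon>=\<epsilon> and \<kappa>=\<kappa>, OF us[OF i] orth[OF i] L _ \<eta> _ _ _ k1 \<kappa>(2) k3])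
           (use elim i c(2) \<epsilon>(2) in auto)
    qed
  qed
qed

end

lemma integral_affine_unit:
  fixes f :: "real \<Rightarrow> real"
  assumes \<sigma>: "\<sigma> = 1 \<or> \<sigma> = -1" and f: "continuous_on {(if \<sigma> = 1 then c + a else c - b)..(if \<sigma> = 1 then c + b else c - a)} f"
  shows "integral {a..b} (\<lambda>s. f (c + \<sigma> * s)) =
    integral {(if \<sigma> = 1 then c + a else c - b)..(if \<sigma> = 1 then c + b else c - a)} f"
proof (cases "\<sigma> = 1")
  case True
  then show ?thesis using integral_shift[of a c b f] f by (simp add: o_def add.commute)
next
  case False
  then have s: "\<sigma> = -1" using \<sigma> by simp
  have "integral {a..b} (\<lambda>s. f (c - s)) = integral {- b..- a} (\<lambda>x. f (x + c))"
    using Henstock_Kurzweil_Integration.integral_reflect_real[of "- a" "- b" "\<lambda>x. f (x + c)"] by (simp add: add.commute)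
  also have "\<dots> = integral {- b + c..- a + c} f"
    using integral_shift[of "- b" c "- a" f] f s by (simp add: o_def add.commute)
  finally show ?thesis using s by (simp add: add.commute)
qed

lemma unit_speed_affine_piece:
  assumes us: "unit_speed l G U K" and \<sigma>: "\<sigma> = 1 \<or> \<sigma> = -1"
    and sub: "\<And>s. s \<in> {a..b} \<Longrightarrow> c + \<sigma> * s \<in> {0..l}"
  shows "C2_arc a b (\<lambda>s. G (c + \<sigma> * s)) (\<lambda>s. \<sigma> *\<^sub>R U (c + \<sigma> * s)) (\<lambda>s. K (c + \<sigma> * s))"
  unfolding C2_arc_def
proof (intro conjI ballI)
  show "continuous_on {a..b} (\<lambda>s. K (c + \<sigma> * s))"
    by (rule continuous_on_compose2[OF unit_speedD(2)[OF us]]) (use sub in \<open>auto intro!: continuous_intros\<close>)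
  fix s assume s: "s \<in> {a..b}"
  have d: "((\<lambda>s. c + \<sigma> * s) has_vector_derivative \<sigma>) (at s within {a..b})"
    unfolding real_derivative_iff_vector[symmetric] by (auto intro!: derivative_eq_intros)
  have img: "(\<lambda>s. c + \<sigma> * s) ` {a..b} \<subseteq> {0..l}" using sub by blast
  have chain: "((\<lambda>s. f (c + \<sigma> * s)) has_vector_derivative \<sigma> *\<^sub>R f') (at s within {a..b})"
    if "(f has_vector_derivative f') (at (c + \<sigma> * s) within {0..l})" for f :: "real \<Rightarrow> plane" and f'
    using vector_diff_chain_within[OF d has_vector_derivative_within_subset[OF that img]] by (simp add: o_def)
  show "((\<lambda>s. G (c + \<sigma> * s)) has_vector_derivative \<sigma> *\<^sub>R U (c + \<sigma> * s)) (at s within {a..b})"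
    by (rule chain[OF unit_speedD(5)[OF us sub[OF s]]])
  have "((\<lambda>s. \<sigma> *\<^sub>R U (c + \<sigma> * s)) has_vector_derivative \<sigma> *\<^sub>R (\<sigma> *\<^sub>R K (c + \<sigma> * s))) (at s within {a..b})"
    by (rule bounded_linear.has_vector_derivative[OF bounded_linear_scaleR_right chain[OF unit_speedD(6)[OF us sub[OF s]]]])
  then show "((\<lambda>s. \<sigma> *\<^sub>R U (c + \<sigma> * s)) has_vector_derivative K (c + \<sigma> * s)) (at s within {a..b})"
    using \<sigma> by auto
qed

lemma gaussian_lipschitz: "\<bar>exp (- x\<^sup>2 / 2) - exp (- y\<^sup>2 / 2)\<bar> \<le> \<bar>x - y\<bar>" for x y :: real
proof -
  have "norm (exp (- x\<^sup>2 / 2) - exp (- y\<^sup>2 / 2)) \<le> 1 * norm (x - y)"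
  proof (rule field_differentiable_bound[where S=UNIV and f'="\<lambda>z. - z * exp (- z\<^sup>2 / 2)"])
    fix z :: real
    show "((\<lambda>x. exp (- x\<^sup>2 / 2)) has_field_derivative - z * exp (- z\<^sup>2 / 2)) (at z within UNIV)"
      by (auto intro!: derivative_eq_intros)
    have "\<bar>z\<bar> \<le> 1 + z\<^sup>2 / 2"
    proof -
      have "0 \<le> (\<bar>z\<bar> - 1)\<^sup>2" by simp
      then show ?thesis by (simp add: power2_diff)
    qed
    also have "\<dots> \<le> exp (z\<^sup>2 / 2)" by (rule exp_ge_add_one_self)
    finally have "\<bar>z\<bar> * exp (- z\<^sup>2 / 2) \<le> exp (z\<^sup>2 / 2) * exp (- z\<^sup>2 / 2)" by (intro mult_right_mono) auto
    then show "norm (- z * exp (- z\<^sup>2 / 2)) \<le> 1" by (simp add: exp_add[symmetric] abs_mult)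
  qed auto
  then show ?thesis by simp
qed

lemma gaussian_half_integral:
  "((\<lambda>R. integral {0..R} (\<lambda>s. exp (- s\<^sup>2 / 2))) \<longlongrightarrow> sqrt (2 * pi) / 2) at_top"
proof -
  have "has_bochner_integral lborel (\<lambda>x. indicator {0..} x *\<^sub>R exp (- x\<^sup>2 :: real)) (sqrt pi / 2)"
    by (rule gaussian_moment_0)
  then have "has_bochner_integral lborel (\<lambda>x. indicator {0..} (0 + (1 / sqrt 2) * x) *\<^sub>R exp (- (0 + (1 / sqrt 2) * x)\<^sup>2))
      ((sqrt pi / 2) /\<^sub>R \<bar>1 / sqrt 2\<bar>)"
    by (subst lborel_has_bochner_integral_real_affine_iff[symmetric]) auto
  moreover have "(\<lambda>x. indicator {0..} (0 + (1 / sqrt 2) * x) *\<^sub>R exp (- (0 + (1 / sqrt 2) * x)\<^sup>2))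
     = (\<lambda>x. indicator {0..} x *\<^sub>R exp (- x\<^sup>2 / 2))"
    by (auto simp: fun_eq_iff indicator_def power_divide zero_le_divide_iff)
  moreover have "(sqrt pi / 2) /\<^sub>R \<bar>1 / sqrt 2\<bar> = sqrt (2 * pi) / 2"
    by (simp add: real_sqrt_mult)
  ultimately have h: "has_bochner_integral lborel (\<lambda>x. indicator {0..} x *\<^sub>R exp (- x\<^sup>2 / 2)) (sqrt (2 * pi) / 2)"
    by simp
  let ?f = "\<lambda>x. indicator {0..} x *\<^sub>R exp (- x\<^sup>2 / 2) :: real"
  have int: "integrable lborel ?f" and val: "(LINT x|lborel. ?f x) = sqrt (2 * pi) / 2"
    using h by (auto simp: has_bochner_integral_iff)
  have "((\<lambda>R. LINT x|lborel. indicator {..R} x *\<^sub>R ?f x) \<longlongrightarrow> sqrt (2 * pi) / 2) at_top"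
    using tendsto_integral_at_top[OF _ int] unfolding val by simp
  moreover have "(LINT x|lborel. indicator {..R} x *\<^sub>R ?f x) = integral {0..R} (\<lambda>s. exp (- s\<^sup>2 / 2))" for R :: real
  proof -
    have "(LINT x|lborel. indicator {..R} x *\<^sub>R ?f x) = (LINT x:{0..R}|lborel. exp (- x\<^sup>2 / 2))"
      unfolding set_lebesgue_integral_def
      by (rule Bochner_Integration.integral_cong) (auto simp: indicator_def)
    also have "\<dots> = integral {0..R} (\<lambda>s. exp (- s\<^sup>2 / 2))"
      by (rule set_borel_integral_eq_integral) (auto intro!: borel_integrable_atLeastAtMost' continuous_intros)
    finally show ?thesis .
  qed
  ultimately show ?thesis by simp
qed

lemma gaussian_symmetric_integral:
  assumes "0 \<le> R"
  shows "integral {- R..R} (\<lambda>s. exp (- s\<^sup>2 / 2)) = 2 * integral {0..R} (\<lambda>s. exp (- s\<^sup>2 / 2 :: real))"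
proof -
  have "integral {- R..0} (\<lambda>s. exp (- s\<^sup>2 / 2)) + integral {0..R} (\<lambda>s. exp (- s\<^sup>2 / 2)) = integral {- R..R} (\<lambda>s. exp (- s\<^sup>2 / 2 :: real))"
    by (rule Henstock_Kurzweil_Integration.integral_combine)
       (use assms in \<open>auto intro!: integrable_continuous_real continuous_intros\<close>)
  moreover have "integral {- R..0} (\<lambda>s. exp (- s\<^sup>2 / 2)) = integral {0..R} (\<lambda>s. exp (- s\<^sup>2 / 2 :: real))"
    using Henstock_Kurzweil_Integration.integral_reflect_real[of R 0 "\<lambda>s. exp (- s\<^sup>2 / 2)"] by simp
  ultimately show ?thesis by simp
qed

locale marked_slices = slices +
  fixes N :: nat and full :: "nat \<Rightarrow> bool" and v :: "nat \<Rightarrow> plane"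
    and I :: "nat \<Rightarrow> nat \<Rightarrow> nat" and c \<sigma> :: "nat \<Rightarrow> nat \<Rightarrow> real"
  assumes unit: "\<And>m. m < N \<Longrightarrow> norm (v m) = 1"
    and windows: "\<And>R. 1 \<le> R \<Longrightarrow> \<forall>\<^sub>F j in sequentially. \<forall>m<N. I j m < n \<and> (\<sigma> j m = 1 \<or> \<sigma> j m = -1) \<and>
       (\<forall>s\<in>{(if full m then - 3 * R else 0)..3 * R}. c j m + \<sigma> j m * s \<in> {0..l j (I j m)})"
    and disjoint: "\<And>R. 1 \<le> R \<Longrightarrow> \<forall>\<^sub>F j in sequentially. \<forall>m<N. \<forall>m'<N. m \<noteq> m' \<and> I j m = I j m' \<longrightarrow>
       (\<forall>s\<in>{(if full m then - 3 * R else 0)<..<3 * R}. \<forall>s'\<in>{(if full m' then - 3 * R else 0)<..<3 * R}.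
          c j m + \<sigma> j m * s \<noteq> c j m' + \<sigma> j m' * s')"
    and covering: "\<And>R. 1 \<le> R \<Longrightarrow> \<forall>\<^sub>F j in sequentially. \<forall>i<n. \<forall>s\<in>{0..l j i}. norm (g j i (\<psi> j i s)) < R \<longrightarrow>
       (\<exists>m<N. I j m = i \<and> (\<exists>r\<in>{(if full m then - 3 * R else 0)..3 * R}. s = c j m + \<sigma> j m * r))"
    and origin: "\<And>m. m < N \<Longrightarrow> (\<lambda>j. g j (I j m) (\<psi> j (I j m) (c j m))) \<longlonglongrightarrow> 0"
    and direction: "\<And>m. m < N \<Longrightarrow> (\<lambda>j. \<sigma> j m *\<^sub>R unit_tangent (g j (I j m)) (\<psi> j (I j m) (c j m))) \<longlonglongrightarrow> v m"
begin

abbreviation (input) "lo R m \<equiv> (if full m then - 3 * R else 0 :: real)"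
abbreviation (input) "Fm j m s \<equiv> G j (I j m) (c j m + \<sigma> j m * s)"
abbreviation (input) "arc_mass R j m \<equiv> integral {lo R m..3 * R} (\<lambda>s. exp (- (norm (Fm j m s))\<^sup>2 / 2))"

lemma arcs_C2:
  assumes "1 \<le> R" "m < N"
  shows "\<forall>\<^sub>F j in sequentially. C2_arc (lo R m) (3 * R) (Fm j m) (\<lambda>s. \<sigma> j m *\<^sub>R U j (I j m) (c j m + \<sigma> j m * s))
     (\<lambda>s. K j (I j m) (c j m + \<sigma> j m * s))"
  using windows[OF assms(1)]
proof (rule eventually_mono)
  fix j assume "\<forall>m<N. I j m < n \<and> (\<sigma> j m = 1 \<or> \<sigma> j m = -1) \<and>
       (\<forall>s\<in>{lo R m..3 * R}. c j m + \<sigma> j m * s \<in> {0..l j (I j m)})"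
  then have j: "I j m < n" "\<sigma> j m = 1 \<or> \<sigma> j m = -1"
    "\<And>s. s \<in> {lo R m..3 * R} \<Longrightarrow> c j m + \<sigma> j m * s \<in> {0..l j (I j m)}" using assms(2) by auto
  show "C2_arc (lo R m) (3 * R) (Fm j m) (\<lambda>s. \<sigma> j m *\<^sub>R U j (I j m) (c j m + \<sigma> j m * s))
     (\<lambda>s. K j (I j m) (c j m + \<sigma> j m * s))"
    by (rule unit_speed_affine_piece[OF us[OF j(1)] j(2,3)])
qed

lemma arcs_small_curvature:
  assumes R: "1 \<le> R" and m: "m < N" and \<epsilon>: "0 < \<epsilon>"
  shows "\<forall>\<^sub>F j in sequentially. integral {lo R m..3 * R} (\<lambda>s. (norm (K j (I j m) (c j m + \<sigma> j m * s)))\<^sup>2) \<le> \<epsilon>"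
proof -
  have "\<forall>\<^sub>F j in sequentially. norm (G j (I j m) (c j m)) < 1"
    using tendstoD[OF origin[OF m], of 1] by (simp add: dist_norm)
  moreover have "\<forall>\<^sub>F j in sequentially. straight_at (3 * R) \<epsilon> j" by (rule straight_eventually) (use R \<epsilon> in auto)
  ultimately show ?thesis using windows[OF R]
  proof eventually_elim
    case (elim j)
    let ?i = "I j m" and ?c = "c j m" and ?\<sigma> = "\<sigma> j m"
    have i: "?i < n" and \<sigma>: "?\<sigma> = 1 \<or> ?\<sigma> = -1" and w: "\<And>s. s \<in> {lo R m..3 * R} \<Longrightarrow> ?c + ?\<sigma> * s \<in> {0..l j ?i}"
      using elim(3) m by auto
    let ?p = "if ?\<sigma> = 1 then ?c + lo R m else ?c - 3 * R" and ?q = "if ?\<sigma> = 1 then ?c + 3 * R else ?c - lo R m"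
    have pq: "?p \<in> {0..l j ?i}" "?q \<in> {0..l j ?i}" "?p \<le> ?q" "\<bar>?p - ?c\<bar> \<le> 3 * R" "\<bar>?q - ?c\<bar> \<le> 3 * R"
      using w[of "lo R m"] w[of "3 * R"] \<sigma> R by auto
    have c0: "?c \<in> {0..l j ?i}" using w[of 0] R by (auto split: if_splits)
    have "continuous_on {?p..?q} (\<lambda>s. (norm (K j ?i s))\<^sup>2)"
      by (intro continuous_intros continuous_on_subset[OF unit_speedD(2)[OF us[OF i]]]) (use pq in auto)
    from integral_affine_unit[OF \<sigma> this]
    have "integral {lo R m..3 * R} (\<lambda>s. (norm (K j ?i (?c + ?\<sigma> * s)))\<^sup>2) = integral {?p..?q} (\<lambda>s. (norm (K j ?i s))\<^sup>2)" .
    also have "\<dots> \<le> \<epsilon>"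
      using elim(2)[rule_format, OF i, unfolded straight_def] elim(1) c0 pq R by auto
    finally show ?case .
  qed
qed

lemma arcs_converge:
  assumes R: "1 \<le> R" and m: "m < N" and \<alpha>: "0 < \<alpha>" "\<alpha> < 1/2"
  shows "C1_hoelder_tendsto \<alpha> (lo R m) (3 * R) (\<lambda>j. Fm j m) (\<lambda>s. s *\<^sub>R v m)"
    "W22_tendsto (lo R m) (3 * R) (\<lambda>j. Fm j m) (\<lambda>s. s *\<^sub>R v m)"
    "\<And>\<epsilon>. 0 < \<epsilon> \<Longrightarrow> \<forall>\<^sub>F j in sequentially. \<forall>s\<in>{lo R m..3 * R}. norm (Fm j m s - s *\<^sub>R v m) \<le> \<epsilon>"
proof -
  have o: "(\<lambda>j. Fm j m 0) \<longlonglongrightarrow> 0" "(\<lambda>j. \<sigma> j m *\<^sub>R U j (I j m) (c j m + \<sigma> j m * 0)) \<longlonglongrightarrow> v m"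
    using origin[OF m] direction[OF m] by simp_all
  have ab: "lo R m \<le> 0" "0 \<le> 3 * R" "lo R m < 3 * R" using R by auto
  note * = arcs_converge_to_line[OF ab \<alpha> arcs_C2[OF R m] o arcs_small_curvature[OF R m]]
  show "C1_hoelder_tendsto \<alpha> (lo R m) (3 * R) (\<lambda>j. Fm j m) (\<lambda>s. s *\<^sub>R v m)" by (rule *(1))
  show "W22_tendsto (lo R m) (3 * R) (\<lambda>j. Fm j m) (\<lambda>s. s *\<^sub>R v m)" by (rule *(2))
  show "\<forall>\<^sub>F j in sequentially. \<forall>s\<in>{lo R m..3 * R}. norm (Fm j m s - s *\<^sub>R v m) \<le> \<epsilon>" if "0 < \<epsilon>" for \<epsilon>
    by (rule *(3), assumption, rule that)
qed

lemma arclength_piece_marker: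
  assumes i: "i < n" and \<sigma>: "\<sigma>' = 1 \<or> \<sigma>' = -1" and ab: "a < b"
    and w: "\<And>s. s \<in> {a..b} \<Longrightarrow> c' + \<sigma>' * s \<in> {0..l j i}"
  shows "arclength_piece (g j i) a b (\<lambda>s. \<psi> j i (c' + \<sigma>' * s))"
proof -
  let ?\<phi> = "\<lambda>s. \<psi> j i (c' + \<sigma>' * s)"
  have r: "?\<phi> s \<in> {0..1}" if "s \<in> {a..b}" for s by (rule \<psi>_range[OF i w[OF that]])
  have arc: "C2_arc a b (\<lambda>s. g j i (?\<phi> s)) (\<lambda>s. \<sigma>' *\<^sub>R unit_tangent (g j i) (?\<phi> s)) (\<lambda>s. curvature_vector (g j i) (?\<phi> s))"
    by (rule unit_speed_affine_piece[OF us[OF i] \<sigma> w])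
  have img: "(\<lambda>s. c' + \<sigma>' * s) ` {a..b} \<subseteq> {0..l j i}" using w by blast
  have d: "(?\<phi> has_vector_derivative \<sigma>' * (1 / norm (g1 j i (?\<phi> s)))) (at s within {a..b})" if s: "s \<in> {a..b}" for s
  proof -
    have "(\<psi> j i has_real_derivative 1 / norm (velocity (g j i) (?\<phi> s))) (at (c' + \<sigma>' * s) within {0..l j i})"
      using param[OF i, of j] w[OF s] unfolding arclength_param_def by blast
    then have 1: "(\<psi> j i has_vector_derivative 1 / norm (g1 j i (?\<phi> s))) (at (c' + \<sigma>' * s) within (\<lambda>s. c' + \<sigma>' * s) ` {a..b})"
      using C2_velocity[OF C2[OF i] r[OF s]] has_vector_derivative_within_subset[OF _ img]
      by (simp add: real_derivative_iff_vector)
    have 2: "((\<lambda>s. c' + \<sigma>' * s) has_vector_derivative \<sigma>') (at s within {a..b})"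
      unfolding real_derivative_iff_vector[symmetric] by (auto intro!: derivative_eq_intros)
    show ?thesis using vector_diff_chain_within[OF 2 1] by (simp add: o_def)
  qed
  have c\<phi>: "continuous_on {a..b} ?\<phi>" by (rule continuous_on_vector_derivative[OF d])
  have "continuous_on {a..b} (\<lambda>s. g1 j i (?\<phi> s))"
    by (rule continuous_on_compose2[OF C2_continuous(2)[OF C2[OF i]] c\<phi>]) (use r in auto)
  then have "continuous_on {a..b} (\<lambda>s. \<sigma>' * (1 / norm (g1 j i (?\<phi> s))))"
    by (intro continuous_intros) (use C2_nonzero[OF C2[OF i] r] in auto)
  then have 1: "C1_on {a..b} ?\<phi>"
    unfolding C1_on_def by (intro exI[of _ "\<lambda>s. \<sigma>' * (1 / norm (g1 j i (?\<phi> s)))"] conjI ballI d)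
  have 2: "inj_on ?\<phi> {a..b}"
  proof (rule inj_onI)
    fix s t assume st: "s \<in> {a..b}" "t \<in> {a..b}" "?\<phi> s = ?\<phi> t"
    then have "c' + \<sigma>' * s = c' + \<sigma>' * t" using \<psi>_inj[OF i w[OF st(1)] w[OF st(2)]] by blast
    then show "s = t" using \<sigma> by auto
  qed
  have 3: "C1_on {a..b} (g j i \<circ> ?\<phi>)" 
    unfolding C1_on_def o_def
    by (intro exI[of _ "\<lambda>s. \<sigma>' *\<^sub>R unit_tangent (g j i) (?\<phi> s)"] conjI ballI C2_arcD(2,4)[OF arc])
  have 4: "norm (vector_derivative (g j i \<circ> ?\<phi>) (at s within {a..b})) = 1" if s: "s \<in> {a..b}" for s
  proof -
    have "vector_derivative (g j i \<circ> ?\<phi>) (at s within {a..b}) = \<sigma>' *\<^sub>R unit_tangent (g j i) (?\<phi> s)"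
      unfolding o_def by (rule vector_derivative_within_Icc[OF ab s C2_arcD(4)[OF arc s]])
    then show ?thesis using C2_norm_unit_tangent[OF C2[OF i] r[OF s]] \<sigma> by auto
  qed
  show ?thesis
    unfolding arclength_piece_def by (intro conjI ballI ab 1 2 3 4 image_subsetI r)
qed

lemma network_converges:
  assumes \<alpha>: "0 < \<alpha>" "\<alpha> < 1/2"
  shows "network_tendsto \<alpha> n g (map (\<lambda>m. (if full m then UNIV else {0..}, \<lambda>s. s *\<^sub>R v m)) [0..<N])"
  unfolding network_tendsto_def
proof (intro allI impI)
  fix R0 :: real assume "0 < R0"
  define R where "R = max R0 1"
  have R: "1 \<le> R" "R0 \<le> R" by (auto simp: R_def)
  let ?L = "map (\<lambda>m. (if full m then UNIV else {0..}, \<lambda>s. s *\<^sub>R v m)) [0..<N]"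
  let ?\<phi> = "\<lambda>j m s. \<psi> j (I j m) (c j m + \<sigma> j m * s)"
  have "\<forall>m<length ?L. case ?L ! m of (J, \<eta>) \<Rightarrow>
           lo R m < 3 * R \<and> {lo R m..3 * R} \<subseteq> J \<and> {s \<in> J. \<eta> s \<in> ball 0 R0} \<subseteq> {lo R m..3 * R} \<and>
           C1_hoelder_tendsto \<alpha> (lo R m) (3 * R) (\<lambda>j. g j (I j m) \<circ> ?\<phi> j m) \<eta> \<and>
           W22_tendsto (lo R m) (3 * R) (\<lambda>j. g j (I j m) \<circ> ?\<phi> j m) \<eta>"
  proof (intro allI impI)
    fix m assume "m < length ?L"
    then have m: "m < N" by simp
    show "case ?L ! m of (J, \<eta>) \<Rightarrow>
           lo R m < 3 * R \<and> {lo R m..3 * R} \<subseteq> J \<and> {s \<in> J. \<eta> s \<in> ball 0 R0} \<subseteq> {lo R m..3 * R} \<and>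
           C1_hoelder_tendsto \<alpha> (lo R m) (3 * R) (\<lambda>j. g j (I j m) \<circ> ?\<phi> j m) \<eta> \<and>
           W22_tendsto (lo R m) (3 * R) (\<lambda>j. g j (I j m) \<circ> ?\<phi> j m) \<eta>"
      using arcs_converge(1,2)[OF R(1) m \<alpha>] R m unit[OF m] by (auto simp: o_def)
  qed
  moreover have "\<forall>\<^sub>F j in sequentially. described_in_ball R0 n (g j) (length ?L) (lo R) (\<lambda>_. 3 * R) (I j) (?\<phi> j)"
    using windows[OF R(1)] disjoint[OF R(1)] covering[OF R(1)]
  proof eventually_elim
    case (elim j)
    show ?case
      unfolding described_in_ball_def length_map length_upt diff_zero
    proof (intro conjI allI impI ballI)
      fix m assume m: "m < N"
      show "I j m < n" using elim(1) m by blast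
      show "arclength_piece (g j (I j m)) (lo R m) (3 * R) (?\<phi> j m)"
        by (rule arclength_piece_marker) (use elim(1) m R in auto)
    next
      fix m m' assume m: "m < N" "m' < N" and ne: "m \<noteq> m' \<and> I j m = I j m'"
      show "?\<phi> j m ` {lo R m<..<3 * R} \<inter> ?\<phi> j m' ` {lo R m'<..<3 * R} = {}"
      proof (rule ccontr)
        assume "\<not> ?thesis"
        then obtain s s' where s: "s \<in> {lo R m<..<3 * R}" "s' \<in> {lo R m'<..<3 * R}" "?\<phi> j m s = ?\<phi> j m' s'" by blast
        have "c j m + \<sigma> j m * s \<in> {0..l j (I j m)}" "c j m' + \<sigma> j m' * s' \<in> {0..l j (I j m')}" "I j m < n"
          using elim(1) m s by auto
        then have "c j m + \<sigma> j m * s = c j m' + \<sigma> j m' * s'" using s(3) ne \<psi>_inj by metis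
        then show False using elim(2) m ne s(1,2) by blast
      qed
    next
      fix i x assume i: "i < n" and x: "x \<in> {0..1}" and b: "g j i x \<in> ball 0 R0"
      obtain s where s: "s \<in> {0..l j i}" "x = \<psi> j i s"
        using param[OF i, of j] x unfolding arclength_param_def by (metis imageE)
      have "norm (g j i (\<psi> j i s)) < R" using b s R by simp
      then obtain m r where "m < N" "I j m = i" "r \<in> {lo R m..3 * R}" "s = c j m + \<sigma> j m * r"
        using elim(3) i s(1) by blast
      then show "\<exists>m<N. I j m = i \<and> x \<in> ?\<phi> j m ` {lo R m..3 * R}" using s(2) by auto
    qed
  qed
  ultimately show "\<exists>a b idx \<phi>. (\<forall>m<length ?L. case ?L ! m of (J, \<eta>) \<Rightarrow>
           a m < b m \<and> {a m..b m} \<subseteq> J \<and> {s \<in> J. \<eta> s \<in> ball 0 R0} \<subseteq> {a m..b m} \<and>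
           C1_hoelder_tendsto \<alpha> (a m) (b m) (\<lambda>j. g j (idx j m) \<circ> \<phi> j m) \<eta> \<and>
           W22_tendsto (a m) (b m) (\<lambda>j. g j (idx j m) \<circ> \<phi> j m) \<eta>) \<and>
        (\<forall>\<^sub>F j in sequentially. described_in_ball R0 n (g j) (length ?L) a b (idx j) (\<phi> j))"
    by (intro exI[of _ "lo R"] exI[of _ "\<lambda>_. 3 * R"] exI[of _ I] exI[of _ ?\<phi>] conjI)
qed

end

lemma sum_indicator_le:
  fixes e :: real
  assumes "finite M" "0 \<le> e" "\<And>m m'. m \<in> M \<Longrightarrow> m' \<in> M \<Longrightarrow> P m \<Longrightarrow> P m' \<Longrightarrow> m = m'"
  shows "(\<Sum>m\<in>M. if P m then e else 0) \<le> e"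
proof -
  have "card {m \<in> M. P m} \<le> 1"
    using assms(1,3) by (subst One_nat_def, subst card_le_Suc0_iff_eq) auto
  then have "real (card {m \<in> M. P m}) * e \<le> 1 * e" using assms(2) by (intro mult_right_mono) auto
  moreover have "(\<Sum>m\<in>M. if P m then e else 0) = real (card {m \<in> M. P m}) * e"
    using sum.inter_filter[OF assms(1), of "\<lambda>_. e" P] by simp
  ultimately show ?thesis by simp
qed

lemma integral_cover_bounds:
  fixes E B :: "real \<Rightarrow> real" and p q :: "'m \<Rightarrow> real"
  assumes M: "finite M" and E: "continuous_on {0..l} E" "\<And>s. s \<in> {0..l} \<Longrightarrow> 0 \<le> E s"
    and B: "continuous_on {0..l} B" "\<And>s. s \<in> {0..l} \<Longrightarrow> 0 \<le> B s"
    and sub: "\<And>m. m \<in> M \<Longrightarrow> 0 \<le> p m \<and> q m \<le> l"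
    and disj: "\<And>m m' s. m \<in> M \<Longrightarrow> m' \<in> M \<Longrightarrow> s \<in> {p m<..<q m} \<Longrightarrow> s \<in> {p m'<..<q m'} \<Longrightarrow> m = m'"
    and cover: "\<And>s. s \<in> {0..l} \<Longrightarrow> E s \<le> B s \<or> (\<exists>m\<in>M. s \<in> {p m..q m})"
  shows "(\<Sum>m\<in>M. integral {p m..q m} E) \<le> integral {0..l} E"
    "integral {0..l} E \<le> (\<Sum>m\<in>M. integral {p m..q m} E) + integral {0..l} B"
proof -
  have sub': "{p m..q m} \<subseteq> {0..l}" "{p m<..<q m} \<subseteq> {0..l}" if "m \<in> M" for m using sub[OF that] by auto
  have hi: "(E has_integral integral {p m..q m} E) {p m..q m}" if "m \<in> M" for m
    by (rule integrable_integral, rule integrable_continuous_real, rule continuous_on_subset[OF E(1) sub'(1)[OF that]])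
  have EI: "(E has_integral integral {0..l} E) {0..l}" "(B has_integral integral {0..l} B) {0..l}"
    by (rule integrable_integral, rule integrable_continuous_real, rule E(1) B(1))+
  have 1: "((\<lambda>s. if s \<in> {p m<..<q m} then E s else 0) has_integral integral {p m..q m} E) {0..l}" if "m \<in> M" for m
    unfolding has_integral_restrict[OF sub'(2)[OF that]]
    using hi[OF that] by (simp add: has_integral_Icc_iff_Ioo)
  have "((\<lambda>s. \<Sum>m\<in>M. if s \<in> {p m<..<q m} then E s else 0) has_integral (\<Sum>m\<in>M. integral {p m..q m} E)) {0..l}"
    by (rule has_integral_sum[OF M 1])
  then show "(\<Sum>m\<in>M. integral {p m..q m} E) \<le> integral {0..l} E"
    by (rule has_integral_le[OF _ EI(1)]) (rule sum_indicator_le[OF M E(2)], assumption, rule disj)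
  have 2: "((\<lambda>s. if s \<in> {p m..q m} then E s else 0) has_integral integral {p m..q m} E) {0..l}" if "m \<in> M" for m
    unfolding has_integral_restrict[OF sub'(1)[OF that]] by (rule hi[OF that])
  have "((\<lambda>s. (\<Sum>m\<in>M. if s \<in> {p m..q m} then E s else 0) + B s) has_integral
     (\<Sum>m\<in>M. integral {p m..q m} E) + integral {0..l} B) {0..l}"
    by (rule has_integral_add[OF has_integral_sum[OF M 2] EI(2)])
  then show "integral {0..l} E \<le> (\<Sum>m\<in>M. integral {p m..q m} E) + integral {0..l} B"
  proof (rule has_integral_le[OF EI(1)])
    fix s assume s: "s \<in> {0..l}"
    have nn: "0 \<le> (\<Sum>m\<in>M. if s \<in> {p m..q m} then E s else 0)" using E(2)[OF s] by (intro sum_nonneg) auto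
    show "E s \<le> (\<Sum>m\<in>M. if s \<in> {p m..q m} then E s else 0) + B s"
    proof (cases "E s \<le> B s")
      case False
      then obtain m where m: "m \<in> M" "s \<in> {p m..q m}" using cover[OF s] by blast
      have "(if s \<in> {p m..q m} then E s else 0) \<le> (\<Sum>m\<in>M. if s \<in> {p m..q m} then E s else 0)"
        by (rule member_le_sum[OF m(1) _ M]) (use E(2)[OF s] in auto)
      then show ?thesis using m(2) B(2)[OF s] by simp
    qed (use nn in simp)
  qed
qed

context marked_slices
begin

lemma density_bounds:
  assumes R: "1 \<le> R"
  shows "\<forall>\<^sub>F j in sequentially.
    (\<Sum>m<N. arc_mass R j m)
      \<le> (\<Sum>i<n. gaussian_length (g j i)) \<and>
    (\<Sum>i<n. gaussian_length (g j i))
      \<le> (\<Sum>m<N. arc_mass R j m) + exp (- R\<^sup>2 / 4) * C"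
  using windows[OF R] disjoint[OF R] covering[OF R]
proof eventually_elim
  case (elim j)
  have I: "I j m < n" and \<sigma>: "\<sigma> j m = 1 \<or> \<sigma> j m = -1"
    and w: "\<And>s. s \<in> {lo R m..3 * R} \<Longrightarrow> c j m + \<sigma> j m * s \<in> {0..l j (I j m)}" if "m < N" for m
    using elim(1) that by auto
  define p where "p m = (if \<sigma> j m = 1 then c j m + lo R m else c j m - 3 * R)" for m
  define q where "q m = (if \<sigma> j m = 1 then c j m + 3 * R else c j m - lo R m)" for m
  define E where "E i s = exp (- (norm (G j i s))\<^sup>2 / 2)" for i s
  define B where "B i s = exp (- R\<^sup>2 / 4) * exp (- (norm (G j i s))\<^sup>2 / 4)" for i s
  have pq: "0 \<le> p m \<and> q m \<le> l j (I j m)" if "m < N" for m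
    using w[OF that, of "lo R m"] w[OF that, of "3 * R"] \<sigma>[OF that] R by (auto simp: p_def q_def)
  have open_iff: "\<exists>r\<in>{lo R m<..<3 * R}. s = c j m + \<sigma> j m * r" if "m < N" "s \<in> {p m<..<q m}" for m s
    using that(2) \<sigma>[OF that(1)]
    by (intro bexI[of _ "\<sigma> j m * (s - c j m)"]) (auto simp: p_def q_def split: if_splits)
  have closed_iff: "s \<in> {p m..q m}" if "m < N" "r \<in> {lo R m..3 * R}" "s = c j m + \<sigma> j m * r" for m s r
    using that \<sigma>[OF that(1)] by (auto simp: p_def q_def)
  have Gc: "continuous_on {0..l j i} (\<lambda>s. G j i s)" if "i < n" for i by (rule unit_speedD(4)[OF us[OF that]])
  have Ec: "continuous_on {0..l j i} (E i)" "continuous_on {0..l j i} (B i)" if "i < n" for i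
    unfolding E_def B_def by (intro continuous_intros Gc[OF that]; simp)+
  have int_eq: "arc_mass R j m = integral {p m..q m} (E (I j m))" if "m < N" for m
    unfolding p_def q_def E_def
  proof (rule integral_affine_unit[OF \<sigma>[OF that]])
    show "continuous_on {if \<sigma> j m = 1 then c j m + lo R m else c j m - 3 * R..if \<sigma> j m = 1 then c j m + 3 * R else c j m - lo R m}
     (\<lambda>s. exp (- (norm (G j (I j m) s))\<^sup>2 / 2))"
      using continuous_on_subset[OF Ec(1)[OF I[OF that]], of "{p m..q m}"] pq[OF that]
      unfolding p_def q_def E_def by auto
  qed
  let ?M = "\<lambda>i. {m \<in> {..<N}. I j m = i}"
  have b: "(\<Sum>m\<in>?M i. integral {p m..q m} (E i)) \<le> integral {0..l j i} (E i) \<and>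
     integral {0..l j i} (E i) \<le> (\<Sum>m\<in>?M i. integral {p m..q m} (E i)) + integral {0..l j i} (B i)" if i: "i < n" for i
  proof -
    have dj: "m = m'" if m: "m \<in> ?M i" "m' \<in> ?M i" and s: "s \<in> {p m<..<q m}" "s \<in> {p m'<..<q m'}" for m m' s
    proof -
    obtain r where r: "r \<in> {lo R m<..<3 * R}" "s = c j m + \<sigma> j m * r"
      using open_iff[OF _ s(1)] m by blast
    obtain r' where r': "r' \<in> {lo R m'<..<3 * R}" "s = c j m' + \<sigma> j m' * r'"
      using open_iff[OF _ s(2)] m by blast
    show ?thesis
    proof (rule ccontr)
      assume "m \<noteq> m'"
      then have "c j m + \<sigma> j m * r \<noteq> c j m' + \<sigma> j m' * r'" using elim(2) m r(1) r'(1) by auto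
      then show False using r r' by simp
    qed
    qed
    have cv: "E i s \<le> B i s \<or> (\<exists>m\<in>?M i. s \<in> {p m..q m})" if s: "s \<in> {0..l j i}" for s
    proof (cases "norm (G j i s) < R")
      case True
      then obtain m r where "m < N" "I j m = i" "r \<in> {lo R m..3 * R}" "s = c j m + \<sigma> j m * r"
        using elim(3) i s by blast
      then show ?thesis using closed_iff by blast
    next
      case False
      then have "R\<^sup>2 \<le> (norm (G j i s))\<^sup>2" using R by (intro power_mono) auto
      then show ?thesis by (simp add: E_def B_def exp_add[symmetric])
    qed
    show ?thesis
      by (intro conjI; rule integral_cover_bounds[where B="B i", OF _ Ec(1)[OF i] _ Ec(2)[OF i] _ _ dj cv])
         (use pq in \<open>auto simp: E_def B_def\<close>)
  qed
  have sum_group: "(\<Sum>i<n. \<Sum>m\<in>?M i. integral {p m..q m} (E i)) = (\<Sum>m<N. arc_mass R j m)"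
  proof -
    have "(\<Sum>i<n. \<Sum>m\<in>?M i. integral {p m..q m} (E i)) = (\<Sum>i<n. \<Sum>m\<in>?M i. integral {p m..q m} (E (I j m)))"
      by (intro sum.cong) auto
    also have "\<dots> = (\<Sum>m<N. integral {p m..q m} (E (I j m)))"
      by (rule sum.group) (use I in auto)
    also have "\<dots> = (\<Sum>m<N. arc_mass R j m)"
      by (rule sum.cong) (use int_eq in auto)
    finally show ?thesis .
  qed
  have lhs: "(\<Sum>i<n. gaussian_length (g j i)) = (\<Sum>i<n. integral {0..l j i} (E i))"
    unfolding E_def by (intro sum.cong refl) (simp only: integral_weight(2) lessThan_iff)
  have Bsum: "(\<Sum>i<n. integral {0..l j i} (B i)) \<le> exp (- R\<^sup>2 / 4) * C"
  proof -
    have "(\<Sum>i<n. integral {0..l j i} (B i)) = exp (- R\<^sup>2 / 4) * (\<Sum>i<n. wide_gaussian_length (g j i))"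
      unfolding sum_distrib_left B_def integral_mult_right by (intro sum.cong refl) (simp only: integral_weight(1) lessThan_iff)
    also have "\<dots> \<le> exp (- R\<^sup>2 / 4) * C" by (intro mult_left_mono wide) simp
    finally show ?thesis .
  qed
  have "(\<Sum>i<n. \<Sum>m\<in>?M i. integral {p m..q m} (E i)) \<le> (\<Sum>i<n. integral {0..l j i} (E i))"
    by (rule sum_mono) (use b in auto)
  moreover have "(\<Sum>i<n. integral {0..l j i} (E i)) \<le>
     (\<Sum>i<n. (\<Sum>m\<in>?M i. integral {p m..q m} (E i)) + integral {0..l j i} (B i))"
    by (rule sum_mono) (use b in auto)
  ultimately show ?case unfolding lhs sum_group[symmetric] using Bsum by (simp add: sum.distrib)
qed

lemma arc_density_tendsto:
  assumes R: "1 \<le> R" and m: "m < N"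
  shows "(\<lambda>j. arc_mass R j m)
     \<longlonglongrightarrow> integral {lo R m..3 * R} (\<lambda>s. exp (- s\<^sup>2 / 2))"
proof (rule tendstoI)
  fix e :: real assume e: "0 < e"
  let ?d = "3 * R - lo R m"
  have d: "0 < ?d" using R by auto
  define \<epsilon> where "\<epsilon> = e / (2 * ?d)"
  have \<epsilon>: "0 < \<epsilon>" "\<epsilon> * ?d = e / 2" using e d R by (simp_all add: \<epsilon>_def)
  have "\<forall>\<^sub>F j in sequentially. \<forall>s\<in>{lo R m..3 * R}. norm (Fm j m s - s *\<^sub>R v m) \<le> \<epsilon>"
    by (rule arcs_converge(3)[OF R m _ _ \<epsilon>(1), of "1/4"]) simp_all
  then show "\<forall>\<^sub>F j in sequentially. dist (arc_mass R j m)
     (integral {lo R m..3 * R} (\<lambda>s. exp (- s\<^sup>2 / 2))) < e"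
    using arcs_C2[OF R m]
  proof eventually_elim
    case (elim j)
    have cF: "continuous_on {lo R m..3 * R} (Fm j m)" by (rule C2_arcD(1)[OF elim(2)])
    have c: "continuous_on {lo R m..3 * R} (\<lambda>s. exp (- (norm (Fm j m s))\<^sup>2 / 2))"
      "continuous_on {lo R m..3 * R} (\<lambda>s::real. exp (- s\<^sup>2 / 2))"
      by (intro continuous_intros cF; simp)+
    have "arc_mass R j m - integral {lo R m..3 * R} (\<lambda>s. exp (- s\<^sup>2 / 2))
      = integral {lo R m..3 * R} (\<lambda>s. exp (- (norm (Fm j m s))\<^sup>2 / 2) - exp (- s\<^sup>2 / 2))"
      by (rule integral_diff[symmetric]) (intro integrable_continuous_real c)+
    also have "norm \<dots> \<le> integral {lo R m..3 * R} (\<lambda>_. \<epsilon>)"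
    proof (rule integral_norm_bound_integral)
      fix s assume s: "s \<in> {lo R m..3 * R}"
      have "\<bar>exp (- (norm (Fm j m s))\<^sup>2 / 2) - exp (- (norm (s *\<^sub>R v m))\<^sup>2 / 2)\<bar> \<le> \<bar>norm (Fm j m s) - norm (s *\<^sub>R v m)\<bar>"
        by (rule gaussian_lipschitz)
      also have "\<dots> \<le> norm (Fm j m s - s *\<^sub>R v m)" by (rule norm_triangle_ineq3)
      also have "\<dots> \<le> \<epsilon>" using elim(1) s by blast
      finally show "norm (exp (- (norm (Fm j m s))\<^sup>2 / 2) - exp (- s\<^sup>2 / 2)) \<le> \<epsilon>" using unit[OF m] by simp
    qed (intro integrable_continuous_real continuous_intros c)+
    also have "\<dots> = \<epsilon> * ?d" using d by simp
    finally show ?case using \<epsilon>(2) e by (simp add: dist_real_def)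
  qed
qed

lemma density_value:
  assumes S: "(\<lambda>j. \<Sum>i<n. gaussian_length (g j i)) \<longlonglongrightarrow> S"
  shows "S = (\<Sum>m<N. if full m then sqrt (2 * pi) else sqrt (2 * pi) / 2)"
proof -
  define D where "D R = (\<Sum>m<N. integral {lo R m..3 * R} (\<lambda>s. exp (- s\<^sup>2 / 2)))" for R
  have lim: "(\<lambda>j. \<Sum>m<N. arc_mass R j m) \<longlonglongrightarrow> D R" if "1 \<le> R" for R
    unfolding D_def by (intro tendsto_sum arc_density_tendsto that) simp
  have lower: "D R \<le> S" and upper: "S \<le> D R + exp (- R\<^sup>2 / 4) * C" if R: "1 \<le> R" for R
  proof -
    show "D R \<le> S"
      by (rule tendsto_le[OF _ S lim[OF R]]) (use density_bounds[OF R] in \<open>auto elim: eventually_mono\<close>)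
    have "(\<lambda>j. (\<Sum>m<N. arc_mass R j m) + exp (- R\<^sup>2 / 4) * C)
        \<longlonglongrightarrow> D R + exp (- R\<^sup>2 / 4) * C" by (intro tendsto_intros lim R)
    note lu = tendsto_le[OF _ this S]
    show "S \<le> D R + exp (- R\<^sup>2 / 4) * C"
      by (rule lu) (use density_bounds[OF R] in \<open>auto elim: eventually_mono\<close>)
  qed
  have half: "((\<lambda>R. integral {0..3 * R} (\<lambda>s. exp (- s\<^sup>2 / 2))) \<longlongrightarrow> sqrt (2 * pi) / 2) at_top"
    by (rule filterlim_compose[OF gaussian_half_integral]) (auto intro!: filterlim_tendsto_pos_mult_at_top filterlim_ident)
  have "((\<lambda>R. integral {lo R m..3 * R} (\<lambda>s. exp (- s\<^sup>2 / 2))) \<longlongrightarrow> (if full m then sqrt (2 * pi) else sqrt (2 * pi) / 2)) at_top" for m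
  proof (cases "full m")
    case True
    have "((\<lambda>R. 2 * integral {0..3 * R} (\<lambda>s. exp (- s\<^sup>2 / 2))) \<longlongrightarrow> 2 * (sqrt (2 * pi) / 2)) at_top"
      by (intro tendsto_intros half)
    moreover have "\<forall>\<^sub>F R in at_top. 2 * integral {0..3 * R} (\<lambda>s. exp (- s\<^sup>2 / 2)) = integral {lo R m..3 * R} (\<lambda>s. exp (- s\<^sup>2 / 2 :: real))"
      using eventually_ge_at_top[of "0::real"]
      by (rule eventually_mono) (use True gaussian_symmetric_integral[of "3 * _"] in simp)
    ultimately show ?thesis using True by (simp add: tendsto_cong)
  qed (use half in simp)
  then have Dlim: "(D \<longlongrightarrow> (\<Sum>m<N. if full m then sqrt (2 * pi) else sqrt (2 * pi) / 2)) at_top"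
    unfolding D_def by (intro tendsto_sum)
  have tail: "((\<lambda>R. D R + exp (- R\<^sup>2 / 4) * C) \<longlongrightarrow> (\<Sum>m<N. if full m then sqrt (2 * pi) else sqrt (2 * pi) / 2) + 0 * C) at_top"
  proof (intro tendsto_add Dlim tendsto_mult tendsto_const)
    have "filterlim (\<lambda>R::real. R\<^sup>2 / 4) at_top at_top"
      unfolding power2_eq_square divide_inverse
      by (intro filterlim_at_top_mult_tendsto_pos[where c="inverse 4"] filterlim_at_top_mult_at_top filterlim_ident tendsto_const) simp
    then have "filterlim (\<lambda>R::real. - (R\<^sup>2 / 4)) at_bot at_top" by (simp add: filterlim_uminus_at_top)
    then show "((\<lambda>R::real. exp (- R\<^sup>2 / 4)) \<longlongrightarrow> 0) at_top"
      using filterlim_compose[OF exp_at_bot] by fastforce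
  qed
  show ?thesis
  proof (rule antisym)
    have "S \<le> (\<Sum>m<N. if full m then sqrt (2 * pi) else sqrt (2 * pi) / 2) + 0 * C"
      by (rule tendsto_lowerbound[OF tail]) (rule eventually_mono[OF eventually_ge_at_top[of 1] upper], simp_all)
    then show "S \<le> (\<Sum>m<N. if full m then sqrt (2 * pi) else sqrt (2 * pi) / 2)" by simp
    show "(\<Sum>m<N. if full m then sqrt (2 * pi) else sqrt (2 * pi) / 2) \<le> S"
      by (rule tendsto_upperbound[OF Dlim]) (rule eventually_mono[OF eventually_ge_at_top[of 1] lower], simp_all)
  qed
qed

end

lemma constant_subsequence:
  fixes f :: "nat \<Rightarrow> 'a"
  assumes "finite A" "\<And>j. f j \<in> A"
  obtains r y where "strict_mono (r :: nat \<Rightarrow> nat)" "\<And>j. f (r j) = y"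
proof -
  have "finite (range f)" by (rule finite_subset[OF _ assms(1)]) (use assms(2) in blast)
  then obtain a where "infinite {j \<in> UNIV. f j = f a}" using pigeonhole_infinite[of "UNIV :: nat set" f] by auto
  then obtain r :: "nat \<Rightarrow> nat" where "strict_mono r" "\<forall>j. r j \<in> {j \<in> UNIV. f j = f a}"
    using infinite_enumerate by blast
  then show ?thesis by (intro that[of r "f a"]) auto
qed

lemma bounded_family_subsequence:
  fixes D :: "nat \<Rightarrow> 'k \<Rightarrow> plane"
  assumes "finite F" "\<And>j k. k \<in> F \<Longrightarrow> norm (D j k) \<le> 1"
  shows "\<exists>(r :: nat \<Rightarrow> nat) w. strict_mono r \<and> (\<forall>k\<in>F. (\<lambda>j. D (r j) k) \<longlonglongrightarrow> w k)"
  using assms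
proof (induction F rule: finite_induct)
  case empty
  then show ?case by (intro exI[of _ id] exI[of _ "\<lambda>_. 0"]) (auto simp: strict_mono_def)
next
  case (insert x F)
  then obtain r :: "nat \<Rightarrow> nat" and w where r: "strict_mono r" and w: "\<And>k. k \<in> F \<Longrightarrow> (\<lambda>j. D (r j) k) \<longlonglongrightarrow> w k"
    by (metis insert_iff)
  have "\<forall>j. D (r j) x \<in> cball 0 1" using insert.prems by simp
  then obtain y r' where r': "strict_mono (r' :: nat \<Rightarrow> nat)" "((\<lambda>j. D (r j) x) \<circ> r') \<longlonglongrightarrow> y"
    using seq_compactE[OF compact_imp_seq_compact[OF compact_cball[of "0::plane" 1]], of "\<lambda>j. D (r j) x"]
    by metis
  have "(\<lambda>j. D ((r \<circ> r') j) k) \<longlonglongrightarrow> (w(x := y)) k" if "k \<in> insert x F" for k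
  proof (cases "k = x")
    case True
    then show ?thesis using r'(2) by (simp add: o_def)
  next
    case False
    then have "k \<in> F" using that by simp
    from LIMSEQ_subseq_LIMSEQ[OF w[OF this] r'(1)] show ?thesis using False by (simp add: o_def)
  qed
  then show ?case using strict_mono_o[OF r r'(1)] by blast
qed

context slices
begin

lemma slices_subsequence:
  assumes r: "strict_mono r"
  shows "slices n (\<lambda>j. g (r j)) (\<lambda>j. g1 (r j)) (\<lambda>j. g2 (r j)) (\<lambda>j. l (r j)) (\<lambda>j. \<psi> (r j)) C"
proof
  show "filterlim (\<lambda>j. l (r j) i) at_top sequentially" if "i < n" for i
    by (rule filterlim_compose[OF long[OF that] filterlim_subseq[OF r]])
  show "(\<lambda>j. \<Sum>i<n. shrinker_energy (g (r j) i)) \<longlonglongrightarrow> 0"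
    using LIMSEQ_subseq_LIMSEQ[OF defect r] by (simp add: o_def)
qed (use C2 param us arc_int embedded wide in \<open>blast+\<close>)

text \<open>The parameters close to which a curve passes by the origin, away from its end-points. The
  parameters satisfying this on one passage cluster together, hence the separation below.\<close>

definition centre :: "nat \<Rightarrow> nat \<Rightarrow> real \<Rightarrow> bool" where
  "centre j i s \<longleftrightarrow> i < n \<and> 2 \<le> s \<and> s \<le> l j i - 2 \<and> norm (G j i s) < 1 \<and> G j i s \<bullet> U j i s = 0"

definition separated :: "nat \<Rightarrow> (nat \<times> real) set \<Rightarrow> bool" where
  "separated j Z \<longleftrightarrow> finite Z \<and> (\<forall>z\<in>Z. centre j (fst z) (snd z)) \<and>
     (\<forall>z\<in>Z. \<forall>z'\<in>Z. z \<noteq> z' \<and> fst z = fst z' \<longrightarrow> 1 < \<bar>snd z - snd z'\<bar>)"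

lemma separated_card_le:
  assumes "separated j Z" shows "real (card Z) \<le> C * exp 1"
proof -
  have Z: "finite Z" "\<And>z. z \<in> Z \<Longrightarrow> centre j (fst z) (snd z)"
    "\<And>z z'. z \<in> Z \<Longrightarrow> z' \<in> Z \<Longrightarrow> z \<noteq> z' \<Longrightarrow> fst z = fst z' \<Longrightarrow> 1 < \<bar>snd z - snd z'\<bar>"
    using assms unfolding separated_def by blast+
  define E where "E i s = exp (- (norm (G j i s))\<^sup>2 / 4)" for i s
  have Ec: "continuous_on {0..l j i} (E i)" if "i < n" for i
    unfolding E_def by (intro continuous_intros unit_speedD(4)[OF us[OF that]]) simp
  have low: "exp (-1) \<le> integral {snd z - 1/2..snd z + 1/2} (E (fst z))" if z: "z \<in> Z" for z
  proof -
    have c: "fst z < n" "2 \<le> snd z" "snd z \<le> l j (fst z) - 2" "norm (G j (fst z) (snd z)) < 1"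
      using Z(2)[OF z] unfolding centre_def by blast+
    have "integral {snd z - 1/2..snd z + 1/2} (\<lambda>_. exp (-1 :: real)) \<le> integral {snd z - 1/2..snd z + 1/2} (E (fst z))"
    proof (rule integral_le)
      show "E (fst z) integrable_on {snd z - 1/2..snd z + 1/2}"
        by (rule integrable_continuous_real, rule continuous_on_subset[OF Ec[OF c(1)]]) (use c in auto)
      fix r assume r: "r \<in> {snd z - 1/2..snd z + 1/2}"
      have "norm (G j (fst z) r - G j (fst z) (snd z)) \<le> \<bar>r - snd z\<bar>"
        by (rule norm_diff_le_of_unit_speed[OF us[OF c(1)]]) (use c r in auto)
      moreover have "\<bar>r - snd z\<bar> \<le> 1/2" using r unfolding abs_le_iff atLeastAtMost_iff by linarith
      ultimately have "norm (G j (fst z) r) \<le> 2" using c(4) norm_triangle_sub[of "G j (fst z) r" "G j (fst z) (snd z)"] by linarith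
      then have "(norm (G j (fst z) r))\<^sup>2 \<le> 2\<^sup>2" by (intro power_mono) auto
      then show "exp (-1) \<le> E (fst z) r" unfolding E_def by simp
    qed (intro integrable_continuous_real continuous_intros)
    then show ?thesis by simp
  qed
  have "(\<Sum>i<n. \<Sum>z\<in>{z \<in> Z. fst z = i}. integral {snd z - 1/2..snd z + 1/2} (E i)) \<le> (\<Sum>i<n. integral {0..l j i} (E i))"
  proof (rule sum_mono)
    fix i assume "i \<in> {..<n}"
    then have i: "i < n" by simp
    show "(\<Sum>z\<in>{z \<in> Z. fst z = i}. integral {snd z - 1/2..snd z + 1/2} (E i)) \<le> integral {0..l j i} (E i)"
    proof (rule integral_cover_bounds(1)[where B="E i", OF _ Ec[OF i] _ Ec[OF i]])
      fix z z' s assume z: "z \<in> {z \<in> Z. fst z = i}" "z' \<in> {z \<in> Z. fst z = i}"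
        and s: "s \<in> {snd z - 1/2<..<snd z + 1/2}" "s \<in> {snd z' - 1/2<..<snd z' + 1/2}"
      have "\<not> 1 < \<bar>snd z - snd z'\<bar>" using s by auto
      moreover have "z \<in> Z" "z' \<in> Z" "fst z = fst z'" using z by auto
      ultimately show "z = z'" using Z(3)[of z z'] by blast
    next
      fix z assume "z \<in> {z \<in> Z. fst z = i}"
      then have "2 \<le> snd z" "snd z \<le> l j i - 2" using Z(2)[of z] unfolding centre_def by auto
      then show "0 \<le> snd z - 1/2 \<and> snd z + 1/2 \<le> l j i" by simp
    qed (use Z(1) in \<open>auto simp: E_def\<close>)
  qed
  moreover have "(\<Sum>i<n. integral {0..l j i} (E i)) \<le> C"
  proof -
    have "(\<Sum>i<n. integral {0..l j i} (E i)) = (\<Sum>i<n. wide_gaussian_length (g j i))"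
      unfolding E_def by (intro sum.cong refl) (simp only: integral_weight(1) lessThan_iff)
    then show ?thesis using wide[of j] by simp
  qed
  moreover have "(\<Sum>i<n. \<Sum>z\<in>{z \<in> Z. fst z = i}. integral {snd z - 1/2..snd z + 1/2} (E i))
    = (\<Sum>z\<in>Z. integral {snd z - 1/2..snd z + 1/2} (E (fst z)))"
  proof -
    have "(\<Sum>i<n. \<Sum>z\<in>{z \<in> Z. fst z = i}. integral {snd z - 1/2..snd z + 1/2} (E i))
      = (\<Sum>i<n. \<Sum>z\<in>{z \<in> Z. fst z = i}. integral {snd z - 1/2..snd z + 1/2} (E (fst z)))"
      by (intro sum.cong) auto
    also have "\<dots> = (\<Sum>z\<in>Z. integral {snd z - 1/2..snd z + 1/2} (E (fst z)))"
      by (rule sum.group) (use Z(1,2) in \<open>auto simp: centre_def\<close>)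
    finally show ?thesis .
  qed
  moreover have "real (card Z) * exp (-1) \<le> (\<Sum>z\<in>Z. integral {snd z - 1/2..snd z + 1/2} (E (fst z)))"
    using sum_mono[of Z "\<lambda>_. exp (-1)", OF low] by simp
  ultimately have "real (card Z) * exp (-1) \<le> C" by linarith
  then have "real (card Z) * exp (-1) * exp 1 \<le> C * exp 1" by (intro mult_right_mono) auto
  then show ?thesis by (simp add: mult.assoc exp_add[symmetric])
qed

lemma maximal_separated:
  obtains Z where "separated j Z" "\<And>i s. centre j i s \<Longrightarrow> \<exists>z\<in>Z. fst z = i \<and> \<bar>s - snd z\<bar> \<le> 1"
proof -
  define P where "P k \<longleftrightarrow> (\<exists>Z. separated j Z \<and> card Z = k)" for k
  have P0: "P 0" unfolding P_def by (rule exI[of _ "{}"]) (simp add: separated_def)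
  have bound: "k \<le> nat \<lceil>C * exp 1\<rceil>" if Pk: "P k" for k
  proof -
    have "real k \<le> C * exp 1" using Pk separated_card_le unfolding P_def by blast
    then show ?thesis by linarith
  qed
  have "P (GREATEST k. P k)" by (rule GreatestI_nat[of P 0]) (use P0 bound in auto)
  then obtain Z where Z: "separated j Z" "card Z = (GREATEST k. P k)" unfolding P_def by blast
  show ?thesis
  proof (rule that[OF Z(1)], rule ccontr)
    fix i s assume c: "centre j i s" and no: "\<not> (\<exists>z\<in>Z. fst z = i \<and> \<bar>s - snd z\<bar> \<le> 1)"
    have fin: "finite Z" and nin: "(i, s) \<notin> Z" using Z(1) no by (auto simp: separated_def)
    have far: "1 < \<bar>s - snd z\<bar>" if "z \<in> Z" "fst z = i" for z using no that by force
    have far': "1 < \<bar>snd z - s\<bar>" if "z \<in> Z" "fst z = i" for z using far[OF that] by (simp add: abs_minus_commute)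
    have "separated j (insert (i, s) Z)"
      using Z(1) c far far' unfolding separated_def by (auto simp del: abs_less_iff)
    then have "P (Suc (card Z))" unfolding P_def using fin nin by (metis card_insert_disjoint)
    then have "Suc (card Z) \<le> card Z" unfolding Z(2) by (rule Greatest_le_nat) (use bound in auto)
    then show False by simp
  qed
qed

end

abbreviation curve_end_set :: "nat \<Rightarrow> (nat \<times> real) set" where
  "curve_end_set n \<equiv> {..<n} \<times> {0, 1}"

abbreviation (input) end_at :: "(nat \<Rightarrow> real \<Rightarrow> plane) \<Rightarrow> nat \<times> real \<Rightarrow> plane" where
  "end_at h k \<equiv> h (fst k) (snd k)"

definition far_end :: "(nat \<Rightarrow> nat \<Rightarrow> real \<Rightarrow> plane) \<Rightarrow> nat \<times> real \<Rightarrow> bool" where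
  "far_end g k \<longleftrightarrow> filterlim (\<lambda>j. norm (end_at (g j) k)) at_top sequentially"

definition zero_end :: "nat \<Rightarrow> (nat \<Rightarrow> nat \<Rightarrow> real \<Rightarrow> plane) \<Rightarrow> nat \<times> real \<Rightarrow> bool" where
  "zero_end n g k \<longleftrightarrow> (\<forall>j. end_at (g j) k = 0 \<and> (\<forall>k'\<in>curve_end_set n. end_at (g j) k' = 0 \<longrightarrow> k' = k)) \<and>
     (\<exists>c>0. \<exists>a. \<forall>\<^sub>F j in sequentially. \<forall>i<n. \<forall>x\<in>{0..1}. c * norm (g j i x) \<le> g j i x \<bullet> a)"

definition triple_ends :: "nat \<Rightarrow> (nat \<Rightarrow> nat \<Rightarrow> real \<Rightarrow> plane) \<Rightarrow> (nat \<times> real) set \<Rightarrow> bool" where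
  "triple_ends n g A \<longleftrightarrow> A \<subseteq> curve_end_set n \<and> card A = 3 \<and>
     (\<forall>j. (\<forall>k\<in>A. \<forall>k'\<in>curve_end_set n. end_at (g j) k' = end_at (g j) k \<longleftrightarrow> k' \<in> A) \<and>
       (\<Sum>k\<in>A. outward_tangent (g j (fst k)) (snd k)) = 0)"

locale network_slices = slices +
  assumes end_cases: "k \<in> curve_end_set n \<Longrightarrow> far_end g k \<or> zero_end n g k \<or> (\<exists>A. k \<in> A \<and> triple_ends n g A)"
begin

lemma network_slices_subsequence:
  assumes r: "strict_mono r"
  shows "network_slices n (\<lambda>j. g (r j)) (\<lambda>j. g1 (r j)) (\<lambda>j. g2 (r j)) (\<lambda>j. l (r j)) (\<lambda>j. \<psi> (r j)) C"
proof (intro network_slices.intro slices_subsequence[OF r] network_slices_axioms.intro)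
  fix k assume k: "k \<in> curve_end_set n"
  have 1: "far_end (\<lambda>j. g (r j)) k" if "far_end g k"
    using filterlim_compose[OF that[unfolded far_end_def] filterlim_subseq[OF r]] unfolding far_end_def .
  have 2: "zero_end n (\<lambda>j. g (r j)) k" if z: "zero_end n g k"
  proof -
    obtain c a where ca: "0 < c" "\<forall>\<^sub>F j in sequentially. \<forall>i<n. \<forall>x\<in>{0..1}. c * norm (g j i x) \<le> g j i x \<bullet> a"
      using z unfolding zero_end_def by blast
    have "\<forall>\<^sub>F j in sequentially. \<forall>i<n. \<forall>x\<in>{0..1}. c * norm (g (r j) i x) \<le> g (r j) i x \<bullet> a"
      using eventually_compose_filterlim[OF ca(2) filterlim_subseq[OF r]] .
    then show ?thesis using z ca(1) unfolding zero_end_def by blast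
  qed
  have 3: "triple_ends n (\<lambda>j. g (r j)) A" if "triple_ends n g A" for A
    using that unfolding triple_ends_def by blast
  show "far_end (\<lambda>j. g (r j)) k \<or> zero_end n (\<lambda>j. g (r j)) k \<or> (\<exists>A. k \<in> A \<and> triple_ends n (\<lambda>j. g (r j)) A)"
    using end_cases[OF k] 1 2 3 by blast
qed

end

text \<open>\<open>end_param\<close> and \<open>end_sign\<close> parametrize the curve by arclength, starting from the given end.\<close>

definition end_param :: "(nat \<Rightarrow> real) \<Rightarrow> nat \<times> real \<Rightarrow> real" where
  "end_param l k = (if snd k = 0 then 0 else l (fst k))"

definition end_sign :: "nat \<times> real \<Rightarrow> real" where
  "end_sign k = (if snd k = 0 then 1 else - 1)"

definition inward :: "(nat \<Rightarrow> real \<Rightarrow> plane) \<Rightarrow> nat \<times> real \<Rightarrow> plane" where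
  "inward h k = end_sign k *\<^sub>R unit_tangent (h (fst k)) (snd k)"

lemma outward_tangent_inward: "outward_tangent (h (fst k)) (snd k) = - inward h k"
  by (simp add: outward_tangent_def inward_def end_sign_def)

locale limit_slices = network_slices +
  fixes E :: "(nat \<times> real) set" and N :: nat and I :: "nat \<Rightarrow> nat \<Rightarrow> nat" and c :: "nat \<Rightarrow> nat \<Rightarrow> real"
    and v :: "nat \<Rightarrow> plane" and w :: "nat \<times> real \<Rightarrow> plane"
  assumes E_subset: "E \<subseteq> curve_end_set n"
    and E_near: "\<And>j k. k \<in> E \<Longrightarrow> norm (end_at (g j) k) < 1"
    and E_far: "\<And>j k. k \<in> curve_end_set n \<Longrightarrow> k \<notin> E \<Longrightarrow> 1 \<le> norm (end_at (g j) k)"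
    and centres: "\<And>j m. m < N \<Longrightarrow> centre j (I j m) (c j m)"
    and centres_apart: "\<And>j m m'. m < N \<Longrightarrow> m' < N \<Longrightarrow> m \<noteq> m' \<Longrightarrow> I j m = I j m' \<Longrightarrow> 1 < \<bar>c j m - c j m'\<bar>"
    and centres_maximal: "\<And>j i s. centre j i s \<Longrightarrow> \<exists>m<N. I j m = i \<and> \<bar>s - c j m\<bar> \<le> 1"
    and centre_direction: "\<And>m. m < N \<Longrightarrow> (\<lambda>j. U j (I j m) (c j m)) \<longlonglongrightarrow> v m"
    and end_direction: "\<And>k. k \<in> E \<Longrightarrow> (\<lambda>j. inward (g j) k) \<longlonglongrightarrow> w k"

lemma (in network_slices) limit_subsequence:
  "\<exists>r E N I c v w. strict_mono r \<and>
     limit_slices n (\<lambda>j. g (r j)) (\<lambda>j. g1 (r j)) (\<lambda>j. g2 (r j)) (\<lambda>j. l (r j)) (\<lambda>j. \<psi> (r j)) C E N I c v w"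
proof -
  have "\<exists>Z. separated j Z \<and> (\<forall>i s. centre j i s \<longrightarrow> (\<exists>z\<in>Z. fst z = i \<and> \<bar>s - snd z\<bar> \<le> 1))" for j
    by (rule maximal_separated[of j]) blast
  then obtain Z where Z: "\<And>j. separated j (Z j)"
    "\<And>j i s. centre j i s \<Longrightarrow> \<exists>z\<in>Z j. fst z = i \<and> \<bar>s - snd z\<bar> \<le> 1" by metis
  define Q where "Q j = ({k \<in> curve_end_set n. norm (end_at (g j) k) < 1}, card (Z j))" for j
  have Q: "Q j \<in> Pow (curve_end_set n) \<times> {..nat \<lceil>C * exp 1\<rceil>}" for j
  proof -
    have "real (card (Z j)) \<le> C * exp 1" by (rule separated_card_le[OF Z(1)])
    then have "card (Z j) \<le> nat \<lceil>C * exp 1\<rceil>" by linarith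
    then show ?thesis by (auto simp: Q_def)
  qed
  obtain r0 y where r0: "strict_mono (r0 :: nat \<Rightarrow> nat)" "\<And>j. Q (r0 j) = y"
    by (rule constant_subsequence[OF _ Q]) (simp, rule that)
  define E where "E = fst y"
  define N where "N = snd y"
  have E: "E = {k \<in> curve_end_set n. norm (end_at (g (r0 j)) k) < 1}" and N: "card (Z (r0 j)) = N" for j
    using r0(2)[of j] by (auto simp: E_def N_def Q_def)
  have "\<exists>f. bij_betw f {0..<N} (Z (r0 j))" for j
    using ex_bij_betw_nat_finite[of "Z (r0 j)"] Z(1)[of "r0 j"] N[of j] by (auto simp: separated_def)
  then obtain f where f: "\<And>j. bij_betw (f j) {0..<N} (Z (r0 j))" by metis
  define D where "D j x = (case x of Inl m \<Rightarrow> unit_tangent (g (r0 j) (fst (f j m))) (\<psi> (r0 j) (fst (f j m)) (snd (f j m)))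
     | Inr k \<Rightarrow> inward (g (r0 j)) k)" for j x
  have fZ: "f j m \<in> Z (r0 j)" if "m < N" for j m using f[of j] that by (auto simp: bij_betw_def)
  have cen: "centre (r0 j) (fst (f j m)) (snd (f j m))" if "m < N" for j m
    using fZ[OF that] Z(1) unfolding separated_def by blast
  have bound: "norm (D j x) \<le> 1" if "x \<in> Inl ` {..<N} \<union> Inr ` E" for j x
    using that
  proof
    assume "x \<in> Inl ` {..<N}"
    then obtain m where m: "m < N" "x = Inl m" by auto
    have "norm (unit_tangent (g (r0 j) (fst (f j m))) (\<psi> (r0 j) (fst (f j m)) (snd (f j m)))) = 1"
      by (rule unit_speedD(7)[OF us]) (use cen[OF m(1), of j] in \<open>auto simp: centre_def\<close>)
    then show ?thesis using m by (simp add: D_def)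
  next
    assume "x \<in> Inr ` E"
    then obtain k where k: "k \<in> E" "x = Inr k" by auto
    then have "k \<in> curve_end_set n" using E by blast
    then have "fst k < n" "snd k \<in> {0..1}" by auto
    then show ?thesis using k C2_norm_unit_tangent[OF C2] by (simp add: D_def inward_def end_sign_def)
  qed
  have fin: "finite (Inl ` {..<N} \<union> Inr ` E)"
    using finite_subset[of E "curve_end_set n"] E by auto
  have ex: "\<exists>(r :: nat \<Rightarrow> nat) u. strict_mono r \<and> (\<forall>x\<in>Inl ` {..<N} \<union> Inr ` E. (\<lambda>j. D (r j) x) \<longlonglongrightarrow> u x)"
    by (rule bounded_family_subsequence[OF fin bound])
  obtain r1 u where r1: "strict_mono (r1 :: nat \<Rightarrow> nat)"
    and u': "\<forall>x\<in>Inl ` {..<N} \<union> Inr ` E. (\<lambda>j. D (r1 j) x) \<longlonglongrightarrow> u x"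
    using ex by (elim exE conjE)
  note u = u'[rule_format]
  let ?r = "\<lambda>j. r0 (r1 j)"
  have r: "strict_mono ?r" using strict_mono_o[OF r0(1) r1] by (simp add: o_def)
  interpret s: network_slices n "\<lambda>j. g (?r j)" "\<lambda>j. g1 (?r j)" "\<lambda>j. g2 (?r j)" "\<lambda>j. l (?r j)" "\<lambda>j. \<psi> (?r j)" C
    by (rule network_slices_subsequence[OF r])
  have sc: "s.centre j i s \<longleftrightarrow> centre (?r j) i s" for j i s by (simp add: s.centre_def centre_def)
  have "limit_slices n (\<lambda>j. g (?r j)) (\<lambda>j. g1 (?r j)) (\<lambda>j. g2 (?r j)) (\<lambda>j. l (?r j)) (\<lambda>j. \<psi> (?r j)) C E N
    (\<lambda>j m. fst (f (r1 j) m)) (\<lambda>j m. snd (f (r1 j) m)) (\<lambda>m. u (Inl m)) (\<lambda>k. u (Inr k))"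
  proof
    show "E \<subseteq> curve_end_set n" using E by blast
    show "norm (end_at (g (?r j)) k) < 1" if "k \<in> E" for j k using that E[of "r1 j"] by auto
    show "1 \<le> norm (end_at (g (?r j)) k)" if "k \<in> curve_end_set n" "k \<notin> E" for j k
      using that E[of "r1 j"] by force
    show "s.centre j (fst (f (r1 j) m)) (snd (f (r1 j) m))" if "m < N" for j m
      unfolding sc by (rule cen[OF that])
    show "1 < \<bar>snd (f (r1 j) m) - snd (f (r1 j) m')\<bar>"
      if "m < N" "m' < N" "m \<noteq> m'" "fst (f (r1 j) m) = fst (f (r1 j) m')" for j m m'
    proof -
      have "f (r1 j) m \<noteq> f (r1 j) m'"
        using f[of "r1 j"] that(1,2,3) unfolding bij_betw_def inj_on_def by auto
      then show ?thesis using Z(1) fZ[OF that(1)] fZ[OF that(2)] that(4) unfolding separated_def by blast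
    qed
    show "\<exists>m<N. fst (f (r1 j) m) = i \<and> \<bar>s - snd (f (r1 j) m)\<bar> \<le> 1" if "s.centre j i s" for j i s
    proof -
      obtain z where z: "z \<in> Z (?r j)" "fst z = i" "\<bar>s - snd z\<bar> \<le> 1" using Z(2) \<open>s.centre j i s\<close> unfolding sc by blast
      then have "z \<in> f (r1 j) ` {0..<N}" using f[of "r1 j"] unfolding bij_betw_def by simp
      then obtain m where "m < N" "z = f (r1 j) m" by auto
      then show ?thesis using z by auto
    qed
    show "(\<lambda>j. unit_tangent (g (?r j) (fst (f (r1 j) m))) (\<psi> (?r j) (fst (f (r1 j) m)) (snd (f (r1 j) m)))) \<longlonglongrightarrow> u (Inl m)"
      if "m < N" for m using u[of "Inl m"] that by (simp add: D_def)
    show "(\<lambda>j. inward (g (?r j)) k) \<longlonglongrightarrow> u (Inr k)" if "k \<in> E" for k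
      using u[of "Inr k"] that by (simp add: D_def)
  qed
  then show ?thesis using r by blast
qed

lemma straightD:
  assumes st: "straight L \<eta> l G U K" and s0: "s0 \<in> {0..l}" "norm (G s0) \<le> L"
  shows "4 * L \<le> l" "0 \<le> L"
    "\<And>s t. s \<in> {0..l} \<Longrightarrow> t \<in> {0..l} \<Longrightarrow> \<bar>s - s0\<bar> \<le> L \<Longrightarrow> \<bar>t - s0\<bar> \<le> L \<Longrightarrow> norm (U t - U s) \<le> \<eta>"
    "\<And>s t. s \<in> {0..l} \<Longrightarrow> t \<in> {0..l} \<Longrightarrow> \<bar>s - s0\<bar> \<le> L \<Longrightarrow> \<bar>t - s0\<bar> \<le> L \<Longrightarrow> s \<le> t \<Longrightarrow>
       \<bar>G t \<bullet> U t - G s \<bullet> U s - (t - s)\<bar> \<le> \<eta>"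
    "\<bar>G s0 \<bullet> rot90 (U s0)\<bar> \<le> \<eta>"
proof -
  show "4 * L \<le> l" using st unfolding straight_def by blast
  show L: "0 \<le> L" using s0(2) norm_ge_zero[of "G s0"] by linarith
  have *: "norm (U t - U s) \<le> \<eta> \<and> \<bar>G t \<bullet> U t - G s \<bullet> U s - (t - s)\<bar> \<le> \<eta> \<and> \<bar>G s \<bullet> rot90 (U s)\<bar> \<le> \<eta>"
    if "s \<in> {0..l}" "t \<in> {0..l}" "\<bar>s - s0\<bar> \<le> L" "\<bar>t - s0\<bar> \<le> L" "s \<le> t" for s t
    using st s0 that unfolding straight_def by blast
  show "norm (U t - U s) \<le> \<eta>" if "s \<in> {0..l}" "t \<in> {0..l}" "\<bar>s - s0\<bar> \<le> L" "\<bar>t - s0\<bar> \<le> L" for s t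
    using *[of s t] *[of t s] that by (cases "s \<le> t") (auto simp: norm_minus_commute)
  show "\<bar>G t \<bullet> U t - G s \<bullet> U s - (t - s)\<bar> \<le> \<eta>"
    if "s \<in> {0..l}" "t \<in> {0..l}" "\<bar>s - s0\<bar> \<le> L" "\<bar>t - s0\<bar> \<le> L" "s \<le> t" for s t
    using *[OF that] by blast
  show "\<bar>G s0 \<bullet> rot90 (U s0)\<bar> \<le> \<eta>" using *[of s0 s0] s0(1) L by simp
qed

lemma straight_nearly_linear:
  assumes us: "unit_speed l G U K" and st: "straight L \<eta> l G U K" and s0: "s0 \<in> {0..l}" "norm (G s0) \<le> L"
    and \<sigma>: "\<sigma> = 1 \<or> \<sigma> = -1" and sub: "\<And>s. s \<in> {a..b} \<Longrightarrow> s0 + \<sigma> * s \<in> {0..l} \<and> \<bar>s\<bar> \<le> L"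
  shows "nearly_linear \<eta> (\<sigma> *\<^sub>R U s0) a b (\<lambda>s. G (s0 + \<sigma> * s))"
proof -
  have *: "norm (G Q - G P - (Q - P) *\<^sub>R U s0) \<le> \<eta> * (Q - P)"
    if PQ: "P \<in> {0..l}" "Q \<in> {0..l}" "\<bar>P - s0\<bar> \<le> L" "\<bar>Q - s0\<bar> \<le> L" "P \<le> Q" for P Q
  proof -
    have "norm ((G Q - Q *\<^sub>R U s0) - (G P - P *\<^sub>R U s0)) \<le> integral {P..Q} (\<lambda>_. \<eta>)"
    proof (rule FTC_norm_bound[OF PQ(5), where f'="\<lambda>x. U x - U s0"])
      fix x assume x: "x \<in> {P..Q}"
      have xl: "x \<in> {0..l}" "\<bar>x - s0\<bar> \<le> L" using x PQ by auto
      have "(G has_vector_derivative U x) (at x within {P..Q})"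
        by (rule has_vector_derivative_within_subset[OF unit_speedD(5)[OF us xl(1)]]) (use PQ in auto)
      then show "((\<lambda>x. G x - x *\<^sub>R U s0) has_vector_derivative U x - U s0) (at x within {P..Q})"
        by (auto intro!: derivative_eq_intros)
      show "norm (U x - U s0) \<le> \<eta>"
        by (rule straightD(3)[OF st s0 s0(1) xl(1)]) (use xl straightD(2)[OF st s0] in auto)
    qed simp
    moreover have "(G Q - Q *\<^sub>R U s0) - (G P - P *\<^sub>R U s0) = G Q - G P - (Q - P) *\<^sub>R U s0"
      by (simp add: algebra_simps)
    ultimately show ?thesis using PQ(5) by (simp add: mult.commute)
  qed
  show ?thesis
    unfolding nearly_linear_def
  proof (intro ballI)
    fix s t assume st: "s \<in> {a..b}" "t \<in> {a..b}"
    let ?P = "s0 + \<sigma> * s" and ?Q = "s0 + \<sigma> * t"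
    have m: "?P \<in> {0..l}" "?Q \<in> {0..l}" "\<bar>?P - s0\<bar> \<le> L" "\<bar>?Q - s0\<bar> \<le> L"
      using sub[OF st(1)] sub[OF st(2)] \<sigma> by auto
    have e: "(t - s) *\<^sub>R (\<sigma> *\<^sub>R U s0) = (?Q - ?P) *\<^sub>R U s0" by (simp add: algebra_simps)
    have d: "\<bar>?Q - ?P\<bar> = \<bar>t - s\<bar>" using \<sigma> by auto
    show "norm (G ?Q - G ?P - (t - s) *\<^sub>R (\<sigma> *\<^sub>R U s0)) \<le> \<eta> * \<bar>t - s\<bar>"
    proof (cases "?P \<le> ?Q")
      case True
      then show ?thesis using *[OF m True] unfolding e d[symmetric] by simp
    next
      case False
      have "norm (G ?P - G ?Q - (?P - ?Q) *\<^sub>R U s0) \<le> \<eta> * (?P - ?Q)" using *[OF m(2,1,4,3)] False by simp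
      moreover have "G ?P - G ?Q - (?P - ?Q) *\<^sub>R U s0 = - (G ?Q - G ?P - (?Q - ?P) *\<^sub>R U s0)"
        by (simp add: algebra_simps)
      ultimately show ?thesis unfolding e d[symmetric] using False by (simp only: norm_minus_cancel) (simp add: abs_if)
    qed
  qed
qed

lemma triple_point_near_origin:
  fixes u :: "'k \<Rightarrow> plane"
  assumes C: "card C = 3" "(\<Sum>k\<in>C. u k) = 0" "\<And>k. k \<in> C \<Longrightarrow> norm (u k) = 1"
    and p: "\<And>k. k \<in> C \<Longrightarrow> \<bar>p \<bullet> rot90 (u k)\<bar> \<le> \<eta>" and \<eta>: "0 \<le> \<eta>"
  shows "norm p \<le> 2 * \<eta>"
proof (cases "p = 0")
  case False
  have "norm (rot90 p /\<^sub>R norm p) = 1" using False by simp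
  then obtain k where k: "k \<in> C" "1/2 \<le> (rot90 p /\<^sub>R norm p) \<bullet> u k"
    using triple_direction[OF C, of "rot90 p /\<^sub>R norm p"] by blast
  have "norm p * (1/2) \<le> norm p * ((rot90 p /\<^sub>R norm p) \<bullet> u k)" using k by (intro mult_left_mono) auto
  also have "\<dots> = - (p \<bullet> rot90 (u k))" using False by (simp add: inner_rot90_swap)
  also have "\<dots> \<le> \<eta>" using p[OF k(1)] by linarith
  finally show ?thesis by simp
qed (use \<eta> in simp)

text \<open>In a cone around \<open>a\<close>, no finite set of directions can sum up to zero.\<close>

lemma cone_excludes_balanced_directions:
  fixes a :: plane and x u :: "'m \<Rightarrow> plane"
  assumes M: "finite M" "M \<noteq> {}" and u: "(\<Sum>m\<in>M. u m) = 0" "\<And>m. m \<in> M \<Longrightarrow> norm (u m) = 1"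
    and x: "\<And>m. m \<in> M \<Longrightarrow> norm (x m - u m) \<le> 2 * \<eta>" "\<And>m. m \<in> M \<Longrightarrow> c * norm (x m) \<le> x m \<bullet> a"
    and c: "0 < c" "2 * \<eta> * (c + norm a) < c"
  shows False
proof -
  have "c - 2 * \<eta> * (c + norm a) \<le> u m \<bullet> a" if m: "m \<in> M" for m
  proof -
    have "1 - 2 * \<eta> \<le> norm (x m)"
      using norm_triangle_sub[of "u m" "x m"] x(1)[OF m] u(2)[OF m] by (simp add: norm_minus_commute)
    then have "c * (1 - 2 * \<eta>) \<le> c * norm (x m)" using c by (intro mult_left_mono) auto
    moreover have "(x m - u m) \<bullet> a \<le> 2 * \<eta> * norm a"
      using norm_cauchy_schwarz[of "x m - u m" a] mult_right_mono[OF x(1)[OF m] norm_ge_zero[of a]] by linarith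
    ultimately show ?thesis using x(2)[OF m] by (simp add: algebra_simps)
  qed
  then have "(\<Sum>m\<in>M. c - 2 * \<eta> * (c + norm a)) \<le> (\<Sum>m\<in>M. u m \<bullet> a)" by (rule sum_mono)
  also have "\<dots> = 0" using u(1) by (simp add: inner_sum_left[symmetric])
  finally have "real (card M) * (c - 2 * \<eta> * (c + norm a)) \<le> 0" by simp
  moreover have "0 < real (card M) * (c - 2 * \<eta> * (c + norm a))"
    using M c by (intro mult_pos_pos) (auto simp: card_gt_0_iff)
  ultimately show False by linarith
qed

context slices
begin

lemma end_param_in: "k \<in> curve_end_set n \<Longrightarrow> end_param (l j) k \<in> {0..l j (fst k)}"
  using l_pos[of "fst k" j] by (auto simp: end_param_def)

lemma \<psi>_end_param: "k \<in> curve_end_set n \<Longrightarrow> \<psi> j (fst k) (end_param (l j) k) = snd k"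
  using \<psi>_ends by (auto simp: end_param_def)

lemma norm_inward: "k \<in> curve_end_set n \<Longrightarrow> norm (inward (g j) k) = 1"
  using C2_norm_unit_tangent[OF C2] by (auto simp: inward_def end_sign_def)

abbreviation (input) "arm j k s \<equiv> G j (fst k) (end_param (l j) k + end_sign k * s)"

lemma arm_start: "k \<in> curve_end_set n \<Longrightarrow> arm j k 0 = end_at (g j) k"
  by (simp add: \<psi>_end_param)

lemma arm_range: "k \<in> curve_end_set n \<Longrightarrow> 0 \<le> s \<Longrightarrow> s \<le> l j (fst k) \<Longrightarrow> end_param (l j) k + end_sign k * s \<in> {0..l j (fst k)}"
  by (auto simp: end_param_def end_sign_def)

lemma end_sign_cases: "end_sign k = 1 \<or> end_sign k = -1"
  by (simp add: end_sign_def)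

lemma arm_linear:
  assumes st: "straight_at L \<eta> j" and k: "k \<in> curve_end_set n" and near: "norm (end_at (g j) k) \<le> L" and b: "b \<le> L"
  shows "nearly_linear \<eta> (inward (g j) k) 0 b (arm j k)"
proof -
  have i: "fst k < n" using k by auto
  have n0: "norm (G j (fst k) (end_param (l j) k)) \<le> L" using near by (simp add: \<psi>_end_param[OF k])
  note D = straightD[OF st[rule_format, OF i] end_param_in[OF k] n0]
  have "nearly_linear \<eta> (end_sign k *\<^sub>R U j (fst k) (end_param (l j) k)) 0 b (arm j k)"
  proof (rule straight_nearly_linear[OF us[OF i] st[rule_format, OF i] end_param_in[OF k] n0 end_sign_cases])
    fix s assume s: "s \<in> {0..b}"
    have "s \<le> l j (fst k)" using s b D(1,2) by auto
    then show "end_param (l j) k + end_sign k * s \<in> {0..l j (fst k)} \<and> \<bar>s\<bar> \<le> L"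
      using arm_range[OF k] s b by auto
  qed
  then show ?thesis by (simp add: inward_def \<psi>_end_param[OF k])
qed

lemma triple_sum_inward: "triple_ends n g A \<Longrightarrow> (\<Sum>k\<in>A. inward (g j) k) = 0"
  unfolding triple_ends_def outward_tangent_inward sum_negf by simp

lemma triple_end_near:
  assumes A: "triple_ends n g A" "k0 \<in> A" and st: "straight_at L \<eta> j" and near: "norm (end_at (g j) k0) \<le> L"
    and \<eta>: "0 \<le> \<eta>"
  shows "norm (end_at (g j) k0) \<le> 2 * \<eta>"
proof (rule triple_point_near_origin[of A "inward (g j)"])
  show "card A = 3" using A unfolding triple_ends_def by blast
  show "(\<Sum>k\<in>A. inward (g j) k) = 0" by (rule triple_sum_inward[OF A(1)])
  fix k assume kA: "k \<in> A"
  then have k: "k \<in> curve_end_set n" and p: "end_at (g j) k = end_at (g j) k0"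
    using A unfolding triple_ends_def by blast+
  show "norm (inward (g j) k) = 1" by (rule norm_inward[OF k])
  have i: "fst k < n" using k by auto
  have "norm (G j (fst k) (end_param (l j) k)) \<le> L" using near p by (simp add: \<psi>_end_param[OF k])
  from straightD(5)[OF st[rule_format, OF i] end_param_in[OF k] this]
  show "\<bar>end_at (g j) k0 \<bullet> rot90 (inward (g j) k)\<bar> \<le> \<eta>"
    using p end_sign_cases[of k] by (auto simp: \<psi>_end_param[OF k] inward_def)
qed (rule \<eta>)

end

context limit_slices
begin

definition good :: "real \<Rightarrow> real \<Rightarrow> nat \<Rightarrow> bool" where
  "good L \<eta> j \<longleftrightarrow> straight_at L \<eta> j \<and> (\<forall>k\<in>E. norm (end_at (g j) k) \<le> \<eta>) \<and>
     (\<forall>k\<in>curve_end_set n - E. L < norm (end_at (g j) k))"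

lemma good_eventually:
  assumes L: "1 \<le> L" and \<eta>: "0 < \<eta>"
  shows "\<forall>\<^sub>F j in sequentially. good L \<eta> j"
proof -
  define \<eta>' where "\<eta>' = min (\<eta> / 2) (1/4)"
  have \<eta>': "0 < \<eta>'" "2 * \<eta>' \<le> \<eta>" "2 * \<eta>' < 1" using \<eta> by (auto simp: \<eta>'_def)
  have "\<forall>\<^sub>F j in sequentially. \<forall>k\<in>curve_end_set n.
    (k \<in> E \<longrightarrow> norm (end_at (g j) k) \<le> \<eta>) \<and> (k \<notin> E \<longrightarrow> L < norm (end_at (g j) k))"
  proof (intro eventually_ball_finite ballI)
    fix k assume k: "k \<in> curve_end_set n"
    from end_cases[OF k] consider "far_end g k" | "zero_end n g k" | A where "k \<in> A" "triple_ends n g A" by blast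
    then show "\<forall>\<^sub>F j in sequentially. (k \<in> E \<longrightarrow> norm (end_at (g j) k) \<le> \<eta>) \<and> (k \<notin> E \<longrightarrow> L < norm (end_at (g j) k))"
    proof cases
      case 1
      then have "\<forall>\<^sub>F j in sequentially. L < norm (end_at (g j) k)" unfolding far_end_def filterlim_at_top_dense by blast
      then show ?thesis
      proof (rule eventually_mono)
        fix j assume j: "L < norm (end_at (g j) k)"
        have "k \<notin> E" using E_near[of k j] j L by auto
        then show "(k \<in> E \<longrightarrow> norm (end_at (g j) k) \<le> \<eta>) \<and> (k \<notin> E \<longrightarrow> L < norm (end_at (g j) k))" using j by blast
      qed
    next
      case 2
      then have "end_at (g j) k = 0" for j unfolding zero_end_def by blast
      then show ?thesis using E_far[OF k, of 0] \<eta> by auto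
    next
      case 3
      show ?thesis using straight_eventually[OF L \<eta>'(1)]
      proof (rule eventually_mono)
        fix j assume st: "straight_at L \<eta>' j"
        have *: "norm (end_at (g j) k) \<le> 2 * \<eta>'" if "norm (end_at (g j) k) \<le> L"
          by (rule triple_end_near[OF 3(2,1) st that]) (use \<eta>' in simp)
        show "(k \<in> E \<longrightarrow> norm (end_at (g j) k) \<le> \<eta>) \<and> (k \<notin> E \<longrightarrow> L < norm (end_at (g j) k))"
          using * E_near[of k j] E_far[OF k, of j] L \<eta>' by force
      qed
    qed
  qed simp
  with straight_eventually[OF L \<eta>] show ?thesis
    by eventually_elim (use E_subset in \<open>unfold good_def, blast\<close>)
qed

lemma goodD:
  assumes "good L \<eta> j"
  shows "straight_at L \<eta> j" "\<And>k. k \<in> E \<Longrightarrow> norm (end_at (g j) k) \<le> \<eta>"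
    "\<And>k. k \<in> curve_end_set n \<Longrightarrow> norm (end_at (g j) k) \<le> L \<Longrightarrow> k \<in> E"
  using assms unfolding good_def by (blast, blast, force)

lemma triple_subset_E:
  assumes A: "triple_ends n g A" "k \<in> A" "k \<in> E" shows "A \<subseteq> E"
proof
  fix k' assume k': "k' \<in> A"
  then have "end_at (g 0) k' = end_at (g 0) k" "k' \<in> curve_end_set n" using A unfolding triple_ends_def by blast+
  then show "k' \<in> E" using E_near[OF A(3), of 0] E_far[of k' 0] by force
qed

lemma E_not_far: "k \<in> E \<Longrightarrow> \<not> far_end g k"
proof
  assume k: "k \<in> E" and "far_end g k"
  then have "\<forall>\<^sub>F j in sequentially. 1 < norm (end_at (g j) k)" unfolding far_end_def filterlim_at_top_dense by blast
  then obtain j where "1 < norm (end_at (g j) k)" using eventually_happens by force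
  then show False using E_near[OF k, of j] by simp
qed

lemma centreD:
  assumes "m < N"
  shows "I j m < n" "2 \<le> c j m" "c j m \<le> l j (I j m) - 2" "norm (G j (I j m) (c j m)) < 1"
    "G j (I j m) (c j m) \<bullet> U j (I j m) (c j m) = 0" "c j m \<in> {0..l j (I j m)}"
    "norm (U j (I j m) (c j m)) = 1"
proof -
  show *: "I j m < n" "2 \<le> c j m" "c j m \<le> l j (I j m) - 2" "norm (G j (I j m) (c j m)) < 1"
    "G j (I j m) (c j m) \<bullet> U j (I j m) (c j m) = 0"
    using centres[OF assms, of j] unfolding centre_def by blast+
  show c: "c j m \<in> {0..l j (I j m)}" using * by auto
  show "norm (U j (I j m) (c j m)) = 1" by (rule unit_speedD(7)[OF us[OF *(1)] c])
qed

context
  fixes L \<eta> j assumes gd: "good L \<eta> j" and L1: "1 \<le> L" and \<eta>1: "\<eta> \<le> 1/4"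
begin

lemma near_start:
  assumes i: "i < n" and s0: "s0 \<in> {0..l j i}" "norm (G j i s0) \<le> R" and near: "s0 + R \<le> L" and R: "0 \<le> R"
  shows "(i, 0) \<in> E" "\<bar>G j i s0 \<bullet> U j i s0 - s0\<bar> \<le> 2 * \<eta>"
proof -
  have l: "0 \<in> {0..l j i}" using l_pos[OF i, of j] by simp
  have "norm (G j i 0 - G j i s0) \<le> \<bar>0 - s0\<bar>" by (rule norm_diff_le_of_unit_speed[OF us[OF i] s0(1) l])
  then have "norm (G j i 0) \<le> L"
    using norm_triangle_sub[of "G j i 0" "G j i s0"] s0 near by auto
  then have n0: "norm (end_at (g j) (i, 0)) \<le> L" using \<psi>_ends(1)[OF i] by simp
  show E: "(i, 0) \<in> E" by (rule goodD(3)[OF gd _ n0]) (use i in auto)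
  have "norm (G j i 0) \<le> \<eta>" using goodD(2)[OF gd E] \<psi>_ends(1)[OF i] by simp
  moreover have "\<bar>G j i 0 \<bullet> U j i 0\<bar> \<le> norm (G j i 0)" by (rule inner_unit_le[OF unit_speedD(7)[OF us[OF i] l]])
  moreover have "\<bar>G j i s0 \<bullet> U j i s0 - G j i 0 \<bullet> U j i 0 - (s0 - 0)\<bar> \<le> \<eta>"
    by (rule straightD(4)[OF goodD(1)[OF gd, rule_format, OF i] s0(1) _ l s0(1)]) (use s0 near R in auto)
  ultimately show "\<bar>G j i s0 \<bullet> U j i s0 - s0\<bar> \<le> 2 * \<eta>" by linarith
qed

lemma near_finish:
  assumes i: "i < n" and s0: "s0 \<in> {0..l j i}" "norm (G j i s0) \<le> R" and near: "l j i - s0 + R \<le> L" and R: "0 \<le> R"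
  shows "(i, 1) \<in> E" "\<bar>G j i s0 \<bullet> U j i s0 + (l j i - s0)\<bar> \<le> 2 * \<eta>"
proof -
  have l: "l j i \<in> {0..l j i}" using l_pos[OF i, of j] by simp
  have "norm (G j i (l j i) - G j i s0) \<le> \<bar>l j i - s0\<bar>" by (rule norm_diff_le_of_unit_speed[OF us[OF i] s0(1) l])
  then have "norm (G j i (l j i)) \<le> L"
    using norm_triangle_sub[of "G j i (l j i)" "G j i s0"] s0 near by auto
  then have n0: "norm (end_at (g j) (i, 1)) \<le> L" using \<psi>_ends(2)[OF i] by simp
  show E: "(i, 1) \<in> E" by (rule goodD(3)[OF gd _ n0]) (use i in auto)
  have "norm (G j i (l j i)) \<le> \<eta>" using goodD(2)[OF gd E] \<psi>_ends(2)[OF i] by simp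
  moreover have "\<bar>G j i (l j i) \<bullet> U j i (l j i)\<bar> \<le> norm (G j i (l j i))" by (rule inner_unit_le[OF unit_speedD(7)[OF us[OF i] l]])
  moreover have "\<bar>G j i (l j i) \<bullet> U j i (l j i) - G j i s0 \<bullet> U j i s0 - (l j i - s0)\<bar> \<le> \<eta>"
    by (rule straightD(4)[OF goodD(1)[OF gd, rule_format, OF i] s0(1) _ s0(1) l]) (use s0 near R in auto)
  ultimately show "\<bar>G j i s0 \<bullet> U j i s0 + (l j i - s0)\<bar> \<le> 2 * \<eta>" by linarith
qed

lemma centre_window:
  assumes m: "m < N" and r: "r + 1 \<le> L"
  shows "r \<le> c j m" "c j m \<le> l j (I j m) - r"
proof -
  note c = centreD[OF m, of j]
  show "r \<le> c j m"
  proof (rule ccontr)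
    assume "\<not> ?thesis"
    then have "\<bar>G j (I j m) (c j m) \<bullet> U j (I j m) (c j m) - c j m\<bar> \<le> 2 * \<eta>"
      by (intro near_start(2)[OF c(1,6), of 1]) (use c(4) r in auto)
    then show False using c(2,5) \<eta>1 by simp
  qed
  show "c j m \<le> l j (I j m) - r"
  proof (rule ccontr)
    assume "\<not> ?thesis"
    then have "\<bar>G j (I j m) (c j m) \<bullet> U j (I j m) (c j m) + (l j (I j m) - c j m)\<bar> \<le> 2 * \<eta>"
      by (intro near_finish(2)[OF c(1,6), of 1]) (use c(4) r in auto)
    then show False using c(3,5) \<eta>1 by simp
  qed
qed

lemma centre_small:
  assumes m: "m < N" shows "norm (G j (I j m) (c j m)) \<le> \<eta>"
proof -
  have "norm (G j (I j m) (c j m)) \<le> L" using centreD(4)[OF m, of j] L1 by linarith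
  from straightD(5)[OF goodD(1)[OF gd, rule_format, OF centreD(1)[OF m]] centreD(6)[OF m] this]
  show ?thesis using norm_le_decomp[OF centreD(7)[OF m], of "G j (I j m) (c j m)" j] centreD(5)[OF m, of j] by linarith
qed

lemma centre_linear:
  assumes m: "m < N" and r: "r + 1 \<le> L" "0 \<le> r" and \<sigma>: "\<sigma> = 1 \<or> \<sigma> = -1"
  shows "nearly_linear \<eta> (\<sigma> *\<^sub>R U j (I j m) (c j m)) (-r) r (\<lambda>s. G j (I j m) (c j m + \<sigma> * s))"
proof (rule straight_nearly_linear[OF us[OF centreD(1)[OF m]] goodD(1)[OF gd, rule_format, OF centreD(1)[OF m]] centreD(6)[OF m] _ \<sigma>])
  show "norm (G j (I j m) (c j m)) \<le> L" using centreD(4)[OF m, of j] L1 by simp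
  fix s assume "s \<in> {- r..r}"
  then show "c j m + \<sigma> * s \<in> {0..l j (I j m)} \<and> \<bar>s\<bar> \<le> L"
    using centre_window[OF m r(1)] \<sigma> r by auto
qed

lemma centres_far_apart:
  assumes m: "m < N" "m' < N" "m \<noteq> m'" "I j m = I j m'"
  shows "L < \<bar>c j m - c j m'\<bar>"
proof (rule ccontr)
  assume no: "\<not> ?thesis"
  define s where "s = min (c j m) (c j m')"
  define t where "t = max (c j m) (c j m')"
  let ?i = "I j m"
  have d: "1 < t - s" "t - s \<le> L" "s \<le> t" using centres_apart[OF m] no by (auto simp: s_def t_def)
  have st: "s \<in> {0..l j ?i}" "t \<in> {0..l j ?i}" "G j ?i s \<bullet> U j ?i s = 0" "G j ?i t \<bullet> U j ?i t = 0" "norm (G j ?i s) \<le> L"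
    using centreD(6,5,4)[OF m(1), of j] centreD(6,5,4)[OF m(2), of j] m(4) L1 by (auto simp: s_def t_def min_def max_def)
  have "\<bar>G j ?i t \<bullet> U j ?i t - G j ?i s \<bullet> U j ?i s - (t - s)\<bar> \<le> \<eta>"
    by (rule straightD(4)[OF goodD(1)[OF gd, rule_format, OF centreD(1)[OF m(1)]] st(1,5,1,2)]) (use d in auto)
  then show False using d st(3,4) \<eta>1 by simp
qed

lemma near_origin_cover:
  assumes R: "1 \<le> R" "4 * R + 4 \<le> L" and i: "i < n" and s0: "s0 \<in> {0..l j i}" "norm (G j i s0) < R"
  shows "(\<exists>m<N. I j m = i \<and> \<bar>s0 - c j m\<bar> \<le> 3 * R) \<or>
    (\<exists>k\<in>E. fst k = i \<and> (\<exists>r\<in>{0..3 * R}. s0 = end_param (l j) k + end_sign k * r))"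
proof -
  note st = goodD(1)[OF gd, rule_format, OF i]
  have q0: "\<bar>G j i s0 \<bullet> U j i s0\<bar> \<le> R"
    using inner_unit_le[OF unit_speedD(7)[OF us[OF i] s0(1)], of "G j i s0"] s0(2) by linarith
  consider "s0 \<le> R + 3" | "l j i - s0 \<le> R + 3" | "R + 3 < s0" "s0 < l j i - R - 3" by linarith
  then show ?thesis
  proof cases
    case 1
    note b = near_start[OF i s0(1) less_imp_le[OF s0(2)]]
    have "(i, 0) \<in> E" by (rule b(1)) (use 1 R in simp_all)
    moreover have "\<bar>G j i s0 \<bullet> U j i s0 - s0\<bar> \<le> 2 * \<eta>" by (rule b(2)) (use 1 R in simp_all)
    then have "s0 \<le> 3 * R" using q0 R(1) \<eta>1 unfolding abs_le_iff by linarith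
    then have "s0 \<in> {0..3 * R}" using s0(1) by simp
    moreover note this
    moreover have "s0 = end_param (l j) (i, 0) + end_sign (i, 0) * s0" by (simp add: end_param_def end_sign_def)
    ultimately show ?thesis by (intro disjI2 bexI[of _ "(i, 0)"]) auto
  next
    case 2
    note b = near_finish[OF i s0(1) less_imp_le[OF s0(2)]]
    have "(i, 1) \<in> E" by (rule b(1)) (use 2 R in simp_all)
    moreover have "\<bar>G j i s0 \<bullet> U j i s0 + (l j i - s0)\<bar> \<le> 2 * \<eta>" by (rule b(2)) (use 2 R in simp_all)
    then have "l j i - s0 \<le> 3 * R" using q0 R(1) \<eta>1 unfolding abs_le_iff by linarith
    then have "l j i - s0 \<in> {0..3 * R}" using s0(1) by simp
    moreover note this
    moreover have "s0 = end_param (l j) (i, 1) + end_sign (i, 1) * (l j i - s0)" by (simp add: end_param_def end_sign_def)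
    ultimately show ?thesis by (intro disjI2 bexI[of _ "(i, 1)"]) auto
  next
    case 3
    define h where "h = R + 1/2"
    define a where "a = s0 - h"
    define b where "b = s0 + h"
    have ab: "a \<in> {0..l j i}" "b \<in> {0..l j i}" "a \<le> s0" "s0 \<le> b" "s0 - a = h" "b - s0 = h" "h \<le> L" "0 \<le> h"
      using 3 R by (auto simp: a_def b_def h_def)
    have nL: "norm (G j i s0) \<le> L" using s0(2) R by simp
    have "\<bar>G j i s0 \<bullet> U j i s0 - G j i a \<bullet> U j i a - (s0 - a)\<bar> \<le> \<eta>"
      by (rule straightD(4)[OF st s0(1) nL ab(1) s0(1)]) (use ab in auto)
    moreover have "\<bar>G j i b \<bullet> U j i b - G j i s0 \<bullet> U j i s0 - (b - s0)\<bar> \<le> \<eta>"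
      by (rule straightD(4)[OF st s0(1) nL s0(1) ab(2)]) (use ab in auto)
    ultimately have "G j i a \<bullet> U j i a \<le> 0" "0 \<le> G j i b \<bullet> U j i b" using q0 ab(5,6) \<eta>1 unfolding h_def by linarith+
    moreover have "continuous_on {a..b} (\<lambda>s. G j i s \<bullet> U j i s)"
      by (intro continuous_on_inner continuous_on_subset[OF unit_speedD(4)[OF us[OF i]]] continuous_on_subset[OF unit_speedD(3)[OF us[OF i]]])
         (use ab in auto)
    ultimately obtain s where s: "a \<le> s" "s \<le> b" "G j i s \<bullet> U j i s = 0"
      using IVT'[of "\<lambda>s. G j i s \<bullet> U j i s" a 0 b] ab by auto
    have sl: "s \<in> {0..l j i}" using s ab by auto
    have ss: "\<bar>s - s0\<bar> \<le> h" using s ab by auto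
    have "norm (G j i s - G j i s0) \<le> \<bar>s - s0\<bar>" by (rule norm_diff_le_of_unit_speed[OF us[OF i] s0(1) sl])
    then have "norm (G j i s) \<le> L" using norm_triangle_sub[of "G j i s" "G j i s0"] s0(2) ss R unfolding h_def by linarith
    from straightD(5)[OF st sl this] have "norm (G j i s) < 1"
      using norm_le_decomp[OF unit_speedD(7)[OF us[OF i] sl], of "G j i s"] s(3) \<eta>1 by simp
    then have "centre j i s" using i s 3 unfolding centre_def a_def b_def h_def by auto
    then obtain m where m: "m < N" "I j m = i" "\<bar>s - c j m\<bar> \<le> 1" using centres_maximal by blast
    have "\<bar>s0 - c j m\<bar> \<le> 3 * R" using m(3) ss R(1) unfolding h_def by linarith
    then show ?thesis using m by blast
  qed
qed

end

end

lemma (in slices) arms_meet_at_ends: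
  assumes k: "k \<in> curve_end_set n" "k' \<in> curve_end_set n" "k \<noteq> k'"
    and l: "6 < l j (fst k)" "6 < l j (fst k')" and st: "s \<in> {0..3}" "t \<in> {0..3}" and eq: "arm j k s = arm j k' t"
  shows "s = 0 \<and> t = 0"
proof -
  have i: "fst k < n" "fst k' < n" using k by auto
  have r: "end_param (l j) k + end_sign k * s \<in> {0..l j (fst k)}"
    by (rule arm_range[OF k(1)]) (use l st in auto)
  have r': "end_param (l j) k' + end_sign k' * t \<in> {0..l j (fst k')}"
    by (rule arm_range[OF k(2)]) (use l st in auto)
  from embedded_arclength[OF i r r' eq] consider
    "fst k = fst k'" "end_param (l j) k + end_sign k * s = end_param (l j) k' + end_sign k' * t" |
    "end_param (l j) k + end_sign k * s = 0 \<or> end_param (l j) k + end_sign k * s = l j (fst k)"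
    "end_param (l j) k' + end_sign k' * t = 0 \<or> end_param (l j) k' + end_sign k' * t = l j (fst k')" by blast
  then show ?thesis
  proof cases
    case 1
    then have "snd k \<noteq> snd k'" using k(3) by (auto simp: prod_eq_iff)
    then show ?thesis using 1 k(1,2) st l by (auto simp: end_param_def end_sign_def split: if_splits)
  next
    case 2
    then show ?thesis using st l by (auto simp: end_param_def end_sign_def split: if_splits)
  qed
qed

context limit_slices
begin

lemma zero_end_alone:
  assumes k0: "k0 \<in> E" "zero_end n g k0" shows "E = {k0}" "N = 0"
proof -
  obtain b a where b: "0 < b" and cone: "\<forall>\<^sub>F j in sequentially. \<forall>i<n. \<forall>x\<in>{0..1}. b * norm (g j i x) \<le> g j i x \<bullet> a"
    using k0(2) unfolding zero_end_def by blast
  define \<eta> where "\<eta> = min (1/4) (b / (4 * (b + norm a)))"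
  have pos: "0 < b + norm a" using b norm_ge_zero[of a] by linarith
  have \<eta>: "0 < \<eta>" "\<eta> \<le> 1/4" using b pos by (auto simp: \<eta>_def)
  have "\<eta> \<le> b / (4 * (b + norm a))" by (simp add: \<eta>_def)
  then have "\<eta> * (4 * (b + norm a)) \<le> b" using pos by (subst (asm) pos_le_divide_eq) auto
  then have "2 * (2 * \<eta> * (b + norm a)) \<le> b" by (simp add: algebra_simps)
  then have \<eta>b: "2 * \<eta> * (b + norm a) < b" using b by linarith
  have "\<forall>\<^sub>F j in sequentially. good 5 \<eta> j \<and> (\<forall>i<n. \<forall>x\<in>{0..1}. b * norm (g j i x) \<le> g j i x \<bullet> a)"
    using good_eventually[of 5 \<eta>] \<eta> cone by (intro eventually_conj) auto
  then obtain j where gd: "good 5 \<eta> j" and cone_j: "\<forall>i<n. \<forall>x\<in>{0..1}. b * norm (g j i x) \<le> g j i x \<bullet> a"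
    using eventually_happens by force
  have coneG: "b * norm (G j i s) \<le> G j i s \<bullet> a" if "i < n" "s \<in> {0..l j i}" for i s
    using cone_j that(1) \<psi>_range[OF that] by blast
  show "E = {k0}"
  proof (rule ccontr)
    assume "E \<noteq> {k0}"
    then obtain k where k: "k \<in> E" "k \<noteq> k0" using k0(1) by blast
    have ke: "k \<in> curve_end_set n" using k E_subset by blast
    have "\<not> zero_end n g k"
    proof
      assume "zero_end n g k"
      then have "end_at (g 0) k = 0" unfolding zero_end_def by blast
      then show False using k0(2) ke k(2) unfolding zero_end_def by blast
    qed
    then obtain A where A: "k \<in> A" "triple_ends n g A" using end_cases[OF ke] E_not_far[OF k(1)] by blast
    have AE: "A \<subseteq> E" by (rule triple_subset_E[OF A(2,1) k(1)])
    have A3: "card A = 3" using A unfolding triple_ends_def by blast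
    show False
    proof (rule cone_excludes_balanced_directions[of A "inward (g j)" "\<lambda>k. arm j k 1" \<eta> b a])
      show "finite A" "A \<noteq> {}" using A3 by (auto intro: card_ge_0_finite)
      show "(\<Sum>m\<in>A. inward (g j) m) = 0" by (rule triple_sum_inward[OF A(2)])
      fix k' assume k': "k' \<in> A"
      then have ke': "k' \<in> curve_end_set n" and n': "norm (end_at (g j) k') \<le> \<eta>"
        using AE E_subset goodD(2)[OF gd] by blast+
      show "norm (inward (g j) k') = 1" by (rule norm_inward[OF ke'])
      have i: "fst k' < n" using ke' by auto
      have "nearly_linear \<eta> (inward (g j) k') 0 1 (arm j k')"
        by (rule arm_linear[OF goodD(1)[OF gd] ke']) (use n' \<eta> in auto)
      from nearly_linear_start[OF this, of 1]
      have "norm (arm j k' 1 - end_at (g j) k' - inward (g j) k') \<le> \<eta>" using arm_start[OF ke'] by simp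
      then show "norm (arm j k' 1 - inward (g j) k') \<le> 2 * \<eta>"
        using n' norm_triangle_ineq[of "arm j k' 1 - end_at (g j) k' - inward (g j) k'" "end_at (g j) k'"] by simp
      have "4 * 5 \<le> l j (fst k')" using goodD(1)[OF gd] i unfolding straight_def by blast
      then show "b * norm (arm j k' 1) \<le> arm j k' 1 \<bullet> a" by (intro coneG[OF i] arm_range[OF ke']) auto
    qed (use b \<eta>b in auto)
  qed
  show "N = 0"
  proof (rule ccontr)
    assume "N \<noteq> 0"
    then have m: "0 < N" by simp
    let ?i = "I j 0" and ?c = "c j 0"
    show False
    proof (rule cone_excludes_balanced_directions[of "{-1, 1 :: real}" "\<lambda>s. s *\<^sub>R U j ?i ?c" "\<lambda>s. G j ?i (?c + s)" \<eta> b a])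
      fix s :: real assume s: "s \<in> {-1, 1}"
      show "norm (s *\<^sub>R U j ?i ?c) = 1" using s centreD(7)[OF m, of j] by auto
      have "nearly_linear \<eta> (1 *\<^sub>R U j ?i ?c) (-1) 1 (\<lambda>s. G j ?i (?c + 1 * s))"
        by (rule centre_linear[OF gd _ \<eta>(2) m]) auto
      from this[unfolded nearly_linear_def, rule_format, of 0 s]
      have "norm (G j ?i (?c + 1 * s) - G j ?i (?c + 1 * 0) - (s - 0) *\<^sub>R (1 *\<^sub>R U j ?i ?c)) \<le> \<eta> * \<bar>s - 0\<bar>"
        using s by fastforce
      moreover have "\<bar>s\<bar> = 1" using s by auto
      ultimately have "norm (G j ?i (?c + s) - G j ?i ?c - s *\<^sub>R U j ?i ?c) \<le> \<eta>" by simp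
      moreover have "norm (G j ?i ?c) \<le> \<eta>" by (rule centre_small[OF gd _ \<eta>(2) m]) simp
      moreover have "norm (G j ?i (?c + s) - s *\<^sub>R U j ?i ?c) \<le> norm (G j ?i (?c + s) - G j ?i ?c - s *\<^sub>R U j ?i ?c) + norm (G j ?i ?c)"
        using norm_triangle_ineq[of "G j ?i (?c + s) - G j ?i ?c - s *\<^sub>R U j ?i ?c" "G j ?i ?c"] by simp
      ultimately show "norm (G j ?i (?c + s) - s *\<^sub>R U j ?i ?c) \<le> 2 * \<eta>" by linarith
      show "b * norm (G j ?i (?c + s)) \<le> G j ?i (?c + s) \<bullet> a"
        by (rule coneG[OF centreD(1)[OF m]]) (use centreD(2,3)[OF m, of j] s in auto)
    qed (use b \<eta>b in auto)
  qed
qed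

lemma triple_alone:
  assumes ne: "E \<noteq> {}" and nz: "\<And>k. k \<in> E \<Longrightarrow> \<not> zero_end n g k"
  shows "triple_ends n g E" "N = 0"
proof -
  have tr: "\<exists>A. k \<in> A \<and> triple_ends n g A" if "k \<in> E" for k
    using end_cases[of k] E_not_far[OF that] nz[OF that] that E_subset by blast
  obtain k where k: "k \<in> E" using ne by blast
  obtain A where A: "k \<in> A" "triple_ends n g A" using tr[OF k] by blast
  obtain j where gd: "good 8 (1/100) j" using eventually_happens[OF good_eventually[of 8 "1/100"]] by auto
  have long: "6 < l j i" if "i < n" for i
    using goodD(1)[OF gd] that unfolding straight_def by force
  have triod: "card B = 3" "(\<Sum>k\<in>B. inward (g j) k) = 0" "\<And>k'. k' \<in> B \<Longrightarrow> norm (inward (g j) k') = 1"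
    "\<And>k'. k' \<in> B \<Longrightarrow> nearly_linear (1/100) (inward (g j) k') 0 3 (arm j k')"
    "\<And>k'. k' \<in> B \<Longrightarrow> arm j k' 0 = end_at (g j) k0" "norm (end_at (g j) k0) \<le> 1/100" "B \<subseteq> curve_end_set n"
    if B: "triple_ends n g B" "k0 \<in> B" "k0 \<in> E" for B k0
  proof -
    have BE: "B \<subseteq> E" by (rule triple_subset_E[OF B])
    show "card B = 3" "B \<subseteq> curve_end_set n" using B unfolding triple_ends_def by blast+
    show "(\<Sum>k\<in>B. inward (g j) k) = 0" by (rule triple_sum_inward[OF B(1)])
    show "norm (end_at (g j) k0) \<le> 1/100" by (rule goodD(2)[OF gd B(3)])
    fix k' assume k': "k' \<in> B"
    have ke: "k' \<in> curve_end_set n" and n: "norm (end_at (g j) k') \<le> 1/100" using k' BE E_subset goodD(2)[OF gd] by blast+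
    show "norm (inward (g j) k') = 1" by (rule norm_inward[OF ke])
    show "nearly_linear (1/100) (inward (g j) k') 0 3 (arm j k')"
      by (rule arm_linear[OF goodD(1)[OF gd] ke]) (use n in auto)
    have "end_at (g j) k' = end_at (g j) k0" using B k' ke unfolding triple_ends_def by blast
    then show "arm j k' 0 = end_at (g j) k0" using arm_start[OF ke] by simp
  qed
  have "E \<subseteq> A"
  proof (rule ccontr)
    assume "\<not> E \<subseteq> A"
    then obtain k' where k': "k' \<in> E" "k' \<notin> A" by blast
    obtain A' where A': "k' \<in> A'" "triple_ends n g A'" using tr[OF k'(1)] by blast
    note a = triod[OF A(2,1) k] and a' = triod[OF A'(2,1) k'(1)]
    have pp: "end_at (g j) k \<noteq> end_at (g j) k'"
    proof
      assume "end_at (g j) k = end_at (g j) k'"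
      then show False using A k' E_subset unfolding triple_ends_def by (metis subsetD)
    qed
    obtain k1 k2 s t where m: "k1 \<in> A" "k2 \<in> A'" "s \<in> {0..3}" "t \<in> {0..3}" "arm j k1 s = arm j k2 t"
      using two_triods_meet[OF a(1,2,3,4,5) a'(1,2,3,4,5) _ _ a(6) a'(6) pp] by auto
    have ke: "k1 \<in> curve_end_set n" "k2 \<in> curve_end_set n" using m a(7) a'(7) by blast+
    have "arm j k1 0 \<noteq> arm j k2 0" using a(5)[OF m(1)] a'(5)[OF m(2)] pp by simp
    moreover from this have "k1 \<noteq> k2" by blast
    moreover have "fst k1 < n" "fst k2 < n" using ke by auto
    ultimately show False using arms_meet_at_ends[OF ke _ long long m(3,4,5)] m(5) by auto
  qed
  then have EA: "E = A" using triple_subset_E[OF A(2,1) k] by blast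
  then show "triple_ends n g E" using A by simp
  show "N = 0"
  proof (rule ccontr)
    assume "N \<noteq> 0"
    then have m: "0 < N" by simp
    let ?i = "I j 0" and ?c = "c j 0"
    note a = triod[OF A(2,1) k]
    have lin: "nearly_linear (1/100) (1 *\<^sub>R U j ?i ?c) (-3) 3 (\<lambda>s. G j ?i (?c + 1 * s))"
      by (rule centre_linear[OF gd _ _ m]) auto
    have sm: "norm (G j ?i (?c + 1 * 0)) \<le> 1/100" using centre_small[OF gd _ _ m] by simp
    obtain k1 s t where k1: "k1 \<in> A" "s \<in> {-3..3}" "t \<in> {0..1}" "G j ?i (?c + 1 * s) = arm j k1 t"
      using line_triod_meet[OF lin sm _ a(1,2,3,4,5) _ _ a(6)] centreD(7)[OF m, of j] by auto
    have ke: "k1 \<in> curve_end_set n" using k1 a(7) by blast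
    have i: "fst k1 < n" using ke by auto
    have w: "7 \<le> ?c" "?c \<le> l j ?i - 7"
      using centre_window[OF gd _ _ m, of 7] by auto
    have r: "?c + 1 * s \<in> {0..l j ?i}" "end_param (l j) k1 + end_sign k1 * t \<in> {0..l j (fst k1)}"
      using w k1 arm_range[OF ke, of t j] long[OF i] by auto
    from embedded_arclength[OF centreD(1)[OF m] i r k1(4)] show False
      using w k1 ke long[OF i] by (auto simp: end_param_def end_sign_def split: if_splits)
  qed
qed

lemma centres_parallel:
  assumes m: "m < N" "m' < N"
  shows "v m \<bullet> rot90 (v m') = 0"
proof (cases "m = m'")
  case False
  have lim: "(\<lambda>j. \<bar>U j (I j m) (c j m) \<bullet> rot90 (U j (I j m') (c j m'))\<bar>) \<longlonglongrightarrow> \<bar>v m \<bullet> rot90 (v m')\<bar>"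
    by (intro tendsto_rabs tendsto_inner centre_direction m bounded_linear.tendsto[OF bounded_linear_rot90])
  have "\<bar>v m \<bullet> rot90 (v m')\<bar> \<le> 6 * \<eta>" if \<eta>: "0 < \<eta>" "\<eta> \<le> 1/10" for \<eta>
  proof (rule tendsto_upperbound[OF lim])
    have "\<forall>\<^sub>F j in sequentially. good 8 \<eta> j" by (rule good_eventually) (use \<eta> in auto)
    then show "\<forall>\<^sub>F j in sequentially. \<bar>U j (I j m) (c j m) \<bullet> rot90 (U j (I j m') (c j m'))\<bar> \<le> 6 * \<eta>"
    proof (rule eventually_mono)
      fix j assume gd: "good 8 \<eta> j"
      have lin: "nearly_linear \<eta> (1 *\<^sub>R U j (I j m) (c j m)) (-3) 3 (\<lambda>s. G j (I j m) (c j m + 1 * s))" if "m < N" for m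
        by (rule centre_linear[OF gd _ _ that]) (use \<eta> in auto)
      have sm: "norm (G j (I j m) (c j m + 1 * 0)) \<le> \<eta>" if "m < N" for m
        using centre_small[OF gd _ _ that] \<eta> by simp
      have un: "norm (1 *\<^sub>R U j (I j m) (c j m)) = 1" if "m < N" for m using centreD(7)[OF that] by simp
      have w: "7 \<le> c j m" "c j m \<le> l j (I j m) - 7" if "m < N" for m
        using centre_window[OF gd _ _ that, of 7] \<eta> by auto
      have "\<bar>(1 *\<^sub>R U j (I j m) (c j m)) \<bullet> rot90 (1 *\<^sub>R U j (I j m') (c j m'))\<bar> \<le> 6 * \<eta>"
      proof (rule disjoint_lines_parallel[OF lin[OF m(2)] sm[OF m(2)] un[OF m(2)] lin[OF m(1)] sm[OF m(1)] un[OF m(1)]])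
        fix s t :: real assume st: "s \<in> {-3..3}" "t \<in> {-3..3}"
        show "G j (I j m') (c j m' + 1 * s) \<noteq> G j (I j m) (c j m + 1 * t)"
        proof
          assume eq: "G j (I j m') (c j m' + 1 * s) = G j (I j m) (c j m + 1 * t)"
          have "c j m' + 1 * s \<in> {0..l j (I j m')}" "c j m + 1 * t \<in> {0..l j (I j m)}" using w[OF m(1)] w[OF m(2)] st by auto
          from embedded_arclength[OF centreD(1)[OF m(2)] centreD(1)[OF m(1)] this eq]
          have i: "I j m' = I j m" and e: "c j m' + s = c j m + t"
            using w[OF m(1)] w[OF m(2)] st by auto
          have "8 < \<bar>c j m' - c j m\<bar>" by (rule centres_far_apart[OF gd _ _ m(2,1) _ i]) (use \<eta> False in auto)
          then show False using e st by auto
        qed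
      qed (use \<eta> in auto)
      then show "\<bar>U j (I j m) (c j m) \<bullet> rot90 (U j (I j m') (c j m'))\<bar> \<le> 6 * \<eta>" by simp
    qed
  qed simp
  then have b: "\<bar>v m \<bullet> rot90 (v m')\<bar> \<le> 6 * min (\<bar>v m \<bullet> rot90 (v m')\<bar> / 12) (1/10)"
    if "v m \<bullet> rot90 (v m') \<noteq> 0" using that by simp
  show ?thesis
  proof (rule ccontr)
    assume ne: "v m \<bullet> rot90 (v m') \<noteq> 0"
    define x where "x = \<bar>v m \<bullet> rot90 (v m')\<bar>"
    have "0 < x" "x \<le> 6 * min (x / 12) (1/10)" using b[OF ne] ne by (simp_all add: x_def)
    moreover have "6 * min (x / 12) (1/10) \<le> 6 * (x / 12)" by simp
    ultimately show False by linarith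
  qed
qed simp

lemma centre_direction_unit: "m < N \<Longrightarrow> norm (v m) = 1"
  using LIMSEQ_unique[OF tendsto_norm[OF centre_direction, of m], of 1] centreD(7)[of m] by simp

lemma end_direction_unit: "k \<in> E \<Longrightarrow> norm (w k) = 1"
proof -
  assume k: "k \<in> E"
  then have "k \<in> curve_end_set n" using E_subset by blast
  then have "(\<lambda>j. norm (inward (g j) k)) \<longlonglongrightarrow> 1" using norm_inward by simp
  then show ?thesis using LIMSEQ_unique[OF tendsto_norm[OF end_direction[OF k]]] by blast
qed

lemma lines_marked:
  assumes E: "E = {}"
  obtains \<sigma> where "marked_slices n g g1 g2 l \<psi> C N (\<lambda>_. True) (\<lambda>_. v 0) I c (\<lambda>j m. \<sigma> m)"
proof -
  define \<sigma> :: "nat \<Rightarrow> real" where "\<sigma> m = (if 0 \<le> v m \<bullet> v 0 then 1 else - 1)" for m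
  have \<sigma>: "\<sigma> m = 1 \<or> \<sigma> m = -1" for m by (simp add: \<sigma>_def)
  have sv: "\<sigma> m *\<^sub>R v m = v 0" if m: "m < N" for m
  proof -
    have 0: "0 < N" using m by simp
    note u = centre_direction_unit[OF 0] centre_direction_unit[OF m]
    have e: "v m = (v m \<bullet> v 0) *\<^sub>R v 0" using plane_decomp[OF u(1), of "v m"] centres_parallel[OF m 0] by simp
    then have "\<bar>v m \<bullet> v 0\<bar> = 1" using u by (metis norm_scaleR mult.right_neutral)
    then have "\<sigma> m * (v m \<bullet> v 0) = 1" by (auto simp: \<sigma>_def)
    then show ?thesis using e by (metis scaleR_scaleR scaleR_one)
  qed
  have ev: "\<forall>\<^sub>F j in sequentially. good (6 * R + 4) (1/4) j" if "1 \<le> R" for R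
    by (rule good_eventually) (use that in auto)
  have "marked_slices n g g1 g2 l \<psi> C N (\<lambda>_. True) (\<lambda>_. v 0) I c (\<lambda>j m. \<sigma> m)"
  proof
    show "norm (v 0) = 1" if "m < N" for m using centre_direction_unit[of 0] that by simp
    fix R :: real assume R: "1 \<le> R"
    show "\<forall>\<^sub>F j in sequentially. \<forall>m<N. I j m < n \<and> (\<sigma> m = 1 \<or> \<sigma> m = - 1) \<and>
        (\<forall>s\<in>{if True then - 3 * R else 0..3 * R}. c j m + \<sigma> m * s \<in> {0..l j (I j m)})"
      using ev[OF R]
    proof (rule eventually_mono, intro allI impI conjI ballI)
      fix j m s assume gd: "good (6 * R + 4) (1/4) j" and m: "m < N"
      show "I j m < n" by (rule centreD(1)[OF m])
      show "\<sigma> m = 1 \<or> \<sigma> m = -1" by (rule \<sigma>)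
      assume s: "s \<in> {if True then - 3 * R else 0..3 * R}"
      have "3 * R \<le> c j m" "c j m \<le> l j (I j m) - 3 * R" by (rule centre_window[OF gd _ _ m]; use R in simp)+
      then show "c j m + \<sigma> m * s \<in> {0..l j (I j m)}" using s \<sigma>[of m] by auto
    qed
    show "\<forall>\<^sub>F j in sequentially. \<forall>m<N. \<forall>m'<N. m \<noteq> m' \<and> I j m = I j m' \<longrightarrow>
       (\<forall>s\<in>{if True then - 3 * R else 0<..<3 * R}. \<forall>s'\<in>{if True then - 3 * R else 0<..<3 * R}. c j m + \<sigma> m * s \<noteq> c j m' + \<sigma> m' * s')"
      using ev[OF R]
    proof (rule eventually_mono, intro allI impI ballI)
      fix j m m' s s' assume gd: "good (6 * R + 4) (1/4) j" and m: "m < N" "m' < N" "m \<noteq> m' \<and> I j m = I j m'"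
        and s: "s \<in> {if True then - 3 * R else 0<..<3 * R}" "s' \<in> {if True then - 3 * R else 0<..<3 * R}"
      have "6 * R + 4 < \<bar>c j m - c j m'\<bar>" by (rule centres_far_apart[OF gd _ _ m(1,2)]) (use R m in auto)
      moreover have "\<bar>\<sigma> m * s\<bar> \<le> 3 * R" "\<bar>\<sigma> m' * s'\<bar> \<le> 3 * R" using s \<sigma>[of m] \<sigma>[of m'] by auto
      ultimately show "c j m + \<sigma> m * s \<noteq> c j m' + \<sigma> m' * s'" by linarith
    qed
    show "\<forall>\<^sub>F j in sequentially. \<forall>i<n. \<forall>s\<in>{0..l j i}. norm (G j i s) < R \<longrightarrow>
       (\<exists>m<N. I j m = i \<and> (\<exists>r\<in>{if True then - 3 * R else 0..3 * R}. s = c j m + \<sigma> m * r))"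
      using ev[OF R]
    proof (rule eventually_mono, intro allI impI ballI)
      fix j i s assume gd: "good (6 * R + 4) (1/4) j" and i: "i < n" and s: "s \<in> {0..l j i}" "norm (G j i s) < R"
      have "\<exists>m<N. I j m = i \<and> \<bar>s - c j m\<bar> \<le> 3 * R"
        using near_origin_cover[OF gd _ _ R _ i s] R E by auto
      then obtain m where m: "m < N" "I j m = i" "\<bar>s - c j m\<bar> \<le> 3 * R" by blast
      have "\<sigma> m * (s - c j m) \<in> {- 3 * R..3 * R}" "s = c j m + \<sigma> m * (\<sigma> m * (s - c j m))"
        using m(3) \<sigma>[of m] by auto
      then show "\<exists>m<N. I j m = i \<and> (\<exists>r\<in>{if True then - 3 * R else 0..3 * R}. s = c j m + \<sigma> m * r)"
        using m by (intro exI[of _ m] conjI bexI[of _ "\<sigma> m * (s - c j m)"]) auto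
    qed
  next
    fix m assume m: "m < N"
    show "(\<lambda>j. G j (I j m) (c j m)) \<longlonglongrightarrow> 0"
    proof (rule tendstoI)
      fix e :: real assume e: "0 < e"
      have "\<forall>\<^sub>F j in sequentially. good 1 (min (1/4) (e/2)) j" by (rule good_eventually) (use e in auto)
      then show "\<forall>\<^sub>F j in sequentially. dist (G j (I j m) (c j m)) 0 < e"
      proof (rule eventually_mono)
        fix j assume gd: "good 1 (min (1/4) (e/2)) j"
        have "norm (G j (I j m) (c j m)) \<le> min (1/4) (e/2)" by (rule centre_small[OF gd _ _ m]) auto
        then show "dist (G j (I j m) (c j m)) 0 < e" using e by simp
      qed
    qed
    show "(\<lambda>j. \<sigma> m *\<^sub>R U j (I j m) (c j m)) \<longlonglongrightarrow> v 0"
      unfolding sv[OF m, symmetric] by (intro tendsto_intros centre_direction m)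
  qed
  then show ?thesis by (rule that)
qed

lemma rays_marked:
  assumes N: "N = 0" and f: "bij_betw f {..<M} E"
  shows "marked_slices n g g1 g2 l \<psi> C M (\<lambda>_. False) (\<lambda>m. w (f m)) (\<lambda>j m. fst (f m))
    (\<lambda>j m. end_param (l j) (f m)) (\<lambda>j m. end_sign (f m))"
proof
  have fE: "f m \<in> E" "f m \<in> curve_end_set n" "fst (f m) < n" if "m < M" for m
  proof -
    show *: "f m \<in> E" using f that by (auto simp: bij_betw_def)
    then show "f m \<in> curve_end_set n" using E_subset by blast
    then show "fst (f m) < n" by auto
  qed
  have ev: "\<forall>\<^sub>F j in sequentially. good (6 * R + 4) (1/4) j" if "1 \<le> R" for R
    by (rule good_eventually) (use that in auto)
  have long: "6 * R < l j i" if "1 \<le> R" "good (6 * R + 4) (1/4) j" "i < n" for R j i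
    using goodD(1)[OF that(2)] that(1,3) unfolding straight_def by force
  show "norm (w (f m)) = 1" if "m < M" for m by (rule end_direction_unit[OF fE(1)[OF that]])
  show "\<forall>\<^sub>F j in sequentially. \<forall>m<M. fst (f m) < n \<and> (end_sign (f m) = 1 \<or> end_sign (f m) = - 1) \<and>
        (\<forall>s\<in>{if False then - 3 * R else 0..3 * R}. end_param (l j) (f m) + end_sign (f m) * s \<in> {0..l j (fst (f m))})"
    if R: "1 \<le> R" for R using ev[OF R]
  proof (rule eventually_mono, intro allI impI conjI ballI)
    fix j m s assume gd: "good (6 * R + 4) (1/4) j" and m: "m < M"
    show "fst (f m) < n" by (rule fE(3)[OF m])
    show "end_sign (f m) = 1 \<or> end_sign (f m) = -1" by (rule end_sign_cases)
    assume "s \<in> {if False then - 3 * R else 0..3 * R}"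
    then show "end_param (l j) (f m) + end_sign (f m) * s \<in> {0..l j (fst (f m))}"
      using arm_range[OF fE(2)[OF m]] long[OF R gd fE(3)[OF m]] R by auto
  qed
  show "\<forall>\<^sub>F j in sequentially. \<forall>m<M. \<forall>m'<M. m \<noteq> m' \<and> fst (f m) = fst (f m') \<longrightarrow>
       (\<forall>s\<in>{if False then - 3 * R else 0<..<3 * R}. \<forall>s'\<in>{if False then - 3 * R else 0<..<3 * R}.
          end_param (l j) (f m) + end_sign (f m) * s \<noteq> end_param (l j) (f m') + end_sign (f m') * s')"
    if R: "1 \<le> R" for R using ev[OF R]
  proof (rule eventually_mono, intro allI impI ballI)
    fix j m m' s s' assume gd: "good (6 * R + 4) (1/4) j" and m: "m < M" "m' < M" and mm: "m \<noteq> m' \<and> fst (f m) = fst (f m')"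
      and s: "s \<in> {if False then - 3 * R else 0<..<3 * R}" "s' \<in> {if False then - 3 * R else 0<..<3 * R}"
    have "f m \<noteq> f m'" using f m mm unfolding bij_betw_def inj_on_def by auto
    then have "snd (f m) \<noteq> snd (f m')" using mm by (auto simp: prod_eq_iff)
    then show "end_param (l j) (f m) + end_sign (f m) * s \<noteq> end_param (l j) (f m') + end_sign (f m') * s'"
      using fE(2)[OF m(1)] fE(2)[OF m(2)] mm s long[OF R gd fE(3)[OF m(1)]]
      by (auto simp: end_param_def end_sign_def split: if_splits)
  qed
  show "\<forall>\<^sub>F j in sequentially. \<forall>i<n. \<forall>s\<in>{0..l j i}. norm (G j i s) < R \<longrightarrow>
       (\<exists>m<M. fst (f m) = i \<and> (\<exists>r\<in>{if False then - 3 * R else 0..3 * R}. s = end_param (l j) (f m) + end_sign (f m) * r))"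
    if R: "1 \<le> R" for R using ev[OF R]
  proof (rule eventually_mono, intro allI impI ballI)
    fix j i s assume gd: "good (6 * R + 4) (1/4) j" and i: "i < n" and s: "s \<in> {0..l j i}" "norm (G j i s) < R"
    have "\<exists>k\<in>E. fst k = i \<and> (\<exists>r\<in>{0..3 * R}. s = end_param (l j) k + end_sign k * r)"
      using near_origin_cover[OF gd _ _ R _ i s] R N by auto
    then obtain k r where k: "k \<in> E" "fst k = i" "r \<in> {0..3 * R}" "s = end_param (l j) k + end_sign k * r" by blast
    have "k \<in> f ` {..<M}" using k(1) f unfolding bij_betw_def by simp
    then obtain m where "m < M" "k = f m" by auto
    then show "\<exists>m<M. fst (f m) = i \<and> (\<exists>r\<in>{if False then - 3 * R else 0..3 * R}. s = end_param (l j) (f m) + end_sign (f m) * r)"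
      using k by (intro exI[of _ m] conjI bexI[of _ r]) auto
  qed
  fix m assume m: "m < M"
  show "(\<lambda>j. G j (fst (f m)) (end_param (l j) (f m))) \<longlonglongrightarrow> 0"
    unfolding \<psi>_end_param[OF fE(2)[OF m]]
  proof (rule tendstoI)
    fix e :: real assume e: "0 < e"
    have "\<forall>\<^sub>F j in sequentially. good 1 (e/2) j" by (rule good_eventually) (use e in auto)
    then show "\<forall>\<^sub>F j in sequentially. dist (end_at (g j) (f m)) 0 < e"
    proof (rule eventually_mono)
      fix j assume gd: "good 1 (e/2) j"
      show "dist (end_at (g j) (f m)) 0 < e" using goodD(2)[OF gd fE(1)[OF m]] e by simp
    qed
  qed
  show "(\<lambda>j. end_sign (f m) *\<^sub>R U j (fst (f m)) (end_param (l j) (f m))) \<longlonglongrightarrow> w (f m)"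
    unfolding \<psi>_end_param[OF fE(2)[OF m]] using end_direction[OF fE(1)[OF m]] unfolding inward_def .
qed

lemma triple_limit_directions:
  assumes "triple_ends n g E" "k \<in> E" "k' \<in> E" "k \<noteq> k'"
  shows "w k \<bullet> w k' = - 1/2"
proof (rule triple_inner[of E])
  show "card E = 3" using assms(1) unfolding triple_ends_def by blast
  have "(\<lambda>j. \<Sum>k\<in>E. inward (g j) k) \<longlonglongrightarrow> (\<Sum>k\<in>E. w k)" by (intro tendsto_sum end_direction)
  then show "(\<Sum>k\<in>E. w k) = 0" unfolding triple_sum_inward[OF assms(1)] by (simp add: LIMSEQ_const_iff)
qed (use assms end_direction_unit in auto)

theorem limit_classification:
  assumes S: "(\<lambda>j. \<Sum>i<n. gaussian_length (g j i)) \<longlonglongrightarrow> sqrt (2 * pi) * \<theta>"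
  shows "\<exists>L. (\<forall>\<alpha>\<in>{0<..<1/2}. network_tendsto \<alpha> n g L) \<and>
    (L = [] \<or> (\<exists>m. line_with_multiplicity m L \<and> \<theta> = real m) \<or>
     (standard_triod L \<and> \<theta> = 3/2) \<or> (halfline_from_origin L \<and> \<theta> = 1/2))"
proof -
  have conv: "\<forall>\<alpha>\<in>{0<..<1/2}. network_tendsto \<alpha> n g (map (\<lambda>m. (if full m then UNIV else {0..}, \<lambda>s. s *\<^sub>R u m)) [0..<M])"
    "\<theta> = (\<Sum>m<M. if full m then 1 else 1/2)"
    if ms: "marked_slices n g g1 g2 l \<psi> C M full u I' c' \<sigma>'" for M full u I' c' \<sigma>'
  proof -
    interpret ms: marked_slices n g g1 g2 l \<psi> C M full u I' c' \<sigma>' by (rule ms)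
    show "\<forall>\<alpha>\<in>{0<..<1/2}. network_tendsto \<alpha> n g (map (\<lambda>m. (if full m then UNIV else {0..}, \<lambda>s. s *\<^sub>R u m)) [0..<M])"
      using ms.network_converges by auto
    have "sqrt (2 * pi) * \<theta> = (\<Sum>m<M. if full m then sqrt (2 * pi) else sqrt (2 * pi) / 2)"
      by (rule ms.density_value[OF S])
    also have "\<dots> = sqrt (2 * pi) * (\<Sum>m<M. if full m then 1 else 1/2)"
      unfolding sum_distrib_left by (intro sum.cong) auto
    finally show "\<theta> = (\<Sum>m<M. if full m then 1 else 1/2)" by simp
  qed
  have finE: "finite E" using E_subset by (rule finite_subset) simp
  consider "E = {}" | k0 where "k0 \<in> E" "zero_end n g k0" | "E \<noteq> {}" "\<And>k. k \<in> E \<Longrightarrow> \<not> zero_end n g k" by blast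
  then show ?thesis
  proof cases
    case 1
    obtain \<sigma> where "marked_slices n g g1 g2 l \<psi> C N (\<lambda>_. True) (\<lambda>_. v 0) I c (\<lambda>j m. \<sigma> m)"
      by (rule lines_marked[OF 1])
    note cv = conv[OF this]
    define L :: "(real set \<times> (real \<Rightarrow> plane)) list" where "L = map (\<lambda>m. (UNIV, \<lambda>s. s *\<^sub>R v 0)) [0..<N]"
    have L: "L = replicate N (UNIV, \<lambda>s. s *\<^sub>R v 0)" unfolding L_def by (simp add: map_replicate_const)
    have "L = [] \<or> (\<exists>m. line_with_multiplicity m L \<and> \<theta> = real m)"
    proof (cases "N = 0")
      case False
      then have "norm (v 0) = 1" by (intro centre_direction_unit) simp
      then have "line_with_multiplicity N L" unfolding line_with_multiplicity_def L using False by auto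
      then show ?thesis using cv(2) by auto
    qed (simp add: L)
    moreover have "\<forall>\<alpha>\<in>{0<..<1/2}. network_tendsto \<alpha> n g L" using cv(1) unfolding L_def by simp
    ultimately show ?thesis by blast
  next
    case 2
    note E1 = zero_end_alone[OF 2]
    have "bij_betw (\<lambda>_. k0) {..<1::nat} E" unfolding E1(1) by (simp add: bij_betw_def inj_on_def lessThan_Suc)
    note cv = conv[OF rays_marked[OF E1(2) this]]
    have "halfline_from_origin [ray (w k0)]" "\<theta> = 1/2"
      using end_direction_unit[OF 2(1)] cv(2) unfolding halfline_from_origin_def by auto
    moreover have "\<forall>\<alpha>\<in>{0<..<1/2}. network_tendsto \<alpha> n g [ray (w k0)]" using cv(1) by (simp add: ray_def)
    ultimately show ?thesis by blast
  next
    case 3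
    note t = triple_alone[OF 3]
    have c3: "card E = 3" using t(1) unfolding triple_ends_def by blast
    obtain f where f: "bij_betw f {..<3::nat} E"
      using ex_bij_betw_nat_finite[OF finE] unfolding c3 atLeast0LessThan by blast
    note cv = conv[OF rays_marked[OF t(2) f]]
    have fE: "f m \<in> E" if "m < 3" for m using f that by (auto simp: bij_betw_def)
    have fne: "f m \<noteq> f m'" if "m < 3" "m' < 3" "m \<noteq> m'" for m m'
      using f that unfolding bij_betw_def inj_on_def by auto
    have c: "cos (2 * pi / 3) = - 1/2" using cos_120 by simp
    have "standard_triod [ray (w (f 0)), ray (w (f 1)), ray (w (f 2))]"
      unfolding standard_triod_def c
      by (intro exI[of _ "w (f 0)"] exI[of _ "w (f 1)"] exI[of _ "w (f 2)"] conjI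
          end_direction_unit triple_limit_directions[OF t(1)] fE fne) auto
    moreover have "\<theta> = 3/2" using cv(2) by simp
    moreover have "[0..<3] = [0, 1, 2::nat]" by (simp add: upt_rec)
    then have "\<forall>\<alpha>\<in>{0<..<1/2}. network_tendsto \<alpha> n g [ray (w (f 0)), ray (w (f 1)), ray (w (f 2))]"
      using cv(1) by (simp add: ray_def)
    ultimately show ?thesis by blast
  qed
qed

end

context slices
begin

lemma arc_integral_linear_combination:
  assumes i: "i < n" and F: "continuous_on {0..1} F" and H: "continuous_on {0..1} H"
  shows "arc_integral (g j i) (\<lambda>x. a * F x + b * H x) = a * arc_integral (g j i) F + b * arc_integral (g j i) H"
proof -
  have "continuous_on {0..l j i} (\<psi> j i)"
    using param[OF i, of j] unfolding arclength_param_def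
    by (meson DERIV_continuous_on)
  then have c: "continuous_on {0..l j i} (\<lambda>s. F (\<psi> j i s))" "continuous_on {0..l j i} (\<lambda>s. H (\<psi> j i s))"
    using \<psi>_range[OF i] by (auto intro: continuous_on_compose2[OF F] continuous_on_compose2[OF H])
  have "arc_integral (g j i) (\<lambda>x. a * F x + b * H x) = integral {0..l j i} (\<lambda>s. a * F (\<psi> j i s) + b * H (\<psi> j i s))"
    by (rule arc_int[OF i, symmetric]) (intro continuous_intros F H)
  also have "\<dots> = integral {0..l j i} (\<lambda>s. a * F (\<psi> j i s)) + integral {0..l j i} (\<lambda>s. b * H (\<psi> j i s))"
    by (rule integral_add) (intro integrable_continuous_real continuous_intros c)+
  also have "\<dots> = a * arc_integral (g j i) F + b * arc_integral (g j i) H"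
    by (simp add: arc_int[OF i F] arc_int[OF i H])
  finally show ?thesis .
qed

lemma arc_integral_mono:
  assumes i: "i < n" and H: "continuous_on {0..1} H" "\<And>x. x \<in> {0..1} \<Longrightarrow> 0 \<le> H x"
    and le: "\<And>x. x \<in> {0..1} \<Longrightarrow> F x \<le> H x"
  shows "arc_integral (g j i) F \<le> arc_integral (g j i) H"
  unfolding arc_integral_def
proof (rule integral_mono')
  have "continuous_on {0..1} (velocity (g j i))"
    by (rule continuous_on_eq[OF C2_continuous(2)[OF C2[OF i, of j]]]) (simp add: C2_velocity[OF C2[OF i]])
  then show "integrable (lebesgue_on {0..1}) (\<lambda>x. H x * norm (velocity (g j i) x))"
    by (intro continuous_imp_integrable_real continuous_intros H)
qed (use H le in \<open>auto intro!: mult_right_mono\<close>)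

lemma curvature_pointwise:
  assumes i: "i < n" and x: "x \<in> {0..1}" and R: "0 < R"
    and \<delta>: "\<And>s. s \<in> {0..l j i} \<Longrightarrow> \<bar>G j i s \<bullet> rot90 (U j i s)\<bar> * exp (- (norm (G j i s))\<^sup>2 / 2) \<le> \<delta>"
  shows "indicator (ball 0 R) (g j i x) * (norm (curvature_vector (g j i) x))\<^sup>2 \<le>
    (2 * exp (R\<^sup>2 / 2)) * (exp (- (norm (g j i x))\<^sup>2 / 2) * ((curvature_vector (g j i) x + g j i x) \<bullet> unit_normal (g j i) x)\<^sup>2)
    + (2 * \<delta>\<^sup>2 * exp (2 * R\<^sup>2)) * exp (- (norm (g j i x))\<^sup>2 / 4)"
proof (cases "g j i x \<in> ball 0 R")
  case True
  let ?k = "curvature_vector (g j i) x" and ?y = "g j i x" and ?u = "unit_tangent (g j i) x"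
  define r where "r = (norm ?y)\<^sup>2"
  have r: "0 \<le> r" "r \<le> R\<^sup>2" using True by (auto simp: r_def intro!: power_mono)
  obtain s where s: "s \<in> {0..l j i}" "x = \<psi> j i s"
    using param[OF i, of j] x unfolding arclength_param_def by (metis imageE)
  have h: "\<bar>?y \<bullet> rot90 ?u\<bar> * exp (- r / 2) \<le> \<delta>" using \<delta>[OF s(1)] s(2) by (simp add: r_def)
  have "\<bar>?y \<bullet> rot90 ?u\<bar> = \<bar>?y \<bullet> rot90 ?u\<bar> * exp (- r / 2) * exp (r / 2)" by (simp add: mult.assoc exp_add[symmetric])
  also have "\<dots> \<le> \<delta> * exp (r / 2)" by (intro mult_right_mono h) simp
  finally have "\<bar>?y \<bullet> rot90 ?u\<bar>\<^sup>2 \<le> (\<delta> * exp (r / 2))\<^sup>2" by (intro power_mono) auto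
  also have "\<dots> = \<delta>\<^sup>2 * exp r" by (simp add: power_mult_distrib power2_eq_square[of "exp _"] exp_add[symmetric])
  also have "\<dots> \<le> \<delta>\<^sup>2 * (exp (2 * R\<^sup>2) * exp (- r / 4))"
    using r by (intro mult_left_mono) (auto simp: exp_add[symmetric])
  finally have A: "(?y \<bullet> rot90 ?u)\<^sup>2 \<le> \<delta>\<^sup>2 * (exp (2 * R\<^sup>2) * exp (- r / 4))" by simp
  have "1 \<le> exp (R\<^sup>2 / 2) * exp (- r / 2)" using r by (simp add: exp_add[symmetric])
  then have B: "1 * ((?k + ?y) \<bullet> rot90 ?u)\<^sup>2 \<le> exp (R\<^sup>2 / 2) * exp (- r / 2) * ((?k + ?y) \<bullet> rot90 ?u)\<^sup>2"
    by (intro mult_right_mono) auto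
  have "(norm ?k)\<^sup>2 = (?k \<bullet> rot90 ?u)\<^sup>2"
    using norm_decomp[OF C2_norm_unit_tangent[OF C2[OF i] x], of ?k j] C2_curvature_orthogonal[OF C2[OF i] x, of j] by simp
  moreover have "(?k \<bullet> rot90 ?u)\<^sup>2 \<le> 2 * ((?k + ?y) \<bullet> rot90 ?u)\<^sup>2 + 2 * (?y \<bullet> rot90 ?u)\<^sup>2"
  proof -
    have "(a - b)\<^sup>2 \<le> 2 * a\<^sup>2 + 2 * b\<^sup>2" for a b :: real
      using zero_le_power2[of "a + b"] by (simp add: power2_sum power2_diff)
    from this[of "(?k + ?y) \<bullet> rot90 ?u" "?y \<bullet> rot90 ?u"] show ?thesis by (simp add: inner_add_left)
  qed
  ultimately have "(norm ?k)\<^sup>2 \<le> 2 * (exp (R\<^sup>2 / 2) * exp (- r / 2) * ((?k + ?y) \<bullet> rot90 ?u)\<^sup>2)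
      + 2 * (\<delta>\<^sup>2 * (exp (2 * R\<^sup>2) * exp (- r / 4)))" using A B by linarith
  then show ?thesis using True unfolding unit_normal_def r_def by (simp add: mult.assoc)
qed simp

lemma curvature_vanishes:
  assumes R: "0 < R" shows "(\<lambda>j. curvature_L2_in_ball n (g j) R) \<longlonglongrightarrow> 0"
proof -
  let ?D = "\<lambda>j i x. exp (- (norm (g j i x))\<^sup>2 / 2) * ((curvature_vector (g j i) x + g j i x) \<bullet> unit_normal (g j i) x)\<^sup>2"
  let ?W = "\<lambda>j i x. exp (- (norm (g j i x))\<^sup>2 / 4)"
  let ?F = "\<lambda>j i x. indicator (ball 0 R) (g j i x) * (norm (curvature_vector (g j i) x))\<^sup>2 :: real"
  have cont: "continuous_on {0..1} (?D j i)" "continuous_on {0..1} (?W j i)" if i: "i < n" for i j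
    using C2_continuous(1)[OF C2[OF i, of j]] C2_continuous_curvature[OF C2[OF i, of j]]
      bounded_linear.continuous_on[OF bounded_linear_rot90 C2_continuous_unit_tangent[OF C2[OF i, of j]]]
    unfolding unit_normal_def by (intro continuous_intros; simp)+
  have "(\<lambda>j. \<Sum>i<n. arc_integral (g j i) (?F j i)) \<longlonglongrightarrow> 0"
  proof (rule LIMSEQ_I)
    fix e :: real assume e: "0 < e"
    define \<delta> where "\<delta> = sqrt (e / (8 * exp (2 * R\<^sup>2) * (C + 1)))"
    have \<delta>2: "\<delta>\<^sup>2 = e / (8 * exp (2 * R\<^sup>2) * (C + 1))" and \<delta>: "0 < \<delta>"
      using e C_nonneg by (simp_all add: \<delta>_def)
    define d where "d = e / (8 * exp (R\<^sup>2 / 2))"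
    have d: "0 < d" "2 * exp (R\<^sup>2 / 2) * d = e / 4" using e by (simp_all add: d_def)
    have dC: "2 * \<delta>\<^sup>2 * exp (2 * R\<^sup>2) * C \<le> e / 4"
    proof -
      have "2 * \<delta>\<^sup>2 * exp (2 * R\<^sup>2) * (C + 1) = e / 4" 
      proof -
        have "2 * (e / (8 * x * y)) * x * y = e / 4" if "0 < x" "0 < y" for x y :: real
          using that by (simp add: field_simps)
        from this[of "exp (2 * R\<^sup>2)" "C + 1"] show ?thesis unfolding \<delta>2 using C_nonneg by simp
      qed
      moreover have "2 * \<delta>\<^sup>2 * exp (2 * R\<^sup>2) * C \<le> 2 * \<delta>\<^sup>2 * exp (2 * R\<^sup>2) * (C + 1)"
        by (intro mult_left_mono) auto
      ultimately show ?thesis by simp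
    qed
    have "\<forall>\<^sub>F j in sequentially. norm ((\<Sum>i<n. arc_integral (g j i) (?F j i)) - 0) < e"
      using support_function_eventually[OF \<delta>] order_tendstoD(2)[OF defect d(1)]
    proof eventually_elim
      case (elim j)
      have "(\<Sum>i<n. arc_integral (g j i) (?F j i)) \<le>
        (\<Sum>i<n. 2 * exp (R\<^sup>2 / 2) * arc_integral (g j i) (?D j i) + 2 * \<delta>\<^sup>2 * exp (2 * R\<^sup>2) * arc_integral (g j i) (?W j i))"
      proof (rule sum_mono)
        fix i assume "i \<in> {..<n}"
        then have i: "i < n" by simp
        have "arc_integral (g j i) (?F j i) \<le>
            arc_integral (g j i) (\<lambda>x. 2 * exp (R\<^sup>2 / 2) * ?D j i x + 2 * \<delta>\<^sup>2 * exp (2 * R\<^sup>2) * ?W j i x)"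
        proof (rule arc_integral_mono[OF i])
          show "continuous_on {0..1} (\<lambda>x. 2 * exp (R\<^sup>2 / 2) * ?D j i x + 2 * \<delta>\<^sup>2 * exp (2 * R\<^sup>2) * ?W j i x)"
            by (intro continuous_intros cont[OF i])
          fix x :: real assume x: "x \<in> {0..1}"
          show "?F j i x \<le> 2 * exp (R\<^sup>2 / 2) * ?D j i x + 2 * \<delta>\<^sup>2 * exp (2 * R\<^sup>2) * ?W j i x"
            by (rule curvature_pointwise[OF i x R]) (use elim(1) i in blast)
        qed simp
        also have "\<dots> = 2 * exp (R\<^sup>2 / 2) * arc_integral (g j i) (?D j i) + 2 * \<delta>\<^sup>2 * exp (2 * R\<^sup>2) * arc_integral (g j i) (?W j i)"
          by (rule arc_integral_linear_combination[OF i cont[OF i]])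
        finally show "arc_integral (g j i) (?F j i) \<le>
          2 * exp (R\<^sup>2 / 2) * arc_integral (g j i) (?D j i) + 2 * \<delta>\<^sup>2 * exp (2 * R\<^sup>2) * arc_integral (g j i) (?W j i)" .
      qed
      also have "\<dots> = 2 * exp (R\<^sup>2 / 2) * (\<Sum>i<n. arc_integral (g j i) (?D j i))
          + 2 * \<delta>\<^sup>2 * exp (2 * R\<^sup>2) * (\<Sum>i<n. arc_integral (g j i) (?W j i))"
        by (simp only: sum.distrib sum_distrib_left)
      also have "\<dots> \<le> 2 * exp (R\<^sup>2 / 2) * d + 2 * \<delta>\<^sup>2 * exp (2 * R\<^sup>2) * C"
        by (intro add_mono mult_left_mono wide less_imp_le[OF elim(2)]) auto
      also have "\<dots> < e" using d(2) dC e by linarith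
      finally have "(\<Sum>i<n. arc_integral (g j i) (?F j i)) < e" .
      moreover have "0 \<le> (\<Sum>i<n. arc_integral (g j i) (?F j i))"
        by (intro sum_nonneg arc_integral_nonneg) auto
      ultimately show ?case by simp
    qed
    then show "\<exists>N. \<forall>j\<ge>N. norm ((\<Sum>i<n. arc_integral (g j i) (?F j i)) - 0) < e"
      unfolding eventually_sequentially .
  qed
  from tendsto_real_sqrt[OF this] show ?thesis unfolding curvature_L2_in_ball_def by simp
qed

end

context flow
begin

lemma outward_tangent_rescaled:
  assumes "- (1/2) * ln T \<le> \<tau>" "e \<in> {0, 1}" "i < n"
  shows "outward_tangent (rescaled_network \<gamma> T x0 \<tau> i) e = outward_tangent (\<gamma> i (T - exp (- 2 * \<tau>))) e"
proof -
  have "unit_tangent (rescaled_network \<gamma> T x0 \<tau> i) e = unit_tangent (\<gamma> i (T - exp (- 2 * \<tau>))) e"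
    unfolding rescaled_eq[OF assms(1)]
    by (rule unit_tangent_rescale[OF C2[OF assms(3) tm[OF assms(1)]]]) (use assms(2) in \<open>auto intro!: exp_gt_zero\<close>)
  then show ?thesis unfolding outward_tangent_def by presburger
qed

lemma rescaled_eq_iff:
  assumes "- (1/2) * ln T \<le> \<tau>"
  shows "rescaled_network \<gamma> T x0 \<tau> i x = rescaled_network \<gamma> T x0 \<tau> i' x' \<longleftrightarrow>
      \<gamma> i (T - exp (- 2 * \<tau>)) x = \<gamma> i' (T - exp (- 2 * \<tau>)) x'"
    "rescaled_network \<gamma> T x0 \<tau> i x = 0 \<longleftrightarrow> \<gamma> i (T - exp (- 2 * \<tau>)) x = x0"
  unfolding rescaled_eq[OF assms] by simp_all

lemma rescaled_embedded:
  assumes \<tau>: "- (1/2) * ln T \<le> \<tau>" and i: "i < n" "i' < n" and x: "x \<in> {0..1}" "x' \<in> {0..1}"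
    and eq: "rescaled_network \<gamma> T x0 \<tau> i x = rescaled_network \<gamma> T x0 \<tau> i' x'"
  shows "(i = i' \<and> x = x') \<or> (x \<in> {0, 1} \<and> x' \<in> {0, 1})"
proof -
  let ?t = "T - exp (- 2 * \<tau>)"
  have e: "\<gamma> i ?t x = \<gamma> i' ?t x'" using eq unfolding rescaled_eq_iff(1)[OF \<tau>] .
  note N = net[OF tm[OF \<tau>], unfolded network_def]
  show ?thesis
  proof (cases "i = i'")
    case True
    have "simple_path (\<gamma> i ?t)" using N i by blast
    then show ?thesis using e x True unfolding simple_path_def loop_free_def by blast
  next
    case False
    have "\<forall>x\<in>{0..1}. \<forall>y\<in>{0..1}. i \<noteq> i' \<and> \<gamma> i ?t x = \<gamma> i' ?t y \<longrightarrow> x \<in> {0, 1} \<and> y \<in> {0, 1}" using N i by blast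
    then show ?thesis using False e x by blast
  qed
qed

lemma dilation_at_top:
  assumes "filterlim \<tau> at_top F" "0 < (d :: real)"
  shows "filterlim (\<lambda>j. d / sqrt (2 * exp (- 2 * \<tau> j))) at_top F"
proof -
  have "d / sqrt (2 * exp (- 2 * t)) = d / sqrt 2 * exp t" for t :: real
  proof -
    have "sqrt (exp (- 2 * t)) = exp (- t)" by (rule real_sqrt_unique) (simp_all add: power2_eq_square exp_add[symmetric])
    then have "sqrt (2 * exp (- 2 * t)) = sqrt 2 * exp (- t)" by (simp only: real_sqrt_mult)
    then show ?thesis by (simp only:) (simp add: exp_minus field_simps)
  qed
  moreover have "filterlim (\<lambda>j. d / sqrt 2 * exp (\<tau> j)) at_top F"
    by (rule filterlim_tendsto_pos_mult_at_top[OF tendsto_const _ filterlim_compose[OF exp_at_top assms(1)]]) (use assms(2) in simp)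
  ultimately show ?thesis by simp
qed

context
  fixes x0 :: plane and \<tau> :: "nat \<Rightarrow> real"
  assumes \<tau>_top: "filterlim \<tau> at_top sequentially" and \<tau>: "\<And>j. - (1/2) * ln T \<le> \<tau> j"
begin

abbreviation (input) "gr j \<equiv> rescaled_network \<gamma> T x0 (\<tau> j)"
abbreviation (input) "tt j \<equiv> T - exp (- 2 * \<tau> j)"

lemma rescaled_time_at_left: "filterlim tt (at_left T) sequentially"
  unfolding filterlim_at
proof (intro conjI always_eventually allI)
  have "filterlim (\<lambda>j. 2 * \<tau> j) at_top sequentially"
    by (rule filterlim_tendsto_pos_mult_at_top[OF tendsto_const _ \<tau>_top]) simp
  then have "filterlim (\<lambda>j. - 2 * \<tau> j) at_bot sequentially" by (simp add: filterlim_uminus_at_top)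
  then have "(\<lambda>j. exp (- 2 * \<tau> j)) \<longlonglongrightarrow> 0" by (rule filterlim_compose[OF exp_at_bot])
  from tendsto_diff[OF tendsto_const[of T] this] show "tt \<longlonglongrightarrow> T" by simp
  show "tt j \<in> {..<T}" "tt j \<noteq> T" for j by auto
qed

lemma rescaled_density_tendsto:
  assumes "(weighted_length T x0 \<longlongrightarrow> \<theta>) (at_left T)"
  shows "(\<lambda>j. \<Sum>i<n. gaussian_length (gr j i)) \<longlonglongrightarrow> sqrt (2 * pi) * \<theta>"
  unfolding rescaled_density[OF \<tau>]
  by (intro tendsto_intros filterlim_compose[OF assms rescaled_time_at_left])

lemma rescaled_end_cases:
  assumes op: "open \<Omega>" and sc: "strictly_convex_domain \<Omega>" and k: "k \<in> curve_end_set n"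
  shows "far_end gr k \<or> zero_end n gr k \<or> (\<exists>A. k \<in> A \<and> triple_ends n gr A)"
proof -
  obtain i e where ie: "k = (i, e)" by fastforce
  have i: "i < n" and e: "e \<in> {0, 1}" and ends: "(i, e) \<in> ends" using k ie by (auto simp: ends_def)
  have t0: "0 \<in> {0..<T}" using T_pos by simp
  note tj = tm[OF \<tau>]
  have ce: "curve_ends n (\<lambda>i. \<gamma> i t) (\<gamma> i t e) = curve_ends n (\<lambda>i. \<gamma> i 0) (\<gamma> i 0 e)" if "t \<in> {0..<T}" for t
    by (rule curve_ends_time[OF that t0 i e])
  show ?thesis
  proof (cases rule: vertex_cases[OF t0 ends, case_names boundary triple])
    case boundary
    have fx: "\<gamma> i t e = \<gamma> i 0 e" if "t \<in> {0..<T}" for t by (rule frontier_fixed[OF i e t0 that boundary(2)])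
    show ?thesis
    proof (cases "\<gamma> i 0 e = x0")
      case True
      have "end_at (gr j) k = 0" for j
        unfolding ie fst_conv snd_conv rescaled_eq_iff(2)[OF \<tau>] fx[OF tj] by (rule True)
      moreover have "k' = k" if k': "k' \<in> curve_end_set n" "end_at (gr j) k' = 0" for j k'
      proof -
        have "\<gamma> (fst k') (tt j) (snd k') = x0" using k'(2) rescaled_eq_iff(2)[OF \<tau>] by blast
        then have "k' \<in> curve_ends n (\<lambda>i. \<gamma> i (tt j)) (\<gamma> i (tt j) e)"
          using k'(1) fx[OF tj] True by (auto simp: curve_ends_def)
        then show ?thesis unfolding ce[OF tj] boundary(1) ie by simp
      qed
      moreover have "\<exists>c>0. \<exists>a. \<forall>\<^sub>F j in sequentially. \<forall>i<n. \<forall>x\<in>{0..1}. c * norm (gr j i x) \<le> gr j i x \<bullet> a"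
      proof -
        obtain c a t1 where c: "0 < c" "t1 \<in> {0..<T}" and cone: "\<forall>t\<in>{t1..<T}. \<forall>j<n. \<forall>x\<in>{0..1}.
           c * norm (\<gamma> j t x - x0) \<le> (\<gamma> j t x - x0) \<bullet> a"
          using cone_at_frontier_end[OF op sc ends True] boundary(2) True by metis
        have "\<forall>\<^sub>F t in at_left T. t1 < t" using c(2) by (intro eventually_at_leftI[of t1]) auto
        then have "\<forall>\<^sub>F j in sequentially. t1 < tt j" by (rule eventually_compose_filterlim[OF _ rescaled_time_at_left])
        then have "\<forall>\<^sub>F j in sequentially. \<forall>i<n. \<forall>x\<in>{0..1}. c * norm (gr j i x) \<le> gr j i x \<bullet> a"
        proof (rule eventually_mono, intro allI impI ballI)
          fix j i and x :: real assume j: "t1 < tt j" and i: "i < n" and x: "x \<in> {0..1}"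
          let ?y = "\<gamma> i (tt j) x - x0"
          have "c * norm ?y \<le> ?y \<bullet> a" using cone tj[of j] j i x by auto
          then have "(c * norm ?y) / sqrt (2 * exp (- 2 * \<tau> j)) \<le> (?y \<bullet> a) / sqrt (2 * exp (- 2 * \<tau> j))"
            by (rule divide_right_mono) simp
          then show "c * norm (gr j i x) \<le> gr j i x \<bullet> a"
            unfolding rescaled_eq[OF \<tau>] by (simp add: divide_inverse mult_ac)
        qed
        then show ?thesis using c(1) by blast
      qed
      ultimately have "zero_end n gr k" unfolding zero_end_def by blast
      then show ?thesis by blast
    next
      case False
      have "norm (end_at (gr j) k) = norm (\<gamma> i 0 e - x0) / sqrt (2 * exp (- 2 * \<tau> j))" for j
        unfolding ie fst_conv snd_conv rescaled_eq[OF \<tau>] fx[OF tj] by (simp add: divide_inverse mult.commute)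
      then have "far_end gr k"
        unfolding far_end_def using dilation_at_top[OF \<tau>_top, of "norm (\<gamma> i 0 e - x0)"] False by simp
      then show ?thesis by blast
    qed
  next
    case triple
    let ?A = "curve_ends n (\<lambda>i. \<gamma> i 0) (\<gamma> i 0 e)"
    have kA: "k \<in> ?A" using i e ie by (simp add: curve_ends_def)
    have "triple_ends n gr ?A"
      unfolding triple_ends_def
    proof (intro conjI allI ballI)
      show "?A \<subseteq> curve_end_set n" by (auto simp: curve_ends_def)
      show "card ?A = 3" by (rule triple(1))
      fix j
      have Aj: "?A = curve_ends n (\<lambda>i. \<gamma> i (tt j)) (\<gamma> i (tt j) e)" by (rule ce[OF tj, symmetric])
      show "end_at (gr j) k' = end_at (gr j) k1 \<longleftrightarrow> k' \<in> ?A" if k1: "k1 \<in> ?A" and k': "k' \<in> curve_end_set n" for k1 k'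
      proof -
        have "\<gamma> (fst k1) (tt j) (snd k1) = \<gamma> i (tt j) e" using k1 unfolding Aj by (auto simp: curve_ends_def)
        then show ?thesis unfolding rescaled_eq_iff(1)[OF \<tau>] Aj using k' by (auto simp: curve_ends_def)
      qed
      have "(\<Sum>(i', e')\<in>curve_ends n (\<lambda>i. \<gamma> i (tt j)) (\<gamma> i (tt j) e). outward_tangent (\<gamma> i' (tt j)) e') = 0"
      proof (cases rule: vertex_cases[OF tj[of j] ends, case_names boundary triple])
        case boundary
        then show ?thesis using triple(1) unfolding Aj by simp
      qed
      moreover have "(\<Sum>k\<in>?A. outward_tangent (gr j (fst k)) (snd k)) = (\<Sum>(i', e')\<in>?A. outward_tangent (\<gamma> i' (tt j)) e')"
        by (rule sum.cong[OF refl]) (auto simp: curve_ends_def outward_tangent_rescaled[OF \<tau>])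
      ultimately show "(\<Sum>k\<in>?A. outward_tangent (gr j (fst k)) (snd k)) = 0" unfolding Aj by simp
    qed
    then show ?thesis using kA by blast
  qed
qed

lemma rescaled_network_slices:
  assumes op: "open \<Omega>" and sc: "strictly_convex_domain \<Omega>"
    and len: "\<forall>i<n. \<exists>c>0. \<forall>t\<in>{0..<T}. c \<le> curve_length (\<gamma> i t)"
    and diss: "(\<lambda>j. 2 * exp (- 2 * \<tau> j) * dissipation T x0 (tt j)) \<longlonglongrightarrow> 0"
  shows "\<exists>g1 g2 l \<psi> C. network_slices n gr g1 g2 l \<psi> C"
proof -
  obtain C where C: "\<And>\<tau>. - (1/2) * ln T \<le> \<tau> \<Longrightarrow> (\<Sum>i<n. wide_gaussian_length (rescaled_network \<gamma> T x0 \<tau> i)) \<le> C"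
    using rescaled_density_wide_bounded[of x0] by blast
  define g1 where "g1 j i x = gx i (tt j) x /\<^sub>R sqrt (2 * exp (- 2 * \<tau> j))" for j i x
  define g2 where "g2 j i x = gxx i (tt j) x /\<^sub>R sqrt (2 * exp (- 2 * \<tau> j))" for j i x
  have c2: "C2_data (gr j i) (g1 j i) (g2 j i)" if "i < n" for j i
    using rescaled_C2[OF \<tau> that] unfolding g1_def g2_def .
  define Q where "Q j i l \<psi> \<longleftrightarrow> arclength_param (gr j i) l \<psi> \<and>
     unit_speed l (\<lambda>s. gr j i (\<psi> s)) (\<lambda>s. unit_tangent (gr j i) (\<psi> s)) (\<lambda>s. curvature_vector (gr j i) (\<psi> s)) \<and>
     (\<forall>F. continuous_on {0..1} F \<longrightarrow> integral {0..l} (\<lambda>s. F (\<psi> s)) = arc_integral (gr j i) F)" for j i l \<psi>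
  have "\<forall>j i. \<exists>p. i < n \<longrightarrow> Q j i (fst p) (snd p)"
  proof (intro allI)
    fix j i
    show "\<exists>p. i < n \<longrightarrow> Q j i (fst p) (snd p)"
    proof (cases "i < n")
      case True
      show ?thesis
      proof (rule unit_speed_reparametrization[OF c2[OF True, of j]])
        fix l \<psi>
        assume "arclength_param (gr j i) l \<psi>"
          "unit_speed l (\<lambda>s. gr j i (\<psi> s)) (\<lambda>s. unit_tangent (gr j i) (\<psi> s)) (\<lambda>s. curvature_vector (gr j i) (\<psi> s))"
          "\<And>F. continuous_on {0..1} F \<Longrightarrow> integral {0..l} (\<lambda>s. F (\<psi> s)) = arc_integral (gr j i) F"
        then have "Q j i l \<psi>" unfolding Q_def by blast
        then show ?thesis by (intro exI[of _ "(l, \<psi>)"]) simp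
      qed
    qed simp
  qed
  then obtain p where p: "\<forall>j i. i < n \<longrightarrow> Q j i (fst (p j i)) (snd (p j i))" unfolding choice_iff by blast
  define l where "l j i = fst (p j i)" for j i
  define \<psi> where "\<psi> j i = snd (p j i)" for j i
  have Q: "Q j i (l j i) (\<psi> j i)" if "i < n" for j i using p that unfolding l_def \<psi>_def by blast
  have "network_slices n gr g1 g2 l \<psi> C"
  proof
    show "filterlim (\<lambda>j. l j i) at_top sequentially" if i: "i < n" for i
    proof -
      obtain c where c: "0 < c" "\<And>t. t \<in> {0..<T} \<Longrightarrow> c \<le> curve_length (\<gamma> i t)" using len i by blast
      have "c / sqrt (2 * exp (- 2 * \<tau> j)) \<le> l j i" for j
      proof -
        have pos: "0 < l j i" using Q[OF i, of j] unfolding Q_def arclength_param_def by blast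
        have "integral {0..l j i} (\<lambda>s. 1) = arc_integral (gr j i) (\<lambda>_. 1)"
          using Q[OF i, of j] continuous_on_const unfolding Q_def by blast
        also have "\<dots> = curve_length (\<gamma> i (tt j)) / sqrt (2 * exp (- 2 * \<tau> j))"
          unfolding rescaled_eq[OF \<tau>] curve_length_def
          by (rule arc_integral_rescale[OF C2[OF i tm[OF \<tau>]]]) simp
        finally have "l j i = curve_length (\<gamma> i (tt j)) / sqrt (2 * exp (- 2 * \<tau> j))" using pos by simp
        then show ?thesis using c(2)[OF tm[OF \<tau>[of j]]] by (simp add: divide_right_mono)
      qed
      then show ?thesis by (intro filterlim_at_top_mono[OF dilation_at_top[OF \<tau>_top c(1)]] always_eventually allI)
    qed
    show "(\<lambda>j. \<Sum>i<n. shrinker_energy (gr j i)) \<longlonglongrightarrow> 0"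
      unfolding rescaled_dissipation[OF \<tau>] using tendsto_mult[OF tendsto_const[of "sqrt (2 * pi)"] diss] by simp
    show "far_end gr k \<or> zero_end n gr k \<or> (\<exists>A. k \<in> A \<and> triple_ends n gr A)" if "k \<in> curve_end_set n" for k
      by (rule rescaled_end_cases[OF op sc that])
  qed (use Q c2 C[OF \<tau>] rescaled_embedded[OF \<tau>] in \<open>unfold Q_def, blast+\<close>)
  then show ?thesis by blast
qed

end

end

lemma network_flow_C12_data:
  assumes flow: "network_flow \<Omega> T n \<gamma>"
  shows "\<exists>gt gx gxx. \<forall>i<n. C12_data T (\<gamma> i) (gt i) (gx i) (gxx i)"
proof -
  have "\<exists>gt gx gxx. C12_data T (\<gamma> i) gt gx gxx" if i: "i < n" for i
  proof -
    have "C12_on T (\<gamma> i)" using flow i by (auto simp: network_flow_def)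
    then obtain gt gx gxx where d: "\<forall>t\<in>{0..<T}. \<forall>x\<in>{0..1}.
           ((\<lambda>s. \<gamma> i s x) has_vector_derivative gt t x) (at t within {0..<T}) \<and>
           (\<gamma> i t has_vector_derivative gx t x) (at x within {0..1}) \<and>
           (gx t has_vector_derivative gxx t x) (at x within {0..1})"
      and c: "continuous_on ({0..<T} \<times> {0..1}) (\<lambda>(t, x). \<gamma> i t x)" "continuous_on ({0..<T} \<times> {0..1}) (\<lambda>(t, x). gt t x)"
        "continuous_on ({0..<T} \<times> {0..1}) (\<lambda>(t, x). gx t x)" "continuous_on ({0..<T} \<times> {0..1}) (\<lambda>(t, x). gxx t x)"
      unfolding C12_on_def by blast
    have "C2_data (\<gamma> i t) (gx t) (gxx t)" if t: "t \<in> {0..<T}" for t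
      unfolding C2_data_def
    proof (intro conjI ballI)
      fix x :: real assume x: "x \<in> {0..1}"
      show "(\<gamma> i t has_vector_derivative gx t x) (at x within {0..1})"
        "(gx t has_vector_derivative gxx t x) (at x within {0..1})" using d t x by blast+
      have "regular_network \<Omega> n (\<lambda>i. \<gamma> i t)" using flow t by (simp add: network_flow_def)
      then have "network \<Omega> n (\<lambda>i. \<gamma> i t)" by (simp add: regular_network_def)
      then have "regular_curve (\<gamma> i t)" using i by (simp add: network_def)
      then have "velocity (\<gamma> i t) x \<noteq> 0" using x unfolding regular_curve_def by blast
      then show "gx t x \<noteq> 0"
        using vector_derivative_within_unit[of "\<gamma> i t" "gx t x" x] d t x unfolding velocity_def by auto
    next
      have "continuous_on {0..1} (\<lambda>x. case (t, x) of (t, x) \<Rightarrow> gxx t x)"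
        by (rule continuous_on_compose2[OF c(4)], rule continuous_on_Pair[OF continuous_on_const continuous_on_id]) (use t in auto)
      then show "continuous_on {0..1} (gxx t)" by simp
    qed
    then show ?thesis using d c unfolding C12_data_def by blast
  qed
  then have "\<forall>i. \<exists>p. i < n \<longrightarrow> C12_data T (\<gamma> i) (fst p) (fst (snd p)) (snd (snd p))"
    by (auto simp: split_paired_Ex)
  then obtain p where p: "\<forall>i. i < n \<longrightarrow> C12_data T (\<gamma> i) (fst (p i)) (fst (snd (p i))) (snd (snd (p i)))"
    unfolding choice_iff by blast
  show ?thesis by (rule exI, rule exI, rule exI, rule p)
qed

theorem proposition6p8:
  fixes \<Omega> :: "plane set" and T :: real and n :: nat
    and \<gamma> :: "nat \<Rightarrow> real \<Rightarrow> real \<Rightarrow> plane" and x0 :: plane and I :: "real set"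
  assumes "open \<Omega>" and "bounded \<Omega>" and "smooth_domain \<Omega>" and "strictly_convex_domain \<Omega>"
    and "0 < T"
    and "network_flow \<Omega> T n \<gamma>"
    and "\<forall>i<n. \<exists>c>0. \<forall>t\<in>{0..<T}. c \<le> curve_length (\<gamma> i t)"
    and "I \<subseteq> {- (1/2) * ln T ..}" and "I \<in> sets lebesgue" and "emeasure lebesgue I = \<infinity>"
  shows "\<exists>\<tau> :: nat \<Rightarrow> real.
    filterlim \<tau> at_top sequentially \<and> (\<forall>j. \<tau> j \<in> I) \<and>
    (\<exists>L. (\<forall>\<alpha>\<in>{0<..<1/2}. network_tendsto \<alpha> n (\<lambda>j. rescaled_network \<gamma> T x0 (\<tau> j)) L) \<and>
         (L = [] \<or>
          (\<exists>m. line_with_multiplicity m L \<and> has_limit_gaussian_density \<gamma> n T x0 (real m)) \<or>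
          (standard_triod L \<and> has_limit_gaussian_density \<gamma> n T x0 (3/2)) \<or>
          (halfline_from_origin L \<and> has_limit_gaussian_density \<gamma> n T x0 (1/2)))) \<and>
    (\<forall>R>0. (\<lambda>j. curvature_L2_in_ball n (rescaled_network \<gamma> T x0 (\<tau> j)) R) \<longlonglongrightarrow> 0)"
proof -
  obtain gt gx gxx where C12: "\<forall>i<n. C12_data T (\<gamma> i) (gt i) (gx i) (gxx i)"
    using network_flow_C12_data[OF assms(6)] by blast
  interpret flow \<Omega> T n \<gamma> gt gx gxx
    by (rule flow.intro[OF assms(5,6)]) (rule C12[rule_format])
  obtain \<tau> where \<tau>: "filterlim \<tau> at_top sequentially" "\<And>j :: nat. \<tau> j \<in> I"
    and diss: "(\<lambda>j. 2 * exp (- 2 * \<tau> j) * dissipation T x0 (T - exp (- 2 * \<tau> j))) \<longlonglongrightarrow> 0"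
    using dissipation_sequence[OF assms(8-10), of x0] by blast
  have ge: "- (1/2) * ln T \<le> \<tau> j" for j using \<tau>(2) assms(8) by auto
  obtain \<theta> where \<theta>: "(weighted_length T x0 \<longlongrightarrow> \<theta>) (at_left T)" using limit_density_exists by blast
  have dens: "has_limit_gaussian_density \<gamma> n T x0 \<theta>"
    using \<theta> unfolding has_limit_gaussian_density_def weighted_length_def .
  obtain g1 g2 l \<psi> C where ns: "network_slices n (\<lambda>j. rescaled_network \<gamma> T x0 (\<tau> j)) g1 g2 l \<psi> C"
    using rescaled_network_slices[OF \<tau>(1) ge assms(1,4,7) diss] by blast
  then obtain r E N J c v w where r: "strict_mono (r :: nat \<Rightarrow> nat)"
    and lim: "limit_slices n (\<lambda>j. rescaled_network \<gamma> T x0 (\<tau> (r j))) (\<lambda>j. g1 (r j)) (\<lambda>j. g2 (r j))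
      (\<lambda>j. l (r j)) (\<lambda>j. \<psi> (r j)) C E N J c v w"
    using network_slices.limit_subsequence[OF ns] by blast
  have r_top: "filterlim (\<lambda>j. \<tau> (r j)) at_top sequentially"
    by (rule filterlim_compose[OF \<tau>(1) filterlim_subseq[OF r]])
  interpret limit_slices n "\<lambda>j. rescaled_network \<gamma> T x0 (\<tau> (r j))" "\<lambda>j. g1 (r j)" "\<lambda>j. g2 (r j)"
    "\<lambda>j. l (r j)" "\<lambda>j. \<psi> (r j)" C E N J c v w by (rule lim)
  have "\<exists>L. (\<forall>\<alpha>\<in>{0<..<1/2}. network_tendsto \<alpha> n (\<lambda>j. rescaled_network \<gamma> T x0 (\<tau> (r j))) L) \<and>
      (L = [] \<or> (\<exists>m. line_with_multiplicity m L \<and> \<theta> = real m) \<or>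
       (standard_triod L \<and> \<theta> = 3/2) \<or> (halfline_from_origin L \<and> \<theta> = 1/2))"
    by (rule limit_classification[OF rescaled_density_tendsto[OF r_top ge \<theta>]])
  then show ?thesis
    using dens r_top \<tau>(2) curvature_vanishes by (intro exI[of _ "\<lambda>j. \<tau> (r j)"]) blast
qed

end
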